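(* Let $D_q\in\mathcal U(\mathfrak g)\otimes L(H^q(\mathfrak g),H^{q+1}(\mathfrak g))$ denote the Rumin differentials associated with the 5-dimensional graded Lie algebra $\mathfrak g=\mathfrak g_{-3}\oplus\mathfrak g_{-2}\oplus\mathfrak g_{-1}$. Let $h_g$ denote the Hermitian inner product on $H^*(\mathfrak g)$ induced from a graded Euclidean inner product $g=g_{-3}\oplus g_{-2}\oplus g_{-1}$ on $\mathfrak g$ such that the Euclidean inner product $b_g$ on $\mathfrak g_{-1}$ is proportional to $g_{-1}$. Then, in the Schrödinger representation $\rho_\hbar$ on $L^2(\mathbb R)$, $0\neq\hbar\in\mathbb R$, we have $$\det\nolimits_*|\rho_\hbar(D_4)|_{h_g}=\det\nolimits_*|\rho_\hbar(D_0)|_{h_g}=2^{1/4},$$ $$\det\nolimits_*|\rho_\hbar(D_3)|_{h_g}=\det\nolimits_*|\rho_\hbar(D_1)|_{h_g}=2^{3/4}\cdot\sin^{1/2}\left(\pi\cdot\frac{\sqrt2-1}2\right),$$ $$\det\nolimits_*|\rho_\hbar(D_2)|_{h_g}=2\cdot\sin\left(\pi\cdot\frac{\sqrt2-1}2\right).$$ In particular, the torsion is trivial: $\tau_{h_g}(\rho_\hbar(D))=1$.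
   Context: **Algebra and group.** $\mathfrak g=\mathfrak g_{-3}\oplus\mathfrak g_{-2}\oplus\mathfrak g_{-1}$ is the 5-dimensional real graded nilpotent Lie algebra with basis $X_1,X_2$ of $\mathfrak g_{-1}$, $X_3=[X_1,X_2]$ of $\mathfrak g_{-2}$, and $X_4=[X_1,X_3]$, $X_5=[X_2,X_3]$ of $\mathfrak g_{-3}$ (all other brackets of basis elements vanish up to antisymmetry). $G$ is the simply connected Lie group with Lie algebra $\mathfrak g$. **Rumin differentials.** $H^q(\mathfrak g)=\ker\partial_q/\operatorname{img}\partial_{q-1}$ is the cohomology of the Chevalley–Eilenberg complex $(\Lambda^*\mathfrak g^*\otimes\mathbb C,\partial)$. With $\chi^1,\dots,\chi^5$ the dual basis and $\chi^{j_1\cdots j_k}=\chi^{j_1}\wedge\cdots\wedge\chi^{j_k}$, the following forms induce bases of $H^q(\mathfrak g)$: $q=0$: $1$; $q=1$: $\chi^1,\chi^2$; $q=2$: $\chi^{14},\tfrac1{\sqrt2}(\chi^{15}+\chi^{24}),\chi^{25}$; $q=3$: $\chi^{134},\tfrac1{\sqrt2}(\chi^{135}+\chi^{234}),\chi^{235}$; $q=4$: $\chi^{1345},\chi^{2345}$; $q=5$: $\chi^{12345}$. With respect to these bases, writing $X_{j_1\cdots j_k}=X_{j_1}\cdots X_{j_k}\in\mathcal U(\mathfrak g)$, the Rumin differentials are $$D_0=\begin{pmatrix}X_1\\ X_2\end{pmatrix},\quad D_1=\begin{pmatrix}-X_{112}-X_{13}-X_4&X_{111}\\ -\sqrt2X_{122}-\sqrt2X_5&\sqrt2X_{211}-\sqrt2X_4\\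 -X_{222}&X_{221}-X_{23}-X_5\end{pmatrix},$$ $$D_2=\begin{pmatrix}-X_{12}-X_3&X_{11}/\sqrt2&0\\ -X_{22}/\sqrt2&-\tfrac32X_3&X_{11}/\sqrt2\\ 0&-X_{22}/\sqrt2&X_{21}-X_3\end{pmatrix},$$ $$D_3=\begin{pmatrix}X_{122}+X_{32}-X_5&-\sqrt2X_{112}+\sqrt2X_4&X_{111}\\ X_{222}&-\sqrt2X_{221}-\sqrt2X_5&X_{211}-X_{31}+X_4\end{pmatrix},\quad D_4=\begin{pmatrix}-X_2&X_1\end{pmatrix}.$$ (These elements do not depend on the choice of the basis $X_1,X_2$ of $\mathfrak g_{-1}$.) **Schrödinger representation.** $\rho_\hbar$ is the irreducible unitary representation of $G$ on $L^2(\mathbb R)=L^2(\mathbb R,d\theta)$ whose infinitesimal representation is $\rho_\hbar(X_1)=\sqrt{|\hbar|}\,\partial_\theta$, $\rho_\hbar(X_2)=\mathbf i\operatorname{sgn}(\hbar)\sqrt{|\hbar|}\,\theta$, $\rho_\hbar(X_3)=\mathbf i\hbar$, $\rho_\hbar(X_4)=\rho_\hbar(X_5)=0$. The operators $\rho_\hbar(D_q)$ act on smooth vectors tensor $H^q(\mathfrak g)$. **Inner products.** A graded Euclidean inner product $g=g_{-3}\oplus g_{-2}\oplus g_{-1}$ induces a Hermitian inner product on $\Lambda^*\mathfrak g^*\otimes\mathbb C$, and $h_g$ on $H^q(\mathfrak g)$ is obtained by restricting it to harmonic forms $\ker\partial_q\cap\ker\partial_{q-1}^{*}\cong H^q(\mathfrak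 g)$ ($\partial^*$ the adjoint with respect to $g$). The Euclidean inner product $b_g$ on $\mathfrak g_{-1}$ is defined by $g_{-3}([X,Z],[Y,Z])=g_{-2}(Z,Z)\,b_g(X,Y)$ for all $X,Y\in\mathfrak g_{-1}$, $Z\in\mathfrak g_{-2}$. **Determinants and torsion.** $\rho(D_q)^{*_h}$ is the formal adjoint with respect to $h$ and the inner product on the representation space; $|\rho(D_q)|_h=\sqrt{\rho(D_q)^{*_h}\rho(D_q)}$; $\zeta_{|\rho(D_q)|_h}(s)=\operatorname{tr}_*(\rho(D_q)^{*_h}\rho(D_q))^{-s/2}$ is the sum of $x^{-s/2}$ over the nonzero eigenvalues $x$ of $\rho(D_q)^{*_h}\rho(D_q)$ (with multiplicity), which converges for $\Re s$ large and extends meromorphically to $\mathbb C$, holomorphically at $s=0$; $\log\det_*|\rho(D_q)|_h:=-\zeta'_{|\rho(D_q)|_h}(0)$; and $$\tau_h(\rho(D))=\frac{\det_*|\rho(D_0)|_h\cdot\det_*|\rho(D_2)|_h\cdot\det_*|\rho(D_4)|_h}{\det_*|\rho(D_1)|_h\cdot\det_*|\rho(D_3)|_h}.$$ *)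

theory Defs
  imports "HOL-Complex_Analysis.Complex_Analysis" "HOL-Library.Function_Algebras"
begin

text \<open>The Lie algebra is \<^typ>\<open>real ^ 5\<close>; indices live in the numeral type \<^typ>\<open>5\<close>, where
  \<open>5 = 0\<close>, so that the standard basis is \<open>X 1, \<dots>, X 5\<close>.\<close>

type_synonym lie = "real ^ 5"

definition X :: "5 \<Rightarrow> lie" where
  "X j = axis j 1"

definition bracket :: "lie \<Rightarrow> lie \<Rightarrow> lie" where
  "bracket u v = (u $ 1 * v $ 2 - u $ 2 * v $ 1) *\<^sub>R X 3
               + (u $ 1 * v $ 3 - u $ 3 * v $ 1) *\<^sub>R X 4
               + (u $ 2 * v $ 3 - u $ 3 * v $ 2) *\<^sub>R X 5"

text \<open>\<open>grade k\<close> is the component of degree \<open>-k\<close>.\<close>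

definition grade :: "nat \<Rightarrow> lie set" where
  "grade k = (if k = 1 then span {X 1, X 2} else if k = 2 then span {X 3}
              else if k = 3 then span {X 4, X 5} else {0})"

definition graded_euclidean :: "(lie \<Rightarrow> lie \<Rightarrow> real) \<Rightarrow> bool" where
  "graded_euclidean g \<longleftrightarrow>
     bilinear g \<and> (\<forall>u v. g u v = g v u) \<and> (\<forall>u. u \<noteq> 0 \<longrightarrow> g u u > 0) \<and>
     (\<forall>k l u v. k \<noteq> l \<longrightarrow> u \<in> grade k \<longrightarrow> v \<in> grade l \<longrightarrow> g u v = 0)"

definition b_form :: "(lie \<Rightarrow> lie \<Rightarrow> real) \<Rightarrow> lie \<Rightarrow> lie \<Rightarrow> real" where
  "b_form g u v = (THE r. \<forall>Z\<in>grade 2. g (bracket u Z) (bracket v Z) = g Z Z * r)"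

definition b_proportional :: "(lie \<Rightarrow> lie \<Rightarrow> real) \<Rightarrow> bool" where
  "b_proportional g \<longleftrightarrow> (\<exists>c>0. \<forall>u\<in>grade 1. \<forall>v\<in>grade 1. b_form g u v = c * g u v)"

text \<open>A complex valued \<open>q\<close>-form is an alternating multilinear function of lists of \<open>q\<close> vectors,
  extended by \<open>0\<close> to lists of any other length.\<close>

type_synonym form = "lie list \<Rightarrow> complex"

definition forms :: "nat \<Rightarrow> form set" where
  "forms q = {\<omega>. (\<forall>vs. length vs \<noteq> q \<longrightarrow> \<omega> vs = 0) \<and>
                 (\<forall>xs ys. length xs + length ys + 1 = q \<longrightarrow> linear (\<lambda>v. \<omega> (xs @ v # ys))) \<and>
                 (\<forall>vs. \<not> distinct vs \<longrightarrow> \<omega> vs = 0)}"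

text \<open>The differential \<open>\<partial>\<close>: \<open>(\<partial>\<omega>)(v\<^sub>0,\<dots>,v\<^sub>q)\<close> is the sum over \<open>i < j\<close> of
  \<open>(-1)\<^bsup>i+j\<^esup> \<omega>([v\<^sub>i,v\<^sub>j], v\<^sub>0, \<dots>, v\<^sub>q)\<close> with \<open>v\<^sub>i\<close> and \<open>v\<^sub>j\<close> omitted from the tail.\<close>

definition ce_diff :: "form \<Rightarrow> form" where
  "ce_diff \<omega> vs = (\<Sum>j<length vs. \<Sum>i<j.
     (-1) ^ (i + j) * \<omega> (bracket (vs ! i) (vs ! j) # nths vs (- {i, j})))"

definition cocycles :: "nat \<Rightarrow> form set" where
  "cocycles q = {\<omega> \<in> forms q. ce_diff \<omega> = 0}"

definition coboundaries :: "nat \<Rightarrow> form set" where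
  "coboundaries q = (case q of 0 \<Rightarrow> {0} | Suc p \<Rightarrow> ce_diff ` forms p)"

definition coh_class :: "nat \<Rightarrow> form \<Rightarrow> form set" where
  "coh_class q \<omega> = {\<eta> \<in> cocycles q. \<eta> - \<omega> \<in> coboundaries q}"

text \<open>The Hermitian inner product on \<open>q\<close>-forms induced by \<open>g\<close>, written with the inverse Gram matrix
  (the dual inner product). Because of the factor \<open>1/q!\<close>, the forms
  \<open>e\<^sup>i\<^sup>1 \<and> \<dots> \<and> e\<^sup>i\<^sup>q\<close> with \<open>i1 < \<dots> < iq\<close> are orthonormal for an orthonormal coframe \<open>e\<close>.\<close>

definition dual_gram :: "(lie \<Rightarrow> lie \<Rightarrow> real) \<Rightarrow> real ^ 5 ^ 5" where
  "dual_gram g = matrix_inv (\<chi> i j. g (X i) (X j))"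

definition form_inner :: "(lie \<Rightarrow> lie \<Rightarrow> real) \<Rightarrow> nat \<Rightarrow> form \<Rightarrow> form \<Rightarrow> complex" where
  "form_inner g q \<alpha> \<beta> =
     (\<Sum>I | length I = q. \<Sum>J | length J = q.
        of_real (\<Prod>k<q. dual_gram g $ (I ! k) $ (J ! k)) * \<alpha> (map X I) * cnj (\<beta> (map X J)))
     / fact q"

text \<open>\<open>codiff g p\<close> is the adjoint of \<open>\<partial>\<close> on \<open>p\<close>-forms; it maps \<open>(p+1)\<close>-forms to \<open>p\<close>-forms.\<close>

definition codiff :: "(lie \<Rightarrow> lie \<Rightarrow> real) \<Rightarrow> nat \<Rightarrow> form \<Rightarrow> form" where
  "codiff g p \<omega> = (THE \<eta>. \<eta> \<in> forms p \<and>
     (\<forall>\<alpha>\<in>forms p. form_inner g (Suc p) (ce_diff \<alpha>) \<omega> = form_inner g p \<alpha> \<eta>))"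

definition harmonic :: "(lie \<Rightarrow> lie \<Rightarrow> real) \<Rightarrow> nat \<Rightarrow> form set" where
  "harmonic g q = {\<omega> \<in> cocycles q. \<forall>p. q = Suc p \<longrightarrow> codiff g p \<omega> = 0}"

definition harmonic_rep :: "(lie \<Rightarrow> lie \<Rightarrow> real) \<Rightarrow> nat \<Rightarrow> form set \<Rightarrow> form" where
  "harmonic_rep g q C = (THE \<omega>. \<omega> \<in> C \<and> \<omega> \<in> harmonic g q)"

definition h_inner :: "(lie \<Rightarrow> lie \<Rightarrow> real) \<Rightarrow> nat \<Rightarrow> form set \<Rightarrow> form set \<Rightarrow> complex" where
  "h_inner g q C C' = form_inner g q (harmonic_rep g q C) (harmonic_rep g q C')"

text \<open>\<open>chi [j\<^sub>1,\<dots>,j\<^sub>k]\<close> is \<open>\<chi>\<^sup>j\<^sup>1 \<and> \<dots> \<and> \<chi>\<^sup>j\<^sup>k\<close>; the value on \<open>k\<close> vectors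
  is the determinant of the corresponding coordinates.\<close>

definition chi :: "5 list \<Rightarrow> form" where
  "chi J vs = (if length vs = length J
     then of_real (\<Sum>p | p permutes {..<length J}.
            of_int (sign p) * (\<Prod>k<length J. (vs ! p k) $ (J ! k)))
     else 0)"

definition coh_basis :: "nat \<Rightarrow> form list" where
  "coh_basis q =
     [ [chi []],
       [chi [1], chi [2]],
       [chi [1,4], (\<lambda>vs. (chi [1,5] vs + chi [2,4] vs) / of_real (sqrt 2)), chi [2,5]],
       [chi [1,3,4], (\<lambda>vs. (chi [1,3,5] vs + chi [2,3,4] vs) / of_real (sqrt 2)), chi [2,3,5]],
       [chi [1,3,4,5], chi [2,3,4,5]],
       [chi [1,2,3,4,5]] ] ! q"

definition coh_dim :: "nat \<Rightarrow> nat" where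
  "coh_dim q = length (coh_basis q)"

definition h_gram :: "(lie \<Rightarrow> lie \<Rightarrow> real) \<Rightarrow> nat \<Rightarrow> nat \<Rightarrow> nat \<Rightarrow> complex" where
  "h_gram g q i j = h_inner g q (coh_class q (coh_basis q ! i)) (coh_class q (coh_basis q ! j))"

text \<open>An element of the universal enveloping algebra is written as a real linear combination of words
  in the basis: \<open>[(c, [j\<^sub>1,\<dots>,j\<^sub>k]), \<dots>]\<close> stands for \<open>c X\<^bsub>j1\<^esub> \<cdots> X\<^bsub>jk\<^esub> + \<dots>\<close>.
  Only the evaluation \<open>rho_U\<close> below is used; by \<open>rho_bracket\<close> it depends only on the
  element represented.\<close>

type_synonym env = "(real \<times> 5 list) list"

text \<open>\<open>rumin q\<close> is the list of rows of the matrix of \<open>D\<^sub>q\<close> with respect to \<open>coh_basis\<close>.\<close>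

definition rumin :: "nat \<Rightarrow> env list list" where
  "rumin q =
     [ [ [ [(1, [1])] ],
         [ [(1, [2])] ] ],

       [ [ [(-1, [1,1,2]), (-1, [1,3]), (-1, [4])],  [(1, [1,1,1])] ],
         [ [(- sqrt 2, [1,2,2]), (- sqrt 2, [5])],   [(sqrt 2, [2,1,1]), (- sqrt 2, [4])] ],
         [ [(-1, [2,2,2])],                          [(1, [2,2,1]), (-1, [2,3]), (-1, [5])] ] ],

       [ [ [(-1, [1,2]), (-1, [3])],  [(1 / sqrt 2, [1,1])],    [] ],
         [ [(- 1 / sqrt 2, [2,2])],   [(- 3 / 2, [3])],         [(1 / sqrt 2, [1,1])] ],
         [ [],                        [(- 1 / sqrt 2, [2,2])],  [(1, [2,1]), (-1, [3])] ] ],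

       [ [ [(1, [1,2,2]), (1, [3,2]), (-1, [5])],  [(- sqrt 2, [1,1,2]), (sqrt 2, [4])],
           [(1, [1,1,1])] ],
         [ [(1, [2,2,2])],  [(- sqrt 2, [2,2,1]), (- sqrt 2, [5])],
           [(1, [2,1,1]), (-1, [3,1]), (1, [4])] ] ],

       [ [ [(-1, [2])], [(1, [1])] ] ] ] ! q"

text \<open>The smooth vectors are the Schwartz functions, and all operators act on these.\<close>

definition vderiv :: "(real \<Rightarrow> complex) \<Rightarrow> real \<Rightarrow> complex" where
  "vderiv f = (\<lambda>\<theta>. vector_derivative f (at \<theta>))"

definition schwartz :: "(real \<Rightarrow> complex) \<Rightarrow> bool" where
  "schwartz f \<longleftrightarrow>
     (\<forall>m \<theta>. (vderiv ^^ m) f differentiable at \<theta>) \<and>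
     (\<forall>k m. bounded (range (\<lambda>\<theta>. of_real (\<theta> ^ k) * (vderiv ^^ m) f \<theta>)))"

definition rho :: "real \<Rightarrow> lie \<Rightarrow> (real \<Rightarrow> complex) \<Rightarrow> real \<Rightarrow> complex" where
  "rho hb v f = (\<lambda>\<theta>.
       of_real (v $ 1) * (of_real (sqrt \<bar>hb\<bar>) * vderiv f \<theta>)
     + of_real (v $ 2) * (\<i> * of_real (sgn hb * sqrt \<bar>hb\<bar> * \<theta>) * f \<theta>)
     + of_real (v $ 3) * (\<i> * of_real hb * f \<theta>))"

lemma rho_bracket:
  assumes "schwartz f"
  shows "rho hb (bracket u v) f = rho hb u (rho hb v f) - rho hb v (rho hb u f)"
proof
  fix \<theta> :: real
  have "(vderiv ^^ 0) f differentiable at t" "(vderiv ^^ 1) f differentiable at t" for t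
    using assms unfolding schwartz_def by blast+
  then have d0: "(f has_vector_derivative vderiv f t) (at t)"
    and d1: "(vderiv f has_vector_derivative vderiv (vderiv f) t) (at t)" for t
    by (simp_all add: vderiv_def vector_derivative_works[symmetric])
  have d: "vderiv (rho hb w f) \<theta> =
       of_real (w $ 1) * (of_real (sqrt \<bar>hb\<bar>) * vderiv (vderiv f) \<theta>)
     + of_real (w $ 2) * (\<i> * of_real (sgn hb * sqrt \<bar>hb\<bar>) * (f \<theta> + of_real \<theta> * vderiv f \<theta>))
     + of_real (w $ 3) * (\<i> * of_real hb * vderiv f \<theta>)" for w
  proof -
    have id: "((\<lambda>t. complex_of_real t) has_vector_derivative 1) (at \<theta>)"
      using has_vector_derivative_of_real[OF DERIV_ident] by simp
    have p: "((\<lambda>t. of_real t * f t) has_vector_derivative (f \<theta> + of_real \<theta> * vderiv f \<theta>)) (at \<theta>)"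
      using has_vector_derivative_mult[OF id d0] by (simp add: algebra_simps)
    have "(rho hb w f has_vector_derivative
       of_real (w $ 1) * (of_real (sqrt \<bar>hb\<bar>) * vderiv (vderiv f) \<theta>)
     + of_real (w $ 2) * (\<i> * of_real (sgn hb * sqrt \<bar>hb\<bar>) * (f \<theta> + of_real \<theta> * vderiv f \<theta>))
     + of_real (w $ 3) * (\<i> * of_real hb * vderiv f \<theta>)) (at \<theta>)"
      unfolding rho_def of_real_mult mult.assoc
      by (intro has_vector_derivative_add has_vector_derivative_mult_right d0 d1 p)
    then show ?thesis
      unfolding vderiv_def[of "rho hb w f"] by (rule vector_derivative_at)
  qed
  have c: "bracket u v $ 1 = 0" "bracket u v $ 2 = 0"
    "bracket u v $ 3 = u $ 1 * v $ 2 - u $ 2 * v $ 1"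
    by (simp_all add: bracket_def X_def axis_def)
  have s: "complex_of_real (sqrt \<bar>hb\<bar>) * (of_real (sgn hb) * of_real (sqrt \<bar>hb\<bar>)) = of_real hb"
  proof -
    have "sqrt \<bar>hb\<bar> * (sgn hb * sqrt \<bar>hb\<bar>) = hb"
      by (simp add: sgn_if)
    then show ?thesis by (metis of_real_mult)
  qed
  have "rho hb u (rho hb v f) \<theta> - rho hb v (rho hb u f) \<theta>
      = of_real (u $ 1 * v $ 2 - u $ 2 * v $ 1) *
        (\<i> * (complex_of_real (sqrt \<bar>hb\<bar>) * (of_real (sgn hb) * of_real (sqrt \<bar>hb\<bar>))) * f \<theta>)"
    unfolding rho_def[of hb u "rho hb v f"] rho_def[of hb v "rho hb u f"] d
    by (simp add: rho_def algebra_simps)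
  then show "rho hb (bracket u v) f \<theta> = (rho hb u (rho hb v f) - rho hb v (rho hb u f)) \<theta>"
    unfolding s by (simp add: rho_def[of hb "bracket u v"] c)
qed

definition rho_U :: "real \<Rightarrow> env \<Rightarrow> (real \<Rightarrow> complex) \<Rightarrow> real \<Rightarrow> complex" where
  "rho_U hb P f = (\<lambda>\<theta>. \<Sum>(c, w)\<leftarrow>P. of_real c * foldr (\<lambda>j. rho hb (X j)) w f \<theta>)"

text \<open>Smooth vectors tensor \<open>H\<^sup>q\<close>: coordinate \<open>i < coh_dim q\<close> belongs to the \<open>i\<close>-th basis class, and
  the remaining coordinates vanish.\<close>

type_synonym svec = "nat \<Rightarrow> real \<Rightarrow> complex"

definition smooth_vecs :: "nat \<Rightarrow> svec set" where
  "smooth_vecs q = {\<psi>. (\<forall>i<coh_dim q. schwartz (\<psi> i)) \<and> (\<forall>i\<ge>coh_dim q. \<psi> i = 0)}"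

definition rho_D :: "real \<Rightarrow> nat \<Rightarrow> svec \<Rightarrow> svec" where
  "rho_D hb q \<psi> = (\<lambda>i. if i < coh_dim (Suc q)
     then (\<Sum>j<coh_dim q. rho_U hb (rumin q ! i ! j) (\<psi> j)) else 0)"

definition vec_inner :: "(lie \<Rightarrow> lie \<Rightarrow> real) \<Rightarrow> nat \<Rightarrow> svec \<Rightarrow> svec \<Rightarrow> complex" where
  "vec_inner g q \<psi> \<phi> = (\<Sum>i<coh_dim q. \<Sum>j<coh_dim q.
     h_gram g q i j * (\<integral>\<theta>. \<psi> i \<theta> * cnj (\<phi> j \<theta>) \<partial>lborel))"

definition rho_D_adj :: "(lie \<Rightarrow> lie \<Rightarrow> real) \<Rightarrow> real \<Rightarrow> nat \<Rightarrow> svec \<Rightarrow> svec" where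
  "rho_D_adj g hb q \<phi> = (THE \<eta>. \<eta> \<in> smooth_vecs q \<and>
     (\<forall>\<psi>\<in>smooth_vecs q. vec_inner g (Suc q) (rho_D hb q \<psi>) \<phi> = vec_inner g q \<psi> \<eta>))"

definition vec_scale :: "complex \<Rightarrow> svec \<Rightarrow> svec" where
  "vec_scale c \<psi> = (\<lambda>i \<theta>. c * \<psi> i \<theta>)"

lemma vector_space_vec_scale: "vector_space vec_scale"
  by unfold_locales (auto simp: vec_scale_def fun_eq_iff algebra_simps)

definition eigenspace :: "(lie \<Rightarrow> lie \<Rightarrow> real) \<Rightarrow> real \<Rightarrow> nat \<Rightarrow> complex \<Rightarrow> svec set" where
  "eigenspace g hb q x =
     {\<psi> \<in> smooth_vecs q. rho_D_adj g hb q (rho_D hb q \<psi>) = vec_scale x \<psi>}"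

definition nonzero_eigenvalues :: "(lie \<Rightarrow> lie \<Rightarrow> real) \<Rightarrow> real \<Rightarrow> nat \<Rightarrow> complex set" where
  "nonzero_eigenvalues g hb q = {x. x \<noteq> 0 \<and> (\<exists>\<psi>\<in>eigenspace g hb q x. \<psi> \<noteq> 0)}"

definition multiplicity_of :: "(lie \<Rightarrow> lie \<Rightarrow> real) \<Rightarrow> real \<Rightarrow> nat \<Rightarrow> complex \<Rightarrow> nat" where
  "multiplicity_of g hb q x = vector_space.dim vec_scale (eigenspace g hb q x)"

text \<open>\<open>is_zeta g hb q Z\<close>: all multiplicities are finite, the zeta function of \<open>\<bar>\<rho>(D\<^sub>q)\<bar>\<close> converges for
  large \<open>Re s\<close>, and \<open>Z\<close> is its meromorphic extension, which is holomorphic at \<open>0\<close>. (Finiteness is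
  required since the dimension of an infinite dimensional space is \<open>0\<close> by convention.)\<close>

definition is_zeta ::
    "(lie \<Rightarrow> lie \<Rightarrow> real) \<Rightarrow> real \<Rightarrow> nat \<Rightarrow> (complex \<Rightarrow> complex) \<Rightarrow> bool" where
  "is_zeta g hb q Z \<longleftrightarrow>
     (\<forall>x\<in>nonzero_eigenvalues g hb q. \<exists>B. finite B \<and>
        eigenspace g hb q x \<subseteq> module.span vec_scale B) \<and>
     (\<exists>\<sigma>. \<forall>s. Re s > \<sigma> \<longrightarrow>
        ((\<lambda>x. of_nat (multiplicity_of g hb q x) * x powr (- s / 2)) has_sum Z s)
          (nonzero_eigenvalues g hb q)) \<and>
     Z meromorphic_on UNIV \<and> Z analytic_on {0}"

text \<open>The derivative at \<open>0\<close> does not depend on the choice of \<open>Z\<close>: two choices can differ only at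
  isolated points away from \<open>0\<close>.\<close>

definition det_star :: "(lie \<Rightarrow> lie \<Rightarrow> real) \<Rightarrow> real \<Rightarrow> nat \<Rightarrow> complex" where
  "det_star g hb q = exp (- deriv (SOME Z. is_zeta g hb q Z) 0)"

definition torsion :: "(lie \<Rightarrow> lie \<Rightarrow> real) \<Rightarrow> real \<Rightarrow> complex" where
  "torsion g hb =
     (det_star g hb 0 * det_star g hb 2 * det_star g hb 4) / (det_star g hb 1 * det_star g hb 3)"

end

theory Submission
  imports Defs "HOL-Probability.Probability" "HOL-Real_Asymp.Real_Asymp"
begin

text \<open>Choose a complex basis of \<open>\<g>\<^sub>-\<^sub>1\<close> that is isotropic for the metric and whose elements act as
  multiples of annihilation and creation operators \<open>a, a\<^sup>*\<close> with \<open>[a, a\<^sup>*] = 1\<close>. Since \<open>b\<^sub>g\<close> is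
  proportional to \<open>g\<^sub>-\<^sub>1\<close>, the Gram matrices of \<open>h\<^sub>g\<close> are multiples of symmetric powers of the dual
  metric on \<open>\<g>\<^sub>-\<^sub>1\<close> and become scalar in this basis. On Hermite functions \<open>D\<^sup>*D\<close> then splits into
  finite blocks, and up to a positive scalar its nonzero eigenvalues are, with \<open>k = 2n+1\<close>: \<open>k\<close> for
  \<open>D\<^sub>0, D\<^sub>4\<close>; \<open>\<bar>k(k\<^sup>2-2)\<bar>\<close> for \<open>D\<^sub>1, D\<^sub>3\<close>; and \<open>(\<plusminus>5/4 + sqrt(k\<^sup>2/2 + 9/16))\<^sup>2\<close> for \<open>D\<^sub>2\<close>. The
  zeta functions of these sequences vanish at \<open>0\<close>, so the scalar does not matter. Their derivatives
  at \<open>0\<close> are combinations of that of \<open>\<Sum> k\<^bsup>-s\<^esup>\<close> and of the sum of \<open>ln \<bar>1 - 2/k\<^sup>2\<bar>\<close> over odd \<open>k\<close>,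
  which the product formula of the cosine evaluates.\<close>

text \<open>Relative to its leading power of k each eigenvalue is an analytic function of u = 1/k,
  so no single zeta function gives the continuation. Parity makes it manageable: the correction is
  even in u, for D_2 only after adding both branches, which u -> -u exchanges. After rescaling s the
  expansion uses zeta at s, s+2, s+4, ..., so poles can occur only at 1, -1, -3, ...; a term linear
  in u would contribute at 0 through the pole of zeta(s+1). Hence the derivative at 0 is the formal
  one, with a convergent sum of logarithms. The value at 0 vanishes because the sum of k^(-s) over
  odd k is (1 - 2^(-s)) zeta(s). The two roots of a D_2 block multiply to (k^2 - 2)/2 up to sign, so
  D_1, D_2 and D_3 involve the same infinite product; this is why one sine value appears and the
  torsion cancels. On the operator side no spectral theorem for unbounded operators enters. Explicit
  eigenvectors and kernel vectors that are total among smooth vectors determine every nonzero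
  eigenspace. Totality reduces to completeness of Hermite functions, and that to uniqueness for
  characteristic functions.\<close>

section \<open>Dirichlet series over the odd integers\<close>

text \<open>A term \<open>k\<^bsup>-s\<^esup> G s (1/k)\<close> of a series to be continued is described by the function \<open>G\<close>. The class
  is closed under difference quotients in the second argument, so subtracting \<open>G s 0\<close> times a zeta
  function improves convergence and the continuation follows by induction on the half-plane.\<close>

definition holo_family :: "real \<Rightarrow> (complex \<Rightarrow> complex \<Rightarrow> complex) \<Rightarrow> bool" where
  "holo_family R G \<longleftrightarrow> (\<forall>u\<in>ball 0 R. (\<lambda>s. G s u) holomorphic_on UNIV) \<and>
     (\<forall>s. G s holomorphic_on ball 0 R) \<and>
     (\<forall>r. \<exists>B. \<forall>s u. norm s \<le> r \<longrightarrow> norm u < R \<longrightarrow> norm (G s u) \<le> B)"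

definition dquot :: "(complex \<Rightarrow> complex \<Rightarrow> complex) \<Rightarrow> complex \<Rightarrow> complex \<Rightarrow> complex" where
  "dquot G s u = (if u = 0 then deriv (G s) 0 else (G s u - G s 0) / u)"

text \<open>For norm u >= R/2 this is the trivial estimate 2B / (R/2). The maximum principle on the
  disc of radius R/2 carries it to small u, where division by u would otherwise spoil it. Only B and
  R enter, so the estimate is uniform in a further parameter.\<close>

lemma norm_difference_quotient_le:
  fixes f :: "complex \<Rightarrow> complex"
  assumes hol: "f holomorphic_on ball 0 R" and R: "0 < R"
    and B: "\<And>u. norm u < R \<Longrightarrow> norm (f u) \<le> B" and u: "norm u < R"
  shows "norm (if u = 0 then deriv f 0 else (f u - f 0) / u) \<le> 4 * B / R"
proof -
  define F where "F = (\<lambda>u. if u = 0 then deriv f 0 else (f u - f 0) / (u - 0))"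
  have hF: "F holomorphic_on ball 0 R"
    unfolding F_def by (rule pole_lemma_open[OF hol]) simp
  have far: "norm (F v) \<le> 4 * B / R" if "norm v < R" "norm v \<ge> R / 2" for v
  proof -
    have v0: "v \<noteq> 0" using that R by auto
    have "norm (f v - f 0) \<le> 2 * B"
      using norm_triangle_ineq4[of "f v" "f 0"] B[of v] B[of 0] that R by simp
    moreover have "0 \<le> B" using B[of 0] R norm_ge_zero[of "f 0"] by (metis norm_zero order_trans)
    ultimately have "norm (f v - f 0) / norm v \<le> 2 * B / (R / 2)"
      using that R by (intro frac_le) auto
    then show ?thesis using v0 by (simp add: F_def norm_divide)
  qed
  have "norm (F u) \<le> 4 * B / R"
  proof (cases "norm u \<ge> R / 2")
    case True then show ?thesis using far u by blast
  next
    case False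
    show ?thesis
    proof (rule maximum_modulus_frontier[of F "cball 0 (R/2)"])
      show "F holomorphic_on interior (cball 0 (R / 2))"
        using R by (intro holomorphic_on_subset[OF hF]) auto
      show "continuous_on (closure (cball 0 (R / 2))) F"
        using R by (intro continuous_on_subset[OF holomorphic_on_imp_continuous_on[OF hF]]) auto
      show "norm (F z) \<le> 4 * B / R" if "z \<in> frontier (cball 0 (R / 2))" for z
        using that R by (intro far) (auto simp: frontier_cball)
    qed (use False in auto)
  qed
  then show ?thesis by (simp add: F_def split: if_splits)
qed

text \<open>The delicate point is holomorphy in s at u = 0, where \<open>dquot G s 0\<close> is a
  derivative in the other variable. It is obtained as a locally uniform limit of the quotients at
  points tending to 0.\<close>

lemma holo_family_dquot:
  assumes G: "holo_family R G" and R: "0 < R"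
  shows "holo_family R (dquot G)"
proof -
  have hs: "\<And>u. norm u < R \<Longrightarrow> (\<lambda>s. G s u) holomorphic_on UNIV"
    and hu: "\<And>s. G s holomorphic_on ball 0 R"
    using G by (auto simp: holo_family_def)
  have hol_dq: "dquot G s holomorphic_on ball 0 R" for s
  proof -
    have "dquot G s = (\<lambda>u. if u = 0 then deriv (G s) 0 else (G s u - G s 0) / (u - 0))"
      by (simp add: fun_eq_iff dquot_def)
    then show ?thesis using pole_lemma_open[OF hu[of s], of 0] by simp
  qed
  have bd: "\<exists>B. \<forall>s u. norm s \<le> r \<longrightarrow> norm u < R \<longrightarrow> norm (dquot G s u) \<le> B" for r
  proof -
    obtain B where B: "\<And>s u. norm s \<le> r \<Longrightarrow> norm u < R \<Longrightarrow> norm (G s u) \<le> B"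
      using G unfolding holo_family_def by meson
    have "norm (dquot G s u) \<le> 4 * B / R" if "norm s \<le> r" "norm u < R" for s u
      unfolding dquot_def
      by (rule norm_difference_quotient_le[OF hu R B[OF that(1)] that(2)])
    then show ?thesis by blast
  qed
  have off0: "(\<lambda>s. dquot G s u) holomorphic_on UNIV" if "norm u < R" "u \<noteq> 0" for u
    using that hs[of u] hs[of 0] R by (auto simp: dquot_def intro!: holomorphic_intros)
  define v where "v n = complex_of_real (R / real (Suc (Suc n)))" for n :: nat
  have v: "norm (v n) < R" "v n \<noteq> 0" for n
    using R unfolding v_def norm_of_real by (simp_all add: field_simps add_pos_nonneg del: of_real_add of_real_divide)
  have at0: "(\<lambda>s. dquot G s 0) holomorphic_on UNIV"
  proof (rule holomorphic_uniform_sequence[of UNIV "\<lambda>n s. dquot G s (v n)"])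
    show "(\<lambda>s. dquot G s (v n)) holomorphic_on UNIV" for n
      by (rule off0[OF v])
    show "\<exists>d>0. cball x d \<subseteq> UNIV \<and>
            uniform_limit (cball x d) (\<lambda>n s. dquot G s (v n)) (\<lambda>s. dquot G s 0) sequentially" for x
    proof (intro exI[of _ 1] conjI)
      obtain B where B: "\<And>s u. norm s \<le> norm x + 1 \<Longrightarrow> norm u < R \<Longrightarrow> norm (dquot G s u) \<le> B"
        using bd[of "norm x + 1"] by meson
      show "uniform_limit (cball x 1) (\<lambda>n s. dquot G s (v n)) (\<lambda>s. dquot G s 0) sequentially"
      proof (rule uniform_limitI)
        fix e :: real assume e: "e > 0"
        have "(\<lambda>n. 4 * B / R * norm (v n)) \<longlonglongrightarrow> 0"
          unfolding v_def norm_of_real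
          using tendsto_mult_right_zero[OF tendsto_rabs_zero[OF tendsto_mult_right_zero[OF LIMSEQ_Suc[OF LIMSEQ_inverse_real_of_nat]]]]
          by (simp add: divide_inverse)
        then have "eventually (\<lambda>n. 4 * B / R * norm (v n) < e) sequentially"
          using e by (rule order_tendstoD)
        then show "\<forall>\<^sub>F n in sequentially. \<forall>s\<in>cball x 1. dist (dquot G s (v n)) (dquot G s 0) < e"
        proof eventually_elim
          case (elim n)
          show ?case
          proof
            fix s assume "s \<in> cball x 1"
            then have "norm s \<le> norm x + 1"
              using norm_triangle_ineq2[of s x] by (simp add: dist_norm norm_minus_commute)
            \<comment> \<open>The bound on difference quotients, applied to \<open>dquot G s\<close>
              itself, gives a rate of convergence that is uniform in s.\<close>
            then have "norm ((dquot G s (v n) - dquot G s 0) / v n) \<le> 4 * B / R"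
              using norm_difference_quotient_le[OF hol_dq R B v(1), of s n] v(2)[of n] by simp
            then have "norm (dquot G s (v n) - dquot G s 0) \<le> 4 * B / R * norm (v n)"
              using v(2)[of n] by (simp add: norm_divide field_simps)
            then show "dist (dquot G s (v n)) (dquot G s 0) < e"
              using elim by (simp add: dist_norm)
          qed
        qed
      qed
    qed auto
  qed auto
  have "(\<lambda>s. dquot G s u) holomorphic_on UNIV" if "u \<in> ball 0 R" for u
    using off0[of u] at0 that by (cases "u = 0") auto
  with hol_dq bd show ?thesis by (auto simp: holo_family_def)
qed

lemma holo_family_shift: "holo_family R G \<Longrightarrow> holo_family R (\<lambda>s. G (s + c))"
proof -
  assume G: "holo_family R G"
  have "(\<lambda>s. G (s + c) u) holomorphic_on UNIV" if "u \<in> ball 0 R" for u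
  proof -
    have "(\<lambda>s. G s u) \<circ> (\<lambda>s. s + c) holomorphic_on UNIV"
      using G that by (intro holomorphic_on_compose_gen[where t = UNIV]) (auto simp: holo_family_def intro!: holomorphic_intros)
    then show ?thesis by (simp add: o_def)
  qed
  moreover have "\<exists>B. \<forall>s u. norm s \<le> r \<longrightarrow> norm u < R \<longrightarrow> norm (G (s + c) u) \<le> B" for r
  proof -
    obtain B where "\<forall>s u. norm s \<le> r + norm c \<longrightarrow> norm u < R \<longrightarrow> norm (G s u) \<le> B"
      using G unfolding holo_family_def by blast
    then show ?thesis by (smt (verit) norm_triangle_ineq)
  qed
  ultimately show ?thesis using G by (auto simp: holo_family_def)
qed

lemma holo_family_exp:
  assumes h: "h holomorphic_on ball 0 R" and B: "\<And>u. norm u < R \<Longrightarrow> norm (h u) \<le> B"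
  shows "holo_family R (\<lambda>s u. exp ((c - s) * h u))"
proof -
  have "norm (exp ((c - s) * h u)) \<le> exp ((norm c + \<bar>r\<bar>) * \<bar>B\<bar>)"
    if "norm s \<le> r" "norm u < R" for s u r
  proof -
    have "Re ((c - s) * h u) \<le> norm ((c - s) * h u)" by (rule complex_Re_le_cmod)
    also have "\<dots> = norm (c - s) * norm (h u)" by (simp add: norm_mult)
    also have "\<dots> \<le> (norm c + \<bar>r\<bar>) * \<bar>B\<bar>"
      using that B[OF that(2)] norm_triangle_ineq4[of c s] by (intro mult_mono) auto
    finally show ?thesis by (simp add: norm_exp_eq_Re)
  qed
  then have "\<exists>C. \<forall>s u. norm s \<le> r \<longrightarrow> norm u < R \<longrightarrow> norm (exp ((c - s) * h u)) \<le> C" for r by blast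
  then show ?thesis using h
    by (simp add: holo_family_def holomorphic_intros)
qed

lemma holo_family_add:
  assumes "holo_family R F" "holo_family R G"
  shows "holo_family R (\<lambda>s u. F s u + G s u)"
proof -
  have "\<exists>B. \<forall>s u. norm s \<le> r \<longrightarrow> norm u < R \<longrightarrow> norm (F s u + G s u) \<le> B" for r
  proof -
    obtain B C where "\<forall>s u. norm s \<le> r \<longrightarrow> norm u < R \<longrightarrow> norm (F s u) \<le> B"
      "\<forall>s u. norm s \<le> r \<longrightarrow> norm u < R \<longrightarrow> norm (G s u) \<le> C"
      using assms unfolding holo_family_def by meson
    then show ?thesis by (intro exI[of _ "B + C"]) (meson norm_triangle_mono)
  qed
  then show ?thesis using assms by (auto simp: holo_family_def intro!: holomorphic_intros)
qed

lemma holo_family_uminus: "holo_family R G \<Longrightarrow> holo_family R (\<lambda>s u. - G s u)"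
  by (auto simp: holo_family_def intro!: holomorphic_intros)

text \<open>Evenness removes the coefficient of u. Subtracting the value at 0 then gains two powers
  of 1/k at once, and only shifts of s by 2 occur.\<close>

definition even_family :: "real \<Rightarrow> (complex \<Rightarrow> complex \<Rightarrow> complex) \<Rightarrow> bool" where
  "even_family R G \<longleftrightarrow> holo_family R G \<and> (\<forall>s. \<forall>u\<in>ball 0 R. G s (-u) = G s u)"

lemma dquot_even_0:
  assumes "even_family R G" "0 < R"
  shows "dquot G s 0 = 0"
proof -
  have "G s holomorphic_on ball 0 R" using assms by (auto simp: even_family_def holo_family_def)
  then have d: "(G s has_field_derivative deriv (G s) 0) (at 0)"
    using assms(2) holomorphic_derivI[of "G s" "ball 0 R" 0 UNIV] by simp
  then have "(G s has_field_derivative deriv (G s) 0) (at (- 0))" by simp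
  then have "((\<lambda>u. G s (- u)) has_field_derivative - deriv (G s) 0) (at 0)"
    using DERIV_chain[of "G s" "deriv (G s) 0" uminus 0 "-1" UNIV]
    by (simp add: o_def DERIV_minus[OF DERIV_ident, simplified])
  then have "(G s has_field_derivative - deriv (G s) 0) (at 0)"
    by (rule has_field_derivative_transform_within_open[where S = "ball 0 R"])
      (use assms in \<open>auto simp: even_family_def\<close>)
  then have "deriv (G s) 0 = - deriv (G s) 0" using DERIV_imp_deriv by metis
  then show ?thesis by (simp add: dquot_def equal_neg_zero)
qed

lemma even_family_dquot2:
  assumes "even_family R G" "0 < R"
  shows "even_family R (dquot (dquot G))"
    and "u \<noteq> 0 \<Longrightarrow> dquot (dquot G) s u = (G s u - G s 0) / u\<^sup>2"
    and "G s u = G s 0 + u\<^sup>2 * dquot (dquot G) s u"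
proof -
  show *: "dquot (dquot G) s u = (G s u - G s 0) / u\<^sup>2" if "u \<noteq> 0" for s u
    using dquot_even_0[OF assms] that by (simp add: dquot_def[of "dquot G"]) (simp add: dquot_def power2_eq_square)
  then show "G s u = G s 0 + u\<^sup>2 * dquot (dquot G) s u"
    by (cases "u = 0") auto
  have "dquot (dquot G) s (-u) = dquot (dquot G) s u" if "norm u < R" for s u
    using *[of u s] *[of "-u" s] that assms by (cases "u = 0") (auto simp: even_family_def)
  then show "even_family R (dquot (dquot G))"
    using assms by (auto simp: even_family_def intro!: holo_family_dquot)
qed

definition zeta_term :: "(nat \<Rightarrow> nat) \<Rightarrow> (complex \<Rightarrow> complex \<Rightarrow> complex) \<Rightarrow> complex \<Rightarrow> nat \<Rightarrow> complex" where
  "zeta_term \<kappa> G s n = of_nat (\<kappa> n) powr (- s) * G s (1 / of_nat (\<kappa> n))"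

definition zeta_sum :: "(nat \<Rightarrow> nat) \<Rightarrow> (complex \<Rightarrow> complex \<Rightarrow> complex) \<Rightarrow> complex \<Rightarrow> complex" where
  "zeta_sum \<kappa> G s = (\<Sum>n. zeta_term \<kappa> G s n)"

text \<open>The growth condition yields convergence for Re s > 1, the other one keeps the argument
  1/k inside the disc of the family. Both \<open>Suc\<close> and \<open>odd3\<close> qualify, for
  different radii.\<close>

definition zeta_index :: "real \<Rightarrow> (nat \<Rightarrow> nat) \<Rightarrow> bool" where
  "zeta_index R \<kappa> \<longleftrightarrow> 0 < R \<and> (\<forall>n. n < \<kappa> n \<and> 1 / real (\<kappa> n) < R)"

lemma zeta_indexD:
  assumes "zeta_index R \<kappa>"
  shows "norm (1 / of_nat (\<kappa> n) :: complex) < R" "\<kappa> n > 0" "0 < R" "Suc n \<le> \<kappa> n"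
  using assms by (auto simp: zeta_index_def norm_divide Suc_le_eq) (metis gr_zeroI not_less_zero)+

text \<open>A local majorant for the Weierstrass test. The radius d is half the distance of Re x
  from 1, so on the ball the exponent still exceeds 1 by d.\<close>

lemma zeta_term_bound:
  assumes G: "holo_family R G" and K: "zeta_index R \<kappa>" and x: "Re x > 1"
  shows "\<exists>d h. 0 < d \<and> summable h \<and> (\<forall>n. \<forall>y\<in>ball x d. norm (zeta_term \<kappa> G y n) \<le> h n)"
proof -
  define d where "d = (Re x - 1) / 2"
  have d: "d > 0" using x by (simp add: d_def)
  obtain B where B: "\<And>s u. norm s \<le> norm x + d \<Longrightarrow> norm u < R \<Longrightarrow> norm (G s u) \<le> B"
    using G unfolding holo_family_def by meson
  have B0: "B \<ge> 0" using B[of 0 0] zeta_indexD(3)[OF K] d norm_ge_zero order_trans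
    by (metis add_nonneg_nonneg less_eq_real_def norm_zero)
  have "summable (\<lambda>n. real (Suc n) powr - (1 + d))"
    using d summable_real_powr_iff[of "- (1 + d)"] by (subst summable_Suc_iff) auto
  then have "summable (\<lambda>n. B * real (Suc n) powr - (1 + d))" by (rule summable_mult)
  moreover have "norm (zeta_term \<kappa> G y n) \<le> B * real (Suc n) powr - (1 + d)" if y: "y \<in> ball x d" for n y
  proof -
    have "\<bar>Re x - Re y\<bar> < d" using y abs_Re_le_cmod[of "x - y"] by (simp add: dist_norm)
    then have "Re x - Re y < d" by linarith
    then have Rey: "Re y \<ge> 1 + d" unfolding d_def by (simp add: field_simps)
    have "norm y \<le> norm x + d"
      using y norm_triangle_ineq2[of y x] by (simp add: dist_norm norm_minus_commute)
    then have "norm (G y (1 / of_nat (\<kappa> n))) \<le> B" using B zeta_indexD(1)[OF K] by blast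
    moreover have "norm (of_nat (\<kappa> n) powr (- y) :: complex) \<le> real (Suc n) powr - (1 + d)"
    proof -
      have "norm (of_nat (\<kappa> n) powr (- y) :: complex) = real (\<kappa> n) powr (- Re y)"
        using norm_powr_real_powr[of "of_nat (\<kappa> n)" "- y"] by simp
      also have "\<dots> \<le> real (\<kappa> n) powr - (1 + d)"
        using Rey zeta_indexD(2)[OF K, of n] by (intro powr_mono) auto
      also have "\<dots> \<le> real (Suc n) powr - (1 + d)"
        using zeta_indexD(4)[OF K, of n] d by (intro powr_mono2') auto
      finally show ?thesis .
    qed
    ultimately show ?thesis
      unfolding zeta_term_def norm_mult using B0 by (subst mult.commute) (intro mult_mono, auto)
  qed
  ultimately show ?thesis using d by blast
qed

lemma zeta_term_hol:
  assumes G: "holo_family R G" and K: "zeta_index R \<kappa>"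
  shows "(\<lambda>s. zeta_term \<kappa> G s n) holomorphic_on UNIV"
proof -
  have "(\<lambda>s. G s (1 / of_nat (\<kappa> n))) holomorphic_on UNIV"
    using G zeta_indexD(1)[OF K, of n] unfolding holo_family_def by (metis mem_ball_0)
  moreover have "(\<lambda>s. of_nat (\<kappa> n) powr - s :: complex) holomorphic_on UNIV"
    using zeta_indexD(2)[OF K, of n] by (intro holomorphic_on_powr_right holomorphic_on_minus holomorphic_on_ident)
  ultimately show ?thesis unfolding zeta_term_def by (intro holomorphic_on_mult)
qed

text \<open>Termwise differentiation is what is needed at s = 2: because of the shift by 2 in
  \<open>qshift\<close>, it expresses the derivative of the continued function at 0 by a convergent
  series.\<close>

lemma zeta_sum_props:
  assumes G: "holo_family R G" and K: "zeta_index R \<kappa>"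
  shows "Re s > 1 \<Longrightarrow> (\<lambda>n. zeta_term \<kappa> G s n) sums zeta_sum \<kappa> G s"
    and "zeta_sum \<kappa> G holomorphic_on {s. Re s > 1}"
    and "Re s > 1 \<Longrightarrow> (\<lambda>n. deriv (\<lambda>s. zeta_term \<kappa> G s n) s) sums deriv (zeta_sum \<kappa> G) s"
    and "Re s > 1 \<Longrightarrow> summable (\<lambda>n. norm (zeta_term \<kappa> G s n))"
proof -
  let ?S = "{s. Re s > 1}"
  have op: "open ?S" by (rule open_halfspace_Re_gt)
  have "\<exists>g g'. \<forall>x\<in>?S. ((\<lambda>n. zeta_term \<kappa> G x n) sums g x) \<and>
      ((\<lambda>n. deriv (\<lambda>s. zeta_term \<kappa> G s n) x) sums g' x) \<and> (g has_field_derivative g' x) (at x)"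
  proof (rule series_and_derivative_comparison_local[OF op])
    show "((\<lambda>s. zeta_term \<kappa> G s n) has_field_derivative deriv (\<lambda>s. zeta_term \<kappa> G s n) x) (at x)" for n x
      using zeta_term_hol[OF G K] holomorphic_derivI by blast
    show "\<exists>d h. 0 < d \<and> summable h \<and> (\<forall>\<^sub>F n in sequentially. \<forall>y\<in>ball x d \<inter> ?S. norm (zeta_term \<kappa> G y n) \<le> h n)"
      if "x \<in> ?S" for x
      using zeta_term_bound[OF G K, of x] that by (fastforce intro: always_eventually)
  qed
  then obtain g g' where g: "\<And>x. Re x > 1 \<Longrightarrow> (\<lambda>n. zeta_term \<kappa> G x n) sums g x"
    "\<And>x. Re x > 1 \<Longrightarrow> (\<lambda>n. deriv (\<lambda>s. zeta_term \<kappa> G s n) x) sums g' x"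
    "\<And>x. Re x > 1 \<Longrightarrow> (g has_field_derivative g' x) (at x)" by auto
  have eq: "zeta_sum \<kappa> G x = g x" if "Re x > 1" for x
    using g(1)[OF that] by (simp add: zeta_sum_def sums_iff)
  have der: "(zeta_sum \<kappa> G has_field_derivative g' x) (at x)" if "Re x > 1" for x
    by (rule has_field_derivative_transform_within_open[OF g(3)[OF that] op]) (use that eq in auto)
  show "Re s > 1 \<Longrightarrow> (\<lambda>n. zeta_term \<kappa> G s n) sums zeta_sum \<kappa> G s" using g(1) eq by simp
  show "zeta_sum \<kappa> G holomorphic_on ?S"
    using der by (auto simp: holomorphic_on_def field_differentiable_def intro: has_field_derivative_at_within)
  show "Re s > 1 \<Longrightarrow> (\<lambda>n. deriv (\<lambda>s. zeta_term \<kappa> G s n) s) sums deriv (zeta_sum \<kappa> G) s"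
    using g(2) DERIV_imp_deriv[OF der] by simp
  show "summable (\<lambda>n. norm (zeta_term \<kappa> G s n))" if "Re s > 1"
  proof -
    obtain d h where d: "0 < d" "summable h" and h: "\<forall>n. \<forall>y\<in>ball s d. norm (zeta_term \<kappa> G y n) \<le> h n"
      using zeta_term_bound[OF G K \<open>Re s > 1\<close>] by blast
    have "norm (norm (zeta_term \<kappa> G s n)) \<le> h n" for n
      using h d(1) by (metis abs_norm_cancel centre_in_ball real_norm_def)
    then show ?thesis by (rule summable_comparison_test'[OF d(2), of 0])
  qed
qed

text \<open>The remainder after subtracting \<open>G s 0\<close> carries k^(-s-2). Written with
  parameter s - 2 it is again a term of the form \<open>zeta_term\<close>, evaluated at s +
  2.\<close>

abbreviation "qshift G \<equiv> (\<lambda>s. dquot (dquot G) (s - 2))"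

lemma even_family_qshift: "even_family R G \<Longrightarrow> 0 < R \<Longrightarrow> even_family R (qshift G)"
  using even_family_dquot2(1)[of R G] holo_family_shift[of R "dquot (dquot G)" "-2"] by (auto simp: even_family_def)

lemma zeta_term_split:
  assumes G: "even_family R G" and K: "zeta_index R \<kappa>"
  shows "zeta_term \<kappa> G s n = G s 0 * zeta_term \<kappa> (\<lambda>_ _. 1) s n + zeta_term \<kappa> (qshift G) (s + 2) n"
proof -
  let ?k = "of_nat (\<kappa> n) :: complex"
  have k: "?k \<noteq> 0" using zeta_indexD(2)[OF K, of n] by simp
  have "?k powr (- (s + 2)) = ?k powr (- s) / ?k ^ 2"
    using k by (simp add: powr_diff powr_numeral)
  moreover have "G s (1 / ?k) = G s 0 + (1 / ?k)\<^sup>2 * dquot (dquot G) s (1 / ?k)"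
    by (rule even_family_dquot2(3)[OF G zeta_indexD(3)[OF K]])
  ultimately show ?thesis by (simp add: zeta_term_def field_simps)
qed

lemma holo_family_one: "holo_family R (\<lambda>_ _. 1)"
  by (auto simp: holo_family_def)

lemma even_family_one: "even_family R (\<lambda>_ _. 1)"
  by (auto simp: even_family_def holo_family_one)

lemma zeta_sum_split:
  assumes G: "even_family R G" and K: "zeta_index R \<kappa>" and s: "Re s > 1"
  shows "zeta_sum \<kappa> G s = G s 0 * zeta_sum \<kappa> (\<lambda>_ _. 1) s + zeta_sum \<kappa> (qshift G) (s + 2)"
proof -
  have "(\<lambda>n. zeta_term \<kappa> G s n) sums (G s 0 * zeta_sum \<kappa> (\<lambda>_ _. 1) s + zeta_sum \<kappa> (qshift G) (s + 2))"
    unfolding zeta_term_split[OF G K]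
    using even_family_qshift[OF G zeta_indexD(3)[OF K]] K s
    by (intro sums_add sums_mult zeta_sum_props(1)[of R] holo_family_one) (auto simp: even_family_def)
  then show ?thesis by (simp add: zeta_sum_def sums_iff)
qed

text \<open>The zeros s = 1, -1, -3, ... of \<open>rGamma ((s - 1) / 2)\<close> are exactly the
  possible simple poles. With this factor a continuation to a half-plane can be stated for
  holomorphic functions only.\<close>

definition zeta_cont :: "(nat \<Rightarrow> nat) \<Rightarrow> (complex \<Rightarrow> complex \<Rightarrow> complex) \<Rightarrow> nat \<Rightarrow> bool" where
  "zeta_cont \<kappa> G J \<longleftrightarrow> (\<exists>H. H holomorphic_on {s. Re s > 1 - 2 * real J} \<and>
     (\<forall>s. Re s > 1 \<longrightarrow> H s = rGamma ((s - 1) / 2) * zeta_sum \<kappa> G s))"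

lemma rGamma_half_step: "rGamma ((s - 1) / 2) = (s - 1) / 2 * rGamma ((s + 1) / 2 :: complex)"
proof -
  have "(s - 1) / 2 + 1 = (s + 1) / 2" by (simp add: field_simps)
  with rGamma_plus1[of "(s - 1) / 2"] show ?thesis by metis
qed

lemma holomorphic_on_shift:
  assumes "H holomorphic_on {s. Re s > c}"
  shows "(\<lambda>s. H (s + 2)) holomorphic_on {s. Re s > c - 2}"
proof -
  have "H \<circ> (\<lambda>s. s + 2) holomorphic_on {s. Re s > c - 2}"
    by (rule holomorphic_on_compose_gen[OF _ assms]) (auto intro!: holomorphic_intros)
  then show ?thesis by (simp add: o_def)
qed

lemma zeta_cont_0:
  assumes "holo_family R G" "zeta_index R \<kappa>"
  shows "zeta_cont \<kappa> G 0"
  unfolding zeta_cont_def using zeta_sum_props(2)[OF assms]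
  by (intro exI[of _ "\<lambda>s. rGamma ((s - 1) / 2) * zeta_sum \<kappa> G s"]) (auto intro!: holomorphic_intros)

lemma even_family_hol0: "even_family R G \<Longrightarrow> 0 < R \<Longrightarrow> (\<lambda>s. G s 0) holomorphic_on A"
  unfolding even_family_def holo_family_def by (meson centre_in_ball holomorphic_on_subset subset_UNIV)

text \<open>In \<open>zeta_sum_split\<close> the remainder is evaluated at s + 2, so its
  continuation reaches two units further left. The factor (s - 1) / 2 accounts for the change of the
  normalising factor from s to s + 2.\<close>

lemma zeta_cont_step:
  assumes G: "even_family R G" and K: "zeta_index R \<kappa>"
    and one: "zeta_cont \<kappa> (\<lambda>_ _. 1) (Suc J)" and Q: "zeta_cont \<kappa> (qshift G) J"
  shows "zeta_cont \<kappa> G (Suc J)"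
proof -
  obtain H1 where H1: "H1 holomorphic_on {s. Re s > 1 - 2 * real (Suc J)}"
    "\<And>s. Re s > 1 \<Longrightarrow> H1 s = rGamma ((s - 1) / 2) * zeta_sum \<kappa> (\<lambda>_ _. 1) s"
    using one by (auto simp: zeta_cont_def)
  obtain H where H: "H holomorphic_on {s. Re s > 1 - 2 * real J}"
    "\<And>s. Re s > 1 \<Longrightarrow> H s = rGamma ((s - 1) / 2) * zeta_sum \<kappa> (qshift G) s"
    using Q by (auto simp: zeta_cont_def)
  have "(\<lambda>s. H (s + 2)) holomorphic_on {s. Re s > 1 - 2 * real (Suc J)}"
    using holomorphic_on_shift[OF H(1)] by (simp add: algebra_simps)
  then have "(\<lambda>s. G s 0 * H1 s + (s - 1) / 2 * H (s + 2)) holomorphic_on {s. Re s > 1 - 2 * real (Suc J)}"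
    using H1(1) even_family_hol0[OF G zeta_indexD(3)[OF K]] by (intro holomorphic_intros) auto
  moreover have "G s 0 * H1 s + (s - 1) / 2 * H (s + 2) = rGamma ((s - 1) / 2) * zeta_sum \<kappa> G s"
    if "Re s > 1" for s
  proof -
    have "(s + 2 - 1) / 2 = (s + 1) / 2" by (simp add: field_simps)
    then have eq: "H (s + 2) = rGamma ((s + 1) / 2) * zeta_sum \<kappa> (qshift G) (s + 2)"
      using H(2)[of "s + 2"] that by (simp add: add.commute)
    show ?thesis
      unfolding H1(2)[OF that] zeta_sum_split[OF G K that] rGamma_half_step[of s] eq
      by (simp only: distrib_left mult_ac)
  qed
  ultimately show ?thesis unfolding zeta_cont_def by blast
qed

lemma zeta_cont_glue:
  assumes "\<And>J. zeta_cont \<kappa> G J"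
  obtains H where "H holomorphic_on UNIV" "\<And>s. Re s > 1 \<Longrightarrow> H s = rGamma ((s - 1) / 2) * zeta_sum \<kappa> G s"
proof -
  have "\<forall>J. \<exists>H. H holomorphic_on {s. Re s > 1 - 2 * real J} \<and>
     (\<forall>s. Re s > 1 \<longrightarrow> H s = rGamma ((s - 1) / 2) * zeta_sum \<kappa> G s)"
    using assms by (simp add: zeta_cont_def)
  then obtain H where H: "\<And>J. H J holomorphic_on {s. Re s > 1 - 2 * real J}"
    "\<And>J s. Re s > 1 \<Longrightarrow> H J s = rGamma ((s - 1) / 2) * zeta_sum \<kappa> G s"
    by metis
  have "2 \<in> {s. 1 < Re s}" by simp
  then have ne: "{s. 1 < Re s} \<noteq> {}" by blast
  have eq: "H J s = H J' s" if "J \<le> J'" "Re s > 1 - 2 * real J" for J J' s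
  proof (rule analytic_continuation_open[of "{s. Re s > 1}" "{s. Re s > 1 - 2 * real J}" "H J" "H J'"])
    show "H J' holomorphic_on {s. Re s > 1 - 2 * real J}"
      by (rule holomorphic_on_subset[OF H(1)]) (use that in auto)
    show "H J z = H J' z" if "z \<in> {s. Re s > 1}" for z using that H(2) by simp
    show "{s. 1 < Re s} \<noteq> {}" 
      by (rule ne)
    show "connected {s. Re s > 1 - 2 * real J}"
      by (intro convex_connected convex_halfspace_Re_gt)
  qed (use that H(1) in \<open>auto intro: open_halfspace_Re_gt\<close>)
  \<comment> \<open>Any N with 2 N > 1 - Re s would do: the half-planes are nested and the
    continuations agree on the smaller one.\<close>
  define N where "N s = nat \<lceil>1 - Re s\<rceil> + 1" for s
  have N: "Re s > 1 - 2 * real (N s)" for s 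
  proof -
    have "1 - Re s \<le> real (nat \<lceil>1 - Re s\<rceil>)" by (rule real_nat_ceiling_ge)
    moreover have "0 \<le> real (nat \<lceil>1 - Re s\<rceil>)" by (rule of_nat_0_le_iff)
    ultimately show ?thesis unfolding N_def of_nat_add of_nat_1 by argo
  qed
  define K where "K s = H (N s) s" for s
  have K: "K s = H J s" if "Re s > 1 - 2 * real J" for J s

  proof (cases "N s \<le> J")
    case True then show ?thesis unfolding K_def using eq[OF True N] by simp
  next
    case False then show ?thesis unfolding K_def using eq[of J "N s" s] that by simp
  qed
  have "K holomorphic_on UNIV"
  proof -
    have "K field_differentiable at s" for s
    proof -
      have "H (N s) field_differentiable at s"
        using H(1)[of "N s"] N[of s] open_halfspace_Re_gt
        by (metis (mono_tags) holomorphic_on_imp_differentiable_at mem_Collect_eq)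
      then obtain D where "(H (N s) has_field_derivative D) (at s)" by (auto simp: field_differentiable_def)
      then have "(K has_field_derivative D) (at s)"
      proof (rule has_field_derivative_transform_within_open)
        show "open {z. Re z > 1 - 2 * real (N s)}" by (rule open_halfspace_Re_gt)
        show "s \<in> {z. Re z > 1 - 2 * real (N s)}" using N by blast
        show "H (N s) z = K z" if "z \<in> {z. Re z > 1 - 2 * real (N s)}" for z
          using K[of "N s" z] that by simp
      qed
      then show ?thesis by (auto simp: field_differentiable_def)
    qed
    then show ?thesis by (simp add: holomorphic_on_def field_differentiable_at_within)
  qed
  moreover have "K s = rGamma ((s - 1) / 2) * zeta_sum \<kappa> G s" if "Re s > 1" for s
    using K[of 0 s] H(2)[OF that] that by simp
  ultimately show ?thesis using that by blast
qed

lemma Ln_1_plus_bounded: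
  assumes "\<rho> < 1"
  shows "\<exists>B. \<forall>w::complex. norm w \<le> \<rho> \<longrightarrow> norm (Ln (1 + w)) \<le> B"
proof -
  have "1 + w \<notin> \<real>\<^sub>\<le>\<^sub>0" if "norm w \<le> \<rho>" for w :: complex
    using complex_Re_le_cmod[of "- w"] that assms by (auto simp: complex_nonpos_Reals_iff)
  then have "continuous_on (cball 0 \<rho>) (\<lambda>w::complex. Ln (1 + w))"
    by (intro continuous_intros) auto
  then have "bounded ((\<lambda>w::complex. Ln (1 + w)) ` cball 0 \<rho>)"
    by (intro compact_imp_bounded compact_continuous_image) auto
  then obtain B where "\<And>w::complex. w \<in> cball 0 \<rho> \<Longrightarrow> norm (Ln (1 + w)) \<le> B"
    unfolding bounded_iff by blast
  then show ?thesis by (intro exI[of _ B]) simp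
qed

text \<open>These are the powers (1 + w u)^(a (c - s)). The margin \<rho> < 1 keeps 1 + w u in a
  compact set off the branch cut, where the logarithm is bounded.\<close>

lemma holo_family_exp_Ln:
  assumes w: "w holomorphic_on ball 0 R" and le: "\<And>u. norm u < R \<Longrightarrow> norm (w u) \<le> \<rho>" and \<rho>: "\<rho> < 1"
  shows "holo_family R (\<lambda>s u. exp ((c - s) * (a * Ln (1 + w u))))"
proof -
  obtain B where B: "\<And>w::complex. norm w \<le> \<rho> \<Longrightarrow> norm (Ln (1 + w)) \<le> B"
    using Ln_1_plus_bounded[OF \<rho>] by blast
  have "1 + w u \<notin> \<real>\<^sub>\<le>\<^sub>0" if "norm u < R" for u
    using complex_Re_le_cmod[of "- w u"] le[OF that] \<rho> by (auto simp: complex_nonpos_Reals_iff)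
  then have "(\<lambda>u. a * Ln (1 + w u)) holomorphic_on ball 0 R"
    by (intro holomorphic_intros w) auto
  then show ?thesis
    by (rule holo_family_exp[where B = "norm a * B"]) (use B le in \<open>auto simp: norm_mult intro!: mult_left_mono\<close>)
qed

text \<open>Telescoping \<open>\<Sum> (n-1/2)\<^bsup>1-s\<^esup> - (n+1/2)\<^bsup>1-s\<^esup>\<close> expresses \<open>(s-1) \<zeta>(s)\<close> through sums
  of the same kind at \<open>s+2\<close>; the symmetric choice makes the family even and yields \<open>\<zeta>(0) = -1/2\<close>.\<close>

definition zeta_fam :: "complex \<Rightarrow> complex \<Rightarrow> complex" where
  "zeta_fam = dquot (\<lambda>s u. exp ((1 - s) * (1 * Ln (1 + (- 1 / 2) * u))) + - exp ((1 - s) * (1 * Ln (1 + (1 / 2) * u))))"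

text \<open>The radius 3/2 exceeds 1, the largest argument 1/k, and stays below 2, where 1 - u/2
  reaches 0. At s = 0 the difference of the two powers is linear in u and the quotient constant, so
  the remainder of the splitting vanishes there.\<close>

lemma zeta_fam:
  shows "even_family (3/2) zeta_fam" and "zeta_fam s 0 = s - 1" and "norm u < 3/2 \<Longrightarrow> zeta_fam 0 u = - 1"
proof -
  let ?F = "\<lambda>s u. exp ((1 - s) * (1 * Ln (1 + (- 1 / 2) * u))) + - exp ((1 - s) * (1 * Ln (1 + (1 / 2) * u))) :: complex"
  have g: "holo_family (3/2) ?F"
    by (intro holo_family_add holo_family_uminus holo_family_exp_Ln[where \<rho> = "3/4"]) (auto simp: norm_mult norm_divide intro!: holomorphic_intros)
  have "zeta_fam s (- u) = zeta_fam s u" for s u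
    by (auto simp: zeta_fam_def dquot_def field_simps)
  with g show "even_family (3/2) zeta_fam"
    unfolding even_family_def zeta_fam_def by (auto intro: holo_family_dquot)
  have "(?F s has_field_derivative (s - 1)) (at 0)" for s
    by (auto intro!: derivative_eq_intros simp: field_simps)
  then show z0: "zeta_fam s 0 = s - 1" for s
    by (simp add: zeta_fam_def dquot_def DERIV_imp_deriv)
  show "zeta_fam 0 u = - 1" if "norm u < 3/2"
  proof (cases "u = 0")
    case True then show ?thesis using z0[of 0] by simp
  next
    case False
    have "1 + (- 1 / 2) * u \<noteq> 0" "1 + (1 / 2) * u \<noteq> 0"
    proof -
      have "norm (u / 2) < 1" using that by (simp add: norm_divide)
      then have "u / 2 \<noteq> 1" "u / 2 \<noteq> - 1" by (metis norm_one less_irrefl norm_minus_cancel)+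
      then show "1 + (- 1 / 2) * u \<noteq> 0" "1 + (1 / 2) * u \<noteq> 0"
        by (auto simp: add_eq_0_iff field_simps) (metis add.inverse_inverse)
    qed
    then show ?thesis using False by (simp add: zeta_fam_def dquot_def field_simps)
  qed
qed

lemma zeta_index_Suc: "R > 1 \<Longrightarrow> zeta_index R Suc"
  by (auto simp: zeta_index_def) (smt (verit) divide_le_eq_1 of_nat_0_le_iff)

lemma of_nat_powr: "n > 0 \<Longrightarrow> of_nat n powr z = exp (z * complex_of_real (ln (real n)))"
  by (simp add: powr_def Ln_of_nat)

lemma zeta_fam_term:
  "zeta_term Suc zeta_fam s n = of_real (real n + 1/2) powr (1 - s) - of_real (real (Suc n) + 1/2) powr (1 - s)"
proof -
  let ?k = "real (Suc n)"
  have k: "?k > 0" "1 - 1 / (2 * ?k) > 0" "1 + 1 / (2 * ?k) > 0" by (auto simp: field_simps add_pos_nonneg)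
  have L: "Ln (of_real x) = of_real (ln x)" if "x > 0" for x using that by (rule Ln_of_real)
  have e1: "1 + (- 1 / 2) * (1 / of_nat (Suc n)) = (of_real (1 - 1 / (2 * ?k)) :: complex)"
    and e2: "1 + (1 / 2) * (1 / of_nat (Suc n)) = (of_real (1 + 1 / (2 * ?k)) :: complex)" by simp_all
  \<comment> \<open>The extra factor k comes from the division by u = 1/k in \<open>dquot\<close>.
    It turns k^(-s) into k^(1-s), which then combines with the powers of 1 - 1/(2k) and 1 +
    1/(2k).\<close>
  have m: "of_nat (Suc n) powr (- s) * of_nat (Suc n) * exp ((1 - s) * of_real (ln y)) = of_real (?k * y) powr (1 - s)"
    if "y > 0" for y
  proof -
    have "of_nat (Suc n) powr (- s) * of_nat (Suc n) = exp ((1 - s) * of_real (ln ?k))"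
    proof -
      have "complex_of_nat (Suc n) = exp (of_real (ln ?k))"
        by (metis exp_ln exp_of_real k(1) of_real_of_nat_eq)
      then show ?thesis
        unfolding of_nat_powr[OF zero_less_Suc] by (simp add: exp_add[symmetric] algebra_simps del: of_nat_Suc)
    qed
    moreover have "of_real (?k * y) powr (1 - s) = exp ((1 - s) * of_real (ln (?k * y)))"
      using k(1) that unfolding powr_def by (subst L) (auto simp del: of_real_mult of_nat_Suc)
    moreover have "ln (?k * y) = ln ?k + ln y" using k(1) that by (rule ln_mult_pos)
    ultimately show ?thesis by (simp add: exp_add[symmetric] algebra_simps del: of_nat_Suc)
  qed
  have "zeta_term Suc zeta_fam s n = of_nat (Suc n) powr (- s) * of_nat (Suc n) *
      (exp ((1 - s) * of_real (ln (1 - 1 / (2 * ?k)))) - exp ((1 - s) * of_real (ln (1 + 1 / (2 * ?k)))))"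
    unfolding zeta_term_def zeta_fam_def dquot_def e1 e2 L[OF k(2)] L[OF k(3)]
    by (simp del: of_nat_Suc)
  also have "\<dots> = of_real (?k * (1 - 1 / (2 * ?k))) powr (1 - s) - of_real (?k * (1 + 1 / (2 * ?k))) powr (1 - s)"
    unfolding right_diff_distrib m[OF k(2)] m[OF k(3)] ..
  also have "?k * (1 - 1 / (2 * ?k)) = real n + 1/2" by (simp add: field_simps)
  also have "?k * (1 + 1 / (2 * ?k)) = ?k + 1/2" using k(1) by (simp add: distrib_left del: of_nat_Suc)
  finally show ?thesis .
qed

lemma zeta_fam_sum:
  assumes "Re s > 1"
  shows "zeta_sum Suc zeta_fam s = of_real (1/2) powr (1 - s)"
proof -
  define f where "f n = complex_of_real (real n + 1/2) powr (1 - s)" for n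
  have "(\<lambda>n. (real n + 1/2) powr (1 - Re s)) \<longlonglongrightarrow> 0"
    using assms by (intro tendsto_neg_powr) (auto, real_asymp)
  moreover have "norm (f n) = (real n + 1/2) powr (1 - Re s)" for n
    unfolding f_def by (subst norm_powr_real_powr) (auto simp del: of_real_add)
  ultimately have "f \<longlonglongrightarrow> 0" by (simp add: tendsto_norm_zero_iff[of f, symmetric])
  from telescope_sums'[OF this] have "(\<lambda>n. f n - f (Suc n)) sums f 0" by simp
  then show ?thesis
    unfolding zeta_sum_def zeta_fam_term by (simp add: f_def sums_iff)
qed

text \<open>Since \<open>zeta_fam s 0\<close> is s - 1, the splitting reads (1/2)^(1-s) = (s - 1)
  zeta(s) + remainder. The factor s - 1 is the one produced by \<open>rGamma_half_step\<close>, so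
  solving for the normalised zeta function needs no division by it.\<close>

lemma zeta_cont_zeta_step:
  assumes Q: "zeta_cont Suc (qshift zeta_fam) J"
  shows "zeta_cont Suc (\<lambda>_ _. 1) (Suc J)"
proof -
  obtain H where H: "H holomorphic_on {s. Re s > 1 - 2 * real J}"
    "\<And>s. Re s > 1 \<Longrightarrow> H s = rGamma ((s - 1) / 2) * zeta_sum Suc (qshift zeta_fam) s"
    using Q by (auto simp: zeta_cont_def)
  define K where "K s = (rGamma ((s + 1) / 2) * of_real (1/2) powr (1 - s) - H (s + 2)) / 2" for s
  have "(\<lambda>s. H (s + 2)) holomorphic_on {s. Re s > 1 - 2 * real (Suc J)}"
    using holomorphic_on_shift[OF H(1)] by (simp add: algebra_simps)
  then have "K holomorphic_on {s. Re s > 1 - 2 * real (Suc J)}"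
    unfolding K_def by (intro holomorphic_intros) auto
  moreover have "K s = rGamma ((s - 1) / 2) * zeta_sum Suc (\<lambda>_ _. 1) s" if s: "Re s > 1" for s
  proof -
    have "(s + 2 - 1) / 2 = (s + 1) / 2" by (simp add: field_simps)
    then have eq: "H (s + 2) = rGamma ((s + 1) / 2) * zeta_sum Suc (qshift zeta_fam) (s + 2)"
      using H(2)[of "s + 2"] that by (simp add: add.commute)
    have eq2: "of_real (1/2) powr (1 - s) = (s - 1) * zeta_sum Suc (\<lambda>_ _. 1) s + zeta_sum Suc (qshift zeta_fam) (s + 2)"
      using zeta_sum_split[OF zeta_fam(1) zeta_index_Suc s] zeta_fam_sum[OF s] zeta_fam(2) by simp
    show ?thesis
      unfolding K_def rGamma_half_step[of s] eq eq2 right_diff_distrib[symmetric] add_diff_cancel by simp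
  qed
  ultimately show ?thesis unfolding zeta_cont_def by blast
qed

text \<open>The induction runs over all even families at once: the step needs the hypothesis for
  \<open>qshift zeta_fam\<close>, to treat the constant family, as well as for
  \<open>qshift G\<close>.\<close>

lemma zeta_cont_Suc: "even_family (3/2) G \<Longrightarrow> zeta_cont Suc G J"
proof (induction J arbitrary: G)
  case 0 then show ?case by (intro zeta_cont_0[of "3/2"] zeta_index_Suc) (auto simp: even_family_def)
next
  case (Suc J)
  show ?case
  proof (rule zeta_cont_step[OF Suc.prems])
    show "zeta_cont Suc (\<lambda>_ _. 1) (Suc J)"
      by (intro zeta_cont_zeta_step Suc.IH even_family_qshift zeta_fam) auto
    show "zeta_cont Suc (qshift G) J" by (intro Suc.IH even_family_qshift Suc.prems) auto
  qed (auto intro: zeta_index_Suc)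
qed

text \<open>The entire function rGamma((s-1)/2) zeta(s), with zeta the Riemann zeta
  function.\<close>

definition zeta_H :: "complex \<Rightarrow> complex" where
  "zeta_H = (SOME H. H holomorphic_on UNIV \<and> (\<forall>s. Re s > 1 \<longrightarrow> H s = rGamma ((s - 1) / 2) * zeta_sum Suc (\<lambda>_ _. 1) s))"

lemma zeta_H: "zeta_H holomorphic_on UNIV" "Re s > 1 \<Longrightarrow> zeta_H s = rGamma ((s - 1) / 2) * zeta_sum Suc (\<lambda>_ _. 1) s"
proof -
  obtain H where "H holomorphic_on UNIV" "\<And>s. Re s > 1 \<Longrightarrow> H s = rGamma ((s - 1) / 2) * zeta_sum Suc (\<lambda>_ _. 1) s"
    using zeta_cont_glue[OF zeta_cont_Suc[OF even_family_one]] by blast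
  then have "\<exists>H. H holomorphic_on UNIV \<and> (\<forall>s. Re s > 1 \<longrightarrow> H s = rGamma ((s - 1) / 2) * zeta_sum Suc (\<lambda>_ _. 1) s)" by blast
  from someI_ex[OF this] show "zeta_H holomorphic_on UNIV" "Re s > 1 \<Longrightarrow> zeta_H s = rGamma ((s - 1) / 2) * zeta_sum Suc (\<lambda>_ _. 1) s"
    by (auto simp: zeta_H_def)
qed

lemma half_plane_nonempty: "{s. 1 < Re s} \<noteq> {}"
proof -
  have "2 \<in> {s. 1 < Re s}" by simp
  then show ?thesis by blast
qed

lemma zeta_sum_shift_hol:
  assumes "holo_family R G" "zeta_index R \<kappa>"
  shows "(\<lambda>s. zeta_sum \<kappa> G (s + 2)) holomorphic_on {s. Re s > - 1}"
  using holomorphic_on_shift[OF zeta_sum_props(2)[OF assms]] by simp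

text \<open>This says zeta(0) = -1/2, the normalising factor at 0 being 1 / Gamma(-1/2). The value
  comes from the telescoped term alone, because the remainder at s = 0 consists of zeros.\<close>

lemma zeta_H_0: "zeta_H 0 * Gamma (- 1 / 2) = - 1 / 2"
proof -
  have G: "holo_family (3/2) (qshift zeta_fam)"
    using even_family_qshift[OF zeta_fam(1)] by (auto simp: even_family_def)
  define K where "K s = rGamma ((s + 1) / 2) * (of_real (1/2) powr (1 - s) - zeta_sum Suc (qshift zeta_fam) (s + 2)) / 2" for s
  have "zeta_H 0 = K 0"
  proof (rule analytic_continuation_open[of "{s. Re s > 1}" "{s. Re s > - 1}" zeta_H K])
    show "K holomorphic_on {s. - 1 < Re s}"
      unfolding K_def by (intro holomorphic_intros zeta_sum_shift_hol[OF G zeta_index_Suc]) auto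
    show "zeta_H z = K z" if "z \<in> {s. Re s > 1}" for z
    proof -
      have z: "Re z > 1" using that by simp
      have "of_real (1/2) powr (1 - z) = (z - 1) * zeta_sum Suc (\<lambda>_ _. 1) z + zeta_sum Suc (qshift zeta_fam) (z + 2)"
        using zeta_sum_split[OF zeta_fam(1) zeta_index_Suc z] zeta_fam_sum[OF z] zeta_fam(2) by simp
      then show ?thesis
        unfolding K_def zeta_H(2)[OF z] rGamma_half_step[of z] by (simp only: add_diff_cancel) simp
    qed
    show "connected {s. - 1 < Re s}" by (intro convex_connected convex_halfspace_Re_gt)
  qed (use half_plane_nonempty zeta_H(1) in \<open>auto intro: open_halfspace_Re_gt holomorphic_on_subset\<close>)
  moreover have "zeta_sum Suc (qshift zeta_fam) 2 = 0"
  proof -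
    have "dquot (dquot zeta_fam) 0 (1 / of_nat (Suc n)) = 0" for n
    proof -
      have "norm (1 / of_nat (Suc n) :: complex) < 3/2" 
        using zeta_indexD(1)[OF zeta_index_Suc[of "3/2"], of n] by (simp del: of_nat_Suc)
      then show ?thesis
        using even_family_dquot2(2)[OF zeta_fam(1), of "1 / of_nat (Suc n)" 0] zeta_fam(2)[of 0]
          zeta_fam(3)[of "1 / of_nat (Suc n)"] by (simp del: of_nat_Suc)
    qed
    then show ?thesis by (simp add: zeta_sum_def zeta_term_def del: of_nat_Suc)
  qed
  ultimately have z: "zeta_H 0 = rGamma (1/2) / 4" by (simp add: K_def)
  have "(- 1 / 2) * Gamma (- 1 / 2 :: complex) = Gamma (1/2)"
  proof -
    have "(- 1 / 2 :: complex) \<notin> \<int>\<^sub>\<le>\<^sub>0"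
    proof
      assume "(- 1 / 2 :: complex) \<in> \<int>\<^sub>\<le>\<^sub>0"
      then obtain m :: int where "- 1 / 2 = (of_int m :: complex)" by (auto elim: nonpos_Ints_cases)
      then have "complex_of_int (2 * m) = of_int (- 1)" by (simp add: field_simps)
      then have "2 * m = - 1" by (simp only: of_int_eq_iff)
      then show False by presburger
    qed
    from Gamma_plus1[OF this] show ?thesis by simp
  qed
  from this[symmetric] have "Gamma (- 1 / 2 :: complex) = - 2 * Gamma (1/2)" by simp
  then have "zeta_H 0 * Gamma (- 1 / 2) = - (rGamma (1/2) * Gamma (1/2)) / 2" unfolding z by simp
  also have "rGamma (1/2) * Gamma (1/2 :: complex) = 1"
    by (simp add: rGamma_inverse_Gamma Gamma_one_half_complex)
  finally show ?thesis by simp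
qed

definition odd3 :: "nat \<Rightarrow> nat" where
  "odd3 n = 2 * n + 3"

lemma zeta_index_odd3: "1 / 3 < R \<Longrightarrow> zeta_index R odd3"
proof -
  assume R: "1 / 3 < R"
  have "1 / real (odd3 n) \<le> 1 / 3" for n by (intro frac_le) (auto simp: odd3_def)
  then have "1 / real (odd3 n) < R" for n using R by (meson le_less_trans)
  moreover have "n < odd3 n" for n by (simp add: odd3_def)
  ultimately show ?thesis using R by (simp add: zeta_index_def)
qed

text \<open>Grouping the zeta series in pairs isolates the even integers, which contribute 2^(-s)
  times the whole series; the final -1 removes k = 1.\<close>

lemma zeta_sum_odd3_one:
  assumes s: "Re s > 1"
  shows "zeta_sum odd3 (\<lambda>_ _. 1) s = (1 - 2 powr (- s)) * zeta_sum Suc (\<lambda>_ _. 1) s - 1"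
proof -
  define f where "f n = (of_nat (Suc n) powr (- s) :: complex)" for n
  let ?Z = "zeta_sum Suc (\<lambda>_ _. 1) s"
  have f: "f sums ?Z"
    using zeta_sum_props(1)[OF holo_family_one[of 2] zeta_index_Suc s] by (simp add: zeta_term_def f_def[abs_def])
  have "(\<lambda>n. sum f {n * 2..<n * 2 + 2}) sums ?Z"
    by (rule sums_group[OF f]) simp
  moreover have "sum f {n * 2..<n * 2 + 2} = f (2 * n) + 2 powr (- s) * f n" for n
  proof -
    have "sum f {n * 2..<n * 2 + 2} = f (2 * n) + f (Suc (2 * n))"
      by (simp add: numeral_2_eq_2 mult.commute)
    moreover have "f (Suc (2 * n)) = 2 powr (- s) * f n"
    proof -
      have "of_nat (2 * Suc n) powr (- s) = exp (- s * complex_of_real (ln (real (2 * Suc n))))"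
        by (rule of_nat_powr) simp
      also have "ln (real (2 * Suc n)) = ln 2 + ln (real (Suc n))"
        unfolding of_nat_mult by (subst ln_mult_pos) auto
      finally show ?thesis
        using of_nat_powr[of 2 "- s"] of_nat_powr[of "Suc n" "- s"]
        by (simp add: f_def exp_add[symmetric] distrib_left del: of_nat_Suc)
    qed
    ultimately show ?thesis by simp
  qed
  ultimately have "(\<lambda>n. f (2 * n) + 2 powr (- s) * f n) sums ?Z" by simp
  from sums_diff[OF this sums_mult[OF f, of "2 powr (- s)"]]
  have "(\<lambda>n. f (2 * n)) sums (?Z - 2 powr (- s) * ?Z)" by simp
  then have "(\<lambda>n. f (2 * Suc n)) sums (?Z - 2 powr (- s) * ?Z - f 0)"
    by (subst sums_Suc_iff) simp
  moreover have "f (2 * Suc n) = zeta_term odd3 (\<lambda>_ _. 1) s n" for n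
    by (simp add: f_def zeta_term_def odd3_def add.commute)
  ultimately have "zeta_term odd3 (\<lambda>_ _. 1) s sums (?Z - 2 powr (- s) * ?Z - f 0)" by (simp cong: sums_cong)
  then show ?thesis by (simp add: zeta_sum_def sums_iff f_def algebra_simps)
qed

lemma zeta_cont_odd3_one: "zeta_cont odd3 (\<lambda>_ _. 1) J"
  unfolding zeta_cont_def
proof (intro exI[of _ "\<lambda>s. (1 - 2 powr (- s)) * zeta_H s - rGamma ((s - 1) / 2)"] conjI allI impI)
  show "(\<lambda>s. (1 - 2 powr (- s)) * zeta_H s - rGamma ((s - 1) / 2)) holomorphic_on {s. 1 - 2 * real J < Re s}"
    by (intro holomorphic_intros holomorphic_on_subset[OF zeta_H(1)]) auto
  show "(1 - 2 powr (- s)) * zeta_H s - rGamma ((s - 1) / 2) = rGamma ((s - 1) / 2) * zeta_sum odd3 (\<lambda>_ _. 1) s"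
    if "1 < Re s" for s
    by (simp only: zeta_H(2)[OF that] zeta_sum_odd3_one[OF that] right_diff_distrib left_diff_distrib mult_ac mult_1)
qed

lemma zeta_cont_odd3: "even_family R G \<Longrightarrow> 1 / 3 < R \<Longrightarrow> zeta_cont odd3 G J"
proof (induction J arbitrary: G)
  case 0 then show ?case by (intro zeta_cont_0[of R] zeta_index_odd3) (auto simp: even_family_def)
next
  case (Suc J)
  show ?case
  proof (rule zeta_cont_step[OF Suc.prems(1) zeta_index_odd3[OF Suc.prems(2)] zeta_cont_odd3_one])
    show "zeta_cont odd3 (qshift G) J"
      using Suc.prems by (intro Suc.IH even_family_qshift) auto
  qed
qed

lemma rGamma_half_nz:
  assumes "Re s > - 1" "s \<noteq> 1"
  shows "rGamma ((s - 1) / 2 :: complex) \<noteq> 0"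
proof
  assume "rGamma ((s - 1) / 2) = 0"
  then obtain n where n: "(s - 1) / 2 = - of_nat n" by (auto simp: rGamma_eq_zero_iff elim: nonpos_Ints_cases')
  then have "s = 1 - 2 * of_nat n" by (simp add: field_simps)
  with assms show False by (cases n) auto
qed

text \<open>The odd integers are summed from \<open>3\<close> on, so that the argument \<open>1/k\<close> stays in a disc on
  which the families used later are holomorphic; \<open>k = 1\<close> contributes a separate entire term.\<close>

lemma odd_zeta:
  assumes G: "even_family R G" and R: "1 / 3 < R"
    and G0: "\<And>u. norm u < R \<Longrightarrow> G 0 u = m"
    and D: "\<And>u. norm u < R \<Longrightarrow> ((\<lambda>s. G s u) has_field_derivative D u) (at 0)" and D0: "D 0 = 0"
  obtains Z where "Z meromorphic_on UNIV" "Z analytic_on {0}"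
    "\<And>s. Re s > 1 \<Longrightarrow> (\<lambda>n. zeta_term odd3 G s n) sums Z s"
    "Z 0 = - m" "summable (\<lambda>n. D (1 / of_nat (odd3 n)))"
    "(Z has_field_derivative (- m * of_real (ln 2) / 2 + (\<Sum>n. D (1 / of_nat (odd3 n))))) (at 0)"
proof -
  have K: "zeta_index R odd3" by (rule zeta_index_odd3[OF R])
  have R0: "0 < R" using R by simp
  have gG: "holo_family R G" and gQ: "holo_family R (qshift G)"
    using G even_family_qshift[OF G R0] by (auto simp: even_family_def)
  obtain H where H: "H holomorphic_on UNIV" "\<And>s. Re s > 1 \<Longrightarrow> H s = rGamma ((s - 1) / 2) * zeta_sum odd3 G s"
    using zeta_cont_glue[OF zeta_cont_odd3[OF G R]] by blast
  define Z where "Z s = H s * inverse (rGamma ((s - 1) / 2))" for s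
  define Y where "Y s = zeta_sum odd3 (qshift G) (s + 2)" for s
  define z where "z s = zeta_H s * inverse (rGamma ((s - 1) / 2))" for s
  have an: "(\<lambda>s. inverse (rGamma ((s - 1) / 2))) analytic_on {0 :: complex}"
    using rGamma_half_nz[of 0] by (intro analytic_intros) auto
  have anH: "H analytic_on {0}" "H analytic_on UNIV" "zeta_H analytic_on {0}"
    using H(1) zeta_H(1) by (auto simp: analytic_on_open[symmetric] intro: analytic_on_subset)
  have Z1: "Z meromorphic_on UNIV"
    unfolding Z_def
    by (intro meromorphic_intros analytic_on_imp_meromorphic_on anH(2) analytic_intros) auto
  have Z2: "Z analytic_on {0}" unfolding Z_def by (intro analytic_on_mult an anH)
  have z_an: "z analytic_on {0}" unfolding z_def by (intro analytic_on_mult an anH)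
  have z0: "z 0 = - 1 / 2"
    using zeta_H_0 by (simp add: z_def rGamma_inverse_Gamma)
  have Z3: "(\<lambda>n. zeta_term odd3 G s n) sums Z s" if "Re s > 1" for s
  proof -
    have "rGamma ((s - 1) / 2) \<noteq> 0" using that by (intro rGamma_half_nz) auto
    then have "Z s = zeta_sum odd3 G s" by (simp add: Z_def H(2)[OF that])
    with zeta_sum_props(1)[OF gG K that] show ?thesis by simp
  qed
  have Y_hol: "Y holomorphic_on {s. - 1 < Re s}"
    unfolding Y_def by (rule zeta_sum_shift_hol[OF gQ K])
  \<comment> \<open>The identity theorem carries the splitting from Re s > 1 to Re s > -1, a region
    that contains 0.\<close>
  have HK: "H s = G s 0 * ((1 - 2 powr (- s)) * zeta_H s - rGamma ((s - 1) / 2)) + rGamma ((s - 1) / 2) * Y s"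
    (is "_ = ?K s") if "Re s > - 1" for s
  proof (rule analytic_continuation_open[of "{s. Re s > 1}" "{s. Re s > - 1}" H ?K])
    show "?K holomorphic_on {s. - 1 < Re s}"
      by (intro holomorphic_intros Y_hol even_family_hol0[OF G R0] holomorphic_on_subset[OF zeta_H(1)]) auto
    show "H z = ?K z" if "z \<in> {s. Re s > 1}" for z
    proof -
      have z: "Re z > 1" using that by simp
      show ?thesis
        unfolding H(2)[OF z] zeta_sum_split[OF G K z] zeta_sum_odd3_one[OF z] zeta_H(2)[OF z] Y_def
        by (simp add: algebra_simps)
    qed
    show "connected {s. - 1 < Re s}" by (intro convex_connected convex_halfspace_Re_gt)
  qed (use that half_plane_nonempty H(1) in \<open>auto intro: open_halfspace_Re_gt holomorphic_on_subset\<close>)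
  have ZY: "Z s = G s 0 * ((1 - 2 powr (- s)) * z s - 1) + Y s" if "s \<in> ball 0 (1/2)" for s
  proof -
    have "\<bar>Re s\<bar> < 1/2" using that abs_Re_le_cmod[of s] by simp
    then have Re: "Re s > - 1" "s \<noteq> 1" by auto
    define r where "r = rGamma ((s - 1) / 2)"
    have "r \<noteq> 0" unfolding r_def by (rule rGamma_half_nz[OF Re])
    then show ?thesis
      unfolding Z_def HK[OF Re(1)] z_def r_def[symmetric] by (simp add: field_simps)
  qed
  have split0: "zeta_term odd3 (qshift G) (w + 2) n = zeta_term odd3 G w n - G w 0 * zeta_term odd3 (\<lambda>_ _. 1) w n" for w n
    using zeta_term_split[OF G K, of w n] by simp
  have u: "norm (1 / of_nat (odd3 n) :: complex) < R" for n by (rule zeta_indexD(1)[OF K])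
  have m0: "G 0 0 = m" using G0[of 0] R0 by simp
  \<comment> \<open>At s = 0 the family is constant in u, so every remainder term vanishes. With the
    vanishing of 1 - 2^(-s) this leaves only the -m that comes from omitting k = 1.\<close>
  have term0: "zeta_term odd3 (qshift G) (0 + 2) n = 0" for n
    unfolding split0 by (simp add: zeta_term_def G0[OF u] m0)
  have Y0: "Y 0 = 0"
  proof -
    have "zeta_term odd3 (qshift G) 2 = (\<lambda>_. 0)" using term0 by (simp add: fun_eq_iff)
    then show ?thesis by (simp add: Y_def zeta_sum_def)
  qed
  have dterm: "deriv (\<lambda>s. zeta_term odd3 (qshift G) s n) 2 = D (1 / of_nat (odd3 n))" for n
  proof -
    let ?k = "of_nat (odd3 n) :: complex"
    have k: "?k \<noteq> 0" using zeta_indexD(2)[OF K, of n] by simp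
    obtain E where E: "((\<lambda>w. ?k powr (- w)) has_field_derivative E) (at 0)"

    proof -
      have "(\<lambda>w. ?k powr (- w)) holomorphic_on UNIV"
        using k by (intro holomorphic_on_powr_right holomorphic_on_minus holomorphic_on_ident)
      from holomorphic_derivI[OF this open_UNIV UNIV_I] show ?thesis by (rule that)
    qed
    \<comment> \<open>The difference of the two values of G vanishes at w = 0, so the derivative E
      of the power of k drops out of the product rule.\<close>
    have "((\<lambda>w. ?k powr (- w) * (G w (1 / ?k) - G w 0)) has_field_derivative D (1 / ?k)) (at 0)"
      by (rule DERIV_cong[OF DERIV_mult[OF E DERIV_diff[OF D[OF u] D[of 0]]]])
        (use R0 k D0 in \<open>simp_all add: G0[OF u] m0\<close>)
    moreover have "zeta_term odd3 (qshift G) (w + 2) n = ?k powr (- w) * (G w (1 / ?k) - G w 0)" for w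
      unfolding split0 by (simp add: zeta_term_def algebra_simps)
    ultimately have "((\<lambda>w. zeta_term odd3 (qshift G) (w + 2) n) has_field_derivative D (1 / ?k)) (at 0)" by simp
    then have "((\<lambda>s. zeta_term odd3 (qshift G) s n) has_field_derivative D (1 / ?k)) (at (0 + 2))"
      by (subst DERIV_shift)
    then show ?thesis by (simp add: DERIV_imp_deriv)
  qed
  have sm: "(\<lambda>n. D (1 / of_nat (odd3 n))) sums deriv (zeta_sum odd3 (qshift G)) 2"
    using zeta_sum_props(3)[OF gQ K, of 2] unfolding dterm by simp
  have "(zeta_sum odd3 (qshift G) has_field_derivative deriv (zeta_sum odd3 (qshift G)) 2) (at (0 + 2))"
    using holomorphic_derivI[OF zeta_sum_props(2)[OF gQ K] open_halfspace_Re_gt, of 2] by simp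
  then have dY: "(Y has_field_derivative (\<Sum>n. D (1 / of_nat (odd3 n)))) (at 0)"
    using sm unfolding Y_def by (subst (asm) DERIV_shift) (simp add: sums_iff)
  obtain z' where z': "(z has_field_derivative z') (at 0)"
    using analytic_on_imp_differentiable_at[OF z_an] by (auto simp: field_differentiable_def)
  have p: "((\<lambda>s. 1 - 2 powr (- s)) has_field_derivative complex_of_real (ln 2)) (at 0)"
  proof -
    have "Ln 2 = complex_of_real (ln 2)" using Ln_of_real[of 2] by simp
    then show ?thesis by (auto intro!: derivative_eq_intros simp: powr_def)
  qed
  \<comment> \<open>As 1 - 2^(-s) vanishes at 0, the unknown z' is multiplied by 0. The term -m ln 2
    / 2 is m times ln 2 times zeta(0).\<close>
  have "((\<lambda>s. G s 0 * ((1 - 2 powr (- s)) * z s - 1) + Y s) has_field_derivative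
      (- m * of_real (ln 2) / 2 + (\<Sum>n. D (1 / of_nat (odd3 n))))) (at 0)"
    by (rule DERIV_cong[OF DERIV_add[OF DERIV_mult[OF D[of 0] DERIV_diff[OF DERIV_mult[OF p z'] DERIV_const]] dY]])
      (use R0 in \<open>simp_all add: D0 m0 z0\<close>)
  then have Z6: "(Z has_field_derivative (- m * of_real (ln 2) / 2 + (\<Sum>n. D (1 / of_nat (odd3 n))))) (at 0)"
    by (rule has_field_derivative_transform_within_open[where S = "ball 0 (1/2)"]) (auto simp: ZY)
  have Z4: "Z 0 = - m" using ZY[of 0] Y0 by (simp add: m0)
  show ?thesis
    by (rule that[OF Z1 Z2 Z3 Z4 sums_summable[OF sm] Z6])
qed

section \<open>The product of 1 - 2/k^2 over odd k\<close>

lemma prod_odd_even_split: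
  fixes a :: "nat \<Rightarrow> real"
  shows "(\<Prod>k=1..2 * Suc n. a k) = a 1 * (\<Prod>i<n. a (2 * i + 3)) * (\<Prod>j=1..Suc n. a (2 * j))"
proof (induction n)
  case 0
  have "{1..2 * Suc 0} = {1, 2}" by auto
  then show ?case by simp
next
  case (Suc n)
  have "prod a {1..2 * Suc (Suc n)} = prod a {1..2 * Suc n} * a (2 * n + 3) * a (2 * Suc (Suc n))"
  proof -
    have "2 * Suc (Suc n) = Suc (Suc (2 * Suc n))" "2 * n + 3 = Suc (2 * Suc n)" by simp_all
    then show ?thesis by (simp only: prod.cl_ivl_Suc) simp
  qed
  moreover have "(\<Prod>j=1..Suc (Suc n). a (2 * j)) = (\<Prod>j=1..Suc n. a (2 * j)) * a (2 * Suc (Suc n))"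
    by (simp only: prod.cl_ivl_Suc) simp
  ultimately show ?case unfolding Suc.IH by (simp only: prod.lessThan_Suc mult_ac)
qed

text \<open>Equal to -cos(pi / sqrt 2). The cosine product over odd k has the factor 1 - 2 = -1 at k
  = 1; leaving it out makes the value positive.\<close>

definition sin_value :: real where
  "sin_value = sin (pi * ((sqrt 2 - 1) / 2))"

lemma sin_value_pos: "sin_value > 0"
proof -
  have "sqrt 2 < 2" by (rule real_less_lsqrt) auto
  then have "0 < (sqrt 2 - 1) / 2" "(sqrt 2 - 1) / 2 < 1" by auto
  then have "0 < pi * ((sqrt 2 - 1) / 2)" "pi * ((sqrt 2 - 1) / 2) < pi * 1"
    by (auto intro: mult_strict_left_mono)
  then show ?thesis unfolding sin_value_def by (intro sin_gt_zero) auto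
qed

text \<open>Divide the sine product at sqrt 2 by the one at sqrt 2 / 2. The even factors of the
  first are the factors of the second, k = 1 gives the sign, and the duplication formula turns the
  quotient of sines into a cosine.\<close>

lemma prod_odd_limit: "(\<lambda>n. \<Prod>i<n. 1 - 2 / real (odd3 i) ^ 2) \<longlonglongrightarrow> sin_value"
proof -
  define y where "y = sqrt 2 / 2"
  define P where "P x n = (\<Prod>k=1..n. 1 - x^2 / real k ^ 2)" for x n
  have P: "P x \<longlonglongrightarrow> sin (pi * x) / (pi * x)" if "x \<noteq> 0" for x
    using sin_product_formula_real'[OF that] by (simp add: P_def[abs_def])
  have y: "y > 0" "y < 1" "2 * y = sqrt 2" "y ^ 2 = 1 / 2"
    by (auto simp: y_def power_divide intro: real_less_lsqrt)
  have sy: "sin (pi * y) > 0"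
    using y by (intro sin_gt_zero) (auto simp: mult_less_cancel_left)
  have "filterlim (\<lambda>n. 2 * Suc n) at_top sequentially"
    by (rule filterlim_subseq) (auto simp: strict_mono_def)
  from filterlim_compose[OF P[of "sqrt 2"] this]
  have l1: "(\<lambda>n. P (sqrt 2) (2 * Suc n)) \<longlonglongrightarrow> sin (pi * sqrt 2) / (pi * sqrt 2)" by simp
  have l2: "(\<lambda>n. P y (Suc n)) \<longlonglongrightarrow> sin (pi * y) / (pi * y)"
    using P[of y] y by (intro LIMSEQ_Suc) auto
  have eq: "P (sqrt 2) (2 * Suc n) = - (\<Prod>i<n. 1 - 2 / real (odd3 i) ^ 2) * P y (Suc n)" for n
  proof -
    have "1 - (sqrt 2)\<^sup>2 / (real (2 * j))\<^sup>2 = 1 - y\<^sup>2 / (real j)\<^sup>2" for j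
      by (simp add: y(4) power_mult_distrib)
    moreover have "1 - (sqrt 2)\<^sup>2 / (real (2 * i + 3))\<^sup>2 = 1 - 2 / (real (odd3 i))\<^sup>2" for i
      by (simp add: odd3_def)
    moreover have "1 - (sqrt 2)\<^sup>2 / (real 1)\<^sup>2 = - 1" by simp
    ultimately show ?thesis unfolding P_def prod_odd_even_split by (simp only: mult_minus_left mult_1)
  qed
  have "(\<lambda>n. - (P (sqrt 2) (2 * Suc n) / P y (Suc n))) \<longlonglongrightarrow>
      - ((sin (pi * sqrt 2) / (pi * sqrt 2)) / (sin (pi * y) / (pi * y)))"
    using sy y by (intro tendsto_intros l1 l2) auto
  moreover have "P y (Suc n) \<noteq> 0" for n
  proof -
    have "1 - y^2 / real k ^ 2 \<noteq> 0" if "k \<ge> 1" for k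
    proof
      assume "1 - y^2 / real k ^ 2 = 0"
      then have "real k ^ 2 = 1 / 2" using that y(4) by (auto simp: field_simps)
      moreover have "real k ^ 2 \<ge> 1" using that by simp
      ultimately show False by simp
    qed
    then show ?thesis unfolding P_def by (subst prod_zero_iff) auto
  qed
  then have "- (P (sqrt 2) (2 * Suc n) / P y (Suc n)) = (\<Prod>i<n. 1 - 2 / real (odd3 i) ^ 2)" for n
    unfolding eq by simp
  moreover have "- ((sin (pi * sqrt 2) / (pi * sqrt 2)) / (sin (pi * y) / (pi * y))) = sin_value"
  proof -
    have "sin (pi * sqrt 2) = 2 * sin (pi * y) * cos (pi * y)"
      using sin_double[of "pi * y"] y(3) by (simp add: algebra_simps)
    then have "- ((sin (pi * sqrt 2) / (pi * sqrt 2)) / (sin (pi * y) / (pi * y))) = - (cos (pi * y) * (2 * y) / sqrt 2)"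
      using sy y(1) by (simp add: field_simps)
    also have "\<dots> = - cos (pi * y)" unfolding y(3) by simp
    also have "\<dots> = sin (pi * y - pi / 2)" by (simp add: sin_diff)
    also have "pi * y - pi / 2 = pi * ((sqrt 2 - 1) / 2)" by (simp add: y_def field_simps)
    finally show ?thesis by (simp add: sin_value_def)
  qed
  ultimately show ?thesis by simp
qed

lemma odd3_ge: "real (odd3 n) \<ge> 3" "odd3 n > 0"
  by (auto simp: odd3_def)

lemma odd3_factor_pos: "1 - 2 / real (odd3 i) ^ 2 > 0"
proof -
  have "real (odd3 i) ^ 2 \<ge> 3 ^ 2" using odd3_ge(1) by (intro power_mono) auto
  then have "2 / real (odd3 i) ^ 2 \<le> 2 / 9" by (intro frac_le) auto
  then show ?thesis by simp
qed

lemma ln_sum_odd: "(\<lambda>i. ln (1 - 2 / real (odd3 i) ^ 2)) sums ln sin_value"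
proof -
  have "(\<lambda>n. ln (\<Prod>i<n. 1 - 2 / real (odd3 i) ^ 2)) \<longlonglongrightarrow> ln sin_value"
    using sin_value_pos by (intro tendsto_ln prod_odd_limit) auto
  moreover have "ln (\<Prod>i<n. 1 - 2 / real (odd3 i) ^ 2) = (\<Sum>i<n. ln (1 - 2 / real (odd3 i) ^ 2))" for n
  proof (rule ln_prod[OF finite_lessThan])
    show "1 - 2 / real (odd3 i) ^ 2 \<noteq> 0" for i using odd3_factor_pos[of i] by (metis less_irrefl)
  qed
  ultimately show ?thesis by (simp add: sums_def)
qed

section \<open>Zeta functions of the three eigenvalue sequences\<close>

lemma has_sum_nat_shift:
  fixes f :: "nat \<Rightarrow> 'a::{topological_comm_monoid_add,t2_space}"
  assumes "((\<lambda>n. f (Suc n)) has_sum a) UNIV"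
  shows "(f has_sum (f 0 + a)) UNIV"
proof -
  have "(f has_sum a) (range Suc)"
    using assms by (subst has_sum_reindex) (auto simp: o_def)
  then have "(f has_sum (f 0 + a)) (insert 0 (range Suc))"
    by (rule has_sum_insert[rotated]) auto
  moreover have "insert 0 (range Suc) = UNIV" using UNIV_nat_eq by simp
  ultimately show ?thesis by simp
qed

lemma zeta_term_has_sum:
  assumes "holo_family R G" "zeta_index R \<kappa>" "Re s > 1"
  shows "((\<lambda>n. zeta_term \<kappa> G s n) has_sum zeta_sum \<kappa> G s) UNIV"
  using norm_summable_imp_has_sum[OF zeta_sum_props(4)[OF assms] zeta_sum_props(1)[OF assms]] .

lemma of_real_powr_exp: "x > 0 \<Longrightarrow> complex_of_real x powr z = exp (z * of_real (ln x))"
  by (simp add: powr_def Ln_of_real)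

text \<open>The index set K labels eigenvectors, so multiplicities are counted by repetition. The
  exponent is -s/2 because \<mu> lists eigenvalues of the adjoint composed with the operator, not of
  its square root.\<close>

definition zeta_data :: "'k set \<Rightarrow> ('k \<Rightarrow> real) \<Rightarrow> complex \<Rightarrow> bool" where
  "zeta_data K \<mu> d \<longleftrightarrow> (\<exists>Z. Z meromorphic_on UNIV \<and> Z analytic_on {0} \<and>
     (\<exists>\<sigma>. \<forall>s. Re s > \<sigma> \<longrightarrow> ((\<lambda>k. complex_of_real (\<mu> k) powr (- s / 2)) has_sum Z s) K) \<and>
     (Z has_field_derivative d) (at 0))"

lemma meromorphic_on_scale:
  assumes Z: "Z meromorphic_on UNIV"
  shows "(\<lambda>s. Z (a * s :: complex)) meromorphic_on UNIV"
  by (rule meromorphic_on_compose[OF Z]) (auto intro!: analytic_intros)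

text \<open>The finitely many \<open>e i\<close> are the eigenvalues for k = 1, and a is half the
  growth exponent of the others in k. The scalar C enters the derivative with weight m from the
  continued part. In each application there are m exceptional eigenvalues, each proportional to the
  scalar, so the scalar cancels.\<close>

lemma zeta_data_build:
  assumes Z: "Z0 meromorphic_on UNIV" "Z0 analytic_on {0}" "(Z0 has_field_derivative d0) (at 0)"
    and Z00: "Z0 0 = - m" and a: "a > 0" and C: "C > 0"
    and F: "finite F" "\<And>i. i \<in> F \<Longrightarrow> e i > 0" 
    and sum: "\<And>s. a * Re s > 1 \<Longrightarrow>
      ((\<lambda>k. complex_of_real (\<mu> k) powr (- s / 2)) has_sum
        ((\<Sum>i\<in>F. complex_of_real (e i) powr (- s / 2)) + of_real C powr (- s / 2) * Z0 (of_real a * s))) K"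
    and d: "d = - of_real (\<Sum>i\<in>F. ln (e i)) / 2 + m * of_real (ln C) / 2 + of_real a * d0"
  shows "zeta_data K \<mu> d"
  unfolding zeta_data_def
proof (intro exI conjI allI impI)
  let ?Z = "\<lambda>s. (\<Sum>i\<in>F. complex_of_real (e i) powr (- s / 2)) + of_real C powr (- s / 2) * Z0 (of_real a * s)"
  have entire: "(\<lambda>s. complex_of_real x powr (- s / 2)) analytic_on A" if "x > 0" for x A
  proof -
    have "(\<lambda>s. complex_of_real x powr (- s / 2)) holomorphic_on UNIV"
      using that by (intro holomorphic_on_powr_right holomorphic_intros) auto
    then show ?thesis by (meson analytic_on_holomorphic open_UNIV subset_UNIV)
  qed
  show "?Z meromorphic_on UNIV"
    by (intro meromorphic_on_add meromorphic_on_mult meromorphic_on_sum meromorphic_on_scale Z(1)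
        analytic_on_imp_meromorphic_on entire C F(2))
  have "(\<lambda>s. Z0 (of_real a * s)) analytic_on {0}"
    using analytic_on_compose_gen[of "\<lambda>s. of_real a * s" "{0}" Z0 "{0}"] Z(2)
    by (auto simp: o_def intro!: analytic_intros)
  then show "?Z analytic_on {0}"
    by (intro analytic_on_add analytic_on_mult analytic_on_sum entire C F(2))
  show "\<And>s. 1 / a < Re s \<Longrightarrow> ((\<lambda>k. complex_of_real (\<mu> k) powr (- s / 2)) has_sum ?Z s) K"
    using a by (intro sum) (simp add: field_simps)
  have p: "((\<lambda>s. complex_of_real x powr (- s / 2)) has_field_derivative - of_real (ln x) / 2) (at 0)"
    if "x > 0" for x
    unfolding of_real_powr_exp[OF that] by (auto intro!: derivative_eq_intros)
  have z: "((\<lambda>s. Z0 (of_real a * s)) has_field_derivative d0 * of_real a) (at 0)"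
    by (rule DERIV_chain2[where f = Z0]) (use Z(3) in \<open>auto intro!: derivative_eq_intros\<close>)
  have "complex_of_real C powr 0 = 1" using C by simp
  then show "(?Z has_field_derivative d) (at 0)"
    by (intro DERIV_cong[OF DERIV_add[OF DERIV_sum[OF p] DERIV_mult[OF p[OF C] z]]] F(2))
      (auto simp: d Z00 sum_negf sum_divide_distrib)
qed

text \<open>The radius 2/5 contains 1/k for all k >= 3 and is small enough for the perturbation in
  \<open>zeta_data_2\<close> to have norm at most 89/100.\<close>

lemma R25: "1 / 3 < (2 / 5 :: real)" by simp

lemma zeta_data_0:
  assumes C: "C > 0"
  shows "zeta_data UNIV (\<lambda>n. C * real (2 * n + 1)) (- of_real (ln 2) / 4)"
proof -
  obtain Z where Z: "Z meromorphic_on UNIV" "Z analytic_on {0}"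
    "\<And>s. Re s > 1 \<Longrightarrow> (\<lambda>n. zeta_term odd3 (\<lambda>_ _. 1) s n) sums Z s" "Z 0 = - 1"
    "(Z has_field_derivative (- 1 * of_real (ln 2) / 2 + (\<Sum>n. 0))) (at 0)"
    using odd_zeta[OF even_family_one R25, of 1 "\<lambda>_. 0"] by (auto simp: DERIV_const)
  show ?thesis
  proof (rule zeta_data_build[OF Z(1,2,5,4), where F = "{()}" and e = "\<lambda>_. C" and C = C and a = "1/2"])
    fix s assume s: "1 / 2 * Re s > 1"
    have Zs: "Z (of_real (1/2) * s) = zeta_sum odd3 (\<lambda>_ _. 1) (of_real (1/2) * s)"
      using Z(3)[of "of_real (1/2) * s"] s by (simp add: zeta_sum_def sums_iff)
    have "((\<lambda>n. of_real C powr (- s / 2) * zeta_term odd3 (\<lambda>_ _. 1) (of_real (1/2) * s) n) has_sum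
        of_real C powr (- s / 2) * Z (of_real (1/2) * s)) UNIV"
      unfolding Zs using s by (intro has_sum_cmult_right zeta_term_has_sum[OF holo_family_one[of "2/5"] zeta_index_odd3]) auto
    moreover have "of_real C powr (- s / 2) * zeta_term odd3 (\<lambda>_ _. 1) (of_real (1/2) * s) n =
        of_real (C * real (2 * Suc n + 1)) powr (- s / 2)" for n
    proof -
      have "C * real (2 * Suc n + 1) = C * real (odd3 n)" by (simp add: odd3_def)
      then show ?thesis
        using C odd3_ge(2)[of n]
        by (simp add: zeta_term_def of_real_powr_exp of_nat_powr ln_mult_pos exp_add[symmetric] algebra_simps add_divide_distrib
            del: of_real_mult of_nat_mult)
    qed
    ultimately have "((\<lambda>n. of_real (C * real (2 * Suc n + 1)) powr (- s / 2)) has_sum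
        of_real C powr (- s / 2) * Z (of_real (1/2) * s)) UNIV" by simp
    from has_sum_nat_shift[OF this]
    show "((\<lambda>n. of_real (C * real (2 * n + 1)) powr (- s / 2)) has_sum
      ((\<Sum>i\<in>{()}. of_real C powr (- s / 2)) + of_real C powr (- s / 2) * Z (of_real (1/2) * s))) UNIV"
      by simp
  qed (use C in auto)
qed

lemma zeta_data_1:
  assumes C: "C > 0"
  shows "zeta_data UNIV (\<lambda>n. C * \<bar>real (2 * n + 1) * (real (2 * n + 1) ^ 2 - 2)\<bar>)
    (- (3 / 4) * of_real (ln 2) - of_real (ln sin_value) / 2)"
proof -
  \<comment> \<open>The eigenvalue is k^3 (1 - 2/k^2), and its power -s/2 is k^(-t) (1 -
    2/k^2)^(-t/3) with t = 3s/2. Hence the 1/3 here and a = 3/2 below.\<close>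
  define G where "G = (\<lambda>s u :: complex. exp ((0 - s) * (1 / 3 * Ln (1 + (- 2 * u\<^sup>2)))))"
  define D where "D = (\<lambda>u :: complex. - (1 / 3 * Ln (1 + (- 2 * u\<^sup>2))))"
  have gG: "holo_family (2/5) G"
    unfolding G_def
  proof (rule holo_family_exp_Ln[where \<rho> = "8/25"])
    show "norm (- 2 * u\<^sup>2) \<le> 8 / 25" if "norm u < 2/5" for u :: complex
    proof -
      have "norm u ^ 2 \<le> (2/5) ^ 2" using that by (intro power_mono) auto
      then show ?thesis by (simp add: norm_mult norm_power power_divide)
    qed
  qed (auto intro!: holomorphic_intros)
  then have eG: "even_family (2/5) G" by (simp add: even_family_def G_def)
  have u2: "1 + - 2 * (1 / of_nat (odd3 n))\<^sup>2 = complex_of_real (1 - 2 / real (odd3 n) ^ 2)" for n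
    by (simp add: power_divide)
  have Dn: "D (1 / of_nat (odd3 n)) = of_real (- (ln (1 - 2 / real (odd3 n) ^ 2)) / 3)" for n
    unfolding D_def u2 Ln_of_real[OF odd3_factor_pos] by simp
  have "(\<lambda>n. D (1 / of_nat (odd3 n))) sums of_real (- (ln sin_value) / 3)"
    unfolding Dn by (intro sums_of_real sums_divide sums_minus ln_sum_odd)
  then have sD: "(\<Sum>n. D (1 / of_nat (odd3 n))) = of_real (- (ln sin_value) / 3)" by (simp add: sums_iff)
  have der: "((\<lambda>s. G s u) has_field_derivative D u) (at 0)" for u
    unfolding G_def D_def by (auto intro!: derivative_eq_intros)
  have G0: "G 0 u = 1" for u by (simp add: G_def)
  have D0: "D 0 = 0" by (simp add: D_def)
  obtain Z where Z: "Z meromorphic_on UNIV" "Z analytic_on {0}"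
    "\<And>s. Re s > 1 \<Longrightarrow> (\<lambda>n. zeta_term odd3 G s n) sums Z s" "Z 0 = - 1"
    "(Z has_field_derivative (- 1 * of_real (ln 2) / 2 + of_real (- (ln sin_value) / 3))) (at 0)"
    using odd_zeta[OF eG R25 G0 der D0] unfolding sD by blast
  show ?thesis
  \<comment> \<open>For k = 1 the factor k^2 - 2 equals -1, so the exceptional eigenvalue is C
    itself.\<close>
  proof (rule zeta_data_build[OF Z(1,2,5,4), where F = "{()}" and e = "\<lambda>_. C" and C = C and a = "3/2"])
    fix s assume s: "3 / 2 * Re s > 1"
    have Zs: "Z (of_real (3/2) * s) = zeta_sum odd3 G (of_real (3/2) * s)"
      using Z(3)[of "of_real (3/2) * s"] s by (simp add: zeta_sum_def sums_iff)
    have "((\<lambda>n. of_real C powr (- s / 2) * zeta_term odd3 G (of_real (3/2) * s) n) has_sum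
        of_real C powr (- s / 2) * Z (of_real (3/2) * s)) UNIV"
      unfolding Zs using s by (intro has_sum_cmult_right zeta_term_has_sum[OF gG zeta_index_odd3]) auto
    moreover have "of_real C powr (- s / 2) * zeta_term odd3 G (of_real (3/2) * s) n =
        of_real (C * \<bar>real (2 * Suc n + 1) * (real (2 * Suc n + 1) ^ 2 - 2)\<bar>) powr (- s / 2)" for n
    proof -
      let ?k = "real (odd3 n)"
      have k: "?k > 0" using odd3_ge(2)[of n] by simp
      have p: "1 - 2 / ?k ^ 2 > 0" by (rule odd3_factor_pos)
      have "real (2 * Suc n + 1) = ?k" by (simp add: odd3_def)
      moreover have "?k * (?k ^ 2 - 2) = ?k ^ 3 * (1 - 2 / ?k ^ 2)"
        using k by (simp add: field_simps power2_eq_square power3_eq_cube)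
      ultimately have x: "C * \<bar>real (2 * Suc n + 1) * (real (2 * Suc n + 1) ^ 2 - 2)\<bar> = C * (?k ^ 3 * (1 - 2 / ?k ^ 2))"
        using k p by (simp add: abs_mult)
      have "ln (C * (?k ^ 3 * (1 - 2 / ?k ^ 2))) = ln C + (3 * ln ?k + ln (1 - 2 / ?k ^ 2))"
        using C k p by (simp add: ln_mult_pos ln_realpow del: of_nat_power)
      moreover have "C * (?k ^ 3 * (1 - 2 / ?k ^ 2)) > 0" using C k p by (intro mult_pos_pos) auto
      ultimately have r: "complex_of_real (C * (?k ^ 3 * (1 - 2 / ?k ^ 2))) powr (- s / 2)
         = exp (- s / 2 * (of_real (ln C) + (3 * of_real (ln ?k) + of_real (ln (1 - 2 / ?k ^ 2)))))"
        by (simp only: of_real_powr_exp) simp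
      show ?thesis
        unfolding x r unfolding zeta_term_def G_def u2 Ln_of_real[OF p] of_nat_powr[OF odd3_ge(2)] of_real_powr_exp[OF C]
        by (simp add: exp_add[symmetric] algebra_simps)
    qed
    ultimately have "((\<lambda>n. of_real (C * \<bar>real (2 * Suc n + 1) * (real (2 * Suc n + 1) ^ 2 - 2)\<bar>) powr (- s / 2)) has_sum
        of_real C powr (- s / 2) * Z (of_real (3/2) * s)) UNIV" by simp
    from has_sum_nat_shift[OF this]
    show "((\<lambda>n. of_real (C * \<bar>real (2 * n + 1) * (real (2 * n + 1) ^ 2 - 2)\<bar>) powr (- s / 2)) has_sum
      ((\<Sum>i\<in>{()}. of_real C powr (- s / 2)) + of_real C powr (- s / 2) * Z (of_real (3/2) * s))) UNIV"
      by simp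
  qed (use C in \<open>auto simp: algebra_simps\<close>)
qed

lemma norm_csqrt_minus_one: "norm (csqrt z - 1) \<le> norm (z - 1)"
proof -
  have "csqrt z * csqrt z = z" using power2_csqrt[of z] by (simp add: power2_eq_square)
  then have "(csqrt z - 1) * (csqrt z + 1) = z - 1" by (simp add: algebra_simps)
  then have "norm (csqrt z - 1) * norm (csqrt z + 1) = norm (z - 1)" by (metis norm_mult)
  moreover have "1 \<le> norm (csqrt z + 1)"
    using complex_Re_le_cmod[of "csqrt z + 1"] Re_csqrt[of z] by (simp del: csqrt.simps)
  ultimately show ?thesis
    by (metis mult.right_neutral mult_left_mono norm_ge_zero)
qed

text \<open>The quadratic lm^2 - 5/2 lm + 1/2 - 2 n (n + 1), a factor of the characteristic
  polynomial of a D_2 block, has the roots \<open>rumin_eig2 n True\<close> and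
  \<open>- rumin_eig2 n False\<close>. Its discriminant produces 25/16 - 1/2 - 1/2 = 9/16 once 2 n
  (n + 1) is written as (k^2 - 1)/2. Only the squares matter, and \<open>rumin_eig2 0 False\<close>
  is in fact negative.\<close>

definition rumin_eig2 :: "nat \<Rightarrow> bool \<Rightarrow> real" where
  "rumin_eig2 n b = sqrt (real (2 * n + 1) ^ 2 / 2 + 9 / 16) + (if b then 5 / 4 else - 5 / 4)"

text \<open>The factor k^2 - 2 is the one that occurs in the eigenvalues of D_1, which is how the
  same infinite product enters the determinant of D_2.\<close>

lemma rumin_eig2_prod: "rumin_eig2 n True * rumin_eig2 n False = (real (2 * n + 1) ^ 2 - 2) / 2"
proof -
  let ?r = "sqrt (real (2 * n + 1) ^ 2 / 2 + 9 / 16)"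
  have "?r * ?r = real (2 * n + 1) ^ 2 / 2 + 9 / 16" by (rule real_sqrt_mult_self[THEN trans]) simp
  then show ?thesis unfolding rumin_eig2_def by (simp add: algebra_simps del: of_nat_add of_nat_mult)
qed

lemma rumin_eig2_nz: "rumin_eig2 n b \<noteq> 0"
proof
  assume "rumin_eig2 n b = 0"
  then have "(real (2 * n + 1) ^ 2 - 2) / 2 = 0"
    using rumin_eig2_prod[of n] by (cases b) auto
  then have "real (2 * n + 1) ^ 2 = real 2" by simp
  then have "(2 * n + 1) ^ 2 = 2" by (metis of_nat_power of_nat_eq_iff)
  moreover have "odd ((2 * n + 1) ^ 2)" by simp
  ultimately show False by simp
qed

lemma has_sum_bool_split:
  fixes f :: "nat \<times> bool \<Rightarrow> complex"
  assumes "((\<lambda>n. f (n, True)) has_sum a) UNIV" "((\<lambda>n. f (n, False)) has_sum b) UNIV"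
  shows "(f has_sum (a + b)) UNIV"
proof -
  have r: "(f has_sum c) (range (\<lambda>n. (n, x)))" if "((\<lambda>n. f (n, x)) has_sum c) UNIV" for x c
    using that by (subst has_sum_reindex) (auto simp: inj_on_def o_def)
  have "(f has_sum (a + b)) (range (\<lambda>n. (n, True)) \<union> range (\<lambda>n. (n, False)))"
    by (intro has_sum_Un_disjoint r assms) auto
  moreover have "range (\<lambda>n. (n, True)) \<union> range (\<lambda>n. (n, False)) = (UNIV :: (nat \<times> bool) set)" by auto
  ultimately show ?thesis by simp
qed

lemma ln_mult_squares:
  fixes c x y :: real
  assumes "c > 0" "x > 0" "y > 0"
  shows "ln (c * (x\<^sup>2 * y\<^sup>2)) = ln c + (2 * ln x + 2 * ln y)"
  using assms by (simp add: ln_mult_pos ln_realpow)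

lemma zeta_data_2:
  assumes C: "C > 0"
  shows "zeta_data UNIV (\<lambda>(n, b). C * rumin_eig2 n b ^ 2) (- of_real (ln 2) - of_real (ln sin_value))"
proof -
  \<comment> \<open>From factoring k / sqrt 2 out of \<open>rumin_eig2\<close>: the square root
    becomes sqrt (1 + 9 / (8 k^2)) and the summand 5/4 becomes (5 sqrt 2 / 4) / k.\<close>
  define \<beta> where "\<beta> b = (if b then 5 * sqrt 2 / 4 else - (5 * sqrt 2 / 4))" for b
  define w where "w b u = csqrt (1 + 9 / 8 * u\<^sup>2) + of_real (\<beta> b) * u - 1" for b u
  define g where "g b = (\<lambda>s u :: complex. exp ((0 - s) * (1 * Ln (1 + w b u))))" for b
  define G where "G = (\<lambda>s u. g True s u + g False s u)"
  define D where "D = (\<lambda>u. - Ln (1 + w True u) + - Ln (1 + w False u))"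
  have s2: "sqrt 2 \<le> 71 / 50" by (rule real_le_lsqrt) (auto simp: power_divide)
  have u2: "norm (9 / 8 * u\<^sup>2) \<le> 9 / 50" if "norm u < 2/5" for u :: complex
  proof -
    have "norm u ^ 2 \<le> (2/5) ^ 2" using that by (intro power_mono) auto
    then show ?thesis by (simp add: norm_mult norm_power norm_divide power_divide)
  qed
  have wle: "norm (w b u) \<le> 89 / 100" if u: "norm u < 2/5" for b u
  proof -
    have "norm (csqrt (1 + 9 / 8 * u\<^sup>2) - 1) \<le> 9 / 50"
      using norm_csqrt_minus_one[of "1 + 9 / 8 * u\<^sup>2"] u2[OF u] by simp
    moreover have "norm (of_real (\<beta> b) * u) \<le> 71 / 100"
    proof -
      have "norm (of_real (\<beta> b) * u) = 5 * sqrt 2 / 4 * norm u" by (simp add: \<beta>_def norm_mult)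
      also have "\<dots> \<le> (5 * (71 / 50) / 4) * (2/5)" using u s2 by (intro mult_mono) auto
      finally show ?thesis by simp
    qed
    moreover have "norm (w b u) \<le> norm (csqrt (1 + 9 / 8 * u\<^sup>2) - 1) + norm (of_real (\<beta> b) * u)"
      using norm_triangle_ineq[of "csqrt (1 + 9 / 8 * u\<^sup>2) - 1" "of_real (\<beta> b) * u"] by (simp add: w_def algebra_simps)
    ultimately show ?thesis by linarith
  qed
  have gg: "holo_family (2/5) (g b)" for b
    unfolding g_def
  proof (rule holo_family_exp_Ln[where \<rho> = "89/100"])
    have "1 + 9 / 8 * u\<^sup>2 \<notin> \<real>\<^sub>\<le>\<^sub>0" if "norm u < 2/5" for u :: complex
      using complex_Re_le_cmod[of "- (9 / 8 * u\<^sup>2)"] u2[OF that] by (auto simp: complex_nonpos_Reals_iff)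
    then show "w b holomorphic_on ball 0 (2 / 5)"
      unfolding w_def by (auto intro!: holomorphic_intros)
  qed (use wle in auto)
  \<comment> \<open>Neither branch is even by itself. The reflection exchanges them, so only their
    sum G is an even family.\<close>
  have even: "w b (- u) = w (\<not> b) u" for b u by (simp add: w_def \<beta>_def)
  have eG: "even_family (2/5) G"
    using holo_family_add[OF gg[of True] gg[of False]] unfolding even_family_def G_def by (simp add: g_def even add.commute)
  have pos: "1 + w b (1 / of_nat (odd3 n)) = complex_of_real (sqrt (1 + 9 / (8 * real (odd3 n) ^ 2)) + \<beta> b / real (odd3 n))"
    and pos': "sqrt (1 + 9 / (8 * real (odd3 n) ^ 2)) + \<beta> b / real (odd3 n) > 0" for b n
  proof -
    let ?k = "real (odd3 n)"
    have k: "?k \<ge> 3" by (rule odd3_ge)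
    have "1 + 9 / 8 * (1 / of_nat (odd3 n))\<^sup>2 = complex_of_real (1 + 9 / (8 * ?k ^ 2))"
      by (simp add: power_divide)
    moreover have "csqrt (complex_of_real (1 + 9 / (8 * ?k ^ 2))) = of_real (sqrt (1 + 9 / (8 * ?k ^ 2)))"
      by (rule csqrt_of_real_nonneg[THEN trans]) auto
    ultimately show "1 + w b (1 / of_nat (odd3 n)) = complex_of_real (sqrt (1 + 9 / (8 * ?k ^ 2)) + \<beta> b / ?k)"
      unfolding w_def by simp
    have "\<bar>\<beta> b / ?k\<bar> \<le> (5 * (71 / 50) / 4) / 3"
      unfolding abs_divide using s2 k by (intro frac_le) (auto simp: \<beta>_def)
    moreover have "sqrt (1 + 9 / (8 * ?k ^ 2)) \<ge> 1" by simp
    ultimately show "sqrt (1 + 9 / (8 * ?k ^ 2)) + \<beta> b / ?k > 0" by linarith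
  qed
  \<comment> \<open>9/8 - 25/8 = -2, so the square roots disappear from the product of the two
    branches.\<close>
  have prod: "(sqrt (1 + 9 / (8 * x ^ 2)) + \<beta> True / x) * (sqrt (1 + 9 / (8 * x ^ 2)) + \<beta> False / x) = 1 - 2 / x ^ 2"
    if "x > 0" for x
  proof -
    have "sqrt (1 + 9 / (8 * x ^ 2)) * sqrt (1 + 9 / (8 * x ^ 2)) = 1 + 9 / (8 * x ^ 2)"
      by (rule real_sqrt_mult_self[THEN trans]) auto
    moreover have "\<beta> True / x * (\<beta> False / x) = - (25 / 8) / x ^ 2"
      by (simp add: \<beta>_def power2_eq_square)
    moreover have "\<beta> False / x = - (\<beta> True / x)" by (simp add: \<beta>_def)
    ultimately show ?thesis using that by (simp add: algebra_simps)
  qed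
  have Dn: "D (1 / of_nat (odd3 n)) = of_real (- ln (1 - 2 / real (odd3 n) ^ 2))" for n
  proof -
    have "ln (1 - 2 / real (odd3 n) ^ 2) = ln (sqrt (1 + 9 / (8 * real (odd3 n) ^ 2)) + \<beta> True / real (odd3 n)) +
        ln (sqrt (1 + 9 / (8 * real (odd3 n) ^ 2)) + \<beta> False / real (odd3 n))"
      using odd3_ge(2)[of n] by (subst prod[symmetric]) (auto intro: ln_mult_pos pos')
    then show ?thesis unfolding D_def pos Ln_of_real[OF pos'] by simp
  qed
  have "(\<lambda>n. D (1 / of_nat (odd3 n))) sums of_real (- ln sin_value)"
    unfolding Dn by (intro sums_of_real sums_minus ln_sum_odd)
  then have sD: "(\<Sum>n. D (1 / of_nat (odd3 n))) = of_real (- ln sin_value)" by (simp add: sums_iff)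
  have der: "((\<lambda>s. G s u) has_field_derivative D u) (at 0)" for u
    unfolding G_def g_def D_def by (auto intro!: derivative_eq_intros)
  have G0: "G 0 u = 2" for u by (simp add: G_def g_def)
  have D0: "D 0 = 0" by (simp add: D_def w_def)
  obtain Z where Z: "Z meromorphic_on UNIV" "Z analytic_on {0}"
    "\<And>s. Re s > 1 \<Longrightarrow> (\<lambda>n. zeta_term odd3 G s n) sums Z s" "Z 0 = - 2"
    "(Z has_field_derivative (- 2 * of_real (ln 2) / 2 + of_real (- ln sin_value))) (at 0)"
    using odd_zeta[OF eG R25 G0 der D0] unfolding sD by blast
  show ?thesis
  \<comment> \<open>Two branches give m = 2 and two exceptional eigenvalues. The scalar of the
    continued part is C / 2 because the leading term of the squared root is k^2 / 2.\<close>
  proof (rule zeta_data_build[OF Z(1,2,5,4), where F = UNIV and e = "\<lambda>b. C * rumin_eig2 0 b ^ 2" and C = "C / 2" and a = 1])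
    fix s assume s: "1 * Re s > 1"
    have Zs: "Z s = zeta_sum odd3 (g True) s + zeta_sum odd3 (g False) s"
    proof -
      have "(\<lambda>n. zeta_term odd3 (g True) s n + zeta_term odd3 (g False) s n) sums (zeta_sum odd3 (g True) s + zeta_sum odd3 (g False) s)"
        using s by (intro sums_add zeta_sum_props(1)[OF gg zeta_index_odd3]) auto
      then have "zeta_term odd3 G s sums (zeta_sum odd3 (g True) s + zeta_sum odd3 (g False) s)"
      proof -
        have "zeta_term odd3 G s = (\<lambda>n. zeta_term odd3 (g True) s n + zeta_term odd3 (g False) s n)"
          by (simp add: fun_eq_iff zeta_term_def G_def algebra_simps)
        then show "zeta_term odd3 G s sums t" if "(\<lambda>n. zeta_term odd3 (g True) s n + zeta_term odd3 (g False) s n) sums t" for t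
          using that by simp
      qed
      with Z(3)[of s] s show ?thesis using sums_unique2 by auto
    qed
    have part: "((\<lambda>n. of_real (C * rumin_eig2 n b ^ 2) powr (- s / 2)) has_sum
        (of_real (C * rumin_eig2 0 b ^ 2) powr (- s / 2) + of_real (C / 2) powr (- s / 2) * zeta_sum odd3 (g b) s)) UNIV" for b
    proof (rule has_sum_nat_shift)
      have "((\<lambda>n. of_real (C / 2) powr (- s / 2) * zeta_term odd3 (g b) s n) has_sum
          of_real (C / 2) powr (- s / 2) * zeta_sum odd3 (g b) s) UNIV"
        using s by (intro has_sum_cmult_right zeta_term_has_sum[OF gg zeta_index_odd3]) auto
      moreover have "of_real (C / 2) powr (- s / 2) * zeta_term odd3 (g b) s n =
          of_real (C * rumin_eig2 (Suc n) b ^ 2) powr (- s / 2)" for n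
      proof -
        let ?k = "real (odd3 n)" and ?q = "sqrt (1 + 9 / (8 * real (odd3 n) ^ 2)) + \<beta> b / real (odd3 n)"
        have k: "?k > 0" using odd3_ge(2)[of n] by simp
        have "rumin_eig2 (Suc n) b = ?k / sqrt 2 * ?q"
        proof -
          have "?k ^ 2 / 2 + 9 / 16 = ?k ^ 2 / 2 * (1 + 9 / (8 * ?k ^ 2))"
            using k by (simp add: field_simps)
          moreover have "sqrt (?k ^ 2 / 2) = ?k / sqrt 2" using k by (simp add: real_sqrt_divide)
          ultimately have "sqrt (?k ^ 2 / 2 + 9 / 16) = ?k / sqrt 2 * sqrt (1 + 9 / (8 * ?k ^ 2))"
            by (simp only: real_sqrt_mult)
          moreover have "?k / sqrt 2 * (\<beta> b / ?k) = (if b then 5 / 4 else - 5 / 4)"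
            using k by (simp add: \<beta>_def)
          moreover have "real (2 * Suc n + 1) = ?k" by (simp add: odd3_def)
          ultimately show ?thesis unfolding rumin_eig2_def distrib_left by simp
        qed
        then have x: "C * rumin_eig2 (Suc n) b ^ 2 = C / 2 * (?k ^ 2 * ?q ^ 2)"
          by (simp add: power_mult_distrib power_divide)
        have "ln (C / 2 * (?k ^ 2 * ?q ^ 2)) = ln (C / 2) + (2 * ln ?k + 2 * ln ?q)"
          by (rule ln_mult_squares) (use C k pos'[of n b] in auto)
        moreover have "C / 2 * (?k ^ 2 * ?q ^ 2) > 0"
          using C k pos'[of n b] by (intro mult_pos_pos zero_less_power) auto
        ultimately have r: "complex_of_real (C / 2 * (?k ^ 2 * ?q ^ 2)) powr (- s / 2)
           = exp (- s / 2 * (of_real (ln (C / 2)) + (2 * of_real (ln ?k) + 2 * of_real (ln ?q))))"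
          by (simp only: of_real_powr_exp) simp
        have C2: "C / 2 > 0" using C by simp
        show ?thesis
          unfolding x r unfolding zeta_term_def g_def pos Ln_of_real[OF pos'] of_nat_powr[OF odd3_ge(2)] of_real_powr_exp[OF C2]
          by (simp add: exp_add[symmetric] algebra_simps)
      qed
      ultimately show "((\<lambda>n. of_real (C * rumin_eig2 (Suc n) b ^ 2) powr (- s / 2)) has_sum
          of_real (C / 2) powr (- s / 2) * zeta_sum odd3 (g b) s) UNIV" by simp
    qed
    have "((\<lambda>k. complex_of_real (case k of (n, b) \<Rightarrow> C * (rumin_eig2 n b)\<^sup>2) powr (- s / 2)) has_sum
        ((of_real (C * rumin_eig2 0 True ^ 2) powr (- s / 2) + of_real (C / 2) powr (- s / 2) * zeta_sum odd3 (g True) s) +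
         (of_real (C * rumin_eig2 0 False ^ 2) powr (- s / 2) + of_real (C / 2) powr (- s / 2) * zeta_sum odd3 (g False) s))) UNIV"
      by (rule has_sum_bool_split) (use part in simp_all)
    then show "((\<lambda>k. complex_of_real (case k of (n, b) \<Rightarrow> C * (rumin_eig2 n b)\<^sup>2) powr (- s / 2)) has_sum
      ((\<Sum>b\<in>UNIV. of_real (C * rumin_eig2 0 b ^ 2) powr (- s / 2)) + of_real (C / 2) powr (- s / 2) * Z (of_real 1 * s))) UNIV"
      by (simp add: UNIV_bool Zs algebra_simps)
  next
    have nz: "rumin_eig2 0 b ^ 2 > 0" for b using rumin_eig2_nz by simp
    then show "\<And>b. C * (rumin_eig2 0 b)\<^sup>2 > 0" using C by simp
    have "(\<Sum>b\<in>UNIV. ln (C * (rumin_eig2 0 b)\<^sup>2)) = 2 * ln C + (ln (rumin_eig2 0 True ^ 2) + ln (rumin_eig2 0 False ^ 2))"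
      unfolding UNIV_bool using C nz by (simp add: ln_mult_pos)
    also have "ln (rumin_eig2 0 True ^ 2) + ln (rumin_eig2 0 False ^ 2) = ln ((rumin_eig2 0 True * rumin_eig2 0 False) ^ 2)"
      using nz by (simp add: ln_mult_pos power_mult_distrib)
    also have "\<dots> = - 2 * ln 2"
      unfolding rumin_eig2_prod using ln_realpow[of "1/2" 2] by (simp add: ln_div power2_eq_square)
    finally have A: "(\<Sum>b\<in>UNIV. ln (C * (rumin_eig2 0 b)\<^sup>2)) = 2 * ln C - 2 * ln 2" by simp
    have B: "ln (C / 2) = ln C - ln 2" using C by (simp add: ln_div)
    show "- complex_of_real (ln 2) - of_real (ln sin_value) = - of_real (\<Sum>b\<in>UNIV. ln (C * (rumin_eig2 0 b)\<^sup>2)) / 2 +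
        2 * of_real (ln (C / 2)) / 2 + of_real 1 * (- 2 * of_real (ln 2) / 2 + of_real (- ln sin_value))"
      unfolding A B by (simp add: field_simps)
  qed (use C in auto)
qed

section \<open>Schwartz functions\<close>

lemma vderiv_eq: "(\<And>\<theta>. (f has_vector_derivative g \<theta>) (at \<theta>)) \<Longrightarrow> vderiv f = g"
  unfolding vderiv_def by (simp add: fun_eq_iff vector_derivative_at)

text \<open>Prescribing the whole sequence of derivatives replaces the computation of iterates of
  \<open>vderiv\<close> by one derivative per index.\<close>

lemma schwartzI:
  assumes "F 0 = f" and d: "\<And>m \<theta>. (F m has_vector_derivative F (Suc m) \<theta>) (at \<theta>)"
    and b: "\<And>k m. \<exists>B. \<forall>\<theta>. norm (of_real (\<theta> ^ k) * F m \<theta>) \<le> B"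
  shows "schwartz f"
proof -
  have *: "(vderiv ^^ m) f = F m" for m
  proof (induction m)
    case (Suc m)
    then show ?case using vderiv_eq[OF d[of m]] by simp
  qed (use assms in simp)
  have "F m differentiable at \<theta>" for m \<theta>
    using d[of m \<theta>] by (auto simp: has_vector_derivative_def differentiable_def)
  then show ?thesis
    unfolding schwartz_def * using b by (auto simp: bounded_iff)
qed

lemma schwartz_derivs:
  assumes "schwartz f"
  shows "((vderiv ^^ m) f has_vector_derivative (vderiv ^^ Suc m) f \<theta>) (at \<theta>)"
  using assms by (simp add: schwartz_def vderiv_def vector_derivative_works[symmetric])

lemma schwartz_bounds:
  assumes "schwartz f"
  shows "\<exists>B. \<forall>\<theta>. norm (of_real (\<theta> ^ k) * (vderiv ^^ m) f \<theta>) \<le> B"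
  using assms by (auto simp: schwartz_def bounded_iff)

lemma schwartz_has_vderiv: "schwartz f \<Longrightarrow> (f has_vector_derivative vderiv f \<theta>) (at \<theta>)"
  using schwartz_derivs[of f 0 \<theta>] by simp

lemma schwartz_vderiv: "schwartz f \<Longrightarrow> schwartz (vderiv f)"
proof (rule schwartzI[where F = "\<lambda>m. (vderiv ^^ Suc m) f"])
  assume f: "schwartz f"
  show "((vderiv ^^ Suc m) f has_vector_derivative (vderiv ^^ Suc (Suc m)) f \<theta>) (at \<theta>)" for m \<theta>
    by (rule schwartz_derivs[OF f])
  show "\<exists>B. \<forall>\<theta>. norm (of_real (\<theta> ^ k) * (vderiv ^^ Suc m) f \<theta>) \<le> B" for k m
    by (rule schwartz_bounds[OF f])
qed simp

lemma schwartz_lin: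
  assumes f: "schwartz f" and g: "schwartz g"
  shows "schwartz (\<lambda>\<theta>. c * f \<theta> + d * g \<theta>)"
proof (rule schwartzI[where F = "\<lambda>m \<theta>. c * (vderiv ^^ m) f \<theta> + d * (vderiv ^^ m) g \<theta>"])
  show "((\<lambda>\<theta>. c * (vderiv ^^ m) f \<theta> + d * (vderiv ^^ m) g \<theta>) has_vector_derivative
     c * (vderiv ^^ Suc m) f \<theta> + d * (vderiv ^^ Suc m) g \<theta>) (at \<theta>)" for m \<theta>
    by (intro has_vector_derivative_add has_vector_derivative_mult_right schwartz_derivs f g)
  show "\<exists>B. \<forall>\<theta>. norm (of_real (\<theta> ^ k) * (c * (vderiv ^^ m) f \<theta> + d * (vderiv ^^ m) g \<theta>)) \<le> B" for k m
  proof -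
    obtain A B where A: "\<And>\<theta>. norm (of_real (\<theta> ^ k) * (vderiv ^^ m) f \<theta>) \<le> A"
      and B: "\<And>\<theta>. norm (of_real (\<theta> ^ k) * (vderiv ^^ m) g \<theta>) \<le> B"
      using schwartz_bounds[OF f] schwartz_bounds[OF g] by meson
    have "norm (of_real (\<theta> ^ k) * (c * (vderiv ^^ m) f \<theta> + d * (vderiv ^^ m) g \<theta>)) \<le> norm c * A + norm d * B" for \<theta>
    proof -
      have "of_real (\<theta> ^ k) * (c * (vderiv ^^ m) f \<theta> + d * (vderiv ^^ m) g \<theta>) =
        c * (of_real (\<theta> ^ k) * (vderiv ^^ m) f \<theta>) + d * (of_real (\<theta> ^ k) * (vderiv ^^ m) g \<theta>)"
        by (simp add: algebra_simps)
      also have "norm \<dots> \<le> norm c * A + norm d * B"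
        by (rule norm_triangle_mono; subst norm_mult; intro mult_left_mono A B norm_ge_zero)
      finally show ?thesis .
    qed
    then show ?thesis by blast
  qed
qed simp

lemma schwartz_times_id:
  assumes f: "schwartz f"
  shows "schwartz (\<lambda>\<theta>. of_real \<theta> * f \<theta>)"
\<comment> \<open>The Leibniz rule for \<theta> f. At m = 0 the truncated index m - 1 is harmless,
  its coefficient being 0.\<close>
proof (rule schwartzI[where F = "\<lambda>m \<theta>. of_real \<theta> * (vderiv ^^ m) f \<theta> + of_nat m * (vderiv ^^ (m - 1)) f \<theta>"])
  show "((\<lambda>\<theta>. of_real \<theta> * (vderiv ^^ m) f \<theta> + of_nat m * (vderiv ^^ (m - 1)) f \<theta>) has_vector_derivative
     of_real \<theta> * (vderiv ^^ Suc m) f \<theta> + of_nat (Suc m) * (vderiv ^^ (Suc m - 1)) f \<theta>) (at \<theta>)" for m \<theta>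
  proof -
    have id: "((\<lambda>t. complex_of_real t) has_vector_derivative 1) (at \<theta>)"
      using has_vector_derivative_of_real[OF DERIV_ident] by simp
    have p: "((\<lambda>t. of_real t * (vderiv ^^ m) f t) has_vector_derivative
        (of_real \<theta> * (vderiv ^^ Suc m) f \<theta> + 1 * (vderiv ^^ m) f \<theta>)) (at \<theta>)"
      by (rule has_vector_derivative_mult[OF id schwartz_derivs[OF f]])
    have "((\<lambda>t. of_nat m * (vderiv ^^ (m - 1)) f t) has_vector_derivative of_nat m * (vderiv ^^ m) f \<theta>) (at \<theta>)"
      using has_vector_derivative_mult_right[OF schwartz_derivs[OF f, of "m - 1" \<theta>], of "of_nat m"]
      by (cases m) simp_all
    from has_vector_derivative_add[OF p this] show ?thesis by (simp add: algebra_simps)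
  qed
  show "\<exists>B. \<forall>\<theta>. norm (of_real (\<theta> ^ k) * (of_real \<theta> * (vderiv ^^ m) f \<theta> + of_nat m * (vderiv ^^ (m - 1)) f \<theta>)) \<le> B" for k m
  proof -
    obtain A B where A: "\<And>\<theta>. norm (of_real (\<theta> ^ Suc k) * (vderiv ^^ m) f \<theta>) \<le> A"
      and B: "\<And>\<theta>. norm (of_real (\<theta> ^ k) * (vderiv ^^ (m - 1)) f \<theta>) \<le> B"
      using schwartz_bounds[OF f] by meson
    have "norm (of_real (\<theta> ^ k) * (of_real \<theta> * (vderiv ^^ m) f \<theta> + of_nat m * (vderiv ^^ (m - 1)) f \<theta>)) \<le> A + norm (of_nat m :: complex) * B" for \<theta>
    proof -
      have "of_real (\<theta> ^ k) * (of_real \<theta> * (vderiv ^^ m) f \<theta> + of_nat m * (vderiv ^^ (m - 1)) f \<theta>) =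
        of_real (\<theta> ^ Suc k) * (vderiv ^^ m) f \<theta> + of_nat m * (of_real (\<theta> ^ k) * (vderiv ^^ (m - 1)) f \<theta>)"
        by (simp add: algebra_simps)
      also have "norm \<dots> \<le> A + norm (of_nat m :: complex) * B"
        by (rule norm_triangle_mono[OF A]; subst norm_mult; intro mult_left_mono B norm_ge_zero)
      finally show ?thesis .
    qed
    then show ?thesis by blast
  qed
qed simp

lemma schwartz_0: "schwartz (\<lambda>_. 0)"
  by (rule schwartzI[where F = "\<lambda>_ _. 0"]) auto

lemma schwartz_add: "schwartz f \<Longrightarrow> schwartz g \<Longrightarrow> schwartz (f + g)"
  using schwartz_lin[of f g 1 1] by (simp add: plus_fun_def)

lemma schwartz_cmult: "schwartz f \<Longrightarrow> schwartz (\<lambda>\<theta>. c * f \<theta>)"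
  using schwartz_lin[of f f c 0] by simp

lemma schwartz_continuous: "schwartz f \<Longrightarrow> continuous_on A f"
  by (meson continuous_at_imp_continuous_on has_vector_derivative_continuous schwartz_has_vderiv)

lemma schwartz_decay:
  assumes f: "schwartz f"
  obtains B where "\<And>\<theta>. norm (f \<theta>) \<le> B * inverse (1 + \<theta>\<^sup>2)" "\<And>\<theta>. norm (f \<theta>) \<le> B" "B \<ge> 0"
proof -
  obtain A B where A: "\<And>\<theta>. norm (f \<theta>) \<le> A" and B: "\<And>\<theta>. norm (of_real (\<theta> ^ 2) * f \<theta>) \<le> B"
    using schwartz_bounds[OF f, of 0 0] schwartz_bounds[OF f, of 2 0] by auto
  have nn: "A \<ge> 0" "B \<ge> 0" using A B norm_ge_zero order_trans by blast+
  have "norm (f \<theta>) \<le> (A + B) * inverse (1 + \<theta>\<^sup>2)" for \<theta>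
  proof -
    have "norm (f \<theta>) * (1 + \<theta>\<^sup>2) \<le> A + B"
      using A[of \<theta>] B[of \<theta>] by (simp add: norm_mult norm_power algebra_simps)
    moreover have "1 + \<theta>\<^sup>2 > 0" by (simp add: add_pos_nonneg)
    ultimately show ?thesis by (simp add: divide_inverse[symmetric] pos_le_divide_eq)
  qed
  moreover have "norm (f \<theta>) \<le> A + B" for \<theta> using A[of \<theta>] nn by linarith
  ultimately show ?thesis using that nn by (meson add_nonneg_nonneg)
qed

lemma integrable_inverse_1_plus_sq: "integrable lborel (\<lambda>x::real. inverse (1 + x\<^sup>2))"
  using integrable_inverse_1_plus_square by (simp add: set_integrable_def)

lemma schwartz_prod_decay:
  assumes f: "schwartz f" and g: "schwartz g"
  obtains B where "\<And>\<theta>. norm (f \<theta> * cnj (g \<theta>)) \<le> B * inverse (1 + \<theta>\<^sup>2)"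
proof -
  obtain A where A: "\<And>\<theta>. norm (f \<theta>) \<le> A * inverse (1 + \<theta>\<^sup>2)" "A \<ge> 0" using schwartz_decay[OF f] by metis
  obtain B where B: "\<And>\<theta>. norm (g \<theta>) \<le> B" "B \<ge> 0" using schwartz_decay[OF g] by metis
  have "norm (f \<theta> * cnj (g \<theta>)) \<le> A * B * inverse (1 + \<theta>\<^sup>2)" for \<theta>
  proof -
    have "norm (f \<theta> * cnj (g \<theta>)) = norm (f \<theta>) * norm (g \<theta>)" by (simp add: norm_mult)
    also have "\<dots> \<le> (A * inverse (1 + \<theta>\<^sup>2)) * B"
      using A B by (intro mult_mono) auto
    finally show ?thesis by (simp add: mult_ac)
  qed
  then show ?thesis by (rule that)
qed

lemma integrable_decay:
  fixes h :: "real \<Rightarrow> complex"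
  assumes "continuous_on UNIV h" "\<And>\<theta>. norm (h \<theta>) \<le> B * inverse (1 + \<theta>\<^sup>2)"
  shows "integrable lborel h"
proof (rule Bochner_Integration.integrable_bound)
  show "integrable lborel (\<lambda>\<theta>. B * inverse (1 + \<theta>\<^sup>2))"
    by (intro integrable_mult_right integrable_inverse_1_plus_sq)
  show "h \<in> borel_measurable lborel"
    using borel_measurable_continuous_onI[OF assms(1)] by simp
  show "AE x in lborel. norm (h x) \<le> norm (B * inverse (1 + x\<^sup>2))"
    using assms(2) by (auto intro: order_trans[OF _ abs_ge_self])
qed

lemma schwartz_integrable:
  assumes f: "schwartz f" and g: "schwartz g"
  shows "integrable lborel (\<lambda>\<theta>. f \<theta> * cnj (g \<theta>))"
proof -
  obtain B where B: "\<And>\<theta>. norm (f \<theta> * cnj (g \<theta>)) \<le> B * inverse (1 + \<theta>\<^sup>2)"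
    using schwartz_prod_decay[OF f g] by blast
  show ?thesis
    by (rule integrable_decay[OF _ B]) (intro continuous_intros schwartz_continuous f g)
qed

definition ip :: "(real \<Rightarrow> complex) \<Rightarrow> (real \<Rightarrow> complex) \<Rightarrow> complex" where
  "ip f g = (\<integral>\<theta>. f \<theta> * cnj (g \<theta>) \<partial>lborel)"

lemma ip_add_left: "schwartz f \<Longrightarrow> schwartz g \<Longrightarrow> schwartz h \<Longrightarrow> ip (f + g) h = ip f h + ip g h"
  by (simp add: ip_def distrib_right schwartz_integrable)

lemma ip_add_right: "schwartz f \<Longrightarrow> schwartz g \<Longrightarrow> schwartz h \<Longrightarrow> ip h (f + g) = ip h f + ip h g"
  by (simp add: ip_def distrib_left schwartz_integrable)

lemma ip_cmult_left: "ip (\<lambda>\<theta>. c * f \<theta>) h = c * ip f h"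
  by (simp add: ip_def mult.assoc)

lemma ip_cmult_right: "ip h (\<lambda>\<theta>. c * f \<theta>) = cnj c * ip h f"
  by (simp add: ip_def mult.left_commute)

lemma ip_zero [simp]: "ip (\<lambda>_. 0) g = 0" "ip g (\<lambda>_. 0) = 0" "ip 0 g = 0" "ip g 0 = 0"
  by (simp_all add: ip_def)

lemma ip_cnj: "cnj (ip f g) = ip g f"
  unfolding ip_def by (subst Bochner_Integration.integral_cnj[symmetric]) (simp add: mult.commute)

lemma continuous_AE_zero:
  fixes h :: "real \<Rightarrow> 'a::real_normed_vector"
  assumes c: "continuous_on UNIV h" and z: "AE x in lborel. h x = 0"
  shows "h x = 0"
proof (rule ccontr)
  assume "h x \<noteq> 0"
  have "open {x. h x \<noteq> 0}" by (rule open_Collect_neq[OF c continuous_on_const])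
  moreover have "{x. h x \<noteq> 0} \<noteq> {}" using \<open>h x \<noteq> 0\<close> by blast
  ultimately have nn: "\<not> negligible {x. h x \<noteq> 0}" by (rule open_not_negligible)
  have "{x. h x \<noteq> 0} \<in> null_sets lborel"
    using z \<open>open {x. h x \<noteq> 0}\<close> by (subst AE_iff_null_sets) auto
  then have "{x. h x \<noteq> 0} \<in> null_sets lebesgue"
    using null_sets_completionI by auto
  with nn show False by (simp add: negligible_iff_null_sets)
qed

lemma ip_self: "ip f f = of_real (\<integral>\<theta>. norm (f \<theta>) ^ 2 \<partial>lborel)"
  unfolding ip_def complex_norm_square[symmetric] by (rule integral_complex_of_real)

lemma ip_self_0:
  assumes f: "schwartz f" and 0: "ip f f = 0"
  shows "f = (\<lambda>_. 0)"
proof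
  fix x
  have i: "integrable lborel (\<lambda>\<theta>. norm (f \<theta>) ^ 2)"
    using integrable_norm[OF schwartz_integrable[OF f f]] by (simp add: norm_mult power2_eq_square)
  have "AE \<theta> in lborel. norm (f \<theta>) ^ 2 = 0"
    using 0 integral_nonneg_eq_0_iff_AE[OF i] unfolding ip_self by simp
  then show "f x = 0"
    by (intro continuous_AE_zero[of f] schwartz_continuous f) simp
qed

lemma ip_self_ge_0: "Re (ip f f) \<ge> 0" "Im (ip f f) = 0"
  unfolding ip_self by simp_all

text \<open>Integration by parts; the boundary terms vanish because the product is bounded by a
  multiple of 1 / (1 + \<theta>^2).\<close>

lemma ip_vderiv:
  assumes f: "schwartz f" and g: "schwartz g"
  shows "ip (vderiv f) g = - ip f (vderiv g)"
proof -
  define F where "F = (\<lambda>\<theta>. f \<theta> * cnj (g \<theta>))"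
  define F' where "F' = (\<lambda>\<theta>. f \<theta> * cnj (vderiv g \<theta>) + vderiv f \<theta> * cnj (g \<theta>))"
  have d: "(F has_vector_derivative F' \<theta>) (at \<theta>)" for \<theta>
    unfolding F_def F'_def
    by (intro has_vector_derivative_mult has_vector_derivative_cnj schwartz_has_vderiv f g)
  have i: "integrable lborel F'"
    unfolding F'_def by (intro Bochner_Integration.integrable_add schwartz_integrable schwartz_vderiv f g)
  obtain B where B: "\<And>\<theta>. norm (F \<theta>) \<le> B * inverse (1 + \<theta>\<^sup>2)"
    using schwartz_prod_decay[OF f g] unfolding F_def by blast
  have lim: "(F \<longlongrightarrow> 0) at_top" "(F \<longlongrightarrow> 0) at_bot"
    by (rule Lim_null_comparison[OF always_eventually[OF allI[OF B]]], real_asymp)+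
  have "(LBINT x=-\<infinity>..\<infinity>. F' x) = 0 - 0"
  proof (rule interval_integral_FTC_integrable)
    show "isCont F' x" for x
    proof -
      have "continuous_on UNIV F'"
        unfolding F'_def by (intro continuous_intros schwartz_continuous schwartz_vderiv f g)
      then show ?thesis by (simp add: continuous_on_eq_continuous_at)
    qed
    show "set_integrable lborel (einterval (- \<infinity>) \<infinity>) F'"
      using i by (simp add: set_integrable_def)
  qed (use d lim in \<open>auto simp: ereal_tendsto_simps\<close>)
  then have "integral\<^sup>L lborel F' = 0"
    by (simp add: interval_lebesgue_integral_def set_lebesgue_integral_def)
  moreover have "integral\<^sup>L lborel F' = ip f (vderiv g) + ip (vderiv f) g"
    unfolding F'_def ip_def
    by (intro Bochner_Integration.integral_add schwartz_integrable schwartz_vderiv f g)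
  ultimately show ?thesis by (simp add: eq_neg_iff_add_eq_0 add.commute)
qed

lemma ip_times_id:
  "ip (\<lambda>\<theta>. of_real \<theta> * f \<theta>) g = ip f (\<lambda>\<theta>. of_real \<theta> * g \<theta>)"
  by (simp add: ip_def mult_ac)

definition first_order :: "complex \<Rightarrow> complex \<Rightarrow> (real \<Rightarrow> complex) \<Rightarrow> real \<Rightarrow> complex" where
  "first_order c d f = (\<lambda>\<theta>. c * vderiv f \<theta> + d * (of_real \<theta> * f \<theta>))"

lemma schwartz_first_order: "schwartz f \<Longrightarrow> schwartz (first_order c d f)"
  unfolding first_order_def by (intro schwartz_lin schwartz_vderiv schwartz_times_id)

lemma ip_first_order:
  assumes f: "schwartz f" and g: "schwartz g"
  shows "ip (first_order c d f) g = ip f (first_order (- cnj c) (cnj d) g)"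
proof -
  have l: "first_order c d f = (\<lambda>\<theta>. c * vderiv f \<theta>) + (\<lambda>\<theta>. d * (of_real \<theta> * f \<theta>))" for c d f
    by (simp add: first_order_def plus_fun_def)
  have s: "schwartz (\<lambda>\<theta>. c * vderiv f \<theta>)" "schwartz (\<lambda>\<theta>. d * (of_real \<theta> * f \<theta>))" if "schwartz f" for c d f
    using schwartz_cmult[OF schwartz_vderiv[OF that]] schwartz_cmult[OF schwartz_times_id[OF that]] by auto
  show ?thesis
    unfolding l
    by (simp only: ip_add_left[OF s[OF f] g] ip_add_right[OF s[OF g] f] ip_cmult_left ip_cmult_right
        ip_vderiv[OF f g] ip_times_id[of f]) simp
qed

lemma vderiv_lin:
  assumes "schwartz f" "schwartz g"
  shows "vderiv (\<lambda>\<theta>. c * f \<theta> + d * g \<theta>) = (\<lambda>\<theta>. c * vderiv f \<theta> + d * vderiv g \<theta>)"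
  by (rule vderiv_eq) (intro has_vector_derivative_add has_vector_derivative_mult_right schwartz_has_vderiv assms)

lemma first_order_lin:
  assumes "schwartz f" "schwartz g"
  shows "first_order p q (\<lambda>\<theta>. c * f \<theta> + d * g \<theta>) = (\<lambda>\<theta>. c * first_order p q f \<theta> + d * first_order p q g \<theta>)"
  unfolding first_order_def vderiv_lin[OF assms] by (simp add: fun_eq_iff algebra_simps)

lemma first_order_cmult: "schwartz f \<Longrightarrow> first_order p q (\<lambda>\<theta>. c * f \<theta>) = (\<lambda>\<theta>. c * first_order p q f \<theta>)"
  using first_order_lin[of f f p q c 0] by simp

lemma vderiv_times_id:
  assumes "schwartz f"
  shows "vderiv (\<lambda>\<theta>. of_real \<theta> * f \<theta>) = (\<lambda>\<theta>. of_real \<theta> * vderiv f \<theta> + f \<theta>)"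
proof (rule vderiv_eq)
  fix \<theta> :: real
  have "((\<lambda>t. complex_of_real t) has_vector_derivative 1) (at \<theta>)"
    using has_vector_derivative_of_real[OF DERIV_ident] by simp
  from has_vector_derivative_mult[OF this schwartz_has_vderiv[OF assms]]
  show "((\<lambda>\<theta>. of_real \<theta> * f \<theta>) has_vector_derivative of_real \<theta> * vderiv f \<theta> + f \<theta>) (at \<theta>)" by simp
qed

lemma first_order_commutator:
  assumes f: "schwartz f"
  shows "first_order p q (first_order p' q' f) = first_order p' q' (first_order p q f) + (\<lambda>\<theta>. (p * q' - p' * q) * f \<theta>)"
proof -
  have "vderiv (first_order c d f) = (\<lambda>\<theta>. c * vderiv (vderiv f) \<theta> + d * (of_real \<theta> * vderiv f \<theta> + f \<theta>))" for c d
    unfolding first_order_def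
    using vderiv_lin[OF schwartz_vderiv[OF f] schwartz_times_id[OF f], of c d] vderiv_times_id[OF f] by simp
  then show ?thesis
    by (simp add: first_order_def[of p q "first_order p' q' f"] first_order_def[of p' q' "first_order p q f"]) (simp add: first_order_def fun_eq_iff algebra_simps)
qed

section \<open>Functions of Gaussian decay are determined by their moments\<close>

lemma measurable_lborel_continuous: "continuous_on UNIV h \<Longrightarrow> h \<in> borel_measurable lborel"
  using borel_measurable_continuous_onI[of h] by simp

lemma power_div_fact_le_exp:
  fixes x :: real
  assumes "x \<ge> 0"
  shows "x ^ n / fact n \<le> exp x"
proof -
  have "(\<lambda>k. x ^ k / fact k) sums exp x"
    using exp_converges[of x] by (simp add: divide_inverse mult.commute)
  then show ?thesis
    using sum_le_suminf[of "\<lambda>k. x ^ k / fact k" "{n}"] assms by (auto simp: sums_iff)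
qed

lemma real_distribution_density:
  fixes p :: "real \<Rightarrow> real"
  assumes "integrable lborel p" "\<And>x. p x \<ge> 0" "(\<integral>x. p x \<partial>lborel) = 1"
  shows "real_distribution (density lborel p)"
proof -
  have "emeasure (density lborel p) (space (density lborel p)) = 1"
    using assms by (simp add: emeasure_density nn_integral_eq_integral)
  then have "prob_space (density lborel p)" by (rule prob_spaceI)
  then show ?thesis by (simp add: real_distribution_def real_distribution_axioms_def)
qed

text \<open>The positive and negative parts of u have equal mass, by the hypothesis at t = 0.
  Normalised, they are probability densities with the same characteristic function, so Levy's
  theorem identifies them.\<close>

lemma fourier_injective:
  fixes u :: "real \<Rightarrow> real"
  assumes c: "continuous_on UNIV u" and i: "integrable lborel u"
    and F: "\<And>t. (\<integral>x. of_real (u x) * iexp (t * x) \<partial>lborel) = 0"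
  shows "u x = 0"
proof -
  define P where "P x = max (u x) 0" for x
  define N where "N x = max (- u x) 0" for x
  have iP: "integrable lborel P" and iN: "integrable lborel N"
    unfolding P_def N_def using i by (auto intro: integrable_max)
  have nn: "P x \<ge> 0" "N x \<ge> 0" and uPN: "u x = P x - N x" for x by (auto simp: P_def N_def)
  define I where "I = (\<integral>x. P x \<partial>lborel)"
  have "complex_of_real (\<integral>x. u x \<partial>lborel) = 0" using F[of 0] by (simp add: integral_complex_of_real)
  then have "(\<integral>x. P x - N x \<partial>lborel) = 0" unfolding uPN by simp
  then have IN: "(\<integral>x. N x \<partial>lborel) = I" using iP iN by (simp add: I_def)
  have I0: "I \<ge> 0" unfolding I_def using nn by simp
  have "AE x in lborel. u x = 0"
  proof (cases "I = 0")
    case True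
    have "AE x in lborel. P x = 0" "AE x in lborel. N x = 0"
      using integral_nonneg_eq_0_iff_AE[OF iP] integral_nonneg_eq_0_iff_AE[OF iN] True IN nn by (auto simp: I_def)
    then show ?thesis by eventually_elim (simp add: uPN)
  next
    case False
    then have I: "I > 0" using I0 by simp
    let ?p = "\<lambda>x. P x / I" and ?n = "\<lambda>x. N x / I"
    have ip: "integrable lborel ?p" "integrable lborel ?n" using iP iN by auto
    have nnn: "?p x \<ge> 0" "?n x \<ge> 0" for x using nn I by auto
    have "char (density lborel ?p) = char (density lborel ?n)"
    proof
      fix t
      have ie: "integrable lborel (\<lambda>x. q x *\<^sub>R iexp (t * x))" if "integrable lborel q" for q :: "real \<Rightarrow> real"
      proof (rule Bochner_Integration.integrable_bound[OF that])
        show "(\<lambda>x. q x *\<^sub>R iexp (t * x)) \<in> borel_measurable lborel" using that by measurable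
      qed (auto simp: norm_mult)
      have ch: "char (density lborel q) t = (\<integral>x. q x *\<^sub>R iexp (t * x) \<partial>lborel)"
        if "integrable lborel q" "\<And>x. q x \<ge> 0" for q :: "real \<Rightarrow> real"
        unfolding char_def using that by (subst integral_density) auto
      have "char (density lborel ?p) t - char (density lborel ?n) t = (\<integral>x. ?p x *\<^sub>R iexp (t * x) - ?n x *\<^sub>R iexp (t * x) \<partial>lborel)"
        unfolding ch[OF ip(1) nnn(1)] ch[OF ip(2) nnn(2)]
        using ie[OF ip(1)] ie[OF ip(2)] by (rule Bochner_Integration.integral_diff[symmetric])
      also have "\<dots> = (\<integral>x. (1 / of_real I) * (of_real (u x) * iexp (t * x)) \<partial>lborel)"
        by (intro Bochner_Integration.integral_cong refl) (simp add: uPN scaleR_conv_of_real diff_divide_distrib left_diff_distrib)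
      also have "\<dots> = 0" using F[of t] by simp
      finally show "char (density lborel ?p) t = char (density lborel ?n) t" by simp
    qed
    moreover have "real_distribution (density lborel ?p)" "real_distribution (density lborel ?n)"
      by (rule real_distribution_density; use ip nnn I IN in \<open>auto simp: I_def\<close>)+
    ultimately have "density lborel ?p = density lborel ?n" by (intro Levy_uniqueness)
    moreover have "(\<lambda>x. ennreal (?p x)) \<in> borel_measurable lborel" "(\<lambda>x. ennreal (?n x)) \<in> borel_measurable lborel"
      using ip by (auto intro!: measurable_compose[OF borel_measurable_integrable measurable_ennreal])
    ultimately have "AE x in lborel. ennreal (?p x) = ennreal (?n x)"
      using sigma_finite_measure.density_unique[OF lborel.sigma_finite_measure_axioms] by blast
    then show ?thesis
    proof eventually_elim
      case (elim x)
      then have "?p x = ?n x" using nnn[of x] by simp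
      then show ?case using I by (simp add: uPN)
    qed
  qed
  then show ?thesis by (rule continuous_AE_zero[OF c])
qed

lemma gaussian_decay:
  assumes "\<epsilon> > (0::real)"
  obtains B where "\<And>\<theta>::real. exp (- \<epsilon> * \<theta>\<^sup>2) \<le> B * inverse (1 + \<theta>\<^sup>2)"
proof -
  have "exp (- \<epsilon> * \<theta>\<^sup>2) \<le> (1 + 1 / \<epsilon>) * inverse (1 + \<theta>\<^sup>2)" for \<theta> :: real
  proof -
    have "1 + \<epsilon> * \<theta>\<^sup>2 \<le> exp (\<epsilon> * \<theta>\<^sup>2)" by (rule exp_ge_add_one_self)
    moreover have "1 + \<theta>\<^sup>2 \<le> (1 + 1 / \<epsilon>) * (1 + \<epsilon> * \<theta>\<^sup>2)"
      using assms by (simp add: field_simps)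
    ultimately have "1 + \<theta>\<^sup>2 \<le> (1 + 1 / \<epsilon>) * exp (\<epsilon> * \<theta>\<^sup>2)"
      using assms by (meson mult_left_mono order_trans add_nonneg_nonneg less_imp_le zero_le_one zero_le_divide_1_iff)
    moreover have "1 + \<theta>\<^sup>2 > 0" by (simp add: add_pos_nonneg)
    ultimately show ?thesis by (simp add: exp_minus field_simps)
  qed
  then show ?thesis by (rule that)
qed

text \<open>Gaussian decay makes u(x) exp |t x| integrable, so the exponential series may be
  integrated termwise against u. Vanishing moments then give a vanishing Fourier transform.\<close>

lemma moments_zero:
  fixes u :: "real \<Rightarrow> real"
  assumes c: "continuous_on UNIV u" and b: "\<And>x. \<bar>u x\<bar> \<le> B * exp (- \<epsilon> * x\<^sup>2)" and e: "\<epsilon> > 0"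
    and m: "\<And>n. (\<integral>x. u x * x ^ n \<partial>lborel) = 0"
  shows "u x = 0"
proof -
  have B: "B \<ge> 0" using b[of 0] by simp
  obtain K where K: "\<And>\<theta>::real. exp (- (\<epsilon> / 2) * \<theta>\<^sup>2) \<le> K * inverse (1 + \<theta>\<^sup>2)"
    using gaussian_decay[of "\<epsilon> / 2"] e by auto
  have K0: "K \<ge> 0" using K[of 0] by (simp add: order_trans[OF exp_ge_zero])
  have dom: "\<bar>u x\<bar> * exp \<bar>t * x\<bar> \<le> (B * exp (t\<^sup>2 / (2 * \<epsilon>)) * K) * inverse (1 + x\<^sup>2)" for t x
  proof -
    \<comment> \<open>Completing the square spends half of the Gaussian on the exponential; the
      other half provides integrability.\<close>
    have "\<bar>t * x\<bar> \<le> \<epsilon> / 2 * x\<^sup>2 + t\<^sup>2 / (2 * \<epsilon>)"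
    proof -
      have "0 \<le> (\<epsilon> * \<bar>x\<bar> - \<bar>t\<bar>)\<^sup>2" by simp
      then have "2 * \<epsilon> * \<bar>t * x\<bar> \<le> \<epsilon>\<^sup>2 * x\<^sup>2 + t\<^sup>2"
        by (simp add: power2_diff abs_mult power_mult_distrib mult_ac)
      then show ?thesis using e by (simp add: field_simps power2_eq_square)
    qed
    then have "\<bar>u x\<bar> * exp \<bar>t * x\<bar> \<le> (B * exp (- \<epsilon> * x\<^sup>2)) * exp (\<epsilon> / 2 * x\<^sup>2 + t\<^sup>2 / (2 * \<epsilon>))"
      using b[of x] by (intro mult_mono) auto
    also have "\<dots> = B * exp (t\<^sup>2 / (2 * \<epsilon>)) * exp (- (\<epsilon> / 2) * x\<^sup>2)"
      by (simp add: exp_add[symmetric] mult.assoc)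
    also have "\<dots> \<le> B * exp (t\<^sup>2 / (2 * \<epsilon>)) * (K * inverse (1 + x\<^sup>2))"
      using K B by (intro mult_left_mono) auto
    finally show ?thesis by (simp add: mult.assoc)
  qed
  have iu: "integrable lborel (\<lambda>x. complex_of_real (u x * x ^ n))" for n
  proof (rule integrable_decay)
    show "norm (complex_of_real (u x * x ^ n)) \<le> (fact n * (B * exp (1\<^sup>2 / (2 * \<epsilon>)) * K)) * inverse (1 + x\<^sup>2)" for x
    proof -
      have "\<bar>x\<bar> ^ n / fact n \<le> exp \<bar>x\<bar>"
        using power_div_fact_le_exp[of "\<bar>x\<bar>" n] by simp
      then have "\<bar>x\<bar> ^ n \<le> fact n * exp \<bar>x\<bar>" by (simp add: field_simps)
      then have "\<bar>u x\<bar> * \<bar>x\<bar> ^ n \<le> \<bar>u x\<bar> * (fact n * exp \<bar>x\<bar>)" by (intro mult_left_mono) auto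
      also have "\<dots> = fact n * (\<bar>u x\<bar> * exp \<bar>1 * x\<bar>)" by simp
      also have "\<dots> \<le> fact n * ((B * exp (1\<^sup>2 / (2 * \<epsilon>)) * K) * inverse (1 + x\<^sup>2))"
        by (intro mult_left_mono dom) auto
      finally show ?thesis by (simp add: norm_mult norm_power mult_ac)
    qed
  qed (intro continuous_intros c)
  have "(\<integral>x. of_real (u x) * iexp (t * x) \<partial>lborel) = 0" for t
  proof -
    define S where "S n x = (\<Sum>k<n. ((\<i> * of_real t) ^ k / fact k) * complex_of_real (u x * x ^ k))" for n x
    have S0: "integral\<^sup>L lborel (S n) = 0" for n
      unfolding S_def
      by (subst Bochner_Integration.integral_sum) (auto intro!: integrable_mult_right iu simp: integral_complex_of_real m simp del: of_real_mult)
    have "(\<lambda>n. integral\<^sup>L lborel (S n)) \<longlonglongrightarrow> (\<integral>x. of_real (u x) * iexp (t * x) \<partial>lborel)"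
    proof (rule integral_dominated_convergence[where w = "\<lambda>x. (B * exp (t\<^sup>2 / (2 * \<epsilon>)) * K) * inverse (1 + x\<^sup>2)"])
      show "(\<lambda>x. of_real (u x) * iexp (t * x)) \<in> borel_measurable lborel"
        by (intro measurable_lborel_continuous continuous_intros c)
      show "S n \<in> borel_measurable lborel" for n
        unfolding S_def by (intro measurable_lborel_continuous continuous_intros c)
      show "integrable lborel (\<lambda>x. (B * exp (t\<^sup>2 / (2 * \<epsilon>)) * K) * inverse (1 + x\<^sup>2))"
        by (intro integrable_mult_right integrable_inverse_1_plus_sq)
      have Seq: "S n x = of_real (u x) * (\<Sum>k<n. (\<i> * of_real (t * x)) ^ k / fact k)" for n x
        by (simp add: S_def sum_distrib_left power_mult_distrib mult_ac)
      show "AE x in lborel. (\<lambda>n. S n x) \<longlonglongrightarrow> of_real (u x) * iexp (t * x)"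
      proof (rule AE_I2)
        fix x
        have "(\<lambda>k. (\<i> * of_real (t * x)) ^ k / fact k) sums iexp (t * x)"
          using exp_converges[of "\<i> * of_real (t * x) :: complex"] by (simp add: scaleR_conv_of_real divide_inverse mult.commute)
        then show "(\<lambda>n. S n x) \<longlonglongrightarrow> of_real (u x) * iexp (t * x)"
          unfolding Seq sums_def by (intro tendsto_mult_left)
      qed
      show "AE x in lborel. norm (S n x) \<le> (B * exp (t\<^sup>2 / (2 * \<epsilon>)) * K) * inverse (1 + x\<^sup>2)" for n
      proof (rule AE_I2)
        fix x
        have "norm (\<Sum>k<n. (\<i> * complex_of_real (t * x)) ^ k / fact k) \<le> (\<Sum>k<n. \<bar>t * x\<bar> ^ k / fact k)"
          by (rule order_trans[OF norm_sum]) (simp add: norm_divide norm_power norm_mult abs_mult)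
        also have "\<dots> \<le> exp \<bar>t * x\<bar>"
        proof -
          have "(\<lambda>k. \<bar>t * x\<bar> ^ k / fact k) sums exp \<bar>t * x\<bar>"
            using exp_converges[of "\<bar>t * x\<bar>"] by (simp add: divide_inverse mult.commute)
          then show ?thesis by (intro sum_le_suminf[THEN order_trans]) (auto simp: sums_iff)
        qed
        finally have "norm (S n x) \<le> \<bar>u x\<bar> * exp \<bar>t * x\<bar>"
          unfolding Seq norm_mult norm_of_real by (intro mult_left_mono) auto
        with dom[of x t] show "norm (S n x) \<le> (B * exp (t\<^sup>2 / (2 * \<epsilon>)) * K) * inverse (1 + x\<^sup>2)" by linarith
      qed
    qed
    then show ?thesis unfolding S0 by (metis LIMSEQ_const_iff)
  qed
  moreover have "integrable lborel u"
    using integrable_Re[OF iu[of 0]] by simp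
  ultimately show ?thesis by (intro fourier_injective[OF c])
qed

lemma schwartz_gaussian:
  fixes c :: complex
  assumes c: "Re c > 0"
  shows "schwartz (\<lambda>\<theta>. exp (- c * of_real (\<theta>\<^sup>2)))"
proof -
  let ?g = "\<lambda>\<theta>::real. exp (- c * of_real (\<theta>\<^sup>2))"
  \<comment> \<open>\<open>Q m\<close> is the polynomial factor of the m-th derivative of the
    Gaussian: differentiating p g gives (p' - 2 c x p) g.\<close>
  define Q where "Q m = ((\<lambda>p. pderiv p - [:0, 2 * c:] * p) ^^ m) 1" for m
  have gd: "(?g has_vector_derivative - (2 * c) * of_real \<theta> * ?g \<theta>) (at \<theta>)" for \<theta>
  proof -
    have "((\<lambda>z. exp (- c * z\<^sup>2)) has_field_derivative exp (- c * (of_real \<theta>)\<^sup>2) * (- c * (2 * of_real \<theta>))) (at (of_real \<theta>))"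
      by (auto intro!: derivative_eq_intros)
    from field_vector_diff_chain_at[OF has_vector_derivative_of_real[OF DERIV_ident] this]
    show ?thesis by (simp add: o_def mult_ac)
  qed
  have pd: "((\<lambda>\<theta>. poly p (of_real \<theta>)) has_vector_derivative poly (pderiv p) (of_real \<theta>)) (at \<theta>)" for p :: "complex poly" and \<theta> :: real
    using field_vector_diff_chain_at[OF has_vector_derivative_of_real[OF DERIV_ident] poly_DERIV[of p]] by (simp add: o_def)
  show ?thesis
  proof (rule schwartzI[where F = "\<lambda>m \<theta>. poly (Q m) (of_real \<theta>) * ?g \<theta>"])
    show "((\<lambda>\<theta>. poly (Q m) (of_real \<theta>) * ?g \<theta>) has_vector_derivative poly (Q (Suc m)) (of_real \<theta>) * ?g \<theta>) (at \<theta>)" for m \<theta>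
      using has_vector_derivative_mult[OF pd[of "Q m" \<theta>] gd[of \<theta>]] by (simp add: Q_def algebra_simps)
    have mono: "\<exists>B. \<forall>\<theta>. norm (of_real (\<theta> ^ k) * ?g \<theta>) \<le> B" for k
    proof -
      have "norm (of_real (\<theta> ^ k) * ?g \<theta>) \<le> fact k * exp (1 / (4 * Re c))" for \<theta>
      proof -
        have "\<bar>\<theta>\<bar> ^ k \<le> fact k * exp \<bar>\<theta>\<bar>"
          using power_div_fact_le_exp[of "\<bar>\<theta>\<bar>" k] by (simp add: field_simps)
        \<comment> \<open>A power of \<theta> is dominated by exp |\<theta>|, and this by the
          Gaussian after completing the square.\<close>
        moreover have "\<bar>\<theta>\<bar> - Re c * \<theta>\<^sup>2 \<le> 1 / (4 * Re c)"
        proof -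
          have "0 \<le> (2 * Re c * \<bar>\<theta>\<bar> - 1)\<^sup>2" by simp
          then have "4 * Re c * \<bar>\<theta>\<bar> \<le> 4 * (Re c)\<^sup>2 * \<theta>\<^sup>2 + 1"
            by (simp add: power2_diff power_mult_distrib)
          then show ?thesis using c by (simp add: field_simps power2_eq_square)
        qed
        moreover have "norm (of_real (\<theta> ^ k) * ?g \<theta>) = \<bar>\<theta>\<bar> ^ k * exp (- Re c * \<theta>\<^sup>2)"
          by (simp add: norm_mult norm_exp_eq_Re norm_power)
        ultimately have "norm (of_real (\<theta> ^ k) * ?g \<theta>) \<le> fact k * exp \<bar>\<theta>\<bar> * exp (- Re c * \<theta>\<^sup>2)"
          by (metis exp_ge_zero mult_right_mono)
        also have "\<dots> = fact k * exp (\<bar>\<theta>\<bar> - Re c * \<theta>\<^sup>2)" by (simp add: exp_diff exp_minus field_simps)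
        also have "\<dots> \<le> fact k * exp (1 / (4 * Re c))"
          using \<open>\<bar>\<theta>\<bar> - Re c * \<theta>\<^sup>2 \<le> 1 / (4 * Re c)\<close> by (intro mult_left_mono) auto
        finally show ?thesis .
      qed
      then show ?thesis by blast
    qed
    show "\<exists>B. \<forall>\<theta>. norm (of_real (\<theta> ^ k) * (poly (Q m) (of_real \<theta>) * ?g \<theta>)) \<le> B" for k m
    proof -
      have "\<forall>k. \<exists>B. \<forall>\<theta>. norm (of_real (\<theta> ^ k) * (poly p (of_real \<theta>) * ?g \<theta>)) \<le> B" for p :: "complex poly"
      proof (induction p)
        case 0 then show ?case by auto
      next
        case (pCons a p)
        show ?case
        proof
          fix k
          obtain A B where A: "\<And>\<theta>. norm (of_real (\<theta> ^ k) * ?g \<theta>) \<le> A"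
            and B: "\<And>\<theta>. norm (of_real (\<theta> ^ Suc k) * (poly p (of_real \<theta>) * ?g \<theta>)) \<le> B"
            using mono pCons.IH by meson
          have "norm (of_real (\<theta> ^ k) * (poly (pCons a p) (of_real \<theta>) * ?g \<theta>)) \<le> norm a * A + B" for \<theta>
          proof -
            have "of_real (\<theta> ^ k) * (poly (pCons a p) (of_real \<theta>) * ?g \<theta>) =
              a * (of_real (\<theta> ^ k) * ?g \<theta>) + of_real (\<theta> ^ Suc k) * (poly p (of_real \<theta>) * ?g \<theta>)"
              by (simp add: algebra_simps)
            also have "norm \<dots> \<le> norm a * A + B"
              by (rule norm_triangle_mono[OF _ B]; subst norm_mult; intro mult_left_mono A norm_ge_zero)
            finally show ?thesis .
          qed
          then show "\<exists>B. \<forall>\<theta>. norm (of_real (\<theta> ^ k) * (poly (pCons a p) (of_real \<theta>) * ?g \<theta>)) \<le> B" by blast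
        qed
      qed
      then show ?thesis by blast
    qed
  qed (simp add: Q_def)
qed

section \<open>Ladder operators\<close>

text \<open>The condition \<open>2 al Re be = 1\<close> is \<open>[lower, raise] = 1\<close> for \<open>lower = al \<partial> + be \<theta>\<close> and its
  formal adjoint \<open>raise\<close>.\<close>

locale ladder =
  fixes al :: real and be :: complex
  assumes al: "al > 0" and ab: "2 * al * Re be = 1"
begin

definition lower :: "(real \<Rightarrow> complex) \<Rightarrow> real \<Rightarrow> complex" where
  "lower = first_order (of_real al) be"

definition raise :: "(real \<Rightarrow> complex) \<Rightarrow> real \<Rightarrow> complex" where
  "raise = first_order (- of_real al) (cnj be)"

lemma schwartz_lower: "schwartz f \<Longrightarrow> schwartz (lower f)"
  and schwartz_raise: "schwartz f \<Longrightarrow> schwartz (raise f)"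
  by (simp_all add: lower_def raise_def schwartz_first_order)

lemma ip_lower: "schwartz f \<Longrightarrow> schwartz g \<Longrightarrow> ip (lower f) g = ip f (raise g)"
  and ip_raise: "schwartz f \<Longrightarrow> schwartz g \<Longrightarrow> ip (raise f) g = ip f (lower g)"
  by (simp_all add: lower_def raise_def ip_first_order)

lemma lower_raise:
  assumes "schwartz f"
  shows "lower (raise f) = raise (lower f) + f"
proof -
  have "of_real al * cnj be - - of_real al * be = of_real al * (be + cnj be)" by (simp add: algebra_simps)
  also have "\<dots> = of_real (2 * al * Re be)" by (simp add: complex_add_cnj mult_ac)
  finally have "of_real al * cnj be - - of_real al * be = 1" by (simp add: ab)
  then show ?thesis
    using first_order_commutator[OF assms, of "of_real al" be "- of_real al" "cnj be"] by (simp add: lower_def raise_def)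
qed

lemma lower_lin: "schwartz f \<Longrightarrow> schwartz g \<Longrightarrow> lower (\<lambda>\<theta>. c * f \<theta> + d * g \<theta>) = (\<lambda>\<theta>. c * lower f \<theta> + d * lower g \<theta>)"
  and raise_lin: "schwartz f \<Longrightarrow> schwartz g \<Longrightarrow> raise (\<lambda>\<theta>. c * f \<theta> + d * g \<theta>) = (\<lambda>\<theta>. c * raise f \<theta> + d * raise g \<theta>)"
  by (simp_all add: lower_def raise_def first_order_lin)

lemma lower_cmult: "schwartz f \<Longrightarrow> lower (\<lambda>\<theta>. c * f \<theta>) = (\<lambda>\<theta>. c * lower f \<theta>)"
  and raise_cmult: "schwartz f \<Longrightarrow> raise (\<lambda>\<theta>. c * f \<theta>) = (\<lambda>\<theta>. c * raise f \<theta>)"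
  by (simp_all add: lower_def raise_def first_order_cmult)

text \<open>The Gaussian solution of al f' + be \<theta> f = 0. It decays because the locale
  condition forces Re be > 0.\<close>

definition ground :: "real \<Rightarrow> complex" where
  "ground = (\<lambda>\<theta>. exp (- (be / (2 * of_real al)) * of_real (\<theta>\<^sup>2)))"

lemma rate_pos: "Re (be / (2 * of_real al)) > 0"
proof -
  have nz: "al \<noteq> 0" using al by simp
  have "Re be = 1 / (2 * al)" using ab nz by (simp add: field_simps)
  moreover have "Re (be / (2 * of_real al)) = Re be / (2 * al)"
    using Re_divide_of_real[of be "2 * al"] nz by simp
  ultimately show ?thesis using nz al by simp
qed

lemma schwartz_ground: "schwartz ground"
  unfolding ground_def by (rule schwartz_gaussian[OF rate_pos])

lemma lower_ground: "lower ground = (\<lambda>_. 0)"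
proof -
  let ?c = "be / (2 * of_real al)"
  have "(ground has_vector_derivative - (2 * ?c) * of_real \<theta> * ground \<theta>) (at \<theta>)" for \<theta>
  proof -
    have "((\<lambda>z. exp (- ?c * z\<^sup>2)) has_field_derivative exp (- ?c * (of_real \<theta>)\<^sup>2) * (- ?c * (2 * of_real \<theta>))) (at (of_real \<theta>))"
      using al by (auto intro!: derivative_eq_intros)
    from field_vector_diff_chain_at[OF has_vector_derivative_of_real[OF DERIV_ident] this]
    show ?thesis unfolding ground_def by (simp add: o_def mult_ac)
  qed
  then have "vderiv ground = (\<lambda>\<theta>. - (2 * ?c) * of_real \<theta> * ground \<theta>)" by (rule vderiv_eq)
  then show ?thesis
    using al by (simp add: lower_def first_order_def fun_eq_iff)
qed

text \<open>Unnormalised, so that \<open>lower\<close> and \<open>raise\<close> act with natural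
  number coefficients and no square roots occur; the squared norms are n! times that of
  \<open>ground\<close>.\<close>

definition herm :: "nat \<Rightarrow> real \<Rightarrow> complex" where
  "herm n = (raise ^^ n) ground"

lemma herm_0: "herm 0 = ground" and raise_herm: "raise (herm n) = herm (Suc n)"
  by (simp_all add: herm_def)

lemma schwartz_herm: "schwartz (herm n)"
  by (induction n) (simp_all add: herm_0 schwartz_ground schwartz_raise raise_herm[symmetric])

lemma lower_herm: "lower (herm n) = (\<lambda>\<theta>. of_nat n * herm (n - 1) \<theta>)"
proof (induction n)
  case 0 then show ?case by (simp add: herm_0 lower_ground)
next
  case (Suc n)
  have "lower (herm (Suc n)) = raise (\<lambda>\<theta>. of_nat n * herm (n - 1) \<theta>) + herm n"
    unfolding raise_herm[symmetric] lower_raise[OF schwartz_herm] Suc.IH ..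
  also have "raise (\<lambda>\<theta>. of_nat n * herm (n - 1) \<theta>) = (\<lambda>\<theta>. of_nat n * herm n \<theta>)"
    unfolding raise_cmult[OF schwartz_herm] by (cases n) (simp_all add: raise_herm)
  finally show ?case by (simp add: fun_eq_iff algebra_simps)
qed

definition gnorm :: complex where
  "gnorm = ip ground ground"

lemma gnorm_nz: "gnorm \<noteq> 0"
proof
  assume "gnorm = 0"
  then have "ground = (\<lambda>_. 0)" using ip_self_0[OF schwartz_ground] by (simp add: gnorm_def)
  then show False by (simp add: ground_def fun_eq_iff)
qed

lemma ip_herm: "ip (herm m) (herm n) = (if m = n then fact n * gnorm else 0)"
proof (induction m arbitrary: n)
  case 0
  show ?case
  proof (cases n)
    case 0 then show ?thesis by (simp add: gnorm_def herm_0)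
  next
    case (Suc k)
    have "ip (herm 0) (raise (herm k)) = ip (lower (herm 0)) (herm k)"
      by (rule ip_lower[symmetric]) (rule schwartz_herm)+
    then show ?thesis using Suc by (simp add: raise_herm lower_herm)
  qed
next
  case (Suc m)
  have "ip (herm (Suc m)) (herm n) = ip (herm m) (lower (herm n))"
    unfolding raise_herm[symmetric] by (intro ip_raise schwartz_herm)
  also have "\<dots> = of_nat n * ip (herm m) (herm (n - 1))"
    by (simp add: lower_herm ip_cmult_right)
  finally show ?case using Suc.IH[of "n - 1"] by (cases n) (auto simp: mult_ac)
qed

text \<open>Multiplication by \<theta> is a multiple of \<open>lower\<close> + \<open>raise\<close>,
  so every \<theta>^n \<open>ground\<close> is a combination of Hermite functions. All moments of f
  times the conjugate Gaussian therefore vanish, and \<open>moments_zero\<close> applies.\<close>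

lemma herm_complete:
  assumes f: "schwartz f" and o: "\<And>n. ip f (herm n) = 0"
  shows "f = (\<lambda>_. 0)"
proof
  fix x
  let ?c = "be / (2 * of_real al)"
  have be: "be + cnj be \<noteq> 0" using ab al by (auto simp: complex_add_cnj)
  have "ip f (\<lambda>\<theta>. of_real (\<theta> ^ n) * herm m \<theta>) = 0" for n m
  proof (induction n arbitrary: m)
    case 0 then show ?case using o by simp
  next
    case (Suc n)
    \<comment> \<open>The three-term recursion for multiplication by \<theta>. It changes the index
      of \<open>herm\<close>, which is why the induction is over arbitrary m.\<close>
    have "(be + cnj be) * (of_real \<theta> * herm m \<theta>) = of_nat m * herm (m - 1) \<theta> + herm (Suc m) \<theta>" for \<theta>
    proof -
      have "lower (herm m) \<theta> + raise (herm m) \<theta> = (be + cnj be) * (of_real \<theta> * herm m \<theta>)"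
        by (simp add: lower_def raise_def first_order_def algebra_simps)
      then show ?thesis by (simp add: lower_herm raise_herm)
    qed
    then have "of_real (\<theta> ^ Suc n) * herm m \<theta> =
        of_nat m / (be + cnj be) * (of_real (\<theta> ^ n) * herm (m - 1) \<theta>) + 1 / (be + cnj be) * (of_real (\<theta> ^ n) * herm (Suc m) \<theta>)" for \<theta>
    proof -
      assume *: "\<And>\<theta>. (be + cnj be) * (of_real \<theta> * herm m \<theta>) = of_nat m * herm (m - 1) \<theta> + herm (Suc m) \<theta>"
      have "(be + cnj be) * (of_real (\<theta> ^ Suc n) * herm m \<theta>) = of_real (\<theta> ^ n) * ((be + cnj be) * (of_real \<theta> * herm m \<theta>))"
        by (simp add: mult_ac)
      also have "\<dots> = of_real (\<theta> ^ n) * (of_nat m * herm (m - 1) \<theta> + herm (Suc m) \<theta>)" unfolding * ..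
      finally have "of_real (\<theta> ^ Suc n) * herm m \<theta> = of_real (\<theta> ^ n) * (of_nat m * herm (m - 1) \<theta> + herm (Suc m) \<theta>) / (be + cnj be)"
        by (metis be nonzero_mult_div_cancel_left)
      also have "\<dots> = of_nat m / (be + cnj be) * (of_real (\<theta> ^ n) * herm (m - 1) \<theta>) + 1 / (be + cnj be) * (of_real (\<theta> ^ n) * herm (Suc m) \<theta>)"
        by (simp add: add_divide_distrib distrib_left mult_ac)
      finally show ?thesis .
    qed
    then have eq: "(\<lambda>\<theta>. of_real (\<theta> ^ Suc n) * herm m \<theta>) =
      (\<lambda>\<theta>. of_nat m / (be + cnj be) * (of_real (\<theta> ^ n) * herm (m - 1) \<theta>)) +
      (\<lambda>\<theta>. 1 / (be + cnj be) * (of_real (\<theta> ^ n) * herm (Suc m) \<theta>))"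
      by (simp add: fun_eq_iff)
    have sw: "schwartz (\<lambda>\<theta>. of_real (\<theta> ^ n) * herm k \<theta>)" for k
    proof (induction n)
      case (Suc n)
      from schwartz_times_id[OF Suc] show ?case by (simp add: mult_ac)
    qed (simp add: schwartz_herm)
    show ?case
      unfolding eq ip_add_right[OF schwartz_cmult[OF sw] schwartz_cmult[OF sw] f] ip_cmult_right Suc.IH by simp
  qed
  from this[of _ 0] have mom: "ip f (\<lambda>\<theta>. of_real (\<theta> ^ n) * ground \<theta>) = 0" for n by (simp add: herm_0)
  define w where "w = (\<lambda>\<theta>. f \<theta> * cnj (ground \<theta>))"
  have mw: "(\<integral>\<theta>. w \<theta> * of_real (\<theta> ^ n) \<partial>lborel) = 0" for n
    using mom[of n] by (simp add: ip_def w_def mult_ac)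
  have iw: "integrable lborel (\<lambda>\<theta>. w \<theta> * of_real (\<theta> ^ n))" for n
  proof -
    have "schwartz (\<lambda>\<theta>. of_real (\<theta> ^ n) * ground \<theta>)"
    proof (induction n)
      case (Suc n)
      from schwartz_times_id[OF Suc] show ?case by (simp add: mult_ac)
    qed (simp add: schwartz_ground)
    from schwartz_integrable[OF f this] show ?thesis by (simp add: w_def mult_ac)
  qed
  obtain B where B: "\<And>\<theta>. norm (f \<theta>) \<le> B" "B \<ge> 0" using schwartz_decay[OF f] by metis
  have nw: "norm (w \<theta>) \<le> B * exp (- Re ?c * \<theta>\<^sup>2)" for \<theta>
    using B by (simp add: w_def norm_mult ground_def norm_exp_eq_Re mult_right_mono)
  have cw: "continuous_on UNIV w"
    unfolding w_def by (intro continuous_intros schwartz_continuous f schwartz_ground)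
  \<comment> \<open>\<open>moments_zero\<close> concerns real functions, so real and imaginary part
    are treated separately.\<close>
  have "Re (w x) = 0"
  proof (rule moments_zero[where u = "\<lambda>x. Re (w x)", OF _ _ rate_pos])
    show "continuous_on UNIV (\<lambda>x. Re (w x))" by (intro continuous_intros cw)
    show "\<bar>Re (w x)\<bar> \<le> B * exp (- Re ?c * x\<^sup>2)" for x
      using abs_Re_le_cmod[of "w x"] nw[of x] by linarith
    show "(\<integral>x. Re (w x) * x ^ n \<partial>lborel) = 0" for n
      using integral_Re[OF iw[of n]] mw[of n] by simp
  qed
  moreover have "Im (w x) = 0"
  proof (rule moments_zero[where u = "\<lambda>x. Im (w x)", OF _ _ rate_pos])
    show "continuous_on UNIV (\<lambda>x. Im (w x))" by (intro continuous_intros cw)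
    show "\<bar>Im (w x)\<bar> \<le> B * exp (- Re ?c * x\<^sup>2)" for x
      using abs_Im_le_cmod[of "w x"] nw[of x] by linarith
    show "(\<integral>x. Im (w x) * x ^ n \<partial>lborel) = 0" for n
      using integral_Im[OF iw[of n]] mw[of n] by simp
  qed
  ultimately have "w x = 0" by (simp add: complex_eq_iff)
  then show "f x = 0" by (simp add: w_def ground_def)
qed

end

section \<open>The Rumin complex in the Schroedinger representation\<close>

lemma coh_dim_simps [simp]:
  "coh_dim 0 = 1" "coh_dim (Suc 0) = 2" "coh_dim 2 = 3" "coh_dim 3 = 3" "coh_dim 4 = 2" "coh_dim 5 = 1"
  by (simp_all add: coh_dim_def coh_basis_def nth_Cons_numeral)

lemma smooth_vecs_add:
  assumes "\<phi> \<in> smooth_vecs q" "\<psi> \<in> smooth_vecs q"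
  shows "\<phi> + \<psi> \<in> smooth_vecs q"
  using assms by (auto simp: smooth_vecs_def schwartz_add)

lemma smooth_vecs_scale: "\<phi> \<in> smooth_vecs q \<Longrightarrow> vec_scale c \<phi> \<in> smooth_vecs q"
  by (auto simp: smooth_vecs_def vec_scale_def schwartz_cmult zero_fun_def)

lemma smooth_vecs_0: "0 \<in> smooth_vecs q"
  using schwartz_0 by (simp add: smooth_vecs_def zero_fun_def)

definition vec_of :: "(real \<Rightarrow> complex) list \<Rightarrow> svec" where
  "vec_of fs i = (if i < length fs then fs ! i else (\<lambda>_. 0))"

lemma vec_of_smooth: "length fs = coh_dim q \<Longrightarrow> (\<And>f. f \<in> set fs \<Longrightarrow> schwartz f) \<Longrightarrow> vec_of fs \<in> smooth_vecs q"
  by (auto simp: smooth_vecs_def vec_of_def zero_fun_def)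

lemma smooth_vecs_eqI:
  assumes "\<phi> \<in> smooth_vecs q" "\<psi> \<in> smooth_vecs q" "\<And>i. i < coh_dim q \<Longrightarrow> \<phi> i = \<psi> i"
  shows "\<phi> = \<psi>"
proof
  fix i show "\<phi> i = \<psi> i" using assms by (cases "i < coh_dim q") (auto simp: smooth_vecs_def)
qed

text \<open>The inner product that would belong to an orthonormal basis of cohomology. Along
  \<open>T\<close> the inner product given by h pulls back to a multiple of it.\<close>

definition vec_ip :: "nat \<Rightarrow> svec \<Rightarrow> svec \<Rightarrow> complex" where
  "vec_ip q \<phi> \<psi> = (\<Sum>i<coh_dim q. ip (\<phi> i) (\<psi> i))"

lemma smooth_vecsD: "\<phi> \<in> smooth_vecs q \<Longrightarrow> i < coh_dim q \<Longrightarrow> schwartz (\<phi> i)"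
  by (simp add: smooth_vecs_def)

lemma vec_ip_add_left: "\<phi> \<in> smooth_vecs q \<Longrightarrow> \<psi> \<in> smooth_vecs q \<Longrightarrow> \<xi> \<in> smooth_vecs q \<Longrightarrow>
    vec_ip q (\<phi> + \<psi>) \<xi> = vec_ip q \<phi> \<xi> + vec_ip q \<psi> \<xi>"
  by (simp add: vec_ip_def ip_add_left smooth_vecsD sum.distrib)

lemma vec_ip_scale_left: "vec_ip q (vec_scale c \<phi>) \<xi> = c * vec_ip q \<phi> \<xi>"
  by (simp add: vec_ip_def vec_scale_def ip_cmult_left sum_distrib_left)

lemma vec_ip_scale_right: "vec_ip q \<phi> (vec_scale c \<xi>) = cnj c * vec_ip q \<phi> \<xi>"
  by (simp add: vec_ip_def vec_scale_def ip_cmult_right sum_distrib_left)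

lemma vec_ip_cnj: "cnj (vec_ip q \<phi> \<psi>) = vec_ip q \<psi> \<phi>"
  by (simp add: vec_ip_def ip_cnj)

lemma vec_ip_self_0:
  assumes "\<phi> \<in> smooth_vecs q" "vec_ip q \<phi> \<phi> = 0"
  shows "\<phi> = 0"
proof (rule smooth_vecs_eqI[OF assms(1) smooth_vecs_0])
  fix i assume i: "i < coh_dim q"
  have "(\<Sum>i<coh_dim q. Re (ip (\<phi> i) (\<phi> i))) = 0"
    using assms(2) by (simp add: vec_ip_def flip: Re_sum)
  then have "Re (ip (\<phi> i) (\<phi> i)) = 0"
    using i ip_self_ge_0 by (subst (asm) sum_nonneg_eq_0_iff) auto
  then have "ip (\<phi> i) (\<phi> i) = 0" using ip_self_ge_0 by (simp add: complex_eq_iff)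
  then show "\<phi> i = 0 i" using ip_self_0[OF smooth_vecsD[OF assms(1) i]] by (simp add: zero_fun_def)
qed

lemma cnj_times_self_sqrt2: "complex_of_real (sqrt 2) * complex_of_real (sqrt 2) = 2"
  "complex_of_real (sqrt 2) * (complex_of_real (sqrt 2) * x) = 2 * x"
proof -
  show "complex_of_real (sqrt 2) * complex_of_real (sqrt 2) = 2"
    by (metis of_real_mult of_real_numeral real_sqrt_mult_self abs_numeral)
  then show "complex_of_real (sqrt 2) * (complex_of_real (sqrt 2) * x) = 2 * x"
    by (metis mult.assoc)
qed

lemma inverse_sqrt2: "x / complex_of_real (sqrt 2) = x * complex_of_real (sqrt 2) / 2"
  using cnj_times_self_sqrt2(1) by (simp add: field_simps)

locale schroedinger = ladder +
  fixes hb :: real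
  assumes hb: "hb \<noteq> 0"
begin

text \<open>Coefficients of X 1 and X 2 with respect to \<open>lower\<close> and
  \<open>raise\<close>, inverted by means of al (be + cnj be) = 1. The primed ones are negative
  conjugates because X 1 and X 2 act by skew operators.\<close>

definition p :: complex where "p = of_real (sqrt \<bar>hb\<bar>) * cnj be"
definition r :: complex where "r = \<i> * of_real (sgn hb * sqrt \<bar>hb\<bar> * al)"
definition p' :: complex where "p' = - cnj p"
definition r' :: complex where "r' = - cnj r"

lemma two_be: "complex_of_real al * (be + cnj be) = 1"
proof -
  have "complex_of_real al * (be + cnj be) = of_real (2 * al * Re be)" by (simp add: complex_add_cnj mult_ac)
  then show ?thesis by (simp add: ab)
qed

lemma rho_X1: "rho hb (X 1) f = (\<lambda>\<theta>. p * lower f \<theta> + p' * raise f \<theta>)"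
proof
  fix \<theta>
  have "p * lower f \<theta> + p' * raise f \<theta> = of_real (sqrt \<bar>hb\<bar>) * (of_real al * (be + cnj be)) * vderiv f \<theta>"
    by (simp add: p_def p'_def lower_def raise_def first_order_def algebra_simps)
  then show "rho hb (X 1) f \<theta> = p * lower f \<theta> + p' * raise f \<theta>"
    unfolding two_be by (simp add: rho_def X_def axis_def)
qed

lemma rho_X2: "rho hb (X 2) f = (\<lambda>\<theta>. r * lower f \<theta> + r' * raise f \<theta>)"
proof
  fix \<theta>
  have "r * lower f \<theta> + r' * raise f \<theta> = \<i> * of_real (sgn hb * sqrt \<bar>hb\<bar>) * (of_real al * (be + cnj be)) * (of_real \<theta> * f \<theta>)"
    by (simp add: r_def r'_def lower_def raise_def first_order_def algebra_simps)
  then show "rho hb (X 2) f \<theta> = r * lower f \<theta> + r' * raise f \<theta>"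
    unfolding two_be by (simp add: rho_def X_def axis_def mult_ac)
qed

text \<open>The determinant of the change of basis is the scalar by which X 3 acts, since the
  commutator of \<open>lower\<close> and \<open>raise\<close> is 1.\<close>

lemma Delta: "p * r' - p' * r = \<i> * of_real hb"
proof -
  have "sqrt \<bar>hb\<bar> * sqrt \<bar>hb\<bar> * sgn hb = hb" by (simp add: sgn_if)
  then have h: "complex_of_real (sqrt \<bar>hb\<bar>) * of_real (sqrt \<bar>hb\<bar>) * of_real (sgn hb) = of_real hb"
    by (metis of_real_mult)
  have "p * r' - p' * r = \<i> * (complex_of_real (sqrt \<bar>hb\<bar>) * of_real (sqrt \<bar>hb\<bar>) * of_real (sgn hb)) * (of_real al * (be + cnj be))"
    by (simp add: p_def p'_def r_def r'_def algebra_simps)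
  then show ?thesis unfolding two_be h by simp
qed

lemma rho_X3: "rho hb (X 3) f = (\<lambda>\<theta>. (p * r' - p' * r) * f \<theta>)"
  unfolding Delta by (simp add: rho_def X_def axis_def fun_eq_iff mult_ac)

lemma rho_X45: "rho hb (X 4) f = (\<lambda>_. 0)" "rho hb (X 5) f = (\<lambda>_. 0)"
  by (simp_all add: rho_def X_def axis_def fun_eq_iff)

lemma schwartz_plus: "schwartz f \<Longrightarrow> schwartz g \<Longrightarrow> schwartz (\<lambda>\<theta>. f \<theta> + g \<theta>)"
  using schwartz_lin[of f g 1 1] by simp

lemma lower_plus: "schwartz f \<Longrightarrow> schwartz g \<Longrightarrow> lower (\<lambda>\<theta>. f \<theta> + g \<theta>) = (\<lambda>\<theta>. lower f \<theta> + lower g \<theta>)"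
  and raise_plus: "schwartz f \<Longrightarrow> schwartz g \<Longrightarrow> raise (\<lambda>\<theta>. f \<theta> + g \<theta>) = (\<lambda>\<theta>. raise f \<theta> + raise g \<theta>)"
  using lower_lin[of f g 1 1] raise_lin[of f g 1 1] by simp_all

lemma lower_rai: "schwartz f \<Longrightarrow> lower (raise f) = (\<lambda>\<theta>. raise (lower f) \<theta> + f \<theta>)"
  by (simp add: lower_raise fun_eq_iff)

lemmas ladder_simps = schwartz_plus schwartz_cmult schwartz_lower schwartz_raise lower_plus raise_plus
  lower_cmult raise_cmult lower_rai

abbreviation s2 :: complex where "s2 \<equiv> of_real (sqrt 2)"

text \<open>The Rumin complex in the basis of \<open>\<g>\<^sub>-\<^sub>1\<close> (complexified) in which \<open>X 1\<close> and \<open>X 2\<close> act as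
  \<open>lower\<close> and \<open>raise\<close>, hence \<open>X 3\<close> as \<open>1\<close>; \<open>T\<close> below is the change of basis on cohomology.\<close>

definition W :: "nat \<Rightarrow> svec \<Rightarrow> svec" where
  "W q \<phi> = vec_of (
    [ [lower (\<phi> 0), raise (\<phi> 0)],
      [\<lambda>\<theta>. - lower (lower (raise (\<phi> 0))) \<theta> - lower (\<phi> 0) \<theta> + lower (lower (lower (\<phi> 1))) \<theta>,
       \<lambda>\<theta>. s2 * (raise (lower (lower (\<phi> 1))) \<theta> - lower (raise (raise (\<phi> 0))) \<theta>),
       \<lambda>\<theta>. - raise (raise (raise (\<phi> 0))) \<theta> + raise (raise (lower (\<phi> 1))) \<theta> - raise (\<phi> 1) \<theta>],
      [\<lambda>\<theta>. - lower (raise (\<phi> 0)) \<theta> - \<phi> 0 \<theta> + s2 / 2 * lower (lower (\<phi> 1)) \<theta>,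
       \<lambda>\<theta>. - (s2 / 2) * raise (raise (\<phi> 0)) \<theta> - 3 / 2 * \<phi> 1 \<theta> + s2 / 2 * lower (lower (\<phi> 2)) \<theta>,
       \<lambda>\<theta>. - (s2 / 2) * raise (raise (\<phi> 1)) \<theta> + raise (lower (\<phi> 2)) \<theta> - \<phi> 2 \<theta>],
      [\<lambda>\<theta>. lower (raise (raise (\<phi> 0))) \<theta> + raise (\<phi> 0) \<theta> - s2 * lower (lower (raise (\<phi> 1))) \<theta> + lower (lower (lower (\<phi> 2))) \<theta>,
       \<lambda>\<theta>. raise (raise (raise (\<phi> 0))) \<theta> - s2 * raise (raise (lower (\<phi> 1))) \<theta> + raise (lower (lower (\<phi> 2))) \<theta> - lower (\<phi> 2) \<theta>],
      [\<lambda>\<theta>. - raise (\<phi> 0) \<theta> + lower (\<phi> 1) \<theta>] ] ! q)"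

definition lin2 :: "complex \<Rightarrow> svec \<Rightarrow> (real \<Rightarrow> complex) list" where
  "lin2 c \<phi> = [\<lambda>\<theta>. c * (p * \<phi> 0 \<theta> + p' * \<phi> 1 \<theta>), \<lambda>\<theta>. c * (r * \<phi> 0 \<theta> + r' * \<phi> 1 \<theta>)]"

text \<open>The symmetric square of the matrix with rows (p, p') and (r, r') in the basis x^2, sqrt
  2 x y, y^2. The sqrt 2 matches the normalisation of the middle basis class.\<close>

definition sym2 :: "complex \<Rightarrow> svec \<Rightarrow> (real \<Rightarrow> complex) list" where
  "sym2 c \<phi> =
    [\<lambda>\<theta>. c * (p * p * \<phi> 0 \<theta> + (s2 * p * p' * \<phi> 1 \<theta> + p' * p' * \<phi> 2 \<theta>)),
     \<lambda>\<theta>. c * (s2 * p * r * \<phi> 0 \<theta> + ((p * r' + p' * r) * \<phi> 1 \<theta> + s2 * p' * r' * \<phi> 2 \<theta>)),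
     \<lambda>\<theta>. c * (r * r * \<phi> 0 \<theta> + (s2 * r * r' * \<phi> 1 \<theta> + r' * r' * \<phi> 2 \<theta>))]"

abbreviation Del :: complex where "Del \<equiv> p * r' - p' * r"

text \<open>The exponents 0, 0, 1, 2, 4, 5 of \<open>Del\<close> count determinants. The change of
  basis acts on \<chi>^3 by its determinant and on \<chi>^4, \<chi>^5 by the matrix times its
  determinant, hence on \<chi>^45 by the third power of the determinant.\<close>

definition T :: "nat \<Rightarrow> svec \<Rightarrow> svec" where
  "T q \<phi> = vec_of ([ [\<phi> 0], lin2 1 \<phi>, sym2 Del \<phi>, sym2 (Del ^ 2) \<phi>, lin2 (Del ^ 4) \<phi>, [\<lambda>\<theta>. Del ^ 5 * \<phi> 0 \<theta>] ] ! q)"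

lemma schwartz_minus: "schwartz f \<Longrightarrow> schwartz (\<lambda>\<theta>. - f \<theta>)"
  using schwartz_cmult[of f "-1"] by simp

lemma schwartz_diff: "schwartz f \<Longrightarrow> schwartz g \<Longrightarrow> schwartz (\<lambda>\<theta>. f \<theta> - g \<theta>)"
  using schwartz_lin[of f g 1 "-1"] by simp

lemma less_3_iff: "(i::nat) < 3 \<longleftrightarrow> i = 0 \<or> i = 1 \<or> i = 2"
  by auto

lemma schwartz_divide: "schwartz f \<Longrightarrow> schwartz (\<lambda>\<theta>. f \<theta> / c)"
  using schwartz_cmult[of f "1 / c"] by simp

lemma coh_dim_le: "q \<le> (5::nat) \<Longrightarrow> q = 0 \<or> q = 1 \<or> q = 2 \<or> q = 3 \<or> q = 4 \<or> q = 5"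
  by linarith

lemma W_smooth:
  assumes q: "q \<le> 4" and \<phi>: "\<phi> \<in> smooth_vecs q"
  shows "W q \<phi> \<in> smooth_vecs (Suc q)"
proof -
  have "q = 0 \<or> q = 1 \<or> q = 2 \<or> q = 3 \<or> q = 4" using q by linarith
  then show ?thesis
    using smooth_vecsD[OF \<phi>, of 0] smooth_vecsD[OF \<phi>, of 1] smooth_vecsD[OF \<phi>, of 2]
    by (elim disjE) (auto simp: W_def numeral_2_eq_2[symmetric] intro!: vec_of_smooth ladder_simps schwartz_minus schwartz_diff schwartz_divide)
qed

lemma T_smooth:
  assumes q: "q \<le> 5" and \<phi>: "\<phi> \<in> smooth_vecs q"
  shows "T q \<phi> \<in> smooth_vecs q"
  using coh_dim_le[OF q] smooth_vecsD[OF \<phi>, of 0] smooth_vecsD[OF \<phi>, of 1] smooth_vecsD[OF \<phi>, of 2]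
  by (elim disjE) (auto simp: T_def lin2_def sym2_def intro!: vec_of_smooth ladder_simps schwartz_minus schwartz_diff schwartz_divide)

lemma sum_lt: "(\<Sum>j<1. f j) = f (0::nat)" "(\<Sum>j<2. f j) = f (0::nat) + f 1" "(\<Sum>j<3. f j) = f (0::nat) + f 1 + f 2"
  for f :: "nat \<Rightarrow> 'a::comm_monoid_add"
  by (simp_all add: eval_nat_numeral)

lemmas rep_unfold = rho_D_def rho_U_def rumin_def T_def W_def vec_of_def lin2_def sym2_def
  rho_X1 rho_X2 rho_X3 rho_X45 sum_lt ladder_simps nth_Cons_numeral inverse_sqrt2

text \<open>This is the independence of the Rumin differentials of the basis of \<open>\<g>\<^sub>-\<^sub>1\<close>.\<close>

lemma rho_D_T_0: "rho_D hb 0 (T 0 \<phi>) = T 1 (W 0 \<phi>)"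
proof (intro ext)
  fix i :: nat and \<theta> :: real
  consider "i = 0" | "i = 1" | "i \<ge> 2" by linarith
  then show "rho_D hb 0 (T 0 \<phi>) i \<theta> = T 1 (W 0 \<phi>) i \<theta>"
    by cases (simp_all add: rep_unfold)
qed

lemma rho_D_T_1:
  assumes "\<phi> \<in> smooth_vecs 1"
  shows "rho_D hb 1 (T 1 \<phi>) = T 2 (W 1 \<phi>)"
proof (intro ext)
  fix i :: nat and \<theta> :: real
  have s: "schwartz (\<phi> 0)" "schwartz (\<phi> (Suc 0))"
    using assms smooth_vecsD[of \<phi> 1 0] smooth_vecsD[of \<phi> 1 1] by simp_all
  consider "i = 0" | "i = 1" | "i = 2" | "i \<ge> 3" by linarith
  then show "rho_D hb 1 (T 1 \<phi>) i \<theta> = T 2 (W 1 \<phi>) i \<theta>"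
  proof cases
    case 1
    show ?thesis unfolding 1
      by (simp add: rep_unfold s numeral_2_eq_2[symmetric]) (simp add: algebra_simps cnj_times_self_sqrt2)
  next
    case 2
    show ?thesis unfolding 2
      by (simp add: rep_unfold s numeral_2_eq_2[symmetric]) (simp add: algebra_simps cnj_times_self_sqrt2)
  next
    case 3
    show ?thesis unfolding 3
      by (simp add: rep_unfold s numeral_2_eq_2[symmetric]) (simp add: algebra_simps cnj_times_self_sqrt2)
  qed (simp add: rho_D_def T_def vec_of_def sym2_def numeral_2_eq_2[symmetric])
qed

lemma rho_D_T_2:
  assumes "\<phi> \<in> smooth_vecs 2"
  shows "rho_D hb 2 (T 2 \<phi>) = T 3 (W 2 \<phi>)"
proof (intro ext)
  fix i :: nat and \<theta> :: real
  have s: "schwartz (\<phi> 0)" "schwartz (\<phi> (Suc 0))" "schwartz (\<phi> 2)"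
    using assms smooth_vecsD[of \<phi> 2 0] smooth_vecsD[of \<phi> 2 1] smooth_vecsD[of \<phi> 2 2] by simp_all
  consider "i = 0" | "i = 1" | "i = 2" | "i \<ge> 3" by linarith
  then show "rho_D hb 2 (T 2 \<phi>) i \<theta> = T 3 (W 2 \<phi>) i \<theta>"
  proof cases
    case 1
    show ?thesis unfolding 1
      by (simp add: rep_unfold s) (simp add: field_simps power2_eq_square cnj_times_self_sqrt2)
  next
    case 2
    show ?thesis unfolding 2
      by (simp add: rep_unfold s) (simp add: field_simps power2_eq_square cnj_times_self_sqrt2)
  next
    case 3
    show ?thesis unfolding 3
      by (simp add: rep_unfold s) (simp add: field_simps power2_eq_square cnj_times_self_sqrt2)
  qed (simp add: rho_D_def T_def vec_of_def sym2_def nth_Cons_numeral)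
qed

lemma rho_D_T_3:
  assumes "\<phi> \<in> smooth_vecs 3"
  shows "rho_D hb 3 (T 3 \<phi>) = T 4 (W 3 \<phi>)"
proof (intro ext)
  fix i :: nat and \<theta> :: real
  have s: "schwartz (\<phi> 0)" "schwartz (\<phi> (Suc 0))" "schwartz (\<phi> 2)"
    using assms smooth_vecsD[of \<phi> 3 0] smooth_vecsD[of \<phi> 3 1] smooth_vecsD[of \<phi> 3 2] by simp_all
  have D4: "Del ^ 4 = Del ^ 2 * (Del * Del)" by (simp add: eval_nat_numeral)
  \<comment> \<open>Keeping this power opaque confines the expansion to the factor
    \<open>Del * Del\<close> that relates degrees 3 and 4.\<close>
  define c where "c = Del ^ 2"
  consider "i = 0" | "i = 1" | "i \<ge> 2" by linarith
  then show "rho_D hb 3 (T 3 \<phi>) i \<theta> = T 4 (W 3 \<phi>) i \<theta>"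
  proof cases
    case 1
    show ?thesis unfolding 1
      by (simp add: rep_unfold s D4 c_def[symmetric]) (simp add: algebra_simps cnj_times_self_sqrt2)
  next
    case 2
    show ?thesis unfolding 2
      by (simp add: rep_unfold s D4 c_def[symmetric]) (simp add: algebra_simps cnj_times_self_sqrt2)
  qed (simp add: rho_D_def T_def vec_of_def lin2_def nth_Cons_numeral)
qed

lemma rho_D_T_4:
  assumes "\<phi> \<in> smooth_vecs 4"
  shows "rho_D hb 4 (T 4 \<phi>) = T 5 (W 4 \<phi>)"
proof (intro ext)
  fix i :: nat and \<theta> :: real
  have s: "schwartz (\<phi> 0)" "schwartz (\<phi> (Suc 0))"
    using assms smooth_vecsD[of \<phi> 4 0] smooth_vecsD[of \<phi> 4 1] by simp_all
  have D5: "Del ^ 5 = Del ^ 4 * Del" by (simp add: eval_nat_numeral)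
  define c where "c = Del ^ 4"
  consider "i = 0" | "i \<ge> 1" by linarith
  then show "rho_D hb 4 (T 4 \<phi>) i \<theta> = T 5 (W 4 \<phi>) i \<theta>"
  proof cases
    case 1
    show ?thesis unfolding 1
      by (simp add: rep_unfold s D5 c_def[symmetric]) (simp add: algebra_simps)
  qed (simp add: rho_D_def T_def vec_of_def lin2_def nth_Cons_numeral)
qed

lemma rho_D_T:
  assumes "q \<le> 4" "\<phi> \<in> smooth_vecs q"
  shows "rho_D hb q (T q \<phi>) = T (Suc q) (W q \<phi>)"
  using assms coh_dim_le[of q] rho_D_T_0[of \<phi>] rho_D_T_1[of \<phi>] rho_D_T_2[of \<phi>] rho_D_T_3[of \<phi>] rho_D_T_4[of \<phi>]
  by (auto simp: numeral_2_eq_2[symmetric])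

lemma Del_nz: "Del \<noteq> 0"
  using hb by (simp add: Delta)

text \<open>Functoriality: the symmetric square of the inverse matrix inverts the symmetric square,
  up to the power of \<open>Del\<close>.\<close>

lemma T_surj:
  assumes q: "q \<le> 5" and \<psi>: "\<psi> \<in> smooth_vecs q"
  obtains \<phi> where "\<phi> \<in> smooth_vecs q" "T q \<phi> = \<psi>"
proof -
  define u where "u = 1 / Del"
  have u: "u * Del = 1" using Del_nz by (simp add: u_def)
  \<comment> \<open>The inverse matrix, as adjugate divided by \<open>Del\<close>.\<close>
  define P P' R R' where d: "P = r' * u" "P' = - p' * u" "R = - r * u" "R' = p * u"
  have e: "p * P + p' * R = 1" "p * P' + p' * R' = 0" "r * P + r' * R = 0" "r * P' + r' * R' = 1"
    using u unfolding d by (simp_all add: algebra_simps)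
  have lin: "lin2 c (vec_of [\<lambda>\<theta>. 1 / c * (P * \<psi> 0 \<theta> + P' * \<psi> 1 \<theta>), \<lambda>\<theta>. 1 / c * (R * \<psi> 0 \<theta> + R' * \<psi> 1 \<theta>)]) = [\<psi> 0, \<psi> 1]"
    if "c \<noteq> 0" for c
  proof -
    have "c * (p * (1 / c * (P * x + P' * y)) + p' * (1 / c * (R * x + R' * y))) = (p * P + p' * R) * x + (p * P' + p' * R') * y"
      "c * (r * (1 / c * (P * x + P' * y)) + r' * (1 / c * (R * x + R' * y))) = (r * P + r' * R) * x + (r * P' + r' * R') * y" for x y
      using that by (simp_all add: field_simps)
    then show ?thesis unfolding lin2_def vec_of_def by (simp add: e)
  qed
  have sym: "sym2 c (vec_of [\<lambda>\<theta>. 1 / c * (P * P * \<psi> 0 \<theta> + (s2 * P * P' * \<psi> 1 \<theta> + P' * P' * \<psi> 2 \<theta>)),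
      \<lambda>\<theta>. 1 / c * (s2 * P * R * \<psi> 0 \<theta> + ((P * R' + P' * R) * \<psi> 1 \<theta> + s2 * P' * R' * \<psi> 2 \<theta>)),
      \<lambda>\<theta>. 1 / c * (R * R * \<psi> 0 \<theta> + (s2 * R * R' * \<psi> 1 \<theta> + R' * R' * \<psi> 2 \<theta>))]) = [\<psi> 0, \<psi> 1, \<psi> 2]"
    if "c \<noteq> 0" for c
  proof -
    have "c * (p * p * (1 / c * A) + (s2 * p * p' * (1 / c * B) + p' * p' * (1 / c * C))) = p * p * A + (s2 * p * p' * B + p' * p' * C)"
      "c * (s2 * p * r * (1 / c * A) + ((p * r' + p' * r) * (1 / c * B) + s2 * p' * r' * (1 / c * C))) = s2 * p * r * A + ((p * r' + p' * r) * B + s2 * p' * r' * C)"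
      "c * (r * r * (1 / c * A) + (s2 * r * r' * (1 / c * B) + r' * r' * (1 / c * C))) = r * r * A + (s2 * r * r' * B + r' * r' * C)" for A B C
      using that by (simp_all add: field_simps)
    \<comment> \<open>The symmetric square of a product, with the entries of the product kept as
      factors so that they can be replaced by 0 and 1.\<close>
    moreover have "p * p * (P * P * x + (s2 * P * P' * y + P' * P' * z)) + (s2 * p * p' * (s2 * P * R * x + ((P * R' + P' * R) * y + s2 * P' * R' * z)) + p' * p' * (R * R * x + (s2 * R * R' * y + R' * R' * z)))
        = (p * P + p' * R) * (p * P + p' * R) * x + s2 * (p * P + p' * R) * (p * P' + p' * R') * y + (p * P' + p' * R') * (p * P' + p' * R') * z"
      "s2 * p * r * (P * P * x + (s2 * P * P' * y + P' * P' * z)) + ((p * r' + p' * r) * (s2 * P * R * x + ((P * R' + P' * R) * y + s2 * P' * R' * z)) + s2 * p' * r' * (R * R * x + (s2 * R * R' * y + R' * R' * z)))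
        = s2 * (p * P + p' * R) * (r * P + r' * R) * x + ((p * P + p' * R) * (r * P' + r' * R') + (p * P' + p' * R') * (r * P + r' * R)) * y + s2 * (p * P' + p' * R') * (r * P' + r' * R') * z"
      "r * r * (P * P * x + (s2 * P * P' * y + P' * P' * z)) + (s2 * r * r' * (s2 * P * R * x + ((P * R' + P' * R) * y + s2 * P' * R' * z)) + r' * r' * (R * R * x + (s2 * R * R' * y + R' * R' * z)))
        = (r * P + r' * R) * (r * P + r' * R) * x + s2 * (r * P + r' * R) * (r * P' + r' * R') * y + (r * P' + r' * R') * (r * P' + r' * R') * z" for x y z
      by (simp_all add: algebra_simps cnj_times_self_sqrt2)
    ultimately show ?thesis unfolding sym2_def vec_of_def e by (simp add: nth_Cons_numeral)
  qed
  have sw: "schwartz (\<psi> i)" if "i < coh_dim q" for i using smooth_vecsD[OF \<psi> that] .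
  have mk: "vec_of fs = \<psi>" if "length fs = coh_dim q" "\<And>i. i < coh_dim q \<Longrightarrow> fs ! i = \<psi> i" for fs
    using that \<psi> by (auto simp: vec_of_def fun_eq_iff smooth_vecs_def)
  consider "q = 0" | "q = 1" | "q = 4" | "q = 2" | "q = 3" | "q = 5" using coh_dim_le[OF q] by blast
  then show ?thesis
  proof cases
    case 1
    then show ?thesis using that[of \<psi>] \<psi> mk[of "[\<psi> 0]"] by (simp add: T_def)
  next
    case 2
    show ?thesis
    proof (rule that)
      show "T q (vec_of [\<lambda>\<theta>. 1 / 1 * (P * \<psi> 0 \<theta> + P' * \<psi> 1 \<theta>), \<lambda>\<theta>. 1 / 1 * (R * \<psi> 0 \<theta> + R' * \<psi> 1 \<theta>)]) = \<psi>"
        unfolding T_def using 2 lin[of 1] by (intro mk) (auto simp: less_2_cases_iff)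
    qed (rule vec_of_smooth, use 2 sw in \<open>auto intro!: ladder_simps\<close>)
  next
    case 3
    show ?thesis
    proof (rule that)
      let ?c = "Del ^ 4"
      have "?c \<noteq> 0" using Del_nz by simp
      from lin[OF this] show "T q (vec_of [\<lambda>\<theta>. 1 / ?c * (P * \<psi> 0 \<theta> + P' * \<psi> 1 \<theta>), \<lambda>\<theta>. 1 / ?c * (R * \<psi> 0 \<theta> + R' * \<psi> 1 \<theta>)]) = \<psi>"
        unfolding T_def using 3 by (intro mk) (auto simp: less_2_cases_iff nth_Cons_numeral)
    qed (rule vec_of_smooth, use 3 sw in \<open>auto intro!: ladder_simps schwartz_divide\<close>)
  next
    case 4
    show ?thesis
    proof (rule that)
      from sym[OF Del_nz] show "T q (vec_of [\<lambda>\<theta>. 1 / Del * (P * P * \<psi> 0 \<theta> + (s2 * P * P' * \<psi> 1 \<theta> + P' * P' * \<psi> 2 \<theta>)),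
      \<lambda>\<theta>. 1 / Del * (s2 * P * R * \<psi> 0 \<theta> + ((P * R' + P' * R) * \<psi> 1 \<theta> + s2 * P' * R' * \<psi> 2 \<theta>)),
      \<lambda>\<theta>. 1 / Del * (R * R * \<psi> 0 \<theta> + (s2 * R * R' * \<psi> 1 \<theta> + R' * R' * \<psi> 2 \<theta>))]) = \<psi>"
        unfolding T_def using 4 by (intro mk) (auto simp: less_3_iff nth_Cons_numeral)
    qed (rule vec_of_smooth, use 4 sw in \<open>auto intro!: ladder_simps schwartz_divide\<close>)
  next
    case 5
    show ?thesis
    proof (rule that)
      let ?c = "Del ^ 2"
      have "?c \<noteq> 0" using Del_nz by simp
      from sym[OF this] show "T q (vec_of [\<lambda>\<theta>. 1 / ?c * (P * P * \<psi> 0 \<theta> + (s2 * P * P' * \<psi> 1 \<theta> + P' * P' * \<psi> 2 \<theta>)),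
      \<lambda>\<theta>. 1 / ?c * (s2 * P * R * \<psi> 0 \<theta> + ((P * R' + P' * R) * \<psi> 1 \<theta> + s2 * P' * R' * \<psi> 2 \<theta>)),
      \<lambda>\<theta>. 1 / ?c * (R * R * \<psi> 0 \<theta> + (s2 * R * R' * \<psi> 1 \<theta> + R' * R' * \<psi> 2 \<theta>))]) = \<psi>"
        unfolding T_def using 5 by (intro mk) (auto simp: less_3_iff nth_Cons_numeral)
    qed (rule vec_of_smooth, use 5 sw in \<open>auto intro!: ladder_simps schwartz_divide\<close>)
  next
    case 6
    show ?thesis
    proof (rule that)
      show "T q (vec_of [\<lambda>\<theta>. 1 / Del ^ 5 * \<psi> 0 \<theta>]) = \<psi>"
        unfolding T_def using 6 Del_nz by (intro mk) (auto simp: vec_of_def nth_Cons_numeral)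
    qed (rule vec_of_smooth, use 6 sw in \<open>auto intro!: ladder_simps schwartz_divide\<close>)
  qed
qed

end

text \<open>This makes the choice of the continuation in \<open>det_star\<close> irrelevant.
  Meromorphic functions may carry arbitrary values at isolated points, so singularities of the
  difference are removed before the identity theorem is applied; analyticity at 0 restores equality
  there.\<close>

lemma meromorphic_continuation_deriv:
  assumes Z: "Z meromorphic_on UNIV" "Z analytic_on {0}" and Z': "Z' meromorphic_on UNIV" "Z' analytic_on {0}"
    and eq: "\<And>s. Re s > \<sigma> \<Longrightarrow> Z s = Z' s" and d: "(Z has_field_derivative d) (at 0)"
  shows "deriv Z' 0 = d"
proof -
  define f where "f s = Z' s - Z s" for s
  define h where "h = remove_sings f"
  have fm: "f meromorphic_on UNIV" unfolding f_def by (intro meromorphic_intros Z Z')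
  have hn: "h nicely_meromorphic_on UNIV" unfolding h_def by (rule remove_sings_nicely_meromorphic[OF fm])
  have f0: "f s = 0" if "Re s > \<sigma>" for s using eq[OF that] by (simp add: f_def)
  have op: "open {s. Re s > \<sigma>}" by (rule open_halfspace_Re_gt)
  have h0: "h s = 0" if "Re s > \<sigma>" for s
  proof -
    have "f holomorphic_on {s. Re s > \<sigma>}"
      by (rule holomorphic_transform[of "\<lambda>_. 0"]) (auto simp: f0)
    then have "f analytic_on {s}" using op that analytic_at by blast
    then show ?thesis using f0[OF that] by (simp add: h_def)
  qed
  let ?z = "complex_of_real (\<sigma> + 1)"
  have "eventually (\<lambda>s. s \<in> {s. Re s > \<sigma>}) (at ?z)"
    using op by (intro eventually_at_in_open') auto
  then have "\<forall>\<^sub>F s in at ?z. h s = 0" by eventually_elim (simp add: h0)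
  then have "\<exists>\<^sub>F s in at ?z. h s = 0" by (rule eventually_frequently[rotated]) simp
  then have hz: "h w = 0" for w
    by (rule frequently_eq_meromorphic_imp_constant[OF _ hn]) auto
  have "f analytic_on {0}" unfolding f_def by (intro analytic_intros Z Z')
  from eventually_remove_sings_eq_nhds[OF this]
  have "eventually (\<lambda>s. Z' s = Z s) (nhds 0)"
    by eventually_elim (use hz in \<open>simp add: h_def f_def\<close>)
  then have "deriv Z' 0 = deriv Z 0" by (rule deriv_cong_ev) simp
  with d show ?thesis by (simp add: DERIV_imp_deriv)
qed

section \<open>Symmetric Gram matrices and formal adjoints\<close>

definition gram_sym1 :: "real \<Rightarrow> real \<Rightarrow> real \<Rightarrow> nat \<Rightarrow> nat \<Rightarrow> real" where
  "gram_sym1 a b c i j = [[a, b], [b, c]] ! i ! j"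

text \<open>The symmetric square of the form with matrix (a b; b c), again in the basis x^2, sqrt 2
  x y, y^2.\<close>

definition gram_sym2 :: "real \<Rightarrow> real \<Rightarrow> real \<Rightarrow> nat \<Rightarrow> nat \<Rightarrow> real" where
  "gram_sym2 a b c i j = [[a * a, sqrt 2 * a * b, b * b], [sqrt 2 * a * b, a * c + b * b, sqrt 2 * b * c], [b * b, sqrt 2 * b * c, c * c]] ! i ! j"

lemma ip_plus_left: "schwartz f \<Longrightarrow> schwartz g \<Longrightarrow> schwartz h \<Longrightarrow> ip (\<lambda>\<theta>. f \<theta> + g \<theta>) h = ip f h + ip g h"
  using ip_add_left[of f g h] by (simp add: plus_fun_def)

lemma ip_plus_right: "schwartz f \<Longrightarrow> schwartz g \<Longrightarrow> schwartz h \<Longrightarrow> ip h (\<lambda>\<theta>. f \<theta> + g \<theta>) = ip h f + ip h g"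
  using ip_add_right[of f g h] by (simp add: plus_fun_def)

lemma ip_minus_left: "ip (\<lambda>\<theta>. - f \<theta>) h = - ip f h" and ip_minus_right: "ip h (\<lambda>\<theta>. - f \<theta>) = - ip h f"
  using ip_cmult_left[of "-1" f h] ip_cmult_right[of h "-1" f] by simp_all

lemma ip_diff_left: "schwartz f \<Longrightarrow> schwartz g \<Longrightarrow> schwartz h \<Longrightarrow> ip (\<lambda>\<theta>. f \<theta> - g \<theta>) h = ip f h - ip g h"
  using ip_plus_left[of f "\<lambda>\<theta>. - g \<theta>" h] schwartz_cmult[of g "-1"] by (simp add: ip_minus_left)

lemma ip_diff_right: "schwartz f \<Longrightarrow> schwartz g \<Longrightarrow> schwartz h \<Longrightarrow> ip h (\<lambda>\<theta>. f \<theta> - g \<theta>) = ip h f - ip h g"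
  using ip_plus_right[of f "\<lambda>\<theta>. - g \<theta>" h] schwartz_cmult[of g "-1"] by (simp add: ip_minus_right)

lemma ip_divide_left: "ip (\<lambda>\<theta>. f \<theta> / c) h = ip f h / c" and ip_divide_right: "ip h (\<lambda>\<theta>. f \<theta> / c) = ip h f / cnj c"
  using ip_cmult_left[of "1/c" f h] ip_cmult_right[of h "1/c" f] by simp_all

lemmas ip_simps = ip_plus_left ip_plus_right ip_minus_left ip_minus_right ip_diff_left ip_diff_right
  ip_cmult_left ip_cmult_right ip_divide_left ip_divide_right

lemma vec_inner_ip: "vec_inner g q \<psi> \<phi> = (\<Sum>i<coh_dim q. \<Sum>j<coh_dim q. h_gram g q i j * ip (\<psi> i) (\<phi> j))"
  by (simp add: vec_inner_def ip_def)

context schroedinger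
begin

lemma cnj_p: "cnj p = - p'" "cnj p' = - p" "cnj r = - r'" "cnj r' = - r"
  by (simp_all add: p'_def r'_def)

text \<open>The adjoint of \<open>W\<close> for \<open>vec_ip\<close>: matrices transposed, words
  reversed, \<open>lower\<close> and \<open>raise\<close> exchanged.\<close>

definition Wad :: "nat \<Rightarrow> svec \<Rightarrow> svec" where
  "Wad q \<eta> = vec_of (
    [ [\<lambda>\<theta>. raise (\<eta> 0) \<theta> + lower (\<eta> 1) \<theta>],
      [\<lambda>\<theta>. - lower (raise (raise (\<eta> 0))) \<theta> - raise (\<eta> 0) \<theta> - s2 * lower (lower (raise (\<eta> 1))) \<theta> - lower (lower (lower (\<eta> 2))) \<theta>,
       \<lambda>\<theta>. raise (raise (raise (\<eta> 0))) \<theta> + s2 * raise (raise (lower (\<eta> 1))) \<theta> + raise (lower (lower (\<eta> 2))) \<theta> - lower (\<eta> 2) \<theta>],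
      [\<lambda>\<theta>. - lower (raise (\<eta> 0)) \<theta> - \<eta> 0 \<theta> - s2 / 2 * lower (lower (\<eta> 1)) \<theta>,
       \<lambda>\<theta>. s2 / 2 * raise (raise (\<eta> 0)) \<theta> - 3 / 2 * \<eta> 1 \<theta> - s2 / 2 * lower (lower (\<eta> 2)) \<theta>,
       \<lambda>\<theta>. s2 / 2 * raise (raise (\<eta> 1)) \<theta> + raise (lower (\<eta> 2)) \<theta> - \<eta> 2 \<theta>],
      [\<lambda>\<theta>. lower (lower (raise (\<eta> 0))) \<theta> + lower (\<eta> 0) \<theta> + lower (lower (lower (\<eta> 1))) \<theta>,
       \<lambda>\<theta>. - s2 * lower (raise (raise (\<eta> 0))) \<theta> - s2 * raise (lower (lower (\<eta> 1))) \<theta>,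
       \<lambda>\<theta>. raise (raise (raise (\<eta> 0))) \<theta> + raise (raise (lower (\<eta> 1))) \<theta> - raise (\<eta> 1) \<theta>],
      [\<lambda>\<theta>. - lower (\<eta> 0) \<theta>, \<lambda>\<theta>. raise (\<eta> 0) \<theta>] ] ! q)"

lemma le_4_cases: "q \<le> (4::nat) \<Longrightarrow> q = 0 \<or> q = 1 \<or> q = 2 \<or> q = 3 \<or> q = 4"
  by linarith

lemma Wad_smooth:
  assumes q: "q \<le> 4" and \<eta>: "\<eta> \<in> smooth_vecs (Suc q)"
  shows "Wad q \<eta> \<in> smooth_vecs q"
  using le_4_cases[OF q] smooth_vecsD[OF \<eta>, of 0] smooth_vecsD[OF \<eta>, of 1] smooth_vecsD[OF \<eta>, of 2]
  by (elim disjE) (auto simp: Wad_def numeral_2_eq_2[symmetric] intro!: vec_of_smooth ladder_simps schwartz_minus schwartz_diff schwartz_divide)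

lemma vec_ip_W:
  assumes q: "q \<le> 4" and \<phi>: "\<phi> \<in> smooth_vecs q" and \<eta>: "\<eta> \<in> smooth_vecs (Suc q)"
  shows "vec_ip (Suc q) (W q \<phi>) \<eta> = vec_ip q \<phi> (Wad q \<eta>)"
  using le_4_cases[OF q] smooth_vecsD[OF \<eta>, of 0] smooth_vecsD[OF \<eta>, of 1] smooth_vecsD[OF \<eta>, of 2]
    smooth_vecsD[OF \<phi>, of 0] smooth_vecsD[OF \<phi>, of 1] smooth_vecsD[OF \<phi>, of 2]
  by (elim disjE) (simp_all add: vec_ip_def W_def Wad_def vec_of_def sum_lt numeral_2_eq_2[symmetric] nth_Cons_numeral ip_simps
     schwartz_plus schwartz_cmult schwartz_lower schwartz_raise schwartz_minus schwartz_diff schwartz_divide ip_lower ip_raise algebra_simps)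

end

text \<open>The condition \<open>isotropic\<close> makes the Gram matrices scalar in the new basis; it holds for a
  suitable choice of \<open>be\<close>.\<close>

locale rumin_metric = schroedinger +
  fixes g :: "lie \<Rightarrow> lie \<Rightarrow> real" and m11 m12 m22 k2 k3 k4 k5 :: real
  assumes m11: "m11 > 0" and det: "m11 * m22 - m12 * m12 > 0"
    and isotropic: "of_real m11 * (p * p) + 2 * of_real m12 * (p * r) + of_real m22 * (r * r) = 0"
    and kpos: "k2 > 0" "k3 > 0" "k4 > 0" "k5 > 0"
    and gram0: "h_gram g 0 0 0 = 1"
    and gram1: "\<And>i j. i < 2 \<Longrightarrow> j < 2 \<Longrightarrow> h_gram g 1 i j = of_real (gram_sym1 m11 m12 m22 i j)"
    and gram2: "\<And>i j. i < 3 \<Longrightarrow> j < 3 \<Longrightarrow> h_gram g 2 i j = of_real (k2 * gram_sym2 m11 m12 m22 i j)"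
    and gram3: "\<And>i j. i < 3 \<Longrightarrow> j < 3 \<Longrightarrow> h_gram g 3 i j = of_real (k3 * gram_sym2 m11 m12 m22 i j)"
    and gram4: "\<And>i j. i < 2 \<Longrightarrow> j < 2 \<Longrightarrow> h_gram g 4 i j = of_real (k4 * gram_sym1 m11 m12 m22 i j)"
    and gram5: "h_gram g 5 0 0 = of_real k5"
begin

text \<open>The complex bilinear extension of the form (m11 m12; m12 m22), evaluated on the columns
  (p, r) and (p', r') of the change of basis. \<open>isotropic\<close> kills Bxx, and conjugation
  then kills Byy.\<close>

definition Bxx where "Bxx = of_real m11 * (p * p) + 2 * of_real m12 * (p * r) + of_real m22 * (r * r)"
definition Byy where "Byy = of_real m11 * (p' * p') + 2 * of_real m12 * (p' * r') + of_real m22 * (r' * r')"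
definition Bxy where "Bxy = of_real m11 * (p * p') + of_real m12 * (p * r' + p' * r) + of_real m22 * (r * r')"

lemma B0: "Bxx = 0" "Byy = 0"
proof -
  show "Bxx = 0" unfolding Bxx_def by (rule isotropic)
  have "Byy = cnj Bxx" by (simp add: Bxx_def Byy_def cnj_p)
  with \<open>Bxx = 0\<close> show "Byy = 0" by simp
qed

text \<open>The Hermitian squared length of (p, r). It is -Bxy, since the second column is minus the
  conjugate of the first.\<close>

definition mm :: real where
  "mm = m11 * norm p ^ 2 + 2 * m12 * Re (p * cnj r) + m22 * norm r ^ 2"

lemma Bxy_mm: "Bxy = - of_real mm"
proof -
  have "p * cnj p = of_real (norm p ^ 2)" "r * cnj r = of_real (norm r ^ 2)"
    by (simp_all only: complex_norm_square)
  moreover have "p * cnj r + cnj (p * cnj r) = of_real (2 * Re (p * cnj r))" by (rule complex_add_cnj)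
  then have "p * cnj r + r * cnj p = of_real (2 * Re (p * cnj r))" by (simp add: mult.commute)
  moreover have "Bxy = - (of_real m11 * (p * cnj p) + of_real m12 * (p * cnj r + r * cnj p) + of_real m22 * (r * cnj r))"
    by (simp add: Bxy_def cnj_p algebra_simps)
  ultimately show ?thesis by (simp add: mm_def)
qed

lemma mm_pos: "mm > 0"
proof -
  have r0: "r \<noteq> 0" using Del_nz by (auto simp: r'_def)
  \<comment> \<open>Completing the square reduces positivity to that of the determinant.\<close>
  have "m11 * mm = norm (of_real m11 * p + of_real m12 * r) ^ 2 + (m11 * m22 - m12 * m12) * norm r ^ 2"
    unfolding mm_def cmod_power2 by (simp add: power2_eq_square algebra_simps)
  also have "\<dots> > 0" using det r0 by (intro add_nonneg_pos mult_pos_pos) auto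
  finally show ?thesis using m11 by (simp add: zero_less_mult_iff)
qed

text \<open>The factor between the two inner products in degree q: the squared norm of the power of
  \<open>Del\<close> in \<open>T\<close>, times the Gram constant, times one power of mm for each
  tensor factor of the plane.\<close>

definition hc :: "nat \<Rightarrow> real" where
  "hc q = [1, mm, norm Del ^ 2 * (k2 * mm ^ 2), norm (Del ^ 2) ^ 2 * (k3 * mm ^ 2),
     norm (Del ^ 4) ^ 2 * (k4 * mm), norm (Del ^ 5) ^ 2 * k5] ! q"

lemma hc_pos:
  assumes q: "q \<le> 5"
  shows "hc q > 0"
  using coh_dim_le[OF q] kpos mm_pos Del_nz by (elim disjE) (auto simp: hc_def nth_Cons_numeral)

text \<open>All off-diagonal terms carry Bxx or Byy and vanish, so the pulled back Gram matrix is
  scalar.\<close>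

lemma lin2_pullback:
  assumes s: "schwartz (\<phi> 0)" "schwartz (\<phi> 1)" "schwartz (\<psi> 0)" "schwartz (\<psi> 1)"
  shows "(\<Sum>i<2. \<Sum>j<2. of_real (k * gram_sym1 m11 m12 m22 i j) * ip (vec_of (lin2 c \<phi>) i) (vec_of (lin2 c \<psi>) j))
     = of_real (norm c ^ 2 * (k * mm)) * (ip (\<phi> 0) (\<psi> 0) + ip (\<phi> 1) (\<psi> 1))"
proof -
  have "(\<Sum>i<2. \<Sum>j<2. of_real (k * gram_sym1 m11 m12 m22 i j) * ip (vec_of (lin2 c \<phi>) i) (vec_of (lin2 c \<psi>) j))
    = - (c * cnj c * of_real k * (Bxy * ip (\<phi> 0) (\<psi> 0) + Bxx * ip (\<phi> 0) (\<psi> 1) + Byy * ip (\<phi> 1) (\<psi> 0) + Bxy * ip (\<phi> 1) (\<psi> 1)))"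
    using s by (simp add: sum_lt gram_sym1_def vec_of_def lin2_def ip_simps ladder_simps cnj_p) (simp add: Bxx_def Byy_def Bxy_def algebra_simps)
  then show ?thesis unfolding B0 Bxy_mm complex_norm_square[symmetric] by (simp add: algebra_simps)
qed

lemma sym2_pullback:
  assumes s: "schwartz (\<phi> 0)" "schwartz (\<phi> 1)" "schwartz (\<phi> 2)" "schwartz (\<psi> 0)" "schwartz (\<psi> 1)" "schwartz (\<psi> 2)"
  shows "(\<Sum>i<3. \<Sum>j<3. of_real (k * gram_sym2 m11 m12 m22 i j) * ip (vec_of (sym2 c \<phi>) i) (vec_of (sym2 c \<psi>) j))
     = of_real (norm c ^ 2 * (k * mm ^ 2)) * (ip (\<phi> 0) (\<psi> 0) + ip (\<phi> 1) (\<psi> 1) + ip (\<phi> 2) (\<psi> 2))"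
proof -
  have "(\<Sum>i<3. \<Sum>j<3. of_real (k * gram_sym2 m11 m12 m22 i j) * ip (vec_of (sym2 c \<phi>) i) (vec_of (sym2 c \<psi>) j))
    = c * cnj c * of_real k *
      (Bxy * Bxy * ip (\<phi> 0) (\<psi> 0) + s2 * Bxy * Bxx * ip (\<phi> 0) (\<psi> 1) + Bxx * Bxx * ip (\<phi> 0) (\<psi> 2)
       + s2 * Bxy * Byy * ip (\<phi> 1) (\<psi> 0) + (Bxx * Byy + Bxy * Bxy) * ip (\<phi> 1) (\<psi> 1) + s2 * Bxx * Bxy * ip (\<phi> 1) (\<psi> 2)
       + Byy * Byy * ip (\<phi> 2) (\<psi> 0) + s2 * Byy * Bxy * ip (\<phi> 2) (\<psi> 1) + Bxy * Bxy * ip (\<phi> 2) (\<psi> 2))"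
    using s by (simp add: sum_lt gram_sym2_def vec_of_def sym2_def ip_simps ladder_simps cnj_p nth_Cons_numeral)
      (simp add: Bxx_def Byy_def Bxy_def algebra_simps cnj_times_self_sqrt2)
  then show ?thesis unfolding B0 Bxy_mm complex_norm_square[symmetric] by (simp add: algebra_simps power2_eq_square)
qed

lemma vec_inner_T:
  assumes q: "q \<le> 5" and \<phi>: "\<phi> \<in> smooth_vecs q" and \<psi>: "\<psi> \<in> smooth_vecs q"
  shows "vec_inner g q (T q \<phi>) (T q \<psi>) = of_real (hc q) * vec_ip q \<phi> \<psi>"
proof -
  note s = smooth_vecsD[OF \<phi>, of 0] smooth_vecsD[OF \<phi>, of 1] smooth_vecsD[OF \<phi>, of 2]
    smooth_vecsD[OF \<psi>, of 0] smooth_vecsD[OF \<psi>, of 1] smooth_vecsD[OF \<psi>, of 2]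
  consider "q = 0" | "q = 1" | "q = 4" | "q = 2" | "q = 3" | "q = 5" using coh_dim_le[OF q] by blast
  then show ?thesis
  proof cases
    case 1
    then show ?thesis by (simp add: vec_inner_ip T_def vec_of_def vec_ip_def gram0 hc_def)
  next
    case 2
    have "vec_inner g q (T q \<phi>) (T q \<psi>) = (\<Sum>i<2. \<Sum>j<2. of_real (1 * gram_sym1 m11 m12 m22 i j) * ip (vec_of (lin2 1 \<phi>) i) (vec_of (lin2 1 \<psi>) j))"
      unfolding vec_inner_ip 2 using gram1 by (simp add: T_def)
    also have "\<dots> = of_real (norm (1::complex) ^ 2 * (1 * mm)) * (ip (\<phi> 0) (\<psi> 0) + ip (\<phi> 1) (\<psi> 1))"
      using s 2 by (intro lin2_pullback) auto
    finally show ?thesis using 2 by (simp add: vec_ip_def sum_lt hc_def)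
  next
    case 3
    have "vec_inner g q (T q \<phi>) (T q \<psi>) = (\<Sum>i<2. \<Sum>j<2. of_real (k4 * gram_sym1 m11 m12 m22 i j) * ip (vec_of (lin2 (Del ^ 4) \<phi>) i) (vec_of (lin2 (Del ^ 4) \<psi>) j))"
      unfolding vec_inner_ip 3 using gram4 by (simp add: T_def nth_Cons_numeral)
    also have "\<dots> = of_real (norm (Del ^ 4) ^ 2 * (k4 * mm)) * (ip (\<phi> 0) (\<psi> 0) + ip (\<phi> 1) (\<psi> 1))"
      using s 3 by (intro lin2_pullback) auto
    finally show ?thesis using 3 by (simp add: vec_ip_def sum_lt hc_def nth_Cons_numeral)
  next
    case 4
    have "vec_inner g q (T q \<phi>) (T q \<psi>) = (\<Sum>i<3. \<Sum>j<3. of_real (k2 * gram_sym2 m11 m12 m22 i j) * ip (vec_of (sym2 Del \<phi>) i) (vec_of (sym2 Del \<psi>) j))"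
      unfolding vec_inner_ip 4 using gram2 by (simp add: T_def nth_Cons_numeral)
    also have "\<dots> = of_real (norm Del ^ 2 * (k2 * mm ^ 2)) * (ip (\<phi> 0) (\<psi> 0) + ip (\<phi> 1) (\<psi> 1) + ip (\<phi> 2) (\<psi> 2))"
      using s 4 by (intro sym2_pullback) auto
    finally show ?thesis using 4 by (simp add: vec_ip_def sum_lt hc_def nth_Cons_numeral)
  next
    case 5
    have "vec_inner g q (T q \<phi>) (T q \<psi>) = (\<Sum>i<3. \<Sum>j<3. of_real (k3 * gram_sym2 m11 m12 m22 i j) * ip (vec_of (sym2 (Del ^ 2) \<phi>) i) (vec_of (sym2 (Del ^ 2) \<psi>) j))"
      unfolding vec_inner_ip 5 using gram3 by (simp add: T_def nth_Cons_numeral)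
    also have "\<dots> = of_real (norm (Del ^ 2) ^ 2 * (k3 * mm ^ 2)) * (ip (\<phi> 0) (\<psi> 0) + ip (\<phi> 1) (\<psi> 1) + ip (\<phi> 2) (\<psi> 2))"
      using s 5 by (intro sym2_pullback) auto
    finally show ?thesis using 5 by (simp add: vec_ip_def sum_lt hc_def nth_Cons_numeral)
  next
    case 6
    define D where "D = Del ^ 5"
    have "ip (\<lambda>\<theta>. D * \<phi> 0 \<theta>) (\<lambda>\<theta>. D * \<psi> 0 \<theta>) = of_real (norm D ^ 2) * ip (\<phi> 0) (\<psi> 0)"
      unfolding ip_cmult_left ip_cmult_right complex_norm_square by (simp add: mult_ac)
    then show ?thesis using 6
      by (simp add: vec_inner_ip T_def vec_of_def vec_ip_def gram5 hc_def nth_Cons_numeral D_def[symmetric])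
  qed
qed

end

section \<open>From eigenvectors to the determinant\<close>

interpretation svs: vector_space vec_scale
  by (rule vector_space_vec_scale)

lemma vec_ip_sum_left:
  assumes "finite A" "\<And>k. k \<in> A \<Longrightarrow> f k \<in> smooth_vecs q" "\<psi> \<in> smooth_vecs q"
  shows "(\<Sum>k\<in>A. vec_scale (c k) (f k)) \<in> smooth_vecs q"
    and "vec_ip q (\<Sum>k\<in>A. vec_scale (c k) (f k)) \<psi> = (\<Sum>k\<in>A. c k * vec_ip q (f k) \<psi>)"
proof -
  have "(\<Sum>k\<in>A. vec_scale (c k) (f k)) \<in> smooth_vecs q \<and> vec_ip q (\<Sum>k\<in>A. vec_scale (c k) (f k)) \<psi> = (\<Sum>k\<in>A. c k * vec_ip q (f k) \<psi>)"
    using assms(1,2)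
  proof (induction A rule: finite_induct)
    case empty
    have "vec_ip q 0 \<psi> = 0" by (simp add: vec_ip_def)
    then show ?case unfolding sum.empty using smooth_vecs_0 by blast
  next
    case (insert x F)
    have a: "vec_scale (c x) (f x) \<in> smooth_vecs q" using insert.prems by (intro smooth_vecs_scale) auto
    have b: "(\<Sum>k\<in>F. vec_scale (c k) (f k)) \<in> smooth_vecs q"
      "vec_ip q (\<Sum>k\<in>F. vec_scale (c k) (f k)) \<psi> = (\<Sum>k\<in>F. c k * vec_ip q (f k) \<psi>)"
      using insert.IH insert.prems by auto
    show ?case
      unfolding sum.insert[OF insert.hyps] vec_ip_add_left[OF a b(1) assms(3)] vec_ip_scale_left b(2)
      using smooth_vecs_add[OF a b(1)] by blast
  qed
  then show "(\<Sum>k\<in>A. vec_scale (c k) (f k)) \<in> smooth_vecs q"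
    and "vec_ip q (\<Sum>k\<in>A. vec_scale (c k) (f k)) \<psi> = (\<Sum>k\<in>A. c k * vec_ip q (f k) \<psi>)" by auto
qed

lemma vec_of_add: "length fs = length gs \<Longrightarrow> vec_of fs + vec_of gs = vec_of (map2 (+) fs gs)"
  by (auto simp: vec_of_def fun_eq_iff)

context rumin_metric
begin

lemma T_add:
  assumes "q \<le> 5"
  shows "T q (\<phi> + \<psi>) = T q \<phi> + T q \<psi>"
  using coh_dim_le[OF assms]
  by (elim disjE) (simp_all add: T_def lin2_def sym2_def vec_of_add nth_Cons_numeral,
      simp_all add: fun_eq_iff vec_of_def algebra_simps nth_Cons')

lemma T_scale:
  assumes "q \<le> 5"
  shows "T q (vec_scale c \<phi>) = vec_scale c (T q \<phi>)"
  using coh_dim_le[OF assms]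
  by (elim disjE) (auto simp: T_def lin2_def sym2_def nth_Cons_numeral fun_eq_iff vec_of_def algebra_simps vec_scale_def nth_Cons')

lemma T_0:
  assumes "q \<le> 5"
  shows "T q 0 = 0"
  using T_scale[OF assms, of 0 0] by (simp add: svs.scale_zero_left)

lemma T_sum:
  assumes "q \<le> 5" "finite A"
  shows "T q (\<Sum>k\<in>A. vec_scale (c k) (f k)) = (\<Sum>k\<in>A. vec_scale (c k) (T q (f k)))"
  using assms(2)
proof (induction A rule: finite_induct)
  case empty
  show ?case unfolding sum.empty by (rule T_0[OF assms(1)])
next
  case (insert x F)
  then show ?case unfolding sum.insert[OF insert.hyps] T_add[OF assms(1)] T_scale[OF assms(1)] by simp
qed

lemma T_inj:
  assumes q: "q \<le> 5" and \<phi>: "\<phi> \<in> smooth_vecs q" and 0: "T q \<phi> = 0"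
  shows "\<phi> = 0"
proof -
  have "of_real (hc q) * vec_ip q \<phi> \<phi> = vec_inner g q (T q \<phi>) (T q \<phi>)" using vec_inner_T[OF q \<phi> \<phi>] by simp
  also have "\<dots> = 0" unfolding 0 by (simp add: vec_inner_def)
  finally have "vec_ip q \<phi> \<phi> = 0" using hc_pos[OF q] by simp
  then show ?thesis by (rule vec_ip_self_0[OF \<phi>])
qed

lemma T_eqD:
  assumes q: "q \<le> 5" and \<phi>: "\<phi> \<in> smooth_vecs q" and \<psi>: "\<psi> \<in> smooth_vecs q" and eq: "T q \<phi> = T q \<psi>"
  shows "\<phi> = \<psi>"
proof -
  have m: "vec_scale (- 1) \<psi> = - \<psi>" by (simp add: vec_scale_def fun_eq_iff)
  have "\<phi> + vec_scale (- 1) \<psi> = 0"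
  proof (rule T_inj[OF q])
    show "\<phi> + vec_scale (- 1) \<psi> \<in> smooth_vecs q" by (intro smooth_vecs_add smooth_vecs_scale \<phi> \<psi>)
    show "T q (\<phi> + vec_scale (- 1) \<psi>) = 0"
      unfolding T_add[OF q] T_scale[OF q] eq by (simp add: vec_scale_def fun_eq_iff)
  qed
  then show ?thesis unfolding m by simp
qed

text \<open>The adjoint is a definite description, so existence and uniqueness are both due. The
  candidate comes from \<open>Wad\<close> by transport along \<open>T\<close>, the ratio of the
  scalars hc entering; uniqueness follows from definiteness of \<open>vec_ip\<close>.\<close>

lemma rho_D_adj_T:
  assumes q: "q \<le> 4" and \<phi>: "\<phi> \<in> smooth_vecs q"
  shows "rho_D_adj g hb q (rho_D hb q (T q \<phi>)) =
    T q (vec_scale (of_real (hc (Suc q) / hc q)) (Wad q (W q \<phi>)))"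
    (is "_ = T q ?\<xi>")
proof -
  have q5: "q \<le> 5" "Suc q \<le> 5" using q by simp_all
  have W\<phi>: "W q \<phi> \<in> smooth_vecs (Suc q)" by (rule W_smooth[OF q \<phi>])
  have \<xi>: "?\<xi> \<in> smooth_vecs q" by (intro smooth_vecs_scale Wad_smooth[OF q W\<phi>])
  have eq: "vec_inner g (Suc q) (rho_D hb q (T q \<zeta>)) (rho_D hb q (T q \<phi>)) = vec_inner g q (T q \<zeta>) (T q ?\<xi>)"
    if \<zeta>: "\<zeta> \<in> smooth_vecs q" for \<zeta>
    unfolding rho_D_T[OF q \<zeta>] rho_D_T[OF q \<phi>] vec_inner_T[OF q5(2) W_smooth[OF q \<zeta>] W\<phi>] vec_inner_T[OF q5(1) \<zeta> \<xi>]
      vec_ip_scale_right vec_ip_W[OF q \<zeta> W\<phi>]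
    using hc_pos[OF q5(1)] by simp
  show ?thesis
    unfolding rho_D_adj_def
  proof (rule the_equality)
    show "T q ?\<xi> \<in> smooth_vecs q \<and> (\<forall>\<psi>\<in>smooth_vecs q.
        vec_inner g (Suc q) (rho_D hb q \<psi>) (rho_D hb q (T q \<phi>)) = vec_inner g q \<psi> (T q ?\<xi>))"
      using eq T_smooth[OF q5(1) \<xi>] T_surj[OF q5(1)] by metis
    fix \<eta>
    assume \<eta>: "\<eta> \<in> smooth_vecs q \<and> (\<forall>\<psi>\<in>smooth_vecs q.
        vec_inner g (Suc q) (rho_D hb q \<psi>) (rho_D hb q (T q \<phi>)) = vec_inner g q \<psi> \<eta>)"
    then obtain \<eta>' where \<eta>': "\<eta>' \<in> smooth_vecs q" "T q \<eta>' = \<eta>" using T_surj[OF q5(1)] by metis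
    have "vec_ip q \<zeta> \<eta>' = vec_ip q \<zeta> ?\<xi>" if \<zeta>: "\<zeta> \<in> smooth_vecs q" for \<zeta>
    proof -
      have "vec_inner g q (T q \<zeta>) (T q \<eta>') = vec_inner g q (T q \<zeta>) (T q ?\<xi>)"
        using \<eta> eq[OF \<zeta>] T_smooth[OF q5(1) \<zeta>] \<eta>'(2) by metis
      then show ?thesis
        unfolding vec_inner_T[OF q5(1) \<zeta> \<eta>'(1)] vec_inner_T[OF q5(1) \<zeta> \<xi>] using hc_pos[OF q5(1)] by simp
    qed
    note l = this
    let ?d = "\<eta>' + vec_scale (- 1) ?\<xi>"
    have d: "?d \<in> smooth_vecs q" by (intro smooth_vecs_add smooth_vecs_scale[of _ _ "-1"] \<eta>' \<xi>)
    have "vec_ip q ?d \<zeta> = 0" if \<zeta>: "\<zeta> \<in> smooth_vecs q" for \<zeta>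
    proof -
      have "vec_ip q \<eta>' \<zeta> = vec_ip q ?\<xi> \<zeta>" using l[OF \<zeta>] vec_ip_cnj by metis
      then show ?thesis
        using vec_ip_add_left[OF \<eta>'(1) smooth_vecs_scale[OF \<xi>, of "-1"] \<zeta>] by (simp only: vec_ip_scale_left) simp
    qed
    then have "?d = 0" using vec_ip_self_0[OF d] d by blast
    then have "\<eta>' = ?\<xi>" by (auto simp: fun_eq_iff vec_scale_def)
    then show "\<eta> = T q ?\<xi>" using \<eta>'(2) by simp
  qed
qed

text \<open>The orthogonal eigenvectors \<open>e k\<close> and the kernel vectors Zs are only
  required to be total, not to form a Hilbert basis. An eigenvector of nonzero eigenvalue x is
  orthogonal to Zs and to every \<open>e k\<close> of another eigenvalue. Subtracting its projection
  to the finitely many remaining \<open>e k\<close> leaves a vector orthogonal to everything. Hence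
  those \<open>e k\<close> span the eigenspace.\<close>

lemma spectral:
  fixes e :: "'k \<Rightarrow> svec"
  assumes q: "q \<le> 4"
    and e: "\<And>k. e k \<in> smooth_vecs q" "\<And>k. vec_ip q (e k) (e k) \<noteq> 0" "\<And>k l. k \<noteq> l \<Longrightarrow> vec_ip q (e k) (e l) = 0"
    and eig: "\<And>k. Wad q (W q (e k)) = vec_scale (of_real (\<mu> k)) (e k)" and \<mu>: "\<And>k. \<mu> k > 0"
    and fin: "\<And>x. finite {k. \<mu> k = x}"
    and ker: "\<And>z. z \<in> Zs \<Longrightarrow> z \<in> smooth_vecs q" "\<And>z. z \<in> Zs \<Longrightarrow> W q z = 0"
    and tot: "\<And>\<phi>. \<phi> \<in> smooth_vecs q \<Longrightarrow> (\<And>k. vec_ip q \<phi> (e k) = 0) \<Longrightarrow> (\<And>z. z \<in> Zs \<Longrightarrow> vec_ip q \<phi> z = 0) \<Longrightarrow> \<phi> = 0"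
    and zd: "zeta_data UNIV (\<lambda>k. hc (Suc q) / hc q * \<mu> k) d"
  shows "(\<exists>Z. is_zeta g hb q Z) \<and> det_star g hb q = exp (- d)"
proof -
  have q5: "q \<le> 5" "Suc q \<le> 5" using q by simp_all
  define c where "c = hc (Suc q) / hc q"
  have c: "c > 0" using hc_pos[OF q5(1)] hc_pos[OF q5(2)] by (simp add: c_def)
  define F where "F x = {k. complex_of_real (c * \<mu> k) = x}" for x
  have finF: "finite (F x)" for x
  proof (rule finite_subset[OF _ fin[of "Re x / c"]])
    show "F x \<subseteq> {k. \<mu> k = Re x / c}" using c by (auto simp: F_def)
  qed
  have sym: "vec_ip q (Wad q (W q \<phi>)) \<psi> = vec_ip q \<phi> (Wad q (W q \<psi>))"
    if "\<phi> \<in> smooth_vecs q" "\<psi> \<in> smooth_vecs q" for \<phi> \<psi>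
    using vec_ip_W[OF q that(1) W_smooth[OF q that(2)]] vec_ip_W[OF q that(2) W_smooth[OF q that(1)]] vec_ip_cnj by metis
  have eigT: "T q \<phi> \<in> eigenspace g hb q x \<longleftrightarrow> vec_scale (of_real c) (Wad q (W q \<phi>)) = vec_scale x \<phi>"
    if \<phi>: "\<phi> \<in> smooth_vecs q" for \<phi> x
  proof -
    have s: "vec_scale (of_real c) (Wad q (W q \<phi>)) \<in> smooth_vecs q" "vec_scale x \<phi> \<in> smooth_vecs q"
      by (intro smooth_vecs_scale Wad_smooth[OF q W_smooth[OF q \<phi>]] \<phi>)+
    have "T q \<phi> \<in> eigenspace g hb q x \<longleftrightarrow> T q (vec_scale (of_real c) (Wad q (W q \<phi>))) = T q (vec_scale x \<phi>)"
    proof -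
      have "T q \<phi> \<in> eigenspace g hb q x \<longleftrightarrow> rho_D_adj g hb q (rho_D hb q (T q \<phi>)) = vec_scale x (T q \<phi>)"
        using T_smooth[OF q5(1) \<phi>] by (simp add: eigenspace_def)
      then show ?thesis unfolding rho_D_adj_T[OF q \<phi>] c_def[symmetric] T_scale[OF q5(1), of x] .
    qed
    also have "\<dots> \<longleftrightarrow> vec_scale (of_real c) (Wad q (W q \<phi>)) = vec_scale x \<phi>"
      by (metis T_eqD[OF q5(1) s])
    finally show ?thesis .
  qed
  have eT: "T q (e k) \<in> eigenspace g hb q (of_real (c * \<mu> k))" for k
    unfolding eigT[OF e(1)] eig by (simp add: vec_scale_def fun_eq_iff mult_ac)
  have esm: "T q (e k) \<in> smooth_vecs q" for k by (rule T_smooth[OF q5(1) e(1)])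
  have comb: "\<phi> = (\<Sum>k\<in>F x. vec_scale (vec_ip q \<phi> (e k) / vec_ip q (e k) (e k)) (e k))"
    if \<phi>: "\<phi> \<in> smooth_vecs q" and x: "x \<noteq> 0" and ev: "vec_scale (of_real c) (Wad q (W q \<phi>)) = vec_scale x \<phi>" for \<phi> x
  proof -
    let ?a = "\<lambda>k. vec_ip q \<phi> (e k) / vec_ip q (e k) (e k)"
    let ?s = "\<Sum>k\<in>F x. vec_scale (?a k) (e k)"
    have s: "?s \<in> smooth_vecs q" by (rule vec_ip_sum_left(1)[OF finF e(1) smooth_vecs_0])
    have key: "of_real c * vec_ip q \<phi> (Wad q (W q \<psi>)) = x * vec_ip q \<phi> \<psi>" if "\<psi> \<in> smooth_vecs q" for \<psi>
    proof -
      have "vec_ip q (vec_scale (of_real c) (Wad q (W q \<phi>))) \<psi> = vec_ip q (vec_scale x \<phi>) \<psi>" unfolding ev ..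
      then show ?thesis unfolding vec_ip_scale_left sym[OF \<phi> that] .
    qed
    have off: "vec_ip q \<phi> (e k) = 0" if "k \<notin> F x" for k
    proof -
      have "of_real c * (of_real (\<mu> k) * vec_ip q \<phi> (e k)) = x * vec_ip q \<phi> (e k)"
        using key[OF e(1)[of k]] unfolding eig vec_ip_scale_right by simp
      then have "(of_real (c * \<mu> k) - x) * vec_ip q \<phi> (e k) = 0" by (simp add: algebra_simps)
      then show ?thesis using that by (auto simp: F_def)
    qed
    \<comment> \<open>Symmetry moves the operator onto z, where it gives 0; as x is nonzero, the
      inner product vanishes.\<close>
    have kz: "vec_ip q \<phi> z = 0" if "z \<in> Zs" for z
    proof -
      have "Wad q (0 :: svec) = 0"
        using le_4_cases[OF q] schwartz_0
        by (elim disjE) (auto simp: Wad_def vec_of_def fun_eq_iff lower_def raise_def first_order_def nth_Cons_numeral zero_fun_def vderiv_def nth_Cons')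
      then have "x * vec_ip q \<phi> z = of_real c * vec_ip q \<phi> 0" using key[OF ker(1)[OF that]] ker(2)[OF that] by simp
      moreover have "vec_ip q \<phi> 0 = 0" by (simp add: vec_ip_def)
      ultimately show ?thesis using x by simp
    qed
    let ?d = "\<phi> + vec_scale (- 1) ?s"
    have d: "?d \<in> smooth_vecs q" by (intro smooth_vecs_add smooth_vecs_scale \<phi> s)
    have ld: "vec_ip q ?d \<psi> = vec_ip q \<phi> \<psi> - (\<Sum>k\<in>F x. ?a k * vec_ip q (e k) \<psi>)" if "\<psi> \<in> smooth_vecs q" for \<psi>
    proof -
      have "vec_ip q ?s \<psi> = (\<Sum>k\<in>F x. ?a k * vec_ip q (e k) \<psi>)"
        by (rule vec_ip_sum_left(2)[OF finF e(1) that])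
      then show ?thesis
        unfolding vec_ip_add_left[OF \<phi> smooth_vecs_scale[OF s, of "-1"] that] vec_ip_scale_left by simp
    qed
    have "?d = 0"
    proof (rule tot[OF d])
      fix l
      have "(\<Sum>k\<in>F x. ?a k * vec_ip q (e k) (e l)) = (\<Sum>k\<in>F x. if k = l then vec_ip q \<phi> (e l) else 0)"
        by (intro sum.cong refl) (use e(2,3) in auto)
      also have "\<dots> = vec_ip q \<phi> (e l)" using finF off[of l] by simp
      finally show "vec_ip q ?d (e l) = 0" using ld[OF e(1)[of l]] by simp
    next
      fix z assume z: "z \<in> Zs"
      have "vec_ip q (e k) z = 0" for k
      proof -
        have "vec_ip (Suc q) (W q (e k)) (W q z) = 0" unfolding ker(2)[OF z] by (simp add: vec_ip_def)
        then have "vec_ip (Suc q) (W q z) (W q (e k)) = 0" by (metis vec_ip_cnj complex_cnj_zero)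
        then have "vec_ip q z (vec_scale (of_real (\<mu> k)) (e k)) = 0"
          unfolding vec_ip_W[OF q ker(1)[OF z] W_smooth[OF q e(1)]] eig .
        then have "vec_ip q z (e k) = 0" using \<mu>[of k] by (simp add: vec_ip_scale_right)
        then show ?thesis by (metis vec_ip_cnj complex_cnj_zero)
      qed
      then show "vec_ip q ?d z = 0" using ld[OF ker(1)[OF z]] kz[OF z] by simp
    qed
    then show ?thesis by (auto simp: fun_eq_iff vec_scale_def)
  qed
  have espan: "eigenspace g hb q x \<subseteq> svs.span ((\<lambda>k. T q (e k)) ` F x)" if x: "x \<noteq> 0" for x
  proof
    fix \<psi> assume \<psi>: "\<psi> \<in> eigenspace g hb q x"
    then obtain \<phi> where \<phi>: "\<phi> \<in> smooth_vecs q" "T q \<phi> = \<psi>"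
      using T_surj[OF q5(1)] unfolding eigenspace_def by blast
    have "\<phi> = (\<Sum>k\<in>F x. vec_scale (vec_ip q \<phi> (e k) / vec_ip q (e k) (e k)) (e k))"
      by (rule comb[OF \<phi>(1) x]) (use eigT[OF \<phi>(1)] \<phi>(2) \<psi> in simp)
    then have "\<psi> = (\<Sum>k\<in>F x. vec_scale (vec_ip q \<phi> (e k) / vec_ip q (e k) (e k)) (T q (e k)))"
      using \<phi>(2) T_sum[OF q5(1) finF] by metis
    also have "\<dots> \<in> svs.span ((\<lambda>k. T q (e k)) ` F x)"
      by (intro svs.span_sum svs.span_scale svs.span_base) auto
    finally show "\<psi> \<in> svs.span ((\<lambda>k. T q (e k)) ` F x)" .
  qed
  have inj: "inj_on (\<lambda>k. T q (e k)) A" for A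
  proof (rule inj_onI, rule ccontr)
    fix k l assume "T q (e k) = T q (e l)" "k \<noteq> l"
    then have "e k = e l" using T_eqD[OF q5(1) e(1) e(1)] by blast
    then show False using e(2)[of k] e(3)[OF \<open>k \<noteq> l\<close>] by metis
  qed
  have indep: "svs.independent ((\<lambda>k. T q (e k)) ` F x)" for x
  proof (rule svs.independent_if_scalars_zero)
    fix f y assume 0: "(\<Sum>y\<in>(\<lambda>k. T q (e k)) ` F x. vec_scale (f y) y) = 0" and "y \<in> (\<lambda>k. T q (e k)) ` F x"
    then obtain l where l: "l \<in> F x" "y = T q (e l)" by blast
    have "(\<Sum>k\<in>F x. vec_scale (f (T q (e k))) (T q (e k))) = 0"
      using 0 by (simp add: sum.reindex[OF inj])
    then have "T q (\<Sum>k\<in>F x. vec_scale (f (T q (e k))) (e k)) = 0" unfolding T_sum[OF q5(1) finF] .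
    then have z: "(\<Sum>k\<in>F x. vec_scale (f (T q (e k))) (e k)) = 0"
      by (rule T_inj[OF q5(1) vec_ip_sum_left(1)[OF finF e(1) smooth_vecs_0]])
    have "(\<Sum>k\<in>F x. f (T q (e k)) * vec_ip q (e k) (e l)) = vec_ip q 0 (e l)"
      unfolding z[symmetric] by (rule vec_ip_sum_left(2)[OF finF e(1) e(1), symmetric])
    also have "\<dots> = 0" by (simp add: vec_ip_def)
    also have "(\<Sum>k\<in>F x. f (T q (e k)) * vec_ip q (e k) (e l)) = (\<Sum>k\<in>F x. if k = l then f y * vec_ip q (e l) (e l) else 0)"
      by (intro sum.cong refl) (use e(3) l in auto)
    finally show "f y = 0" using finF l e(2)[of l] by simp
  qed (use finF in auto)
  have subsp: "eigenspace g hb q x = svs.span ((\<lambda>k. T q (e k)) ` F x)" if x: "x \<noteq> 0" for x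
  proof (rule antisym[OF espan[OF x]])
    show "svs.span ((\<lambda>k. T q (e k)) ` F x) \<subseteq> eigenspace g hb q x"
    proof (rule svs.span_minimal)
      show "(\<lambda>k. T q (e k)) ` F x \<subseteq> eigenspace g hb q x" using eT by (auto simp: F_def)
      \<comment> \<open>Linearity follows from symmetry and definiteness, without unfolding the
        matrices in each degree.\<close>
      have lin: "Wad q (W q (\<phi> + \<psi>)) = Wad q (W q \<phi>) + Wad q (W q \<psi>)" "Wad q (W q (vec_scale b \<phi>)) = vec_scale b (Wad q (W q \<phi>))"
        if s: "\<phi> \<in> smooth_vecs q" "\<psi> \<in> smooth_vecs q" for \<phi> \<psi> b
      proof -
        have nd: "\<phi>' = \<psi>'" if "\<phi>' \<in> smooth_vecs q" "\<psi>' \<in> smooth_vecs q" "\<And>\<zeta>. \<zeta> \<in> smooth_vecs q \<Longrightarrow> vec_ip q \<phi>' \<zeta> = vec_ip q \<psi>' \<zeta>" for \<phi>' \<psi>'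
        proof -
          let ?d = "\<phi>' + vec_scale (- 1) \<psi>'"
          have d: "?d \<in> smooth_vecs q" by (intro smooth_vecs_add smooth_vecs_scale that)
          have "vec_ip q ?d ?d = 0"
            using vec_ip_add_left[OF that(1) smooth_vecs_scale[OF that(2), of "-1"] d] that(3)[OF d] by (simp only: vec_ip_scale_left) simp
          then have "?d = 0" by (rule vec_ip_self_0[OF d])
          then show ?thesis by (auto simp: fun_eq_iff vec_scale_def)
        qed
        note WW = Wad_smooth[OF q W_smooth[OF q]]
        show "Wad q (W q (\<phi> + \<psi>)) = Wad q (W q \<phi>) + Wad q (W q \<psi>)"
          by (rule nd) (use s in \<open>simp_all add: WW smooth_vecs_add vec_ip_add_left sym\<close>)
        show "Wad q (W q (vec_scale b \<phi>)) = vec_scale b (Wad q (W q \<phi>))"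
          by (rule nd) (use s in \<open>simp_all add: WW smooth_vecs_scale vec_ip_scale_left sym\<close>)
      qed
      show "svs.subspace (eigenspace g hb q x)"
      proof (rule svs.subspaceI)
        show "0 \<in> eigenspace g hb q x"
        proof -
          have "vec_scale 0 (T q (T q 0)) = (0::svec)" by simp
          have "T q 0 \<in> eigenspace g hb q x"
            unfolding eigT[OF smooth_vecs_0] using lin(2)[OF smooth_vecs_0 smooth_vecs_0, of 0] by simp
          then show ?thesis by (simp add: T_0 q5)
        qed
      next
        fix \<psi> \<psi>' assume *: "\<psi> \<in> eigenspace g hb q x" "\<psi>' \<in> eigenspace g hb q x"
        then obtain \<phi> \<phi>' where \<phi>: "\<phi> \<in> smooth_vecs q" "T q \<phi> = \<psi>" "\<phi>' \<in> smooth_vecs q" "T q \<phi>' = \<psi>'"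
          using T_surj[OF q5(1)] unfolding eigenspace_def by (metis (no_types, lifting) mem_Collect_eq)
        have "T q (\<phi> + \<phi>') \<in> eigenspace g hb q x"
          unfolding eigT[OF smooth_vecs_add[OF \<phi>(1,3)]] lin(1)[OF \<phi>(1,3)] svs.scale_right_distrib
          using * \<phi> eigT by metis
        then show "\<psi> + \<psi>' \<in> eigenspace g hb q x" using \<phi> by (simp add: T_add q5)
      next
        fix b \<psi> assume *: "\<psi> \<in> eigenspace g hb q x"
        then obtain \<phi> where \<phi>: "\<phi> \<in> smooth_vecs q" "T q \<phi> = \<psi>"
          using T_surj[OF q5(1)] unfolding eigenspace_def by (metis (no_types, lifting) mem_Collect_eq)
        have "vec_scale (of_real c) (Wad q (W q \<phi>)) = vec_scale x \<phi>" using * \<phi> eigT by metis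
        then have "vec_scale b (vec_scale (of_real c) (Wad q (W q \<phi>))) = vec_scale b (vec_scale x \<phi>)" by simp
        then have "T q (vec_scale b \<phi>) \<in> eigenspace g hb q x"
          unfolding eigT[OF smooth_vecs_scale[OF \<phi>(1)]] lin(2)[OF \<phi>(1) \<phi>(1)] by (simp add: mult.commute)
        then show "vec_scale b \<psi> \<in> eigenspace g hb q x" using \<phi> by (simp add: T_scale q5)
      qed
    qed
  qed
  have mult: "multiplicity_of g hb q x = card (F x)" if x: "x \<noteq> 0" for x
    unfolding multiplicity_of_def subsp[OF x] svs.dim_span_eq_card_independent[OF indep]
    by (rule card_image[OF inj])
  have nz: "nonzero_eigenvalues g hb q = (\<lambda>k. complex_of_real (c * \<mu> k)) ` UNIV"
  proof (intro equalityI subsetI)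
    fix x assume "x \<in> nonzero_eigenvalues g hb q"
    then obtain \<psi> where x: "x \<noteq> 0" "\<psi> \<in> eigenspace g hb q x" "\<psi> \<noteq> 0" by (auto simp: nonzero_eigenvalues_def)
    have "F x \<noteq> {}"
    proof
      assume "F x = {}"
      then have "\<psi> \<in> svs.span {}" using espan[OF x(1)] x(2) by auto
      with x(3) show False by simp
    qed
    then show "x \<in> (\<lambda>k. complex_of_real (c * \<mu> k)) ` UNIV" by (auto simp: F_def)
  next
    fix x assume "x \<in> (\<lambda>k. complex_of_real (c * \<mu> k)) ` UNIV"
    then obtain k where k: "x = complex_of_real (c * \<mu> k)" by blast
    have "T q (e k) \<noteq> 0"
    proof
      assume "T q (e k) = 0"
      then have "e k = 0" by (rule T_inj[OF q5(1) e(1)])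
      with e(2)[of k] show False by (simp add: vec_ip_def)
    qed
    moreover have "x \<noteq> 0" using k c \<mu>[of k] by simp
    ultimately show "x \<in> nonzero_eigenvalues g hb q" unfolding nonzero_eigenvalues_def using eT[of k] k by blast
  qed
  have x0: "x \<noteq> 0" if "x \<in> nonzero_eigenvalues g hb q" for x using that by (simp add: nonzero_eigenvalues_def)
  have sums: "((\<lambda>x. of_nat (multiplicity_of g hb q x) * x powr (- s / 2)) has_sum S) (nonzero_eigenvalues g hb q)"
    if S: "((\<lambda>k. complex_of_real (c * \<mu> k) powr (- s / 2)) has_sum S) UNIV" for s S
  proof -
    let ?E = "nonzero_eigenvalues g hb q"
    \<comment> \<open>The sum over k is fibred over the eigenvalues; the fibre over x has as many
      elements as the multiplicity of x.\<close>
    have bij: "bij_betw (\<lambda>k. (complex_of_real (c * \<mu> k), k)) UNIV (Sigma ?E F)"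
    proof (rule bij_betw_byWitness[where f' = snd])
      show "\<forall>y\<in>Sigma ?E F. (complex_of_real (c * \<mu> (snd y)), snd y) = y" by (auto simp: F_def)
      show "(\<lambda>k. (complex_of_real (c * \<mu> k), k)) ` UNIV \<subseteq> Sigma ?E F" unfolding nz F_def by blast
    qed auto
    have "((\<lambda>(x, k). complex_of_real (c * \<mu> k) powr (- s / 2)) has_sum S) (Sigma ?E F)"
      using has_sum_reindex_bij_betw[OF bij, of "\<lambda>(x, k). complex_of_real (c * \<mu> k) powr (- s / 2)" S] S by simp
    then show ?thesis
    proof (rule has_sum_SigmaD)
      fix x assume x: "x \<in> ?E"
      have "((\<lambda>k. x powr (- s / 2)) has_sum (of_nat (card (F x)) * x powr (- s / 2))) (F x)"
        using finF by (intro has_sum_finiteI) auto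
      moreover have "complex_of_real (c * \<mu> k) powr (- s / 2) = x powr (- s / 2)" if "k \<in> F x" for k
        using that by (simp add: F_def)
      ultimately show "((\<lambda>k. case (x, k) of (x, k) \<Rightarrow> complex_of_real (c * \<mu> k) powr (- s / 2)) has_sum
          of_nat (multiplicity_of g hb q x) * x powr (- s / 2)) (F x)"
        unfolding mult[OF x0[OF x]] by (simp cong: has_sum_cong)
    qed
  qed
  obtain Z \<sigma> where Z: "Z meromorphic_on UNIV" "Z analytic_on {0}" "(Z has_field_derivative d) (at 0)"
    "\<And>s. Re s > \<sigma> \<Longrightarrow> ((\<lambda>k. complex_of_real (c * \<mu> k) powr (- s / 2)) has_sum Z s) UNIV"
    using zd unfolding zeta_data_def c_def by metis
  have isZ: "is_zeta g hb q Z"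
    unfolding is_zeta_def
  proof (intro conjI ballI)
    fix x assume x: "x \<in> nonzero_eigenvalues g hb q"
    show "\<exists>B. finite B \<and> eigenspace g hb q x \<subseteq> svs.span B"
      using finF[of x] espan[OF x0[OF x]] by blast
  qed (use Z sums in blast)+
  \<comment> \<open>Any admissible continuation agrees with Z on a right half-plane, hence has the
    same derivative at 0.\<close>
  have uniq: "deriv Z' 0 = d" if Z': "is_zeta g hb q Z'" for Z'
  proof -
    obtain \<sigma>' where \<sigma>': "\<And>s. Re s > \<sigma>' \<Longrightarrow> ((\<lambda>x. of_nat (multiplicity_of g hb q x) * x powr (- s / 2)) has_sum Z' s) (nonzero_eigenvalues g hb q)"
      using Z' unfolding is_zeta_def by blast
    have eq: "Z s = Z' s" if "Re s > max \<sigma> \<sigma>'" for s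
      using has_sum_unique[OF sums[OF Z(4)] \<sigma>'] that by simp
    have "Z' meromorphic_on UNIV" "Z' analytic_on {0}" using Z' by (simp_all add: is_zeta_def)
    then show ?thesis
      by (rule meromorphic_continuation_deriv[OF Z(1,2) _ _ eq Z(3)])
  qed
  have "deriv (SOME Z. is_zeta g hb q Z) 0 = d" by (rule uniq[OF someI[of "is_zeta g hb q", OF isZ]])
  with isZ show ?thesis unfolding det_star_def by auto
qed

end

section \<open>Eigenvectors and determinants\<close>

context schroedinger
begin

lemma lower_minus: "schwartz f \<Longrightarrow> lower (\<lambda>\<theta>. - f \<theta>) = (\<lambda>\<theta>. - lower f \<theta>)"
  and raise_minus: "schwartz f \<Longrightarrow> raise (\<lambda>\<theta>. - f \<theta>) = (\<lambda>\<theta>. - raise f \<theta>)"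
  using lower_cmult[of f "-1"] raise_cmult[of f "-1"] by simp_all

lemma lower_diff: "schwartz f \<Longrightarrow> schwartz g \<Longrightarrow> lower (\<lambda>\<theta>. f \<theta> - g \<theta>) = (\<lambda>\<theta>. lower f \<theta> - lower g \<theta>)"
  and raise_diff: "schwartz f \<Longrightarrow> schwartz g \<Longrightarrow> raise (\<lambda>\<theta>. f \<theta> - g \<theta>) = (\<lambda>\<theta>. raise f \<theta> - raise g \<theta>)"
  using lower_lin[of f g 1 "-1"] raise_lin[of f g 1 "-1"] by simp_all

lemma lower_divide: "schwartz f \<Longrightarrow> lower (\<lambda>\<theta>. f \<theta> / c) = (\<lambda>\<theta>. lower f \<theta> / c)"
  and raise_divide: "schwartz f \<Longrightarrow> raise (\<lambda>\<theta>. f \<theta> / c) = (\<lambda>\<theta>. raise f \<theta> / c)"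
  using lower_cmult[of f "1 / c"] raise_cmult[of f "1 / c"] by simp_all

lemma lower_zero: "lower (\<lambda>_. 0) = (\<lambda>_. 0)" and raise_zero: "raise (\<lambda>_. 0) = (\<lambda>_. 0)"
  using lower_cmult[of ground 0] raise_cmult[of ground 0] schwartz_ground by simp_all

lemmas herm_simps = lower_herm raise_herm schwartz_herm lower_plus raise_plus lower_minus raise_minus
  lower_diff raise_diff lower_divide raise_divide lower_cmult raise_cmult lower_zero raise_zero
  schwartz_plus schwartz_cmult schwartz_minus schwartz_diff schwartz_divide schwartz_0

lemma herm_nz: "herm n \<noteq> (\<lambda>_. 0)"
proof
  assume "herm n = (\<lambda>_. 0)"
  then have "ip (herm n) (herm n) = 0" by simp
  then show False using ip_herm[of n n] gnorm_nz by simp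
qed

lemma vec_ip_vec_of1: "vec_ip 0 \<phi> (vec_of [f]) = ip (\<phi> 0) f"
  and vec_ip_vec_of2: "q = 1 \<or> q = 4 \<Longrightarrow> vec_ip q \<phi> (vec_of [f, g]) = ip (\<phi> 0) f + ip (\<phi> 1) g"
  and vec_ip_vec_of3: "q = 2 \<or> q = 3 \<Longrightarrow> vec_ip q \<phi> (vec_of [f, g, h]) = ip (\<phi> 0) f + ip (\<phi> 1) g + ip (\<phi> 2) h"
  by (auto simp: vec_ip_def sum_lt vec_of_def nth_Cons_numeral)

lemma vec_of_nth: "vec_of [f] 0 = f" "vec_of [f, g] 0 = f" "vec_of [f, g] 1 = g" "vec_of [f, g, h] 0 = f" "vec_of [f, g, h] 1 = g" "vec_of [f, g, h] 2 = h"
  by (simp_all add: vec_of_def nth_Cons_numeral)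

lemma vec_herm_complete:
  assumes \<phi>: "\<phi> \<in> smooth_vecs q" and 0: "\<And>i n. i < coh_dim q \<Longrightarrow> ip (\<phi> i) (herm n) = 0"
  shows "\<phi> = 0"
proof (rule smooth_vecs_eqI[OF \<phi> smooth_vecs_0])
  fix i assume "i < coh_dim q"
  then show "\<phi> i = 0 i" using herm_complete[OF smooth_vecsD[OF \<phi>] 0] by (simp add: zero_fun_def)
qed

lemma vec_of_eq_iff: "vec_of [f] = vec_of [f'] \<longleftrightarrow> f = f'" "vec_of [f, g] = vec_of [f', g'] \<longleftrightarrow> f = f' \<and> g = g'"
  "vec_of [f, g, h] = vec_of [f', g', h'] \<longleftrightarrow> f = f' \<and> g = g' \<and> h = h'"
  using vec_of_nth by metis+

lemma vec_scale_vec_of: "vec_scale c (vec_of [f]) = vec_of [\<lambda>\<theta>. c * f \<theta>]" "vec_scale c (vec_of [f, g]) = vec_of [\<lambda>\<theta>. c * f \<theta>, \<lambda>\<theta>. c * g \<theta>]"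
  "vec_scale c (vec_of [f, g, h]) = vec_of [\<lambda>\<theta>. c * f \<theta>, \<lambda>\<theta>. c * g \<theta>, \<lambda>\<theta>. c * h \<theta>]"
  by (auto simp: vec_scale_def vec_of_def fun_eq_iff nth_Cons')

lemma zero_vec_of: "(0::svec) = vec_of [\<lambda>_. 0]" "(0::svec) = vec_of [\<lambda>_. 0, \<lambda>_. 0]" "(0::svec) = vec_of [\<lambda>_. 0, \<lambda>_. 0, \<lambda>_. 0]"
  by (auto simp: vec_of_def fun_eq_iff nth_Cons')

lemmas mat_simps = W_def Wad_def vec_of_nth vec_of_nth[unfolded One_nat_def] vec_scale_vec_of nth_Cons_numeral vec_of_eq_iff

text \<open>The absolute value matters only at n = 0, where k (k^2 - 2) = -1.\<close>

definition eig1 :: "nat \<Rightarrow> real" where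
  "eig1 n = \<bar>real (2 * n + 1) * (real (2 * n + 1) ^ 2 - 2)\<bar>"

lemma eig1_Suc: "eig1 (Suc l) = (2 * real l + 3) * (4 * real l ^ 2 + 12 * real l + 7)"
proof -
  have "real (2 * Suc l + 1) * (real (2 * Suc l + 1) ^ 2 - 2) = (2 * real l + 3) * (4 * real l ^ 2 + 12 * real l + 7)"
    by (simp add: algebra_simps power2_eq_square)
  moreover have "(2 * real l + 3) * (4 * real l ^ 2 + 12 * real l + 7) \<ge> 0" by (intro mult_nonneg_nonneg) auto
  ultimately show ?thesis unfolding eig1_def by simp
qed

lemma eig1_0: "eig1 0 = 1" by (simp add: eig1_def)

lemma eig1_pos: "eig1 n > 0"
proof (cases n)
  case (Suc l)
  have "4 * real l ^ 2 + 12 * real l + 7 > 0" by (intro add_nonneg_pos add_nonneg_nonneg) auto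
  then show ?thesis unfolding Suc eig1_Suc by (intro mult_pos_pos) auto
qed (simp add: eig1_0)

text \<open>Here the operator is raise lower + lower raise, the harmonic oscillator.\<close>

lemma e0_eig: "Wad 0 (W 0 (vec_of [herm n])) = vec_scale (of_real (real (2 * n + 1))) (vec_of [herm n])"
  by (cases n; simp add: mat_simps herm_simps; simp add: fun_eq_iff algebra_simps)

text \<open>On the plane spanned by herm l in the first and herm (l + 2) in the second slot,
  \<open>W 1\<close> has rank one: everything is governed by the functional (l + 1) y - x. Each such
  block thus contributes one eigenvector and one kernel vector.\<close>

lemma W1_block: "W 1 (vec_of [\<lambda>\<theta>. x * herm l \<theta>, \<lambda>\<theta>. y * herm (l + 2) \<theta>]) =
    vec_of [\<lambda>\<theta>. (of_nat (l + 1) * y - x) * (of_nat l * (of_nat (l + 2) * herm (l - 1) \<theta>)),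
         \<lambda>\<theta>. (of_nat (l + 1) * y - x) * (s2 * (of_nat (l + 2) * herm (l + 1) \<theta>)),
         \<lambda>\<theta>. (of_nat (l + 1) * y - x) * herm (l + 3) \<theta>]"
  by (simp add: mat_simps herm_simps) (simp add: fun_eq_iff algebra_simps eval_nat_numeral)

lemma Wad1_block: "Wad 1 (vec_of [\<lambda>\<theta>. t * (of_nat l * (u * herm (l - 1) \<theta>)),
         \<lambda>\<theta>. t * (s2 * (u * herm (l + 1) \<theta>)), \<lambda>\<theta>. t * herm (l + 3) \<theta>]) =
    vec_of [\<lambda>\<theta>. - t * (of_nat l * (of_nat (l + 2) * u) + 2 * (of_nat (l + 2) * (of_nat (l + 1) * u)) + of_nat (l + 3) * (of_nat (l + 2) * of_nat (l + 1))) * herm l \<theta>,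
      \<lambda>\<theta>. t * (of_nat l * u + 2 * (of_nat (l + 1) * u) + of_nat (l + 3) * of_nat (l + 1)) * herm (l + 2) \<theta>]"
  by (cases l; simp add: mat_simps herm_simps; simp add: fun_eq_iff algebra_simps eval_nat_numeral cnj_times_self_sqrt2)

text \<open>In each block the vector orthogonal to the kernel vector \<open>z1 (Suc l)\<close>, the
  squared norms of herm l and herm (l + 2) having ratio 1 : (l + 1)(l + 2). Case 0 is a bottom
  vector without partner in the first slot.\<close>

definition e1 :: "nat \<Rightarrow> svec" where
  "e1 n = (case n of 0 \<Rightarrow> vec_of [\<lambda>_. 0, herm 0] | Suc l \<Rightarrow> vec_of [\<lambda>\<theta>. of_nat (l + 2) * herm l \<theta>, \<lambda>\<theta>. - 1 * herm (l + 2) \<theta>])"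

lemma e1_eig: "Wad 1 (W 1 (e1 n)) = vec_scale (of_real (eig1 n)) (e1 n)"
proof (cases n)
  case 0
  show ?thesis unfolding 0 e1_def eig1_0 by (simp add: mat_simps herm_simps)
next
  case (Suc l)
  show ?thesis
    unfolding Suc e1_def nat.case W1_block Wad1_block eig1_Suc
    by (simp add: mat_simps) (simp add: fun_eq_iff algebra_simps power2_eq_square)
qed

text \<open>These are the images of \<open>herm n\<close> under \<open>W 0\<close>.\<close>

definition z1 :: "nat \<Rightarrow> svec" where
  "z1 n = (case n of 0 \<Rightarrow> vec_of [\<lambda>_. 0, herm 1] | Suc l \<Rightarrow> vec_of [\<lambda>\<theta>. of_nat (l + 1) * herm l \<theta>, \<lambda>\<theta>. 1 * herm (l + 2) \<theta>])"

lemma z1_ker: "W 1 (z1 n) = 0"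
proof (cases n)
  case 0
  show ?thesis unfolding 0 z1_def zero_vec_of(3) by (simp add: mat_simps herm_simps)
next
  case (Suc l)
  show ?thesis unfolding Suc z1_def nat.case W1_block zero_vec_of(3) by (simp add: vec_of_eq_iff fun_eq_iff)
qed

lemma W3_block: "W 3 (vec_of [\<lambda>\<theta>. of_nat l * (x * herm (l - 1) \<theta>), \<lambda>\<theta>. y * herm (l + 1) \<theta>, \<lambda>\<theta>. z * herm (l + 3) \<theta>]) =
    vec_of [\<lambda>\<theta>. of_nat (l + 2) * (of_nat l * x - s2 * of_nat (l + 1) * y + of_nat (l + 3) * of_nat (l + 1) * z) * herm l \<theta>,
         \<lambda>\<theta>. (of_nat l * x - s2 * of_nat (l + 1) * y + of_nat (l + 3) * of_nat (l + 1) * z) * herm (l + 2) \<theta>]"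
  by (cases l; simp add: mat_simps herm_simps; simp add: fun_eq_iff algebra_simps eval_nat_numeral cnj_times_self_sqrt2)

lemma Wad3_block: "Wad 3 (vec_of [\<lambda>\<theta>. x * herm l \<theta>, \<lambda>\<theta>. y * herm (l + 2) \<theta>]) =
    vec_of [\<lambda>\<theta>. of_nat l * (of_nat (l + 2) * (x + of_nat (l + 1) * y)) * herm (l - 1) \<theta>,
         \<lambda>\<theta>. - s2 * (of_nat (l + 2) * (x + of_nat (l + 1) * y)) * herm (l + 1) \<theta>,
         \<lambda>\<theta>. (x + of_nat (l + 1) * y) * herm (l + 3) \<theta>]"
  by (simp add: mat_simps herm_simps) (simp add: fun_eq_iff algebra_simps eval_nat_numeral)

text \<open>In every block the range of \<open>Wad 3\<close> is a line by \<open>Wad3_block\<close>,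
  and this vector spans it. Case 0 is the bottom vector, where only the third slot is
  occupied.\<close>

definition e3 :: "nat \<Rightarrow> svec" where
  "e3 n = (case n of 0 \<Rightarrow> vec_of [\<lambda>_. 0, \<lambda>_. 0, herm 1]
     | Suc l \<Rightarrow> vec_of [\<lambda>\<theta>. of_nat l * (of_nat (l + 2) * herm (l - 1) \<theta>), \<lambda>\<theta>. - (s2 * of_nat (l + 2)) * herm (l + 1) \<theta>, \<lambda>\<theta>. 1 * herm (l + 3) \<theta>])"

lemma e3_eig: "Wad 3 (W 3 (e3 n)) = vec_scale (of_real (eig1 n)) (e3 n)"
proof (cases n)
  case 0
  show ?thesis unfolding 0 e3_def eig1_0 by (simp add: mat_simps herm_simps)
next
  case (Suc l)
  show ?thesis
    unfolding Suc e3_def nat.case W3_block Wad3_block eig1_Suc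
    by (simp add: mat_simps) (simp add: fun_eq_iff algebra_simps power2_eq_square cnj_times_self_sqrt2)
qed

text \<open>Vectors supported on two neighbouring slots, together with those truncated at the
  bottom. They are not orthogonal to each other, but \<open>spectral\<close> asks only that they lie
  in the kernel and complete the family.\<close>

definition Z3 :: "svec set" where
  "Z3 = insert (vec_of [\<lambda>_. 0, \<lambda>_. 0, herm 0]) (insert (vec_of [\<lambda>_. 0, herm 0, \<lambda>_. 0])
    (range (\<lambda>m. vec_of [\<lambda>\<theta>. s2 * of_nat (m + 2) * herm m \<theta>, herm (m + 2), \<lambda>_. 0]) \<union>
     range (\<lambda>n. vec_of [\<lambda>_. 0, \<lambda>\<theta>. of_nat (n + 2) * herm n \<theta>, \<lambda>\<theta>. s2 * herm (n + 2) \<theta>])))"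

lemma Z3_ker: "z \<in> Z3 \<Longrightarrow> W 3 z = 0"
proof -
  have "W 3 (vec_of [\<lambda>\<theta>. s2 * of_nat (m + 2) * herm m \<theta>, herm (m + 2), \<lambda>_. 0]) = 0" for m
    unfolding zero_vec_of(2)
    by (simp add: mat_simps herm_simps) (simp add: fun_eq_iff algebra_simps eval_nat_numeral)
  moreover have "W 3 (vec_of [\<lambda>_. 0, \<lambda>\<theta>. of_nat (n + 2) * herm n \<theta>, \<lambda>\<theta>. s2 * herm (n + 2) \<theta>]) = 0" for n
    unfolding zero_vec_of(2)
    by (cases n; simp add: mat_simps herm_simps; simp add: fun_eq_iff algebra_simps eval_nat_numeral)
  moreover have "W 3 (vec_of [\<lambda>_. 0, herm 0, \<lambda>_. 0]) = 0" "W 3 (vec_of [\<lambda>_. 0, \<lambda>_. 0, herm 0]) = 0"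
    unfolding zero_vec_of(2) by (simp_all add: mat_simps herm_simps)
  ultimately show "z \<in> Z3 \<Longrightarrow> W 3 z = 0" unfolding Z3_def by auto
qed

text \<open>This is \<open>Wad 4\<close> applied to \<open>herm n\<close>. In the top degree
  \<open>W 4\<close> followed by \<open>Wad 4\<close> has its nonzero spectrum in common with the
  opposite composition, the harmonic oscillator.\<close>

definition e4 :: "nat \<Rightarrow> svec" where
  "e4 n = vec_of [\<lambda>\<theta>. - of_nat n * herm (n - 1) \<theta>, herm (n + 1)]"

lemma e4_eig: "Wad 4 (W 4 (e4 n)) = vec_scale (of_real (real (2 * n + 1))) (e4 n)"
  unfolding e4_def
  by (cases n; simp add: mat_simps herm_simps; simp add: fun_eq_iff algebra_simps)

definition Z4 :: "svec set" where
  "Z4 = insert (vec_of [\<lambda>_. 0, herm 0]) (range (\<lambda>m. vec_of [\<lambda>\<theta>. of_nat (m + 2) * herm m \<theta>, herm (m + 2)]))"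

lemma Z4_ker: "z \<in> Z4 \<Longrightarrow> W 4 z = 0"
proof -
  have "W 4 (vec_of [\<lambda>_. 0, herm 0]) = 0" "W 4 (vec_of [\<lambda>\<theta>. of_nat (m + 2) * herm m \<theta>, herm (m + 2)]) = 0" for m
    unfolding zero_vec_of(1) by (simp_all add: mat_simps herm_simps)
  then show "z \<in> Z4 \<Longrightarrow> W 4 z = 0" unfolding Z4_def by auto
qed

text \<open>The factor j (j - 1) comes from lowering \<open>herm j\<close> twice. It also removes
  the first slot for j < 2, where the truncated index j - 2 is meaningless, so one formula covers
  the blocks of dimension less than 3.\<close>

definition blk :: "nat \<Rightarrow> complex \<Rightarrow> complex \<Rightarrow> complex \<Rightarrow> svec" where
  "blk j x y z = vec_of [\<lambda>\<theta>. of_nat (j * (j - 1)) * x * herm (j - 2) \<theta>, \<lambda>\<theta>. y * herm j \<theta>, \<lambda>\<theta>. z * herm (j + 2) \<theta>]"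

lemma W2_blk: "W 2 (blk j x y z) =
   blk j (- of_nat j * x + s2 / 2 * y) (- (s2 / 2) * (of_nat (j * (j - 1)) * x) - 3 / 2 * y + s2 / 2 * of_nat (j + 2) * of_nat (j + 1) * z)
     (- (s2 / 2) * y + of_nat (j + 1) * z)"
proof -
  consider "j = 0" | "j = 1" | l where "j = Suc (Suc l)" by (metis One_nat_def not0_implies_Suc)
  then show ?thesis
    by cases (simp_all add: blk_def mat_simps herm_simps, simp_all add: fun_eq_iff field_simps eval_nat_numeral)
qed

lemma Wad2_blk: "Wad 2 (blk j x y z) =
   blk j (- of_nat j * x - s2 / 2 * y) (s2 / 2 * (of_nat (j * (j - 1)) * x) - 3 / 2 * y - s2 / 2 * of_nat (j + 2) * of_nat (j + 1) * z)
     (s2 / 2 * y + of_nat (j + 1) * z)"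
proof -
  consider "j = 0" | "j = 1" | l where "j = Suc (Suc l)" by (metis One_nat_def not0_implies_Suc)
  then show ?thesis
    by cases (simp_all add: blk_def mat_simps herm_simps, simp_all add: fun_eq_iff field_simps eval_nat_numeral)
qed

text \<open>With \<open>J = diag(1,-1,1)\<close>, \<open>J W 2\<close> is symmetric; \<open>v2 j lm\<close> is its eigenvector for a root \<open>lm\<close>
  of the characteristic polynomial of the block spanned by \<open>h\<^sub>j\<^sub>-\<^sub>2, h\<^sub>j, h\<^sub>j\<^sub>+\<^sub>2\<close>.\<close>

definition v2 :: "nat \<Rightarrow> complex \<Rightarrow> svec" where
  "v2 j lm = blk j (s2 / 2 * (of_nat j + 1 - lm)) ((of_nat j + lm) * (of_nat j + 1 - lm)) (s2 / 2 * (of_nat j + lm))"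

lemma blk_scale: "vec_scale c (blk j x y z) = blk j (c * x) (c * y) (c * z)"
  unfolding blk_def vec_scale_vec_of by (simp add: mult_ac)

lemma of_nat_pred: "of_nat (j * (j - 1)) = (of_nat j * (of_nat j - 1) :: complex)"
  by (cases j) (auto simp: algebra_simps)

text \<open>The first and third coordinates agree identically in lm; these two equations determine
  the vector up to scale. The middle one is the cubic characteristic equation.\<close>

lemma W2_v2:
  assumes "lm * (lm\<^sup>2 - 5 / 2 * lm + 1 / 2 - 2 * of_nat j * (of_nat j + 1)) = 0"
  shows "W 2 (v2 j lm) = vec_scale lm (blk j (s2 / 2 * (of_nat j + 1 - lm)) (- ((of_nat j + lm) * (of_nat j + 1 - lm))) (s2 / 2 * (of_nat j + lm)))"
proof -
  let ?n = "of_nat j :: complex" and ?x = "s2 / 2 * (of_nat j + 1 - lm)" and ?y = "(of_nat j + lm) * (of_nat j + 1 - lm)" and ?z = "s2 / 2 * (of_nat j + lm)"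
  have h: "s2 / 2 * (s2 / 2) = 1 / 2" using cnj_times_self_sqrt2(1) by simp
  have 1: "- ?n * ?x + s2 / 2 * ?y = lm * ?x" "- (s2 / 2) * ?y + of_nat (j + 1) * ?z = lm * ?z"
    by (simp_all add: field_simps)
  have "- (s2 / 2) * (of_nat (j * (j - 1)) * ?x) - 3 / 2 * ?y + s2 / 2 * of_nat (j + 2) * of_nat (j + 1) * ?z
     = - (s2 / 2 * (s2 / 2)) * (?n * (?n - 1) * (?n + 1 - lm)) - 3 / 2 * ?y + (s2 / 2 * (s2 / 2)) * ((?n + 2) * (?n + 1) * (?n + lm))"
    unfolding of_nat_pred by (simp add: mult_ac add.commute)
  also have "\<dots> = lm * (- ?y) - lm * (lm\<^sup>2 - 5 / 2 * lm + 1 / 2 - 2 * ?n * (?n + 1))"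
    unfolding h by (simp add: field_simps power2_eq_square)
  finally have 2: "- (s2 / 2) * (of_nat (j * (j - 1)) * ?x) - 3 / 2 * ?y + s2 / 2 * of_nat (j + 2) * of_nat (j + 1) * ?z = lm * (- ?y)"
    unfolding assms by simp
  show ?thesis unfolding v2_def W2_blk blk_scale 1 2 ..
qed

text \<open>On blocks \<open>Wad 2\<close> is J \<open>W 2\<close> J. Since \<open>W 2\<close> sends
  v to lm J v, applying both gives lm^2 v.\<close>

lemma v2_eig:
  assumes q: "lm * (lm\<^sup>2 - 5 / 2 * lm + 1 / 2 - 2 * of_nat j * (of_nat j + 1)) = 0"
  shows "Wad 2 (W 2 (v2 j lm)) = vec_scale (lm\<^sup>2) (v2 j lm)"
proof -
  let ?x = "s2 / 2 * (of_nat j + 1 - lm)" and ?y = "(of_nat j + lm) * (of_nat j + 1 - lm)" and ?z = "s2 / 2 * (of_nat j + lm)"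
  from W2_v2[OF q] have "blk j (- of_nat j * ?x + s2 / 2 * ?y) (- (s2 / 2) * (of_nat (j * (j - 1)) * ?x) - 3 / 2 * ?y + s2 / 2 * of_nat (j + 2) * of_nat (j + 1) * ?z)
     (- (s2 / 2) * ?y + of_nat (j + 1) * ?z) = blk j (lm * ?x) (lm * - ?y) (lm * ?z)"
    unfolding v2_def W2_blk blk_scale .
  \<comment> \<open>The middle coefficient can be read off because \<open>herm j\<close> is nonzero;
    the first one could be hidden by the factor j (j - 1).\<close>
  moreover have cancel: "b = b'" if "blk j a b c = blk j a' b' c'" for a b c a' b' c'
    using that herm_nz[of j] unfolding blk_def vec_of_eq_iff by (metis (no_types, lifting) mult_cancel_right)
  ultimately have m: "- (s2 / 2) * (of_nat (j * (j - 1)) * ?x) - 3 / 2 * ?y + s2 / 2 * of_nat (j + 2) * of_nat (j + 1) * ?z = lm * - ?y"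
    by blast
  have gen: "c * (m * (lm * x)) - 3 / 2 * (lm * - y) - c * k * k' * (lm * z) = - lm * (- c * (m * x) - 3 / 2 * y + c * k * k' * z)"
    for c m x y z k k' :: complex by (simp add: algebra_simps)
  have 1: "- of_nat j * (lm * ?x) - s2 / 2 * (lm * - ?y) = lm\<^sup>2 * ?x" "s2 / 2 * (lm * - ?y) + of_nat (j + 1) * (lm * ?z) = lm\<^sup>2 * ?z"
    by (simp_all add: field_simps power2_eq_square)
  have "s2 / 2 * (of_nat (j * (j - 1)) * (lm * ?x)) - 3 / 2 * (lm * - ?y) - s2 / 2 * of_nat (j + 2) * of_nat (j + 1) * (lm * ?z)
    = - lm * (- (s2 / 2) * (of_nat (j * (j - 1)) * ?x) - 3 / 2 * ?y + s2 / 2 * of_nat (j + 2) * of_nat (j + 1) * ?z)"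
    by (rule gen)
  also have "\<dots> = lm\<^sup>2 * ?y" unfolding m by (simp add: power2_eq_square)
  finally have 2: "s2 / 2 * (of_nat (j * (j - 1)) * (lm * ?x)) - 3 / 2 * (lm * - ?y) - s2 / 2 * of_nat (j + 2) * of_nat (j + 1) * (lm * ?z) = lm\<^sup>2 * ?y" .
  show ?thesis unfolding W2_v2[OF q] blk_scale Wad2_blk 1 2 unfolding v2_def blk_scale ..
qed

end

section \<open>Determinants in degrees 0, 1, 3 and 4\<close>

context rumin_metric
begin

lemma vec_ip_self_nz: "e \<in> smooth_vecs q \<Longrightarrow> e i \<theta> \<noteq> 0 \<Longrightarrow> vec_ip q e e \<noteq> 0"
  using vec_ip_self_0[of e q] by auto

lemma herm_nz_at: "\<exists>\<theta>. herm n \<theta> \<noteq> 0"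
  using herm_nz[of n] by (auto simp: fun_eq_iff)

lemma finite_bounded:
  fixes f :: "nat \<Rightarrow> real"
  assumes "\<And>n. real n \<le> f n" shows "finite {n. f n = x}"
proof (rule finite_subset)
  show "{n. f n = x} \<subseteq> {..nat \<lceil>x\<rceil>}"
  proof
    fix n assume "n \<in> {n. f n = x}"
    with assms[of n] have "real n \<le> x" by simp
    then show "n \<in> {..nat \<lceil>x\<rceil>}" by simp linarith
  qed
qed simp

lemma hc_ratio: "q \<le> 4 \<Longrightarrow> hc (Suc q) / hc q > 0"
  using hc_pos[of q] hc_pos[of "Suc q"] by simp

lemma of_nat_nz: "2 * of_nat l + 3 \<noteq> (0 :: complex)"
proof -
  have "2 * of_nat l + 3 = (of_nat (2 * l + 3) :: complex)" by simp
  then show ?thesis by (metis add_is_0 of_nat_eq_0_iff zero_neq_numeral)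
qed

lemma det_0: "(\<exists>Z. is_zeta g hb 0 Z) \<and> det_star g hb 0 = exp (- (- of_real (ln 2) / 4))"
proof (rule spectral[where e = "\<lambda>n. vec_of [herm n]" and \<mu> = "\<lambda>n. real (2 * n + 1)" and Zs = "{}"])
  show sm: "vec_of [herm n] \<in> smooth_vecs 0" for n by (rule vec_of_smooth) (auto simp: schwartz_herm)
  show "vec_ip 0 (vec_of [herm n]) (vec_of [herm n]) \<noteq> 0" for n
    by (simp add: vec_ip_vec_of1 vec_of_nth ip_herm gnorm_nz)
  show "vec_ip 0 (vec_of [herm n]) (vec_of [herm m]) = 0" if "n \<noteq> m" for n m
    using that by (simp add: vec_ip_vec_of1 vec_of_nth ip_herm)
  show "Wad 0 (W 0 (vec_of [herm n])) = vec_scale (complex_of_real (real (2 * n + 1))) (vec_of [herm n])" for n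
    by (rule e0_eig)
  show "finite {k. real (2 * k + 1) = x}" for x by (rule finite_bounded) simp
  show "\<phi> = 0" if "\<phi> \<in> smooth_vecs 0" "\<And>k. vec_ip 0 \<phi> (vec_of [herm k]) = 0" for \<phi>
    using that by (intro vec_herm_complete[of \<phi> 0]) (auto simp: vec_ip_vec_of1)
  show "zeta_data UNIV (\<lambda>k. hc (Suc 0) / hc 0 * real (2 * k + 1)) (- of_real (ln 2) / 4)"
    by (rule zeta_data_0[OF hc_ratio]) simp
qed auto

lemma det_1: "(\<exists>Z. is_zeta g hb 1 Z) \<and> det_star g hb 1 = exp (- (- (3 / 4) * of_real (ln 2) - of_real (ln sin_value) / 2))"
proof (rule spectral[where e = e1 and \<mu> = eig1 and Zs = "range z1"])
  show sm: "e1 n \<in> smooth_vecs 1" for n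
    unfolding e1_def by (cases n) (auto intro!: vec_of_smooth simp: herm_simps)
  show zm: "z \<in> smooth_vecs 1" if zr: "z \<in> range z1" for z
  proof -
    obtain n where "z = z1 n" using zr by blast
    then show ?thesis unfolding z1_def by (cases n) (auto intro!: vec_of_smooth simp: herm_simps)
  qed
  show "vec_ip 1 (e1 n) (e1 n) \<noteq> 0" for n
  proof -
    obtain \<theta> where "herm (if n = 0 then 0 else n + 1) \<theta> \<noteq> 0" using herm_nz_at by blast
    then show ?thesis by (intro vec_ip_self_nz[OF sm, of n 1 \<theta>]) (cases n; simp add: e1_def vec_of_nth vec_of_nth[unfolded One_nat_def])
  qed
  show "vec_ip 1 (e1 n) (e1 m) = 0" if "n \<noteq> m" for n m
    using that by (cases n; cases m) (auto simp: e1_def vec_ip_vec_of2 vec_of_nth vec_of_nth[unfolded One_nat_def] ip_cmult_left ip_cmult_right ip_minus_left ip_minus_right ip_herm)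
  show "Wad 1 (W 1 (e1 k)) = vec_scale (of_real (eig1 k)) (e1 k)" for k by (rule e1_eig)
  show "0 < eig1 k" for k by (rule eig1_pos)
  show "finite {k. eig1 k = x}" for x
  proof (rule finite_bounded)
    show "real n \<le> eig1 n" for n
    proof (cases n)
      case (Suc l)
      have "(2 * real l + 3) * 7 \<le> eig1 (Suc l)" unfolding eig1_Suc by (intro mult_left_mono) auto
      then show ?thesis using Suc by simp
    qed (simp add: eig1_0)
  qed
  show "W 1 z = 0" if "z \<in> range z1" for z using that z1_ker by blast
  show "\<phi> = 0" if \<phi>: "\<phi> \<in> smooth_vecs 1" and e: "\<And>k. vec_ip 1 \<phi> (e1 k) = 0" and z: "\<And>z. z \<in> range z1 \<Longrightarrow> vec_ip 1 \<phi> z = 0" for \<phi>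
  proof (rule vec_herm_complete[OF \<phi>])
    have z': "vec_ip 1 \<phi> (z1 k) = 0" for k using z by blast
    \<comment> \<open>Orthogonality to e1 and z1 is a 2 by 2 linear system in each block, with
      determinant 2 l + 3.\<close>
    have s: "ip (\<phi> 0) (herm l) = 0 \<and> ip (\<phi> 1) (herm (l + 2)) = 0" for l
    proof -
      have a: "of_nat (l + 2) * ip (\<phi> 0) (herm l) - ip (\<phi> 1) (herm (l + 2)) = 0"
        using e[of "Suc l"] by (simp add: e1_def vec_ip_vec_of2 ip_cmult_right ip_minus_right)
      have b: "of_nat (l + 1) * ip (\<phi> 0) (herm l) + ip (\<phi> 1) (herm (l + 2)) = 0"
        using z'[of "Suc l"] by (simp add: z1_def vec_ip_vec_of2 ip_cmult_right)
      have "(2 * of_nat l + 3) * ip (\<phi> 0) (herm l) = (of_nat (l + 2) * ip (\<phi> 0) (herm l) - ip (\<phi> 1) (herm (l + 2)))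
        + (of_nat (l + 1) * ip (\<phi> 0) (herm l) + ip (\<phi> 1) (herm (l + 2)))"
        by (simp add: algebra_simps)
      then have "ip (\<phi> 0) (herm l) = 0" unfolding a b using of_nat_nz by simp
      then show ?thesis using b by simp
    qed
    have s0: "ip (\<phi> 1) (herm 0) = 0" "ip (\<phi> 1) (herm 1) = 0"
      using e[of 0] z'[of 0] by (simp_all add: e1_def z1_def vec_ip_vec_of2)
    fix i n :: nat assume "i < coh_dim 1"
    then consider "i = 0" | "i = 1" "n = 0" | "i = 1" "n = 1" | l where "i = 1" "n = l + 2"
      using le_Suc_ex[of 2 n] by (auto simp: less_2_cases_iff add.commute) (metis One_nat_def add.commute less_2_cases_iff not_le_imp_less le_Suc_ex)
    then show "ip (\<phi> i) (herm n) = 0" by cases (use s s0 in auto)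
  qed
  show "zeta_data UNIV (\<lambda>k. hc (Suc 1) / hc 1 * eig1 k) (- (3 / 4) * of_real (ln 2) - of_real (ln sin_value) / 2)"
    using zeta_data_1[OF hc_ratio[of 1]] unfolding eig1_def by simp
qed auto

lemma det_4: "(\<exists>Z. is_zeta g hb 4 Z) \<and> det_star g hb 4 = exp (- (- of_real (ln 2) / 4))"
proof (rule spectral[where e = e4 and \<mu> = "\<lambda>n. real (2 * n + 1)" and Zs = Z4])
  show sm: "e4 n \<in> smooth_vecs 4" for n
    unfolding e4_def by (auto intro!: vec_of_smooth simp: herm_simps)
  show "vec_ip 4 (e4 n) (e4 n) \<noteq> 0" for n
  proof -
    obtain \<theta> where "herm (n + 1) \<theta> \<noteq> 0" using herm_nz_at by blast
    then show ?thesis by (intro vec_ip_self_nz[OF sm, of n 1 \<theta>]) (simp add: e4_def vec_of_nth[unfolded One_nat_def])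
  qed
  show "vec_ip 4 (e4 n) (e4 m) = 0" if "n \<noteq> m" for n m
    using that by (cases n; cases m) (auto simp: e4_def vec_ip_vec_of2 vec_of_nth vec_of_nth[unfolded One_nat_def] ip_cmult_left ip_cmult_right ip_minus_left ip_minus_right ip_herm)
  show "Wad 4 (W 4 (e4 k)) = vec_scale (of_real (real (2 * k + 1))) (e4 k)" for k by (rule e4_eig)
  show "finite {k. real (2 * k + 1) = x}" for x by (rule finite_bounded) simp
  show "z \<in> smooth_vecs 4" if "z \<in> Z4" for z
    using that unfolding Z4_def by (auto intro!: vec_of_smooth simp: herm_simps)
  show "W 4 z = 0" if "z \<in> Z4" for z using that by (rule Z4_ker)
  show "\<phi> = 0" if \<phi>: "\<phi> \<in> smooth_vecs 4" and e: "\<And>k. vec_ip 4 \<phi> (e4 k) = 0" and z: "\<And>z. z \<in> Z4 \<Longrightarrow> vec_ip 4 \<phi> z = 0" for \<phi>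
  proof (rule vec_herm_complete[OF \<phi>])
    have s: "ip (\<phi> 0) (herm l) = 0 \<and> ip (\<phi> 1) (herm (l + 2)) = 0" for l
    proof -
      have a: "ip (\<phi> 1) (herm (l + 2)) - of_nat (l + 1) * ip (\<phi> 0) (herm l) = 0"
      proof -
        have gen: "- n * A + B = 0 \<Longrightarrow> B - n * A = 0" for n A B :: complex by simp
        show ?thesis
          by (rule gen) (use e[of "Suc l"] in \<open>unfold e4_def vec_ip_vec_of2[OF disjI2[OF refl]] ip_cmult_right, simp\<close>)
      qed
      have "vec_of [\<lambda>\<theta>. of_nat (l + 2) * herm l \<theta>, herm (l + 2)] \<in> Z4" by (auto simp: Z4_def)
      from z[OF this] have b: "of_nat (l + 2) * ip (\<phi> 0) (herm l) + ip (\<phi> 1) (herm (l + 2)) = 0"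
        by (simp add: vec_ip_vec_of2 ip_cmult_right)
      have "(2 * of_nat l + 3) * ip (\<phi> 0) (herm l) = (of_nat (l + 2) * ip (\<phi> 0) (herm l) + ip (\<phi> 1) (herm (l + 2)))
        - (ip (\<phi> 1) (herm (l + 2)) - of_nat (l + 1) * ip (\<phi> 0) (herm l))"
        by (simp add: algebra_simps)
      then have "ip (\<phi> 0) (herm l) = 0" unfolding a b using of_nat_nz by simp
      then show ?thesis using b by simp
    qed
    have s0: "ip (\<phi> 1) (herm 0) = 0" "ip (\<phi> 1) (herm 1) = 0"
      using e[of 0] z[of "vec_of [\<lambda>_. 0, herm 0]"] by (simp_all add: e4_def Z4_def vec_ip_vec_of2)
    fix i n :: nat assume "i < coh_dim 4"
    then consider "i = 0" | "i = 1" "n = 0" | "i = 1" "n = 1" | l where "i = 1" "n = l + 2"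
      using le_Suc_ex[of 2 n] by (auto simp: less_2_cases_iff add.commute) (metis One_nat_def add.commute less_2_cases_iff not_le_imp_less le_Suc_ex)
    then show "ip (\<phi> i) (herm n) = 0" by cases (use s s0 in auto)
  qed
  show "zeta_data UNIV (\<lambda>k. hc (Suc 4) / hc 4 * real (2 * k + 1)) (- of_real (ln 2) / 4)"
    by (rule zeta_data_0[OF hc_ratio]) simp
qed auto

lemma det_3: "(\<exists>Z. is_zeta g hb 3 Z) \<and> det_star g hb 3 = exp (- (- (3 / 4) * of_real (ln 2) - of_real (ln sin_value) / 2))"
proof (rule spectral[where e = e3 and \<mu> = eig1 and Zs = Z3])
  show sm: "e3 n \<in> smooth_vecs 3" for n
    unfolding e3_def by (cases n) (auto intro!: vec_of_smooth simp: herm_simps)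
  show "vec_ip 3 (e3 n) (e3 n) \<noteq> 0" for n
  proof -
    obtain \<theta> where "herm (if n = 0 then 1 else n + 2) \<theta> \<noteq> 0" using herm_nz_at by blast
    then show ?thesis by (intro vec_ip_self_nz[OF sm, of n 2 \<theta>]) (cases n; simp add: e3_def vec_of_nth numeral_3_eq_3)
  qed
  show "vec_ip 3 (e3 n) (e3 m) = 0" if "n \<noteq> m" for n m
  proof -
    have pr: "of_nat a * of_nat b * ip (herm (a - 1)) (herm (b - 1)) = 0" if "a \<noteq> b" for a b :: nat
      using that by (cases a; cases b) (auto simp: ip_herm)
    show ?thesis
      using that by (cases n; cases m) (auto simp: e3_def vec_ip_vec_of3 vec_of_nth vec_of_nth[unfolded One_nat_def] ip_cmult_left ip_cmult_right ip_minus_left ip_minus_right ip_herm pr)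
  qed
  show "Wad 3 (W 3 (e3 k)) = vec_scale (of_real (eig1 k)) (e3 k)" for k by (rule e3_eig)
  show "0 < eig1 k" for k by (rule eig1_pos)
  show "finite {k. eig1 k = x}" for x
  proof (rule finite_bounded)
    show "real n \<le> eig1 n" for n
    proof (cases n)
      case (Suc l)
      have "(2 * real l + 3) * 7 \<le> eig1 (Suc l)" unfolding eig1_Suc by (intro mult_left_mono) auto
      then show ?thesis using Suc by simp
    qed (simp add: eig1_0)
  qed
  show "z \<in> smooth_vecs 3" if "z \<in> Z3" for z
    using that unfolding Z3_def by (auto intro!: vec_of_smooth simp: herm_simps)
  show "W 3 z = 0" if "z \<in> Z3" for z using that by (rule Z3_ker)
  show "\<phi> = 0" if \<phi>: "\<phi> \<in> smooth_vecs 3" and e: "\<And>k. vec_ip 3 \<phi> (e3 k) = 0" and z: "\<And>z. z \<in> Z3 \<Longrightarrow> vec_ip 3 \<phi> z = 0" for \<phi>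
  proof (rule vec_herm_complete[OF \<phi>])
    let ?A = "\<lambda>n. ip (\<phi> 0) (herm n)" and ?B = "\<lambda>n. ip (\<phi> 1) (herm n)" and ?C = "\<lambda>n. ip (\<phi> 2) (herm n)"
    have C0: "?C 0 = 0" "?B 0 = 0" using z[of "vec_of [\<lambda>_. 0, \<lambda>_. 0, herm 0]"] z[of "vec_of [\<lambda>_. 0, herm 0, \<lambda>_. 0]"]
      by (simp_all add: Z3_def vec_ip_vec_of3)
    have C1: "?C 1 = 0" using e[of 0] by (simp add: e3_def vec_ip_vec_of3)
    have k1: "s2 * of_nat (m + 2) * ?A m + ?B (m + 2) = 0" for m
    proof -
      have "vec_of [\<lambda>\<theta>. s2 * of_nat (m + 2) * herm m \<theta>, herm (m + 2), \<lambda>_. 0] \<in> Z3" by (auto simp: Z3_def)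
      from z[OF this] show ?thesis unfolding vec_ip_vec_of3[OF disjI2[OF refl]] ip_cmult_right by simp
    qed
    have k2: "of_nat (n + 2) * ?B n + s2 * ?C (n + 2) = 0" for n
    proof -
      have "vec_of [\<lambda>_. 0, \<lambda>\<theta>. of_nat (n + 2) * herm n \<theta>, \<lambda>\<theta>. s2 * herm (n + 2) \<theta>] \<in> Z3" by (auto simp: Z3_def)
      from z[OF this] show ?thesis unfolding vec_ip_vec_of3[OF disjI2[OF refl]] ip_cmult_right by simp
    qed
    have k3: "of_nat l * (of_nat (l + 2) * ?A (l - 1)) - s2 * of_nat (l + 2) * ?B (l + 1) + ?C (l + 3) = 0" for l
      using e[of "Suc l"] unfolding e3_def nat.case vec_ip_vec_of3[OF disjI2[OF refl]] ip_cmult_right by simp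
    \<comment> \<open>The kernel vectors express the outer coefficients by the middle one. Inserted
      into orthogonality to e3 they leave a strictly positive multiple of the middle
      coefficient.\<close>
    have B: "?B (l + 1) = 0" for l
    proof -
      have "of_nat l * (of_nat (l + 2) * ?A (l - 1)) = - (s2 / 2 * (of_nat l * (of_nat (l + 2) * ?B (l + 1)) / of_nat (l + 1)))"
      proof (cases l)
        case (Suc m)
        have gen: "A = - (s2 / 2 * (B / n))" if "s2 * n * A + B = 0" "n \<noteq> 0" for n A B :: complex
        proof -
          have "2 * n * A = s2 * (s2 * n * A + B) - s2 * B"
            by (simp add: distrib_left mult.assoc cnj_times_self_sqrt2)
          then have "2 * n * A = - (s2 * B)" unfolding that by simp
          moreover have "A = 2 * n * A / (2 * n)" using that(2) by simp
          ultimately show ?thesis by simp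
        qed
        have "of_nat (m + 2) \<noteq> (0 :: complex)" by (metis add_is_0 of_nat_eq_0_iff zero_neq_numeral)
        with k1[of m] have "?A m = - (s2 / 2 * (?B (m + 2) / of_nat (m + 2)))" by (rule gen)
        then show ?thesis using Suc by simp
      qed simp
      moreover have "?C (l + 3) = - (s2 / 2 * (of_nat (l + 3) * ?B (l + 1)))"
      proof -
        have gen: "C = - (s2 / 2 * Y)" if "Y + s2 * C = 0" for C Y :: complex
        proof -
          have "2 * C = s2 * (Y + s2 * C) - s2 * Y"
            by (simp add: distrib_left cnj_times_self_sqrt2)
          then have "2 * C = - (s2 * Y)" unfolding that by simp
          moreover have "C = 2 * C / 2" by simp
          ultimately show ?thesis by simp
        qed
        show ?thesis by (rule gen) (use k2[of "l + 1"] in \<open>simp add: numeral_3_eq_3\<close>)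
      qed
      ultimately have f1: "- (s2 / 2 * (of_nat l * (of_nat (l + 2) * ?B (l + 1)) / of_nat (l + 1))) - s2 * of_nat (l + 2) * ?B (l + 1) - s2 / 2 * (of_nat (l + 3) * ?B (l + 1)) = 0"
        using k3[of l] by simp
      have gen: "- (s / 2) * ((a * b / d + 2 * b + c) * B) = - (s / 2 * (a * (b * B) / d)) - s * b * B - s / 2 * (c * B)" for a b c d s B :: complex
        by (simp add: algebra_simps add_divide_distrib)
      have "- (s2 / 2) * ((of_nat l * of_nat (l + 2) / of_nat (l + 1) + 2 * of_nat (l + 2) + of_nat (l + 3)) * ?B (l + 1)) = 0"
        unfolding gen by (rule f1)
      then have *: "(of_nat l * of_nat (l + 2) / of_nat (l + 1) + 2 * of_nat (l + 2) + of_nat (l + 3)) * ?B (l + 1) = 0" by simp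
      have "real l * real (l + 2) / real (l + 1) + 2 * real (l + 2) + real (l + 3) > 0" by (intro add_nonneg_pos) auto
      then have "complex_of_real (real l * real (l + 2) / real (l + 1) + 2 * real (l + 2) + real (l + 3)) \<noteq> 0" by (metis less_irrefl of_real_eq_0_iff)
      moreover have "complex_of_real (real l * real (l + 2) / real (l + 1) + 2 * real (l + 2) + real (l + 3)) = of_nat l * of_nat (l + 2) / of_nat (l + 1) + 2 * of_nat (l + 2) + of_nat (l + 3)"
        by simp
      ultimately show ?thesis using * by simp
    qed
    have B': "?B n = 0" for n using C0 B[of "n - 1"] by (cases n) auto
    have A': "?A n = 0" for n
    proof -
      have "of_nat (n + 2) \<noteq> (0 :: complex)" by (metis add_is_0 of_nat_eq_0_iff zero_neq_numeral)
      then show ?thesis using k1[of n] B' by simp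
    qed
    have C': "?C n = 0" for n
    proof -
      consider "n = 0" | "n = 1" | l where "n = l + 2" by (metis One_nat_def add_2_eq_Suc' not0_implies_Suc)
      then show ?thesis using C0 C1 k2 B' by cases auto
    qed
    fix i n :: nat assume "i < coh_dim 3"
    then show "ip (\<phi> i) (herm n) = 0" using A' B' C' by (auto simp: less_3_iff)
  qed
  show "zeta_data UNIV (\<lambda>k. hc (Suc 3) / hc 3 * eig1 k) (- (3 / 4) * of_real (ln 2) - of_real (ln sin_value) / 2)"
    using zeta_data_1[OF hc_ratio[of 3]] unfolding eig1_def by simp
qed auto

end

section \<open>The determinant in degree 2\<close>

context rumin_metric
begin

text \<open>With the sign restored both values are roots of one quadratic, which lets
  \<open>v2\<close> be evaluated at them uniformly.\<close>

definition eig2_root :: "nat \<Rightarrow> bool \<Rightarrow> real" where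
  "eig2_root j b = (if b then 1 else - 1) * rumin_eig2 j b"

lemma eig2_root_quad: "eig2_root j b ^ 2 - 5 / 2 * eig2_root j b + 1 / 2 - 2 * real j * (real j + 1) = 0"
proof -
  let ?r = "sqrt (real (2 * j + 1) ^ 2 / 2 + 9 / 16)"
  have r: "?r ^ 2 = real (2 * j + 1) ^ 2 / 2 + 9 / 16" by (intro real_sqrt_pow2) simp
  have "eig2_root j b ^ 2 - 5 / 2 * eig2_root j b + 1 / 2 = ?r ^ 2 - 17 / 16"
  proof -
    have "(t + 5 / 4)\<^sup>2 - 5 / 2 * (t + 5 / 4) + 1 / 2 = t\<^sup>2 - 17 / 16" "(- (t - 5 / 4))\<^sup>2 - 5 / 2 * (- (t - 5 / 4)) + 1 / 2 = t\<^sup>2 - 17 / 16" for t :: real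
      by (simp_all add: power2_eq_square field_simps)
    then show ?thesis by (cases b) (simp_all add: eig2_root_def rumin_eig2_def)
  qed
  then show ?thesis unfolding r by (simp add: power2_eq_square field_simps)
qed

lemma eig2_root_cubic: "complex_of_real (eig2_root j b) * (of_real (eig2_root j b) ^ 2 - 5 / 2 * of_real (eig2_root j b) + 1 / 2 - 2 * of_nat j * (of_nat j + 1)) = 0"
proof -
  have "complex_of_real (eig2_root j b ^ 2 - 5 / 2 * eig2_root j b + 1 / 2 - 2 * real j * (real j + 1)) = 0" unfolding eig2_root_quad by simp
  then show ?thesis by simp
qed

lemma eig2_root_sq: "eig2_root j b ^ 2 = rumin_eig2 j b ^ 2"
  by (simp add: eig2_root_def power_mult_distrib)

lemma eig2_root_nz: "eig2_root j b \<noteq> 0"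
  using rumin_eig2_nz[of j b] by (simp add: eig2_root_def)

lemma rt_pos: "sqrt (real (2 * j + 1) ^ 2 / 2 + 9 / 16) > 0"
  by (intro real_sqrt_gt_zero add_nonneg_pos) auto

lemma eig2_root_distinct: "eig2_root j True \<noteq> eig2_root j False"
  using rt_pos[of j] by (simp add: eig2_root_def rumin_eig2_def)

lemma eig2_distinct: "rumin_eig2 j True ^ 2 \<noteq> rumin_eig2 j False ^ 2"
proof -
  define t where "t = sqrt (real (2 * j + 1) ^ 2 / 2 + 9 / 16)"
  have "(t + 5 / 4)\<^sup>2 - (t - 5 / 4)\<^sup>2 = 5 * t" by (simp add: power2_eq_square algebra_simps)
  then show ?thesis using rt_pos[of j] unfolding rumin_eig2_def t_def[symmetric] by simp
qed

lemma sqrt_81_16: "sqrt (81 / 16) = 9 / 4"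
  by (rule real_sqrt_unique) (simp_all add: power2_eq_square)

lemma eig2_root_1: "eig2_root 1 True = 7 / 2" "eig2_root 1 False = - 1"
  using sqrt_81_16 by (simp_all add: eig2_root_def rumin_eig2_def power2_eq_square)

text \<open>This ensures a nonzero third coordinate of \<open>v2\<close>. Inserting -j into the
  quadratic gives (2 j + 1)(j - 1) = 0, so j = 1 with root -1 is the only exception.\<close>

lemma eig2_root_plus: "\<not> (j = 1 \<and> \<not> b) \<Longrightarrow> real j + eig2_root j b \<noteq> 0"
proof
  assume nb: "\<not> (j = 1 \<and> \<not> b)" and "real j + eig2_root j b = 0"
  then have "eig2_root j b = - real j" by simp
  with eig2_root_quad[of j b] have "(2 * real j + 1) * (real j - 1) = 0" by (simp add: power2_eq_square algebra_simps)
  then have "j = 1" by auto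
  with nb \<open>eig2_root j b = - real j\<close> eig2_root_1 show False by (cases b) auto
qed

lemma real_le_rumin_eig2: "real j - 5 / 4 \<le> rumin_eig2 j b"
proof -
  have "real j \<le> sqrt (real (2 * j + 1) ^ 2 / 2 + 9 / 16)"
  proof (rule real_le_rsqrt)
    have "0 \<le> real j * real j" by simp
    then show "(real j)\<^sup>2 \<le> (real (2 * j + 1))\<^sup>2 / 2 + 9 / 16" by (simp add: power2_eq_square field_simps)
  qed
  then show ?thesis by (simp add: rumin_eig2_def)
qed

text \<open>For j = 1 and the root -1 all coordinates of \<open>v2\<close> vanish, the first through
  the factor j (j - 1). The eigenvector missing there is \<open>herm 0\<close> in the third slot,
  which lies in no block and happens to have the same eigenvalue 1, so the labelling by (j, b) stays
  complete.\<close>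

definition e2 :: "nat \<times> bool \<Rightarrow> svec" where
  "e2 k = (if k = (1, False) then vec_of [\<lambda>_. 0, \<lambda>_. 0, herm 0] else v2 (fst k) (of_real (eig2_root (fst k) (snd k))))"

lemma e2_v2: "k \<noteq> (1, False) \<Longrightarrow> e2 k = v2 (fst k) (of_real (eig2_root (fst k) (snd k)))"
  by (simp add: e2_def)

lemma e2_eig: "Wad 2 (W 2 (e2 k)) = vec_scale (of_real (case k of (j, b) \<Rightarrow> rumin_eig2 j b ^ 2)) (e2 k)"
proof (cases "k = (1, False)")
  case True
  have 1: "rumin_eig2 1 False ^ 2 = 1" using eig2_root_sq[of 1 False] eig2_root_1 by simp
  show ?thesis unfolding True prod.case 1 by (simp add: e2_def mat_simps herm_simps)
next
  case False
  obtain j b where k: "k = (j, b)" by fastforce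
  show ?thesis unfolding e2_v2[OF False] unfolding k prod.case eig2_root_sq[symmetric] fst_conv snd_conv of_real_power
    by (rule v2_eig[OF eig2_root_cubic])
qed

lemma blk_smooth: "blk j x y z \<in> smooth_vecs 2"
  unfolding blk_def by (auto intro!: vec_of_smooth simp: herm_simps)

lemma e2_smooth: "e2 k \<in> smooth_vecs 2"
  unfolding e2_def v2_def by (auto intro!: vec_of_smooth blk_smooth simp: herm_simps)

lemma vec_ip_blk: "vec_ip 2 \<phi> (blk j x y z) = of_nat (j * (j - 1)) * cnj x * ip (\<phi> 0) (herm (j - 2)) + cnj y * ip (\<phi> 1) (herm j) + cnj z * ip (\<phi> 2) (herm (j + 2))"
  unfolding blk_def vec_ip_vec_of3[OF disjI1[OF refl]] ip_cmult_right by simp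

lemma blk_orth:
  assumes "j \<noteq> j'" shows "vec_ip 2 (blk j x y z) (blk j' x' y' z') = 0"
proof -
  have 0: "of_nat (j' * (j' - 1)) * cnj x' * (of_nat (j * (j - 1)) * x * ip (herm (j - 2)) (herm (j' - 2))) = 0"
    using assms by (cases j; cases "j - 1"; cases j'; cases "j' - 1") (auto simp: ip_herm)
  have "blk j x y z 0 = (\<lambda>\<theta>. of_nat (j * (j - 1)) * x * herm (j - 2) \<theta>)" "blk j x y z 1 = (\<lambda>\<theta>. y * herm j \<theta>)"
    "blk j x y z 2 = (\<lambda>\<theta>. z * herm (j + 2) \<theta>)"
    by (simp_all add: blk_def vec_of_nth vec_of_nth[unfolded One_nat_def])
  then show ?thesis
    unfolding vec_ip_blk by (simp only: ip_cmult_left 0) (simp add: ip_herm assms)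
qed

text \<open>Within a block the two eigenvalues of a symmetric operator differ by
  \<open>eig2_distinct\<close>; different blocks involve different Hermite indices in each
  slot.\<close>

lemma e2_orth:
  assumes "k \<noteq> l" shows "vec_ip 2 (e2 k) (e2 l) = 0"
proof (cases "fst k = fst l")
  case True
  let ?m = "\<lambda>k. complex_of_real (case k of (j, b) \<Rightarrow> rumin_eig2 j b ^ 2)"
  have "rumin_eig2 (fst k) (snd k) ^ 2 \<noteq> rumin_eig2 (fst l) (snd l) ^ 2"
    using assms True eig2_distinct[of "fst k"] by (cases k; cases l; cases "snd k"; cases "snd l") auto
  then have ne: "?m k \<noteq> ?m l" by (simp only: of_real_eq_iff split_beta) simp
  have W: "vec_ip (Suc 2) (W 2 (e2 i)) (W 2 (e2 j)) = cnj (?m j) * vec_ip 2 (e2 i) (e2 j)" for i j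
  proof -
    have "vec_ip (Suc 2) (W 2 (e2 i)) (W 2 (e2 j)) = vec_ip 2 (e2 i) (Wad 2 (W 2 (e2 j)))"
      by (rule vec_ip_W) (use W_smooth[OF _ e2_smooth[of j]] e2_smooth in simp_all)
    then show ?thesis unfolding e2_eig vec_ip_scale_right .
  qed
  have "cnj (?m l) * vec_ip 2 (e2 k) (e2 l) = cnj (cnj (?m k) * vec_ip 2 (e2 l) (e2 k))"
    unfolding W[symmetric] vec_ip_cnj ..
  then have "?m l * vec_ip 2 (e2 k) (e2 l) = ?m k * vec_ip 2 (e2 k) (e2 l)"
    by (simp add: vec_ip_cnj)
  then show ?thesis using ne by simp
next
  case False
  have sp: "vec_ip 2 (vec_of [\<lambda>_. 0, \<lambda>_. 0, herm 0]) (blk j x y z) = 0" for j x y z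
    unfolding vec_ip_blk by (simp add: vec_of_nth vec_of_nth[unfolded One_nat_def] ip_herm)
  have sp': "vec_ip 2 (blk j x y z) (vec_of [\<lambda>_. 0, \<lambda>_. 0, herm 0]) = 0" for j x y z
    using sp[of j x y z] vec_ip_cnj by (metis complex_cnj_zero)
  show ?thesis using False unfolding e2_def v2_def by (auto simp: sp sp' blk_orth)
qed

text \<open>For totality in degree 2: the inner product with \<open>v2 j lm\<close> is a quadratic
  polynomial in lm, to be annihilated at 0 and at the two roots.\<close>

lemma quadratic_3_roots:
  fixes a b c :: complex
  assumes "a + b * x + c * x\<^sup>2 = 0" "a + b * y + c * y\<^sup>2 = 0" "a + b * z + c * z\<^sup>2 = 0" "x \<noteq> y" "y \<noteq> z" "x \<noteq> z"
  shows "a = 0 \<and> b = 0 \<and> c = 0"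
proof -
  have "(x - y) * (b + c * (x + y)) = (a + b * x + c * x\<^sup>2) - (a + b * y + c * y\<^sup>2)"
    by (simp add: algebra_simps power2_eq_square)
  then have 1: "b + c * (x + y) = 0" using assms by simp
  have "(x - z) * (b + c * (x + z)) = (a + b * x + c * x\<^sup>2) - (a + b * z + c * z\<^sup>2)"
    by (simp add: algebra_simps power2_eq_square)
  then have 2: "b + c * (x + z) = 0" using assms by simp
  have "c * (y - z) = (b + c * (x + y)) - (b + c * (x + z))" by (simp add: algebra_simps)
  then have "c = 0" unfolding 1 2 using assms by simp
  with 1 assms(1) show ?thesis by simp
qed

lemma det_2: "(\<exists>Z. is_zeta g hb 2 Z) \<and> det_star g hb 2 = exp (- (- of_real (ln 2) - of_real (ln sin_value)))"
proof (rule spectral[where e = e2 and \<mu> = "\<lambda>(j, b). rumin_eig2 j b ^ 2" and Zs = "insert (vec_of [\<lambda>_. 0, \<lambda>_. 0, herm 1]) (range (\<lambda>j. v2 j 0))"])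
  show "e2 k \<in> smooth_vecs 2" for k by (rule e2_smooth)
  show "vec_ip 2 (e2 k) (e2 k) \<noteq> 0" for k
  proof (cases "k = (1, False)")
    case True
    then show ?thesis by (simp add: e2_def vec_ip_vec_of3 vec_of_nth ip_herm gnorm_nz)
  next
    case False
    obtain j b where k: "k = (j, b)" by fastforce
    obtain \<theta> where "herm (j + 2) \<theta> \<noteq> 0" using herm_nz_at by blast
    moreover have "complex_of_real (real j + eig2_root j b) \<noteq> 0"
      using eig2_root_plus[of j b] False k by (metis (full_types) of_real_eq_0_iff)
    ultimately show ?thesis using False
      by (intro vec_ip_self_nz[OF e2_smooth, of k 2 \<theta>]) (unfold e2_v2[OF False], simp add: k v2_def blk_def vec_of_nth)
  qed
  show "vec_ip 2 (e2 k) (e2 l) = 0" if "k \<noteq> l" for k l using that by (rule e2_orth)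
  show "Wad 2 (W 2 (e2 k)) = vec_scale (of_real (case k of (j, b) \<Rightarrow> rumin_eig2 j b ^ 2)) (e2 k)" for k by (rule e2_eig)
  show "0 < (case k of (j, b) \<Rightarrow> rumin_eig2 j b ^ 2)" for k using rumin_eig2_nz by (cases k) simp
  show "finite {k. (case k of (j, b) \<Rightarrow> rumin_eig2 j b ^ 2) = x}" for x
  proof (rule finite_subset)
    have "j \<le> nat \<lceil>sqrt x + 5 / 4\<rceil>" if "rumin_eig2 j b ^ 2 = x" for j b
    proof -
      have "sqrt x = \<bar>rumin_eig2 j b\<bar>" unfolding that[symmetric] by simp
      then have "real j \<le> sqrt x + 5 / 4" using real_le_rumin_eig2[of j b] by linarith
      then show ?thesis by linarith
    qed
    then show "{k. (case k of (j, b) \<Rightarrow> rumin_eig2 j b ^ 2) = x} \<subseteq> {..nat \<lceil>sqrt x + 5 / 4\<rceil>} \<times> UNIV" by auto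
  qed simp
  show "z \<in> smooth_vecs 2" if "z \<in> insert (vec_of [\<lambda>_. 0, \<lambda>_. 0, herm 1]) (range (\<lambda>j. v2 j 0))" for z
    using that by (auto intro!: vec_of_smooth blk_smooth simp: herm_simps v2_def)
  show "W 2 z = 0" if z: "z \<in> insert (vec_of [\<lambda>_. 0, \<lambda>_. 0, herm 1]) (range (\<lambda>j. v2 j 0))" for z
  proof -
    have "W 2 (vec_of [\<lambda>_. 0, \<lambda>_. 0, herm 1]) = 0" unfolding zero_vec_of(3) by (simp add: mat_simps herm_simps)
    moreover have "W 2 (v2 j 0) = 0" for j by (subst W2_v2) (auto simp: vec_scale_def fun_eq_iff)
    ultimately show ?thesis using z by auto
  qed
  show "\<phi> = 0" if \<phi>: "\<phi> \<in> smooth_vecs 2" and e: "\<And>k. vec_ip 2 \<phi> (e2 k) = 0"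
    and z: "\<And>z. z \<in> insert (vec_of [\<lambda>_. 0, \<lambda>_. 0, herm 1]) (range (\<lambda>j. v2 j 0)) \<Longrightarrow> vec_ip 2 \<phi> z = 0" for \<phi>
  proof (rule vec_herm_complete[OF \<phi>])
    let ?A = "\<lambda>n. ip (\<phi> 0) (herm n)" and ?B = "\<lambda>n. ip (\<phi> 1) (herm n)" and ?C = "\<lambda>n. ip (\<phi> 2) (herm n)"
    have C01: "?C 0 = 0" "?C 1 = 0" using e[of "(1, False)"] z[of "vec_of [\<lambda>_. 0, \<lambda>_. 0, herm 1]"]
      by (simp_all add: e2_def vec_ip_vec_of3)
    have main: "of_nat (j * (j - 1)) * ?A (j - 2) = 0 \<and> ?B j = 0 \<and> ?C (j + 2) = 0" for j
    proof -
      let ?G = "s2 / 2 * (of_nat (j * (j - 1)) * ?A (j - 2))" and ?H = "s2 / 2 * ?C (j + 2)" and ?n = "of_nat j :: complex"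
      \<comment> \<open>Coefficients of 1, lm and lm^2 in the inner product with
        \<open>v2 j lm\<close>.\<close>
      define a where "a = ?G * (?n + 1) + ?n * (?n + 1) * ?B j + ?n * ?H"
      define b where "b = - ?G + ?B j + ?H"
      define c where "c = - ?B j"
      have P: "vec_ip 2 \<phi> (v2 j (of_real x)) = a + b * of_real x + c * (of_real x)\<^sup>2" for x
      proof -
        have gen: "N * (h * (n + 1 - y)) * A + ((n + y) * (n + 1 - y)) * B + (h * (n + y)) * C =
          (h * (N * A)) * (n + 1) + n * (n + 1) * B + n * (h * C) + (- (h * (N * A)) + B + h * C) * y + (- B) * y\<^sup>2"
          for N h n y A B C :: complex by (simp add: algebra_simps power2_eq_square)
        have "cnj (s2 / 2 * (?n + 1 - of_real x)) = s2 / 2 * (?n + 1 - of_real x)" "cnj ((?n + of_real x) * (?n + 1 - of_real x)) = (?n + of_real x) * (?n + 1 - of_real x)"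
          "cnj (s2 / 2 * (?n + of_real x)) = s2 / 2 * (?n + of_real x)" by simp_all
        then show ?thesis unfolding v2_def vec_ip_blk a_def b_def c_def by (simp only: gen)
      qed
      have 0: "a + b * of_real 0 + c * (of_real 0)\<^sup>2 = 0" using z[of "v2 j 0"] P[of 0] by simp
      have 1: "a + b * of_real (eig2_root j bb) + c * (of_real (eig2_root j bb))\<^sup>2 = 0" for bb
      proof (cases "(j, bb) = (1, False)")
        case True
        \<comment> \<open>For j = 1 the first slot drops out, and evaluation at -1 gives 0
          identically; this replaces the missing vector \<open>v2 1 (-1)\<close>.\<close>
        have "a - b + c = 0" using True by (simp add: a_def b_def c_def)
        then show ?thesis using True eig2_root_1 by simp
      next
        case False
        show ?thesis using e[of "(j, bb)"] unfolding P[symmetric] e2_v2[OF False] by simp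
      qed
      have abc: "a = 0 \<and> b = 0 \<and> c = 0"
        by (rule quadratic_3_roots[OF 0 1[of True] 1[of False]])
           (use eig2_root_nz[of j] eig2_root_distinct[of j] in \<open>simp_all only: of_real_eq_iff\<close>, metis+)
      have B: "?B j = 0" using abc c_def by simp
      have H: "?H = ?G" using abc B b_def by (simp add: add_eq_0_iff)
      have "(2 * ?n + 1) * ?G = a" 
      proof -
        have "(2 * n + 1) * G = G * (n + 1) + n * (n + 1) * 0 + n * G" for n G :: complex by (simp add: algebra_simps)
        then show ?thesis unfolding a_def H B .
      qed
      moreover have "2 * ?n + 1 \<noteq> 0"
      proof -
        have "2 * ?n + 1 = of_nat (2 * j + 1)" by simp
        then show ?thesis by (metis add_is_0 of_nat_eq_0_iff zero_neq_one)
      qed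
      ultimately have "?G = 0" using abc by simp
      then show ?thesis using H B by simp
    qed
    have A: "?A n = 0" for n
    proof -
      have "of_nat ((n + 2) * (n + 2 - 1)) * ?A n = 0" using main[of "n + 2"] by simp
      moreover have "of_nat ((n + 2) * (n + 2 - 1)) \<noteq> (0 :: complex)" by (subst of_nat_eq_0_iff) simp
      ultimately show ?thesis by simp
    qed
    have C: "?C n = 0" for n
    proof -
      consider "n = 0" | "n = 1" | l where "n = l + 2" by (metis One_nat_def add_2_eq_Suc' not0_implies_Suc)
      then show ?thesis using C01 main by cases auto
    qed
    fix i n :: nat assume "i < coh_dim 2"
    then show "ip (\<phi> i) (herm n) = 0" using A main C by (auto simp: less_3_iff)
  qed
  show "zeta_data UNIV (\<lambda>k. hc (Suc 2) / hc 2 * (case k of (j, b) \<Rightarrow> rumin_eig2 j b ^ 2)) (- of_real (ln 2) - of_real (ln sin_value))"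
  proof -
    have eq: "(\<lambda>k. c * (case k of (j, b) \<Rightarrow> rumin_eig2 j b ^ 2)) = (\<lambda>(j, b). c * rumin_eig2 j b ^ 2)" for c
      by (auto simp: fun_eq_iff)
    show ?thesis unfolding eq by (rule zeta_data_2[OF hc_ratio]) simp
  qed
qed auto

end

section \<open>Alternating forms and their inner products\<close>

definition multilin :: "nat \<Rightarrow> form \<Rightarrow> bool" where
  "multilin q \<omega> \<longleftrightarrow> (\<forall>xs ys. length xs + length ys + 1 = q \<longrightarrow> linear (\<lambda>v. \<omega> (xs @ v # ys)))"

lemma multilinD: "multilin q \<omega> \<Longrightarrow> length xs + length ys + 1 = q \<Longrightarrow> linear (\<lambda>v. \<omega> (xs @ v # ys))"
  by (simp add: multilin_def)

lemma forms_multilin: "\<omega> \<in> forms q \<Longrightarrow> multilin q \<omega>"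
  by (simp add: forms_def multilin_def)

lemma forms_not_distinct: "\<omega> \<in> forms q \<Longrightarrow> \<not> distinct vs \<Longrightarrow> \<omega> vs = 0"
  by (simp add: forms_def)

lemma forms_length: "\<omega> \<in> forms q \<Longrightarrow> length vs \<noteq> q \<Longrightarrow> \<omega> vs = 0"
  by (simp add: forms_def)

lemma sum_lists_Suc:
  fixes f :: "'a::finite list \<Rightarrow> 'b::comm_monoid_add"
  shows "(\<Sum>L | length L = Suc n. f L) = (\<Sum>l\<in>UNIV. \<Sum>L | length L = n. f (l # L))"
proof -
  have eq: "{L. length L = Suc n} = (\<lambda>(l, L). l # L) ` (UNIV \<times> {L. length L = n})"
    by (auto simp: length_Suc_conv image_iff)
  have inj: "inj_on (\<lambda>(l, L). l # L) (UNIV \<times> {L :: 'a list. length L = n})"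
    by (auto simp: inj_on_def)
  show ?thesis unfolding eq sum.reindex[OF inj] sum.cartesian_product by (simp add: split_beta)
qed

lemma prod_sum_lists:
  fixes h :: "nat \<Rightarrow> 'a::finite \<Rightarrow> 'b::comm_semiring_1"
  shows "(\<Prod>k<q. \<Sum>l\<in>UNIV. h k l) = (\<Sum>L | length L = q. \<Prod>k<q. h k (L ! k))"
proof (induction q arbitrary: h)
  case (Suc q)
  have "(\<Prod>k<Suc q. \<Sum>l\<in>UNIV. h k l) = (\<Sum>l\<in>UNIV. h 0 l) * (\<Sum>L | length L = q. \<Prod>k<q. h (Suc k) (L ! k))"
    unfolding prod.lessThan_Suc_shift Suc.IH ..
  also have "\<dots> = (\<Sum>l\<in>UNIV. \<Sum>L | length L = q. \<Prod>k<Suc q. h k ((l # L) ! k))"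
    unfolding sum_product prod.lessThan_Suc_shift by simp
  finally show ?case unfolding sum_lists_Suc .
qed simp

text \<open>The prefix xs holds the arguments already expanded; it lets the induction proceed
  through the list.\<close>

lemma multilin_expand:
  fixes Y :: "'a::finite \<Rightarrow> lie"
  assumes "multilin (length xs + length fs) \<omega>"
  shows "\<omega> (xs @ map (\<lambda>f. \<Sum>l\<in>UNIV. f l *\<^sub>R Y l) fs) =
    (\<Sum>L | length L = length fs. of_real (\<Prod>k<length fs. (fs ! k) (L ! k)) * \<omega> (xs @ map Y L))"
  using assms
proof (induction fs arbitrary: xs)
  case (Cons f fs)
  let ?ys = "map (\<lambda>f. \<Sum>l\<in>UNIV. f l *\<^sub>R Y l) fs"
  have lin: "linear (\<lambda>v. \<omega> (xs @ v # ?ys))" by (rule multilinD[OF Cons.prems]) simp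
  have "\<omega> (xs @ (\<Sum>l\<in>UNIV. f l *\<^sub>R Y l) # ?ys) = (\<Sum>l\<in>UNIV. of_real (f l) * \<omega> ((xs @ [Y l]) @ ?ys))"
    unfolding linear_sum[OF lin] linear_scale[OF lin] scaleR_conv_of_real[where 'a = complex] by simp
  also have "\<dots> = (\<Sum>l\<in>UNIV. of_real (f l) * (\<Sum>L | length L = length fs. of_real (\<Prod>k<length fs. (fs ! k) (L ! k)) * \<omega> ((xs @ [Y l]) @ map Y L)))"
    using Cons.prems by (subst Cons.IH) simp_all
  also have "\<dots> = (\<Sum>l\<in>UNIV. \<Sum>L | length L = length fs. of_real (\<Prod>k<length (f # fs). ((f # fs) ! k) ((l # L) ! k)) * \<omega> (xs @ map Y (l # L)))"
    unfolding sum_distrib_left length_Cons prod.lessThan_Suc_shift by (simp add: mult_ac)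
  finally show ?case unfolding length_Cons sum_lists_Suc by simp
qed simp

lemma multilin_update:
  assumes "multilin q \<omega>" "length vs = q" "a < q"
  shows "linear (\<lambda>v. \<omega> (vs[a := v]))"
proof -
  have "(\<lambda>v. \<omega> (vs[a := v])) = (\<lambda>v. \<omega> (take a vs @ v # drop (Suc a) vs))"
    using assms by (simp add: upd_conv_take_nth_drop)
  then show ?thesis using multilinD[OF assms(1), of "take a vs" "drop (Suc a) vs"] assms by simp
qed

text \<open>Polarisation: \<open>forms\<close> demands vanishing on lists with repetition, and
  inserting the sum of the two entries in both places yields antisymmetry.\<close>

lemma forms_swap:
  assumes \<omega>: "\<omega> \<in> forms q" and vs: "length vs = q" "a < q" "b < q" "a \<noteq> b"
  shows "\<omega> (vs[a := vs ! b, b := vs ! a]) = - \<omega> vs"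
proof -
  define B where "B u v = \<omega> (vs[a := u, b := v])" for u v
  have r: "linear (B u)" for u
    unfolding B_def by (rule multilin_update[OF forms_multilin[OF \<omega>]]) (use vs in auto)
  have l: "linear (\<lambda>u. B u v)" for v
    unfolding B_def list_update_swap[OF vs(4)] by (rule multilin_update[OF forms_multilin[OF \<omega>]]) (use vs in auto)
  have d: "B w w = 0" for w
  proof -
    have "vs[a := w, b := w] ! a = vs[a := w, b := w] ! b" using vs by simp
    then have "\<not> distinct (vs[a := w, b := w])" using vs by (metis nth_eq_iff_index_eq length_list_update)
    then show ?thesis unfolding B_def by (rule forms_not_distinct[OF \<omega>])
  qed
  have "B (vs ! a + vs ! b) (vs ! a + vs ! b) = B (vs ! b) (vs ! a) + B (vs ! a) (vs ! b)"
    by (simp only: linear_add[OF r] linear_add[OF l]) (simp add: d)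
  from trans[OF this[symmetric] d] have "B (vs ! b) (vs ! a) = - B (vs ! a) (vs ! b)"
    by (simp only: eq_neg_iff_add_eq_0)
  then show ?thesis unfolding B_def by simp
qed

lemma forms_permute:
  assumes \<omega>: "\<omega> \<in> forms q" and "length vs = q" and p: "p permutes {..<q}"
  shows "\<omega> (permute_list p vs) = of_int (sign p) * \<omega> vs"
  using p finite_lessThan assms(2)
proof (induction arbitrary: vs rule: permutes_induct)
  case (swap a b p)
  have eq: "permute_list (Transposition.transpose a b) vs = vs[a := vs ! b, b := vs ! a]"
    using swap by (intro nth_equalityI) (auto simp: permute_list_def nth_list_update Transposition.transpose_def)
  have "permutation p" using swap.hyps(4) permutation_permutes by blast
  then have s: "sign (Transposition.transpose a b \<circ> p) = - sign p"
    using swap.hyps(3) by (simp add: sign_compose permutation_swap_id sign_swap_id)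
  have "\<omega> (permute_list (Transposition.transpose a b \<circ> p) vs) = \<omega> (permute_list p (permute_list (Transposition.transpose a b) vs))"
    using swap by (subst permute_list_compose) auto
  also have "\<dots> = of_int (sign p) * - \<omega> vs"
    unfolding eq using swap by (simp add: forms_swap[OF \<omega>])
  also have "\<dots> = of_int (sign (Transposition.transpose a b \<circ> p)) * \<omega> vs" unfolding s by simp
  finally show ?case .
qed (simp add: sign_id)

text \<open>Wedges of general functionals, since \<open>codiff_exists\<close> expands a form in the coframe of an
  orthonormal basis and not in the forms \<open>chi J\<close>.\<close>

definition wedge :: "(lie \<Rightarrow> real) list \<Rightarrow> form" where
  "wedge fs vs = (if length vs = length fs
     then of_real (\<Sum>p | p permutes {..<length fs}. of_int (sign p) * (\<Prod>k<length fs. (fs ! k) (vs ! p k)))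
     else 0)"

lemma chi_wedge: "chi J = wedge (map (\<lambda>j v. v $ j) J)"
  by (auto simp: chi_def wedge_def fun_eq_iff)

lemma wedge_multilin:
  assumes "\<And>f. f \<in> set fs \<Longrightarrow> linear f"
  shows "multilin (length fs) (wedge fs)"
  unfolding multilin_def
proof (intro allI impI)
  fix xs ys :: "lie list" assume l: "length xs + length ys + 1 = length fs"
  let ?m = "length xs" and ?q = "length fs"
  have "linear (\<lambda>v. \<Prod>k<?q. (fs ! k) ((xs @ v # ys) ! p k))" if p: "p permutes {..<?q}" for p
  proof -
    have "?m \<in> p ` {..<?q}" using permutes_image[OF p] l by simp
    \<comment> \<open>Exactly one factor of each product, the one with p k equal to the position of
      v, depends on v.\<close>
    then obtain k where k: "k < ?q" "p k = ?m" by auto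
    have a: "(\<Prod>k\<in>{..<?q} - {k}. (fs ! k) ((xs @ v # ys) ! p k)) = (\<Prod>k\<in>{..<?q} - {k}. (fs ! k) ((xs @ 0 # ys) ! p k))" for v
    proof (rule prod.cong)
      fix i assume "i \<in> {..<?q} - {k}"
      then have "p i \<noteq> ?m" using k permutes_inj[OF p] by (metis DiffD2 injD insertI1)
      then show "(fs ! i) ((xs @ v # ys) ! p i) = (fs ! i) ((xs @ 0 # ys) ! p i)" by (simp add: nth_append nth_Cons')
    qed simp
    have b: "(\<Prod>k<?q. (fs ! k) ((xs @ v # ys) ! p k)) = (fs ! k) v * (\<Prod>k\<in>{..<?q} - {k}. (fs ! k) ((xs @ v # ys) ! p k))" for v
      using k by (subst prod.remove[of "{..<?q}" k]) simp_all
    have "(\<lambda>v. \<Prod>k<?q. (fs ! k) ((xs @ v # ys) ! p k)) = (\<lambda>v. (fs ! k) v * (\<Prod>k\<in>{..<?q} - {k}. (fs ! k) ((xs @ 0 # ys) ! p k)))"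
    proof
      fix v show "(\<Prod>k<?q. (fs ! k) ((xs @ v # ys) ! p k)) = (fs ! k) v * (\<Prod>k\<in>{..<?q} - {k}. (fs ! k) ((xs @ 0 # ys) ! p k))"
        using b[of v] a[of v] by (simp only:)
    qed
    moreover have "linear (fs ! k)" using assms k by simp
    ultimately show ?thesis by (auto simp: linear_iff algebra_simps)
  qed
  then have "linear (\<lambda>v. \<Sum>p | p permutes {..<?q}. of_int (sign p) * (\<Prod>k<?q. (fs ! k) ((xs @ v # ys) ! p k)))"
    by (intro linear_compose_sum) (auto simp: linear_iff algebra_simps)
  then have "linear (\<lambda>v. complex_of_real (\<Sum>p | p permutes {..<?q}. of_int (sign p) * (\<Prod>k<?q. (fs ! k) ((xs @ v # ys) ! p k))))"
    by (rule linear_compose[OF _ bounded_linear.linear[OF bounded_linear_of_real], unfolded o_def])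
  then show "linear (\<lambda>v. wedge fs (xs @ v # ys))" using l by (simp add: wedge_def)
qed

lemma wedge_not_distinct:
  assumes "\<not> distinct vs" shows "wedge fs vs = 0"
proof (cases "length vs = length fs")
  case True
  obtain a b where ab: "a < length fs" "b < length fs" "a \<noteq> b" "vs ! a = vs ! b"
    using assms True by (auto simp: distinct_conv_nth)
  let ?q = "length fs" and ?t = "Transposition.transpose a b"
  let ?f = "\<lambda>p. of_int (sign p) * (\<Prod>k<?q. (fs ! k) (vs ! p k)) :: real"
  have t: "?t permutes {..<?q}" using ab by (intro permutes_swap_id) auto
  have "(\<Sum>p | p permutes {..<?q}. ?f p) = (\<Sum>p | p permutes {..<?q}. ?f (?t \<circ> p))"
    by (rule setum_permutations_compose_left[OF t])
  also have "\<dots> = (\<Sum>p | p permutes {..<?q}. - ?f p)"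
  proof (intro sum.cong refl)
    fix p assume "p \<in> {p. p permutes {..<?q}}"
    then have "permutation p" using permutation_permutes by blast
    then have "sign (?t \<circ> p) = - sign p"
      using ab by (simp add: sign_compose permutation_swap_id sign_swap_id)
    moreover have "vs ! (?t \<circ> p) k = vs ! p k" for k using ab(4) by (auto simp: Transposition.transpose_def)
    ultimately show "?f (?t \<circ> p) = - ?f p" by simp
  qed
  finally have "(\<Sum>p | p permutes {..<?q}. ?f p) = 0" by (simp add: sum_negf)
  then show ?thesis by (simp add: wedge_def)
qed (simp add: wedge_def)

lemma wedge_forms: "(\<And>f. f \<in> set fs \<Longrightarrow> linear f) \<Longrightarrow> wedge fs \<in> forms (length fs)"
  using wedge_multilin[of fs] wedge_not_distinct by (auto simp: forms_def multilin_def wedge_def)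

lemma linear_component: "linear (\<lambda>v :: lie. v $ j)"
  by (simp add: linear_iff)

lemma chi_forms: "chi J \<in> forms (length J)"
  unfolding chi_wedge using wedge_forms[of "map (\<lambda>j v. v $ j) J"] linear_component by auto

section \<open>The differential preserves alternating forms\<close>

lemma bracket_add_left: "bracket (u + u') v = bracket u v + bracket u' v"
  and bracket_add_right: "bracket u (v + v') = bracket u v + bracket u v'"
  and bracket_scale_left: "bracket (c *\<^sub>R u) v = c *\<^sub>R bracket u v"
  and bracket_scale_right: "bracket u (c *\<^sub>R v) = c *\<^sub>R bracket u v"
  and bracket_self: "bracket u u = 0"
  by (simp_all add: bracket_def algebra_simps)

lemma linear_bracket: "linear (\<lambda>v. bracket v u)" "linear (bracket u)"
  by (simp_all add: linear_iff bracket_add_left bracket_add_right bracket_scale_left bracket_scale_right)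

lemma nths_cong:
  "(\<And>i. i < length xs \<Longrightarrow> i \<in> A \<longleftrightarrow> i \<in> B) \<Longrightarrow> nths xs A = nths xs B"
proof (induction xs arbitrary: A B)
  case (Cons x xs)
  have "nths xs {j. Suc j \<in> A} = nths xs {j. Suc j \<in> B}" by (rule Cons.IH) (use Cons.prems in auto)
  moreover have "0 \<in> A \<longleftrightarrow> 0 \<in> B" using Cons.prems[of 0] by simp
  ultimately show ?case by (simp add: nths_Cons)
qed simp

lemma nths_insert: "nths (xs @ v # ys) A =
    nths xs A @ (if length xs \<in> A then [v] else []) @ nths ys {j. Suc (j + length xs) \<in> A}"
  by (simp add: nths_append nths_Cons)

lemma length_nths_remove2:
  assumes "i < j" "j < length vs" shows "length (nths vs (- {i, j})) = length vs - 2"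
proof -
  have eq: "{k. k < length vs \<and> k \<in> - {i, j}} = {..<length vs} - {i, j}" by auto
  show ?thesis unfolding length_nths eq using assms by (subst card_Diff_subset) auto
qed

lemma ce_diff_length: "\<omega> \<in> forms q \<Longrightarrow> length vs \<noteq> Suc q \<Longrightarrow> ce_diff \<omega> vs = 0"
  unfolding ce_diff_def by (intro sum.neutral ballI) (auto simp: forms_length length_nths_remove2)

lemma multilin_ce_diff:
  assumes "multilin q \<omega>" shows "multilin (Suc q) (ce_diff \<omega>)"
  unfolding multilin_def
proof (intro allI impI)
  fix xs ys :: "lie list" assume l: "length xs + length ys + 1 = Suc q"
  let ?m = "length xs" and ?vs = "\<lambda>v. xs @ v # ys"
  have "linear (\<lambda>v. \<omega> (bracket (?vs v ! i) (?vs v ! j) # nths (?vs v) (- {i, j})))" if ij: "i < j" "j < Suc q" for i j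
  proof -
    let ?P = "nths xs (- {i, j})" and ?Q = "nths ys {k. Suc (k + ?m) \<in> - {i, j}}"
    have len: "length (nths (?vs 0) (- {i, j})) = q - 1" using ij l by (subst length_nths_remove2) auto
    have nth: "?vs v ! k = ?vs 0 ! k" if "k \<noteq> ?m" for v k using that by (simp add: nth_append nth_Cons')
    show ?thesis
    \<comment> \<open>The varying vector enters either through the bracket or through the tail, and
      in both cases linearly.\<close>
    proof (cases "?m \<in> {i, j}")
      case True
      have "nths (?vs v) (- {i, j}) = ?P @ ?Q" for v using True unfolding nths_insert by auto
      moreover from this len have "linear (\<lambda>w. \<omega> ([] @ w # (?P @ ?Q)))" using ij by (intro multilinD[OF assms]) auto
      moreover have "linear (\<lambda>v. bracket (?vs v ! i) (?vs v ! j))"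
      proof (cases "?m = i")
        case True
        then have "(\<lambda>v. bracket (?vs v ! i) (?vs v ! j)) = (\<lambda>v. bracket v (?vs 0 ! j))"
          using nth[of j] ij by (intro ext) (metis nth_append_length less_irrefl)
        then show ?thesis using linear_bracket by simp
      next
        case False
        then have "(\<lambda>v. bracket (?vs v ! i) (?vs v ! j)) = (\<lambda>v. bracket (?vs 0 ! i) v)"
          using nth[of i] True by (simp add: fun_eq_iff) (metis nth_append_length)
        then show ?thesis using linear_bracket by simp
      qed
      ultimately show ?thesis using linear_compose[of "\<lambda>v. bracket (?vs v ! i) (?vs v ! j)" "\<lambda>w. \<omega> ([] @ w # (?P @ ?Q))"] by (simp add: o_def)
    next
      case False
      define c where "c = bracket (?vs 0 ! i) (?vs 0 ! j)"
      have "nths (?vs v) (- {i, j}) = ?P @ v # ?Q" for v using False unfolding nths_insert by auto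
      moreover from this len have "linear (\<lambda>v. \<omega> ((c # ?P) @ v # ?Q))" using ij by (intro multilinD[OF assms]) auto
      moreover have "bracket (?vs v ! i) (?vs v ! j) = c" for v
        unfolding c_def using nth[of i v] nth[of j v] False by simp
      ultimately show ?thesis by simp
    qed
  qed
  then have "linear (\<lambda>v. (-1) ^ (i + j) * \<omega> (bracket (?vs v ! i) (?vs v ! j) # nths (?vs v) (- {i, j})))" if "i < j" "j < Suc q" for i j
    using that by (simp add: linear_iff algebra_simps)
  then have "linear (\<lambda>v. \<Sum>j<Suc q. \<Sum>i<j. (-1) ^ (i + j) * \<omega> (bracket (?vs v ! i) (?vs v ! j) # nths (?vs v) (- {i, j})))"
    by (intro linear_compose_sum ballI) auto
  moreover have "length (?vs v) = Suc q" for v using l by simp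
  ultimately show "linear (\<lambda>v. ce_diff \<omega> (?vs v))" unfolding ce_diff_def by (simp only:)
qed

text \<open>Vanishing on adjacent equal arguments implies antisymmetry under adjacent exchanges, and
  these bring any repeated entry next to its copy.\<close>

lemma formsI:
  assumes len: "\<And>vs. length vs \<noteq> q \<Longrightarrow> \<omega> vs = 0" and lin: "multilin q \<omega>"
    and adj: "\<And>xs u ys. length xs + length ys + 2 = q \<Longrightarrow> \<omega> (xs @ u # u # ys) = 0"
  shows "\<omega> \<in> forms q"
proof -
  have swap: "\<omega> (xs @ u # y # zs) = - \<omega> (xs @ y # u # zs)" if "length xs + length zs + 2 = q" for xs u y zs
  proof -
    have l: "linear (\<lambda>v. \<omega> (xs @ v # w # zs))" for w using multilinD[OF lin, of xs "w # zs"] that by simp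
    have r: "linear (\<lambda>v. \<omega> (xs @ w # v # zs))" for w using multilinD[OF lin, of "xs @ [w]" zs] that by simp
    have "\<omega> (xs @ (u + y) # (u + y) # zs) = \<omega> (xs @ u # y # zs) + \<omega> (xs @ y # u # zs)"
      unfolding linear_add[OF l] linear_add[OF r] using adj that by simp
    then show ?thesis using adj that by (simp add: eq_neg_iff_add_eq_0)
  qed
  have rep: "\<omega> (xs @ u # ys @ u # zs) = 0" if "length xs + length ys + length zs + 2 = q" for xs u ys zs
    using that
  proof (induction ys arbitrary: xs)
    case (Cons y ys)
    have "\<omega> (xs @ u # y # (ys @ u # zs)) = - \<omega> ((xs @ [y]) @ u # ys @ u # zs)"
      using swap[of xs "ys @ u # zs" u y] Cons.prems by simp
    also have "\<dots> = 0" using Cons.prems by (subst Cons.IH) simp_all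
    finally show ?case by simp
  qed (use adj in simp)
  have "\<omega> vs = 0" if nd: "\<not> distinct vs" for vs
  proof (cases "length vs = q")
    case True
    obtain xs u ys zs where "vs = xs @ [u] @ ys @ [u] @ zs" using not_distinct_decomp[OF nd] by blast
    then show ?thesis using rep[of xs ys zs u] True by simp
  qed (rule len)
  then show ?thesis using len lin by (auto simp: forms_def multilin_def)
qed

text \<open>If \<open>v\<^sub>m = v\<^sub>m\<^sub>+\<^sub>1\<close>, exchanging \<open>m\<close> and \<open>m + 1\<close> in the summation index changes the sign of every
  term of \<open>\<partial>\<omega>\<close>.\<close>

lemma ce_diff_adjacent:
  assumes \<omega>: "\<omega> \<in> forms q" and l: "length xs + length ys + 2 = Suc q"
  shows "ce_diff \<omega> (xs @ u # u # ys) = 0"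
proof -
  define vs where "vs = xs @ u # u # ys"
  let ?m = "length xs" and ?n = "length vs"
  define t where "t = (\<lambda>(i, j). (-1) ^ (i + j) * \<omega> (bracket (vs ! i) (vs ! j) # nths vs (- {i, j})))"
  define S where "S = Sigma {..<?n} (\<lambda>j. {..<j})"
  let ?tr = "Transposition.transpose ?m (Suc ?m)"
  \<comment> \<open>The pair of the two equal positions is kept fixed, as exchanging them would
    violate i < j; its term is zero because the bracket is [u, u].\<close>
  define \<phi> where "\<phi> = (\<lambda>(j, i). if j = Suc ?m \<and> i = ?m then (j, i) else (?tr j, ?tr i))"
  have n: "?n = Suc q" using l by (simp add: vs_def)
  have d: "ce_diff \<omega> vs = (\<Sum>(j, i)\<in>S. t (i, j))"
    unfolding ce_diff_def S_def t_def by (simp add: sum.Sigma)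
  have tr: "?tr k = (if k = ?m then Suc ?m else if k = Suc ?m then ?m else k)" for k
    by (simp add: Transposition.transpose_def)
  have "bij_betw \<phi> S S"
  proof (rule bij_betw_byWitness[where f' = \<phi>])
    show "\<forall>a\<in>S. \<phi> (\<phi> a) = a" by (auto simp: \<phi>_def S_def tr split: if_splits)
    then show "\<forall>a\<in>S. \<phi> (\<phi> a) = a" .
    show "\<phi> ` S \<subseteq> S" by (auto simp: \<phi>_def S_def tr vs_def split: if_splits)
    then show "\<phi> ` S \<subseteq> S" .
  qed
  then have "(\<Sum>(j, i)\<in>S. t (i, j)) = (\<Sum>x\<in>S. case \<phi> x of (j, i) \<Rightarrow> t (i, j))"
    by (rule sum.reindex_bij_betw[symmetric])
  also have "\<dots> = (\<Sum>x\<in>S. - (case x of (j, i) \<Rightarrow> t (i, j)))"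
  proof (intro sum.cong refl)
    fix x assume "x \<in> S"
    then obtain i j where x: "x = (j, i)" "i < j" "j < ?n" by (auto simp: S_def)
    have same: "vs ! Suc ?m = vs ! ?m" by (simp add: vs_def nth_append)
    have vtr: "vs ! ?tr k = vs ! k" for k using same by (auto simp: tr)
    show "(case \<phi> x of (j, i) \<Rightarrow> t (i, j)) = - (case x of (j, i) \<Rightarrow> t (i, j))"
    proof (cases "j = Suc ?m \<and> i = ?m")
      case True
      have "linear (\<lambda>v. \<omega> ([] @ v # nths vs (- {i, j})))"
        using x n by (intro multilinD[OF forms_multilin[OF \<omega>]]) (simp add: length_nths_remove2)
      from linear_0[OF this] have "t (i, j) = 0" unfolding t_def using True same by (simp add: bracket_self)
      then show ?thesis using True by (simp add: \<phi>_def x)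
    next
      case F: False
      show ?thesis
      proof (cases "?m \<in> {i, j} \<or> Suc ?m \<in> {i, j}")
        case False
        have "\<not> distinct (nths vs (- {i, j}))"
          using False unfolding vs_def nths_insert by (auto simp: nths_Cons)
        then have "t (i, j) = 0" unfolding t_def by (simp add: forms_not_distinct[OF \<omega>])
        moreover have "\<phi> x = x" using False by (auto simp: \<phi>_def x tr)
        ultimately show ?thesis by (simp add: x)
      next
        case True
        have "nths vs (- {?tr i, ?tr j}) = nths vs (- {i, j})"
        proof -
          have "nths xs (- {?tr i, ?tr j}) = nths xs (- {i, j})" by (rule nths_cong) (auto simp: tr)
          moreover have "nths ys {k. Suc (Suc (k + ?m)) \<in> - {?tr i, ?tr j}} = nths ys {k. Suc (Suc (k + ?m)) \<in> - {i, j}}"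
            by (rule nths_cong) (auto simp: tr)
          ultimately show ?thesis using True F x(2) unfolding vs_def nths_insert by (auto simp: nths_Cons tr)
        qed
        moreover have "(-1) ^ (?tr i + ?tr j) = - ((-1) ^ (i + j) :: complex)"
          using True F x(2) by (auto simp: tr)
        moreover have "\<phi> x = (?tr j, ?tr i)" using F by (auto simp: \<phi>_def x)
        ultimately show ?thesis by (simp add: x t_def vtr)
      qed
    qed
  qed
  finally show ?thesis unfolding vs_def[symmetric] d by (simp add: sum_negf split_beta)
qed

lemma ce_diff_forms: "\<omega> \<in> forms q \<Longrightarrow> ce_diff \<omega> \<in> forms (Suc q)"
  by (rule formsI) (auto simp: ce_diff_length ce_diff_adjacent multilin_ce_diff forms_multilin)

section \<open>Inner products of forms in an orthonormal frame\<close>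

lemma linear_cmult: "linear f \<Longrightarrow> linear (\<lambda>v. k * f v)" for f :: "'a::real_vector \<Rightarrow> complex"
  by (auto simp: linear_iff distrib_left)

text \<open>In the application Y is a g-orthonormal basis and \<open>c l v\<close> is
  \<open>g v (Y l)\<close>. The last condition says that the inverse Gram matrix is the sum of the Y
  l times their transposes.\<close>

locale coframe =
  fixes g :: "lie \<Rightarrow> lie \<Rightarrow> real" and Y :: "5 \<Rightarrow> lie" and c :: "5 \<Rightarrow> lie \<Rightarrow> real"
  assumes linear_c: "linear (c l)"
    and expand_c: "v = (\<Sum>l\<in>UNIV. c l v *\<^sub>R Y l)"
    and c_Y: "c l (Y m) = c m (Y l)"
    and dual_gram_Y: "dual_gram g $ i $ j = (\<Sum>l\<in>UNIV. Y l $ i * Y l $ j)"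
begin

definition sharp :: "(lie \<Rightarrow> real) \<Rightarrow> lie" where
  "sharp f = (\<Sum>l\<in>UNIV. f (Y l) *\<^sub>R Y l)"

lemma X_expand: "v = (\<Sum>i\<in>UNIV. (v $ i) *\<^sub>R X i)" for v :: lie
  using basis_expansion[of v] unfolding X_def scalar_mult_eq_scaleR by simp

lemma sharp_c: "sharp (c l) = Y l"
  unfolding sharp_def c_Y[of l] by (rule expand_c[symmetric])

lemma map_X_expand:
  assumes "multilin q \<omega>" "length L = q"
  shows "\<omega> (map Y L) = (\<Sum>I | length I = q. of_real (\<Prod>k<q. Y (L ! k) $ (I ! k)) * \<omega> (map X I))"
proof -
  let ?fs = "map (\<lambda>l i. Y l $ i) L"
  have A: "\<omega> (map (\<lambda>f. \<Sum>i\<in>UNIV. f i *\<^sub>R X i) ?fs) = (\<Sum>I | length I = q. of_real (\<Prod>k<q. (?fs ! k) (I ! k)) * \<omega> (map X I))"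
    using multilin_expand[of "[]" ?fs \<omega> X] assms by simp
  have B: "map (\<lambda>f. \<Sum>i\<in>UNIV. f i *\<^sub>R X i) ?fs = map Y L"
    by (simp add: o_def X_expand[symmetric])
  have C: "(\<Prod>k<q. (?fs ! k) (I ! k)) = (\<Prod>k<q. Y (L ! k) $ (I ! k))" for I
    using assms by simp
  show ?thesis using A unfolding B C .
qed

text \<open>The factorisation in \<open>dual_gram_Y\<close> is distributed over the slots; the sums
  over I and J then rebuild both forms on the vectors of the frame.\<close>

lemma form_inner_Y:
  assumes "multilin q \<alpha>" "multilin q \<beta>"
  shows "form_inner g q \<alpha> \<beta> = (\<Sum>L | length L = q. \<alpha> (map Y L) * cnj (\<beta> (map Y L))) / fact q"
proof -
  let ?A = "{L :: 5 list. length L = q}" and ?p = "\<lambda>L I. \<Prod>k<q. Y (L ! k) $ (I ! k)"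
  have "(\<Sum>I\<in>?A. \<Sum>J\<in>?A. of_real (\<Prod>k<q. dual_gram g $ (I ! k) $ (J ! k)) * \<alpha> (map X I) * cnj (\<beta> (map X J)))
     = (\<Sum>I\<in>?A. \<Sum>J\<in>?A. \<Sum>L\<in>?A. (of_real (?p L I) * \<alpha> (map X I)) * (of_real (?p L J) * cnj (\<beta> (map X J))))"
    unfolding dual_gram_Y prod_sum_lists prod.distrib of_real_sum of_real_mult sum_distrib_right by (simp add: mult_ac)
  also have "\<dots> = (\<Sum>I\<in>?A. \<Sum>L\<in>?A. \<Sum>J\<in>?A. (of_real (?p L I) * \<alpha> (map X I)) * (of_real (?p L J) * cnj (\<beta> (map X J))))"
    by (intro sum.cong refl sum.swap)
  also have "\<dots> = (\<Sum>L\<in>?A. \<Sum>I\<in>?A. \<Sum>J\<in>?A. (of_real (?p L I) * \<alpha> (map X I)) * (of_real (?p L J) * cnj (\<beta> (map X J))))"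
    by (rule sum.swap)
  also have "\<dots> = (\<Sum>L\<in>?A. \<alpha> (map Y L) * cnj (\<beta> (map Y L)))"
  proof (intro sum.cong refl)
    fix L assume "L \<in> ?A"
    then have L: "length L = q" by simp
    show "(\<Sum>I\<in>?A. \<Sum>J\<in>?A. (of_real (?p L I) * \<alpha> (map X I)) * (of_real (?p L J) * cnj (\<beta> (map X J)))) = \<alpha> (map Y L) * cnj (\<beta> (map Y L))"
      unfolding map_X_expand[OF assms(1) L] map_X_expand[OF assms(2) L] sum_product cnj_sum complex_cnj_mult complex_cnj_complex_of_real ..
  qed
  finally show ?thesis unfolding form_inner_def by simp
qed

lemma form_expand:
  assumes "\<alpha> \<in> forms q" "length vs = q"
  shows "\<alpha> vs = (\<Sum>L | length L = q. of_real (\<Prod>k<q. c (L ! k) (vs ! k)) * \<alpha> (map Y L))"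
proof -
  let ?fs = "map (\<lambda>v l. c l v) vs"
  have A: "\<alpha> (map (\<lambda>f. \<Sum>l\<in>UNIV. f l *\<^sub>R Y l) ?fs) = (\<Sum>L | length L = q. of_real (\<Prod>k<q. (?fs ! k) (L ! k)) * \<alpha> (map Y L))"
    using multilin_expand[of "[]" ?fs \<alpha> Y] assms forms_multilin by simp
  have B: "map (\<lambda>f. \<Sum>l\<in>UNIV. f l *\<^sub>R Y l) ?fs = vs"
    by (simp add: o_def expand_c[symmetric])
  have C: "(\<Prod>k<q. (?fs ! k) (L ! k)) = (\<Prod>k<q. c (L ! k) (vs ! k))" for L
    using assms by simp
  show ?thesis using A unfolding B C .
qed

lemma form_inner_self:
  assumes "\<alpha> \<in> forms q"
  shows "form_inner g q \<alpha> \<alpha> = of_real ((\<Sum>L | length L = q. (cmod (\<alpha> (map Y L)))\<^sup>2) / fact q)"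
  unfolding form_inner_Y[OF forms_multilin[OF assms] forms_multilin[OF assms]]
  by (simp add: complex_norm_square[symmetric])

lemma finite_lists: "finite {L :: 5 list. length L = q}"
  using finite_lists_length_eq[of "UNIV :: 5 set" q] by simp

lemma form_inner_self_0:
  assumes \<alpha>: "\<alpha> \<in> forms q" and 0: "form_inner g q \<alpha> \<alpha> = 0"
  shows "\<alpha> = 0"
proof
  fix vs
  have "(\<Sum>L | length L = q. (cmod (\<alpha> (map Y L)))\<^sup>2) = 0"
    using 0 unfolding form_inner_self[OF \<alpha>] by (simp only: of_real_eq_0_iff) simp
  then have "\<alpha> (map Y L) = 0" if "length L = q" for L
    using that by (subst (asm) sum_nonneg_eq_0_iff) (auto simp: finite_lists)
  then show "\<alpha> vs = 0 vs"
    using form_expand[OF \<alpha>, of vs] forms_length[OF \<alpha>, of vs] by (cases "length vs = q") (auto intro!: sum.neutral)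
qed

text \<open>Pairing with a decomposable form is evaluation on the dual vectors: all q! permutations
  contribute the same, which cancels the factor 1/q!. This turns later inner products into
  evaluations.\<close>

lemma form_inner_wedge:
  assumes \<beta>: "\<beta> \<in> forms q" and fs: "length fs = q" "\<And>f. f \<in> set fs \<Longrightarrow> linear f"
  shows "form_inner g q \<beta> (wedge fs) = \<beta> (map sharp fs)"
proof -
  let ?A = "{L :: 5 list. length L = q}" and ?P = "{p. p permutes {..<q}}"
  have w: "multilin q (wedge fs)" using wedge_multilin[of fs] fs by simp
  have "(\<Sum>L\<in>?A. \<beta> (map Y L) * cnj (wedge fs (map Y L))) =
    (\<Sum>L\<in>?A. \<Sum>p\<in>?P. of_int (sign p) * (of_real (\<Prod>k<q. (fs ! k) (Y (L ! p k))) * \<beta> (map Y L)))"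
  proof (intro sum.cong refl)
    fix L assume L: "L \<in> ?A"
    have pk: "map Y L ! p k = Y (L ! p k)" if "p \<in> ?P" "k < q" for p k
      using that L permutes_in_image[of p "{..<q}" k] by simp
    have "wedge fs (map Y L) = of_real (\<Sum>p\<in>?P. of_int (sign p) * (\<Prod>k<q. (fs ! k) (Y (L ! p k))))"
      unfolding wedge_def using L fs pk by (auto intro!: sum.cong prod.cong)
    then show "\<beta> (map Y L) * cnj (wedge fs (map Y L)) = (\<Sum>p\<in>?P. of_int (sign p) * (of_real (\<Prod>k<q. (fs ! k) (Y (L ! p k))) * \<beta> (map Y L)))"
      by (simp add: sum_distrib_left mult_ac)
  qed
  also have "\<dots> = (\<Sum>p\<in>?P. of_int (sign p) * (\<Sum>L\<in>?A. of_real (\<Prod>k<q. (fs ! k) (Y (L ! p k))) * \<beta> (map Y L)))"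
    unfolding sum_distrib_left by (rule sum.swap)
  also have "\<dots> = (\<Sum>p\<in>?P. \<beta> (map sharp fs))"
  proof (intro sum.cong refl)
    fix p assume "p \<in> ?P"
    then have p: "p permutes {..<q}" by simp
    have ip: "inv p permutes {..<q}" by (rule permutes_inv[OF p])
    let ?fs = "map (\<lambda>f l. f (Y l)) (permute_list (inv p) fs)"
    have "(\<Prod>k<q. (fs ! k) (Y (L ! p k))) = (\<Prod>k<length ?fs. (?fs ! k) (L ! k))" for L
    proof -
      have "(\<Prod>k<q. (fs ! k) (Y (L ! p k))) = (\<Prod>k<q. (fs ! inv p k) (Y (L ! k)))"
        unfolding prod.permute[OF ip, of "\<lambda>k. (fs ! k) (Y (L ! p k))"] by (simp add: permutes_inverses[OF p])
      also have "\<dots> = (\<Prod>k<length ?fs. (?fs ! k) (L ! k))"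
        using fs ip by (auto intro!: prod.cong simp: permute_list_nth)
      finally show ?thesis .
    qed
    then have "(\<Sum>L\<in>?A. of_real (\<Prod>k<q. (fs ! k) (Y (L ! p k))) * \<beta> (map Y L)) = \<beta> ([] @ map (\<lambda>f. \<Sum>l\<in>UNIV. f l *\<^sub>R Y l) ?fs)"
      by (subst multilin_expand) (use forms_multilin[OF \<beta>] fs in simp_all)
    also have "map (\<lambda>f. \<Sum>l\<in>UNIV. f l *\<^sub>R Y l) ?fs = permute_list (inv p) (map sharp fs)"
      using ip fs by (simp add: permute_list_map sharp_def o_def)
    also have "\<beta> ([] @ permute_list (inv p) (map sharp fs)) = of_int (sign p) * \<beta> (map sharp fs)"
      using forms_permute[OF \<beta> _ ip, of "map sharp fs"] fs p permutation_permutes finite_lessThan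
      by (metis append_Nil length_map sign_inverse)
    finally show "of_int (sign p) * (\<Sum>L\<in>?A. of_real (\<Prod>k<q. (fs ! k) (Y (L ! p k))) * \<beta> (map Y L)) = \<beta> (map sharp fs)"
      by (simp add: mult.assoc[symmetric] flip: of_int_mult)
  qed
  also have "\<dots> = fact q * \<beta> (map sharp fs)"
    using card_permutations[of "{..<q}" q] by simp
  finally show ?thesis unfolding form_inner_Y[OF forms_multilin[OF \<beta>] w] by simp
qed

lemma form_wedge_expand:
  assumes \<alpha>: "\<alpha> \<in> forms q"
  shows "\<alpha> = (\<lambda>vs. \<Sum>L | length L = q. \<alpha> (map Y L) / fact q * wedge (map c L) vs)"
proof
  fix vs
  let ?A = "{L :: 5 list. length L = q}" and ?P = "{p. p permutes {..<q}}"
  show "\<alpha> vs = (\<Sum>L\<in>?A. \<alpha> (map Y L) / fact q * wedge (map c L) vs)"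
  proof (cases "length vs = q")
    case True
    have "(\<Sum>L\<in>?A. \<alpha> (map Y L) / fact q * wedge (map c L) vs) =
      (\<Sum>L\<in>?A. \<Sum>p\<in>?P. of_int (sign p) / fact q * (of_real (\<Prod>k<q. c (L ! k) (vs ! p k)) * \<alpha> (map Y L)))"
      using True by (intro sum.cong refl) (simp add: wedge_def sum_distrib_left sum_divide_distrib mult_ac)
    also have "\<dots> = (\<Sum>p\<in>?P. of_int (sign p) / fact q * (\<Sum>L\<in>?A. of_real (\<Prod>k<q. c (L ! k) (vs ! p k)) * \<alpha> (map Y L)))"
      unfolding sum_distrib_left by (rule sum.swap)
    also have "\<dots> = (\<Sum>p\<in>?P. \<alpha> vs / fact q)"
    proof (intro sum.cong refl)
      fix p assume "p \<in> ?P"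
      then have p: "p permutes {..<q}" by simp
      have "(\<Sum>L\<in>?A. of_real (\<Prod>k<q. c (L ! k) (vs ! p k)) * \<alpha> (map Y L)) = \<alpha> (permute_list p vs)"
        using True p by (subst form_expand[OF \<alpha>, of "permute_list p vs"]) (auto intro!: sum.cong prod.cong simp: permute_list_nth)
      also have "\<dots> = of_int (sign p) * \<alpha> vs" by (rule forms_permute[OF \<alpha> True p])
      finally show "of_int (sign p) / fact q * (\<Sum>L\<in>?A. of_real (\<Prod>k<q. c (L ! k) (vs ! p k)) * \<alpha> (map Y L)) = \<alpha> vs / fact q"
        by (simp add: mult.assoc[symmetric] flip: of_int_mult)
    qed
    also have "\<dots> = \<alpha> vs" using card_permutations[of "{..<q}" q] by simp
    finally show ?thesis ..
  qed (simp add: forms_length[OF \<alpha>] wedge_def)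
qed

lemma wedge_c_forms: "wedge (map c L) \<in> forms (length L)"
  using wedge_forms[of "map c L"] linear_c by auto

text \<open>The Riesz representation in finite dimension, with coefficients read off from F on the
  wedges of the coframe. The sum runs over all index lists, hence the factor 1/p!.\<close>

lemma codiff_exists:
  "\<exists>\<eta>. \<eta> \<in> forms p \<and> (\<forall>\<alpha>\<in>forms p. form_inner g (Suc p) (ce_diff \<alpha>) \<omega> = form_inner g p \<alpha> \<eta>)"
proof -
  let ?A = "{L :: 5 list. length L = p}"
  define F where "F \<alpha> = form_inner g (Suc p) (ce_diff \<alpha>) \<omega>" for \<alpha>
  have F: "F (\<lambda>vs. \<Sum>L\<in>?A. a L * e L vs) = (\<Sum>L\<in>?A. a L * F (e L))" for a :: "5 list \<Rightarrow> complex" and e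
  proof -
    have d: "ce_diff (\<lambda>vs. \<Sum>L\<in>?A. a L * e L vs) vs = (\<Sum>L\<in>?A. a L * ce_diff (e L) vs)" for vs
    proof -
      have "ce_diff (\<lambda>vs. \<Sum>L\<in>?A. a L * e L vs) vs = (\<Sum>j<length vs. \<Sum>L\<in>?A. \<Sum>i<j. a L * ((-1) ^ (i + j) * e L (bracket (vs ! i) (vs ! j) # nths vs (- {i, j}))))"
        unfolding ce_diff_def by (intro sum.cong refl, subst sum.swap[of _ _ ?A]) (simp add: sum_distrib_left mult_ac)
      also have "\<dots> = (\<Sum>L\<in>?A. a L * ce_diff (e L) vs)"
        unfolding ce_diff_def sum_distrib_left by (rule sum.swap)
      finally show ?thesis .
    qed
    let ?B = "{I :: 5 list. length I = Suc p}" and ?k = "\<lambda>I J. complex_of_real (\<Prod>k<Suc p. dual_gram g $ (I ! k) $ (J ! k))"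
    have "(\<Sum>I\<in>?B. \<Sum>J\<in>?B. ?k I J * (\<Sum>L\<in>?A. a L * ce_diff (e L) (map X I)) * cnj (\<omega> (map X J)))
      = (\<Sum>I\<in>?B. \<Sum>L\<in>?A. \<Sum>J\<in>?B. a L * (?k I J * ce_diff (e L) (map X I) * cnj (\<omega> (map X J))))"
      by (rule sum.cong[OF refl], subst sum.swap[of _ ?B ?A]) (simp add: sum_distrib_left sum_distrib_right mult_ac)
    also have "\<dots> = (\<Sum>L\<in>?A. a L * (\<Sum>I\<in>?B. \<Sum>J\<in>?B. ?k I J * ce_diff (e L) (map X I) * cnj (\<omega> (map X J))))"
      unfolding sum_distrib_left by (rule sum.swap)
    finally have eq: "(\<Sum>I\<in>?B. \<Sum>J\<in>?B. ?k I J * (\<Sum>L\<in>?A. a L * ce_diff (e L) (map X I)) * cnj (\<omega> (map X J)))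
      = (\<Sum>L\<in>?A. a L * (\<Sum>I\<in>?B. \<Sum>J\<in>?B. ?k I J * ce_diff (e L) (map X I) * cnj (\<omega> (map X J))))" .
    show ?thesis unfolding F_def form_inner_def d eq
      by (simp only: sum_divide_distrib[of _ ?A] times_divide_eq_right)
  qed
  define \<eta> where "\<eta> vs = (\<Sum>L\<in>?A. cnj (F (wedge (map c L))) / fact p * wedge (map c L) vs)" for vs
  have \<eta>: "\<eta> \<in> forms p"
  proof -
    have w: "wedge (map c L) \<in> forms p" if "L \<in> ?A" for L using wedge_c_forms[of L] that by simp
    have "linear (\<lambda>v. \<eta> (xs @ v # ys))" if "length xs + length ys + 1 = p" for xs ys
      unfolding \<eta>_def
    proof (intro linear_compose_sum ballI)
      fix L assume "L \<in> ?A"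
      then have "linear (\<lambda>v. wedge (map c L) (xs @ v # ys))"
        using multilinD[OF forms_multilin[OF w] that] by blast
      then show "linear (\<lambda>v. cnj (F (wedge (map c L))) / fact p * wedge (map c L) (xs @ v # ys))"
        by (rule linear_cmult)
    qed
    moreover have "\<eta> vs = 0" if "length vs \<noteq> p \<or> \<not> distinct vs" for vs
    proof -
      have "wedge (map c L) vs = 0" if "L \<in> ?A" for L
        using w[OF that] \<open>length vs \<noteq> p \<or> \<not> distinct vs\<close> by (auto simp: forms_length forms_not_distinct)
      then show ?thesis unfolding \<eta>_def by (intro sum.neutral ballI) simp
    qed
    ultimately show ?thesis unfolding forms_def by blast
  qed
  have "F \<alpha> = form_inner g p \<alpha> \<eta>" if \<alpha>: "\<alpha> \<in> forms p" for \<alpha>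
  proof -
    have lin: "form_inner g p \<alpha> \<eta> = (\<Sum>L\<in>?A. F (wedge (map c L)) / fact p * form_inner g p \<alpha> (wedge (map c L)))"
    proof -
      have "(\<Sum>I\<in>?A. \<alpha> (map Y I) * cnj (\<eta> (map Y I))) = (\<Sum>I\<in>?A. \<Sum>L\<in>?A. F (wedge (map c L)) / fact p * (\<alpha> (map Y I) * cnj (wedge (map c L) (map Y I))))"
        unfolding \<eta>_def by (simp add: sum_distrib_left mult_ac)
      also have "\<dots> = (\<Sum>L\<in>?A. F (wedge (map c L)) / fact p * (\<Sum>I\<in>?A. \<alpha> (map Y I) * cnj (wedge (map c L) (map Y I))))"
        unfolding sum_distrib_left by (rule sum.swap)
      finally have "form_inner g p \<alpha> \<eta> = (\<Sum>L\<in>?A. F (wedge (map c L)) / fact p * ((\<Sum>I\<in>?A. \<alpha> (map Y I) * cnj (wedge (map c L) (map Y I))) / fact p))"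
        unfolding form_inner_Y[OF forms_multilin[OF \<alpha>] forms_multilin[OF \<eta>]]
        by (simp only:) (subst sum_divide_distrib, simp)
      also have "\<dots> = (\<Sum>L\<in>?A. F (wedge (map c L)) / fact p * form_inner g p \<alpha> (wedge (map c L)))"
      proof (intro sum.cong refl)
        fix L assume "L \<in> ?A"
        then have "multilin p (wedge (map c L))" using wedge_c_forms[of L] forms_multilin by simp
        from form_inner_Y[OF forms_multilin[OF \<alpha>] this]
        show "F (wedge (map c L)) / fact p * ((\<Sum>I\<in>?A. \<alpha> (map Y I) * cnj (wedge (map c L) (map Y I))) / fact p) =
          F (wedge (map c L)) / fact p * form_inner g p \<alpha> (wedge (map c L))" by simp
      qed
      finally show ?thesis .
    qed
    have "form_inner g p \<alpha> (wedge (map c L)) = \<alpha> (map Y L)" if "L \<in> ?A" for L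
      using form_inner_wedge[OF \<alpha>, of "map c L"] that linear_c by (auto simp: sharp_c o_def)
    then have "form_inner g p \<alpha> \<eta> = (\<Sum>L\<in>?A. \<alpha> (map Y L) / fact p * F (wedge (map c L)))"
      unfolding lin by (intro sum.cong refl) simp
    also have "\<dots> = F (\<lambda>vs. \<Sum>L\<in>?A. \<alpha> (map Y L) / fact p * wedge (map c L) vs)" by (rule F[symmetric])
    also have "(\<lambda>vs. \<Sum>L\<in>?A. \<alpha> (map Y L) / fact p * wedge (map c L) vs) = \<alpha>" by (rule form_wedge_expand[OF \<alpha>, symmetric])
    finally show ?thesis ..
  qed
  then show ?thesis using \<eta> unfolding F_def by blast
qed

end

section \<open>Harmonic representatives\<close>

lemma forms_0: "0 \<in> forms q"
  by (simp add: forms_def linear_iff)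

lemma forms_diff: "\<alpha> \<in> forms q \<Longrightarrow> \<beta> \<in> forms q \<Longrightarrow> \<alpha> - \<beta> \<in> forms q"
  unfolding forms_def mem_Collect_eq minus_apply by (auto intro!: linear_compose_sub)

lemma form_inner_diff_right: "form_inner g q \<alpha> (\<beta> - \<beta>') = form_inner g q \<alpha> \<beta> - form_inner g q \<alpha> \<beta>'"
  by (simp add: form_inner_def sum_subtractf right_diff_distrib diff_divide_distrib)

lemma form_inner_0_right: "form_inner g q \<alpha> 0 = 0"
  by (simp add: form_inner_def)

lemma ce_diff_0: "ce_diff 0 = 0"
  by (simp add: ce_diff_def fun_eq_iff)

context coframe
begin

lemma codiff_eq:
  assumes "\<eta> \<in> forms p" "\<And>\<alpha>. \<alpha> \<in> forms p \<Longrightarrow> form_inner g (Suc p) (ce_diff \<alpha>) \<omega> = form_inner g p \<alpha> \<eta>"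
  shows "codiff g p \<omega> = \<eta>"
  unfolding codiff_def
proof (rule the_equality)
  fix \<eta>' assume \<eta>': "\<eta>' \<in> forms p \<and> (\<forall>\<alpha>\<in>forms p. form_inner g (Suc p) (ce_diff \<alpha>) \<omega> = form_inner g p \<alpha> \<eta>')"
  then have d: "\<eta>' - \<eta> \<in> forms p" using assms forms_diff by blast
  have "form_inner g p (\<eta>' - \<eta>) (\<eta>' - \<eta>) = 0"
    using \<eta>' assms(2)[OF d] d unfolding form_inner_diff_right by simp
  then have "\<eta>' - \<eta> = 0" by (rule form_inner_self_0[OF d])
  then show "\<eta>' = \<eta>" by simp
qed (use assms in blast)

lemma codiff_adjoint:
  assumes "\<alpha> \<in> forms p"
  shows "form_inner g (Suc p) (ce_diff \<alpha>) \<omega> = form_inner g p \<alpha> (codiff g p \<omega>)"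
proof -
  obtain \<eta> where \<eta>: "\<eta> \<in> forms p" "\<forall>\<alpha>\<in>forms p. form_inner g (Suc p) (ce_diff \<alpha>) \<omega> = form_inner g p \<alpha> \<eta>"
    using codiff_exists by blast
  then have "codiff g p \<omega> = \<eta>" by (intro codiff_eq) auto
  then show ?thesis using \<eta> assms by simp
qed

text \<open>Another harmonic form in the class differs by a coboundary that is orthogonal to all
  coboundaries, hence to itself. Only orthogonality to coboundaries has to be verified for a given
  form; the codifferential need not be computed.\<close>

lemma harmonic_rep_eq:
  assumes \<omega>: "\<omega> \<in> forms q" "ce_diff \<omega> = 0"
    and orth: "\<And>p \<alpha>. q = Suc p \<Longrightarrow> \<alpha> \<in> forms p \<Longrightarrow> form_inner g q (ce_diff \<alpha>) \<omega> = 0"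
  shows "harmonic_rep g q (coh_class q \<omega>) = \<omega>"
  unfolding harmonic_rep_def
proof (rule the_equality)
  have cyc: "\<omega> \<in> cocycles q" using \<omega> by (simp add: cocycles_def)
  have "0 \<in> coboundaries q"
    using forms_0 ce_diff_0 by (cases q) (auto simp: coboundaries_def image_iff intro!: bexI[of _ 0])
  moreover have "codiff g p \<omega> = 0" if "q = Suc p" for p
    by (rule codiff_eq) (use orth that forms_0 form_inner_0_right in auto)
  ultimately show "\<omega> \<in> coh_class q \<omega> \<and> \<omega> \<in> harmonic g q"
    using cyc by (auto simp: coh_class_def harmonic_def)
next
  fix \<eta> assume \<eta>: "\<eta> \<in> coh_class q \<omega> \<and> \<eta> \<in> harmonic g q"
  then have cob: "\<eta> - \<omega> \<in> coboundaries q" and f: "\<eta> \<in> forms q" by (auto simp: coh_class_def cocycles_def)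
  show "\<eta> = \<omega>"
  proof (cases q)
    case 0
    then show ?thesis using cob by (simp add: coboundaries_def)
  next
    case (Suc p)
    then obtain \<alpha> where \<alpha>: "\<alpha> \<in> forms p" "\<eta> - \<omega> = ce_diff \<alpha>" using cob by (auto simp: coboundaries_def)
    have "codiff g p \<eta> = 0" using \<eta> Suc by (simp add: harmonic_def)
    then have "form_inner g q (ce_diff \<alpha>) \<eta> = 0"
      using codiff_adjoint[OF \<alpha>(1), of \<eta>] Suc by (simp add: form_inner_0_right)
    then have "form_inner g q (ce_diff \<alpha>) (\<eta> - \<omega>) = 0"
      using orth[OF Suc \<alpha>(1)] unfolding form_inner_diff_right by simp
    then have "form_inner g q (\<eta> - \<omega>) (\<eta> - \<omega>) = 0" unfolding \<alpha>(2)[symmetric] .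
    then have "\<eta> - \<omega> = 0" by (rule form_inner_self_0[OF forms_diff[OF f \<omega>(1)]])
    then show ?thesis by simp
  qed
qed

abbreviation sh :: "5 \<Rightarrow> lie" where "sh j \<equiv> sharp (\<lambda>v. v $ j)"

lemma form_inner_chi: "\<beta> \<in> forms q \<Longrightarrow> length S = q \<Longrightarrow> form_inner g q \<beta> (chi S) = \<beta> (map sh S)"
  unfolding chi_wedge by (subst form_inner_wedge) (auto simp: linear_component o_def)

end

section \<open>Closed and coclosed basis forms\<close>

lemma exhaust_5: fixes x :: 5 shows "x = 1 \<or> x = 2 \<or> x = 3 \<or> x = 4 \<or> x = 5"
proof (induct x)
  case (of_int z)
  then have "z = 0 \<or> z = 1 \<or> z = 2 \<or> z = 3 \<or> z = 4" by fastforce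
  then show ?case by auto
qed

lemma UNIV_5: "UNIV = {1, 2, 3, 4, 5 :: 5}"
  using exhaust_5 by auto

lemma sum_5: "sum f (UNIV :: 5 set) = f 1 + f 2 + f 3 + f 4 + f 5"
  unfolding UNIV_5 by (simp add: ac_simps)

lemma forall_5: "(\<forall>i::5. P i) \<longleftrightarrow> P 1 \<and> P 2 \<and> P 3 \<and> P 4 \<and> P 5"
  by (metis exhaust_5)

lemma X_component: "X i $ j = (if i = j then 1 else 0)"
  by (simp add: X_def axis_def)

text \<open>The bracket relations up to scalars. They hold for the standard basis as well as for the
  g-dual vectors \<open>sh\<close>, so closedness and coclosedness become statements about index
  sets.\<close>

definition bracket_table :: "(5 \<Rightarrow> lie) \<Rightarrow> bool" where
  "bracket_table Z \<longleftrightarrow> (\<forall>a b. bracket (Z a) (Z b) = 0 \<or> ({a, b} = {1, 2} \<and> (\<exists>r. bracket (Z a) (Z b) = r *\<^sub>R Z 3)) \<or>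
     ({a, b} = {1, 3} \<and> (\<exists>r. bracket (Z a) (Z b) = r *\<^sub>R Z 4)) \<or> ({a, b} = {2, 3} \<and> (\<exists>r. bracket (Z a) (Z b) = r *\<^sub>R Z 5)))"

lemma bracket_tableE:
  assumes "bracket_table Z"
  obtains "bracket (Z a) (Z b) = 0" | r where "{a, b} = {1, 2}" "bracket (Z a) (Z b) = r *\<^sub>R Z 3"
    | r where "{a, b} = {1, 3}" "bracket (Z a) (Z b) = r *\<^sub>R Z 4"
    | r where "{a, b} = {2, 3}" "bracket (Z a) (Z b) = r *\<^sub>R Z 5"
  using assms[unfolded bracket_table_def, rule_format, of a b] by (elim disjE conjE exE)

lemma bracket_table_X: "bracket_table X"
  unfolding bracket_table_def forall_5
  by (auto simp: bracket_def X_component intro: exI[of _ 1] exI[of _ "-1"])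

lemma forms_head_scale:
  assumes "\<omega> \<in> forms (Suc (length vs))"
  shows "\<omega> ((r *\<^sub>R v) # vs) = of_real r * \<omega> (v # vs)" "\<omega> (0 # vs) = 0"
proof -
  have lin: "linear (\<lambda>v. \<omega> ([] @ v # vs))" using assms by (intro multilinD[OF forms_multilin]) auto
  show "\<omega> ((r *\<^sub>R v) # vs) = of_real r * \<omega> (v # vs)" "\<omega> (0 # vs) = 0"
    using linear_scale[OF lin, of r v] linear_0[OF lin] by (simp_all add: scaleR_conv_of_real)
qed

lemma mem_nths_remove2:
  assumes "x \<in> set xs" "x \<noteq> xs ! i" "x \<noteq> xs ! j" shows "x \<in> set (nths xs (- {i, j}))"
  using assms by (force simp: set_nths in_set_conv_nth)

text \<open>Each nonzero bracket of two members is a multiple of some \<open>Z k\<close> with k in S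
  and different from both, so \<open>Z k\<close> occurs again in the tail and the alternating form
  vanishes.\<close>

lemma coclosed:
  assumes \<alpha>: "\<alpha> \<in> forms p" and S: "length S = Suc p" "distinct S" and Z: "bracket_table Z"
    and c: "1 \<in> set S \<Longrightarrow> 2 \<in> set S \<Longrightarrow> 3 \<in> set S" "1 \<in> set S \<Longrightarrow> 3 \<in> set S \<Longrightarrow> 4 \<in> set S" "2 \<in> set S \<Longrightarrow> 3 \<in> set S \<Longrightarrow> 5 \<in> set S"
  shows "ce_diff \<alpha> (map Z S) = 0"
  unfolding ce_diff_def
proof (intro sum.neutral ballI)
  fix j i assume "j \<in> {..<length (map Z S)}" "i \<in> {..<j}"
  then have ij: "i < j" "j < length S" by auto
  let ?R = "nths S (- {i, j})"
  have R: "nths (map Z S) (- {i, j}) = map Z ?R" by (simp add: nths_map)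
  have len: "Suc (length (map Z ?R)) = p" using ij S by (simp add: length_nths_remove2)
  have z: "\<alpha> (r *\<^sub>R Z k # map Z ?R) = 0" if "k \<in> set S" "k \<noteq> S ! i" "k \<noteq> S ! j" for r k
  proof -
    have "k \<in> set ?R" using that by (rule mem_nths_remove2)
    then have "\<not> distinct (Z k # map Z ?R)" by auto
    then show ?thesis using \<alpha> len by (subst forms_head_scale) (auto simp: forms_not_distinct)
  qed
  have mem: "S ! i \<in> set S" "S ! j \<in> set S" using ij by auto
  have "\<alpha> (bracket (Z (S ! i)) (Z (S ! j)) # map Z ?R) = 0"
  proof (cases rule: bracket_tableE[OF Z, of "S ! i" "S ! j"])
    case 1
    then show ?thesis using \<alpha> len forms_head_scale(2)[of \<alpha> "map Z ?R"] by simp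
  next
    case 2
    have "3 \<in> set S" "3 \<noteq> S ! i" "3 \<noteq> S ! j" using 2(1) mem c by (auto simp: doubleton_eq_iff)
    then show ?thesis unfolding 2(2) by (rule z)
  next
    case 3
    have "4 \<in> set S" "4 \<noteq> S ! i" "4 \<noteq> S ! j" using 3(1) mem c by (auto simp: doubleton_eq_iff)
    then show ?thesis unfolding 3(2) by (rule z)
  next
    case 4
    have "5 \<in> set S" "5 \<noteq> S ! i" "5 \<noteq> S ! j" using 4(1) mem c by (auto simp: doubleton_eq_iff)
    then show ?thesis unfolding 4(2) by (rule z)
  qed
  then show "(-1) ^ (i + j) * \<alpha> (bracket (map Z S ! i) (map Z S ! j) # nths (map Z S) (- {i, j})) = 0"
    using ij unfolding R by simp
qed

lemma chi_X_0:
  assumes "set T \<noteq> set S" shows "chi S (map X T) = 0"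
proof (cases "length T = length S")
  case True
  have "(\<Prod>k<length S. (map X T ! p k) $ (S ! k)) = 0" if p: "p permutes {..<length S}" for p
  proof (rule ccontr)
    assume "(\<Prod>k<length S. (map X T ! p k) $ (S ! k)) \<noteq> 0"
    then have *: "(map X T ! p k) $ (S ! k) \<noteq> 0" if "k < length S" for k using that by auto
    have eq: "T ! p k = S ! k" if "k < length S" for k
      using *[OF that] permutes_in_image[OF p, of k] True that by (simp add: X_component split: if_splits)
    have "S = permute_list p T"
      using True p by (intro nth_equalityI) (auto simp: permute_list_nth eq)
    then have "set S = set T" using p True by (metis set_permute_list)
    with assms show False by simp
  qed
  then have "(\<Sum>p | p permutes {..<length S}. of_int (sign p) * (\<Prod>k<length S. (map X T ! p k) $ (S ! k))) = 0"
    by (intro sum.neutral ballI) simp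
  then show ?thesis unfolding chi_def using True by (simp only: length_map if_True of_real_0 refl)
qed (simp add: chi_def)

lemma forms_X_eq_0:
  assumes \<omega>: "\<omega> \<in> forms q" and 0: "\<And>J. length J = q \<Longrightarrow> distinct J \<Longrightarrow> \<omega> (map X J) = 0"
  shows "\<omega> = 0"
proof
  fix vs
  show "\<omega> vs = 0 vs"
  proof (cases "length vs = q")
    case True
    let ?fs = "map (\<lambda>v i. v $ i) vs"
    have X: "v = (\<Sum>i\<in>UNIV. (v $ i) *\<^sub>R X i)" for v :: lie
      using basis_expansion[of v] unfolding X_def scalar_mult_eq_scaleR by simp
    have "\<omega> (map (\<lambda>f. \<Sum>i\<in>UNIV. f i *\<^sub>R X i) ?fs) = (\<Sum>I | length I = q. of_real (\<Prod>k<q. (?fs ! k) (I ! k)) * \<omega> (map X I))"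
      using multilin_expand[of "[]" ?fs \<omega> X] True forms_multilin[OF \<omega>] by simp
    moreover have "\<omega> (map X I) = 0" if "length I = q" for I
    proof (cases "distinct I")
      case False
      then have "\<not> distinct (map X I)" by (auto simp: distinct_map)
      then show ?thesis by (rule forms_not_distinct[OF \<omega>])
    qed (use 0 that in auto)
    moreover have "map (\<lambda>f. \<Sum>i\<in>UNIV. f i *\<^sub>R X i) ?fs = vs"
      by (simp add: o_def X[symmetric])
    ultimately show ?thesis by simp
  qed (simp add: forms_length[OF \<omega>])
qed

text \<open>A nonzero term would replace X a and X b by a multiple of X c, with c in S and neither a
  nor b in the remaining list. The hypotheses say that S contains a or b whenever it contains
  c.\<close>

lemma chi_closed:
  assumes S: "1 \<in> set S \<or> 2 \<in> set S \<or> 3 \<notin> set S" "1 \<in> set S \<or> 3 \<in> set S \<or> 4 \<notin> set S" "2 \<in> set S \<or> 3 \<in> set S \<or> 5 \<notin> set S"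
  shows "ce_diff (chi S) = 0"
proof (rule forms_X_eq_0[OF ce_diff_forms[OF chi_forms]])
  fix J :: "5 list" assume J: "length J = Suc (length S)" "distinct J"
  show "ce_diff (chi S) (map X J) = 0"
    unfolding ce_diff_def
  proof (intro sum.neutral ballI)
    fix j i assume "j \<in> {..<length (map X J)}" "i \<in> {..<j}"
    then have ij: "i < j" "j < length J" by auto
    let ?R = "nths J (- {i, j})"
    have R: "nths (map X J) (- {i, j}) = map X ?R" by (simp add: nths_map)
    have len: "Suc (length (map X ?R)) = length S" if "S \<noteq> []" using that ij J by (cases S) (simp_all add: length_nths_remove2)
    have nR: "J ! i \<notin> set ?R" "J ! j \<notin> set ?R"
      using ij J by (auto simp: set_nths nth_eq_iff_index_eq)
    have z: "chi S (r *\<^sub>R X k # map X ?R) = 0" if "set (k # ?R) \<noteq> set S" for r k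
    proof (cases "S = []")
      case False
      then show ?thesis using chi_forms[of S] len chi_X_0[OF that]
        by (subst forms_head_scale) simp_all
    qed (simp add: chi_def)
    have "chi S (bracket (X (J ! i)) (X (J ! j)) # map X ?R) = 0"
    proof (cases rule: bracket_tableE[OF bracket_table_X, of "J ! i" "J ! j"])
      case 1
      show ?thesis
      proof (cases "S = []")
        case False
        then show ?thesis using chi_forms[of S] len forms_head_scale(2)[of "chi S" "map X ?R"] 1 by simp
      qed (simp add: chi_def)
    next
      case 2
      then have "1 \<notin> set ?R" "2 \<notin> set ?R" using nR by (auto simp: doubleton_eq_iff)
      then have "set (3 # ?R) \<noteq> set S" using S(1) by force
      then show ?thesis unfolding 2(2) by (rule z)
    next
      case 3
      then have "1 \<notin> set ?R" "3 \<notin> set ?R" using nR by (auto simp: doubleton_eq_iff)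
      then have "set (4 # ?R) \<noteq> set S" using S(2) by force
      then show ?thesis unfolding 3(2) by (rule z)
    next
      case 4
      then have "2 \<notin> set ?R" "3 \<notin> set ?R" using nR by (auto simp: doubleton_eq_iff)
      then have "set (5 # ?R) \<noteq> set S" using S(3) by force
      then show ?thesis unfolding 4(2) by (rule z)
    qed
    then show "(-1) ^ (i + j) * chi S (bracket (map X J ! i) (map X J ! j) # nths (map X J) (- {i, j})) = 0"
      using ij unfolding R by simp
  qed
qed

lemma perm_sum_2: "(\<Sum>p | p permutes {..<2::nat}. of_int (sign p) * h (p 0) (p 1)) = (h 0 1 - h 1 0 :: real)"
proof -
  have e: "{..<2::nat} = insert 0 {1}" by auto
  have 1: "finite {1::nat}" "0 \<notin> {1::nat}" by auto
  show ?thesis unfolding e sum_over_permutations_insert[OF 1] permutes_sing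
    by (simp add: sign_swap_id sign_id swap_id_eq)
qed

lemma perm_sum_3: "(\<Sum>p | p permutes {..<3::nat}. of_int (sign p) * h (p 0) (p 1) (p 2)) = (h 0 1 2 - h 0 2 1 - h 1 0 2 + h 1 2 0 + h 2 0 1 - h 2 1 0 :: real)"
proof -
  have e: "{..<3::nat} = insert 0 (insert 1 {2})" by auto
  have 1: "finite {1, 2::nat}" "0 \<notin> {1, 2::nat}" "finite {2::nat}" "1 \<notin> {2::nat}" by auto
  show ?thesis unfolding e sum_over_permutations_insert[OF 1(1,2)] sum_over_permutations_insert[OF 1(3,4)] permutes_sing
    by (simp add: sign_swap_id permutation_swap_id sign_compose sign_id swap_id_eq)
qed

lemma perm_sum_4: "(\<Sum>p | p permutes {..<4::nat}. of_int (sign p) * h (p 0) (p 1) (p 2) (p 3)) = (h 0 1 2 3 - h 0 1 3 2 - h 0 2 1 3 + h 0 2 3 1 + h 0 3 1 2 - h 0 3 2 1 - h 1 0 2 3 + h 1 0 3 2 + h 1 2 0 3 - h 1 2 3 0 - h 1 3 0 2 + h 1 3 2 0 + h 2 0 1 3 - h 2 0 3 1 - h 2 1 0 3 + h 2 1 3 0 + h 2 3 0 1 - h 2 3 1 0 - h 3 0 1 2 + h 3 0 2 1 + h 3 1 0 2 - h 3 1 2 0 - h 3 2 0 1 + h 3 2 1 0 :: real)"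
proof -
  have e: "{..<4::nat} = insert 0 (insert 1 (insert 2 {3}))" by auto
  have 1: "finite {1, 2, 3::nat}" "0 \<notin> {1, 2, 3::nat}" "finite {2, 3::nat}" "1 \<notin> {2, 3::nat}" "finite {3::nat}" "2 \<notin> {3::nat}" by auto
  show ?thesis unfolding e sum_over_permutations_insert[OF 1(1,2)] sum_over_permutations_insert[OF 1(3,4)] sum_over_permutations_insert[OF 1(5,6)] permutes_sing
    by (simp add: sign_swap_id permutation_swap_id permutation_compose sign_compose sign_id swap_id_eq)
qed

lemma chi_0: "chi [] [] = 1"
  by (simp add: chi_def sign_id)

lemma chi_1: "chi [a] [u] = of_real (vec_nth u a)"
  by (simp add: chi_def lessThan_Suc permutes_sing sign_id)

lemma chi_2: "chi [a, b] [u, v] = of_real (vec_nth u a * vec_nth v b - vec_nth v a * vec_nth u b)"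
proof -
  have l: "length [a, b] = 2" by simp
  have p: "(\<Prod>k<2. h k) = h 0 * h 1" for h :: "nat \<Rightarrow> real" by (simp add: eval_nat_numeral)
  show ?thesis unfolding chi_def l p perm_sum_2[of "\<lambda>i j. vec_nth ([u, v] ! i) ([a, b] ! 0) * vec_nth ([u, v] ! j) ([a, b] ! 1)"] by simp
qed

lemma chi_3: "chi [a, b, c] [u, v, w] = of_real (vec_nth u a * (vec_nth v b * vec_nth w c - vec_nth w b * vec_nth v c) - vec_nth v a * (vec_nth u b * vec_nth w c - vec_nth w b * vec_nth u c)
    + vec_nth w a * (vec_nth u b * vec_nth v c - vec_nth v b * vec_nth u c))"
proof -
  have l: "length [a, b, c] = 3" by simp
  have p: "(\<Prod>k<3. h k) = h 0 * h 1 * h 2" for h :: "nat \<Rightarrow> real" by (simp add: eval_nat_numeral)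
  show ?thesis 
    unfolding chi_def l p perm_sum_3[of "\<lambda>i j k. vec_nth ([u, v, w] ! i) ([a, b, c] ! 0) * vec_nth ([u, v, w] ! j) ([a, b, c] ! 1) * vec_nth ([u, v, w] ! k) ([a, b, c] ! 2)"]
    by simp (simp add: algebra_simps)
qed

lemma chi_4: "chi [a, b, c, d] [u, v, w, x] = of_real
   (vec_nth u a * (vec_nth v b * (vec_nth w c * vec_nth x d - vec_nth x c * vec_nth w d) - vec_nth w b * (vec_nth v c * vec_nth x d - vec_nth x c * vec_nth v d) + vec_nth x b * (vec_nth v c * vec_nth w d - vec_nth w c * vec_nth v d))
  - vec_nth v a * (vec_nth u b * (vec_nth w c * vec_nth x d - vec_nth x c * vec_nth w d) - vec_nth w b * (vec_nth u c * vec_nth x d - vec_nth x c * vec_nth u d) + vec_nth x b * (vec_nth u c * vec_nth w d - vec_nth w c * vec_nth u d))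
  + vec_nth w a * (vec_nth u b * (vec_nth v c * vec_nth x d - vec_nth x c * vec_nth v d) - vec_nth v b * (vec_nth u c * vec_nth x d - vec_nth x c * vec_nth u d) + vec_nth x b * (vec_nth u c * vec_nth v d - vec_nth v c * vec_nth u d))
  - vec_nth x a * (vec_nth u b * (vec_nth v c * vec_nth w d - vec_nth w c * vec_nth v d) - vec_nth v b * (vec_nth u c * vec_nth w d - vec_nth w c * vec_nth u d) + vec_nth w b * (vec_nth u c * vec_nth v d - vec_nth v c * vec_nth u d)))"
proof -
  have l: "length [a, b, c, d] = 4" by simp
  have p: "(\<Prod>k<4. h k) = h 0 * h 1 * h 2 * h 3" for h :: "nat \<Rightarrow> real" by (simp add: eval_nat_numeral)
  show ?thesis 
    unfolding chi_def l p perm_sum_4[of "\<lambda>i j k m. vec_nth ([u, v, w, x] ! i) ([a, b, c, d] ! 0) * vec_nth ([u, v, w, x] ! j) ([a, b, c, d] ! 1) * vec_nth ([u, v, w, x] ! k) ([a, b, c, d] ! 2) * vec_nth ([u, v, w, x] ! m) ([a, b, c, d] ! 3)"]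
    by simp (simp add: algebra_simps)
qed

lemma forms_add_divide:
  assumes "\<alpha> \<in> forms q" "\<beta> \<in> forms q" shows "(\<lambda>vs. (\<alpha> vs + \<beta> vs) / k) \<in> forms q"
proof -
  have "linear (\<lambda>v. (\<alpha> (xs @ v # ys) + \<beta> (xs @ v # ys)) / k)" if "length xs + length ys + 1 = q" for xs ys
    using linear_cmult[OF linear_compose_add[OF multilinD[OF forms_multilin[OF assms(1)] that] multilinD[OF forms_multilin[OF assms(2)] that]], of "1 / k"]
    by simp
  then show ?thesis using assms unfolding forms_def by auto
qed

lemma ce_diff_add_divide: "ce_diff (\<lambda>vs. (\<alpha> vs + \<beta> vs) / k) vs = (ce_diff \<alpha> vs + ce_diff \<beta> vs) / k"
proof -
  have "(-1) ^ n * ((a + b) / k) = ((-1) ^ n * a + (-1) ^ n * b) / k" for n a b by (simp add: distrib_left)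
  then show ?thesis unfolding ce_diff_def by (simp only: sum.distrib sum_divide_distrib[symmetric])
qed

lemma form_inner_add_divide_left:
  "form_inner g q (\<lambda>vs. (\<alpha> vs + \<beta> vs) / k) \<gamma> = (form_inner g q \<alpha> \<gamma> + form_inner g q \<beta> \<gamma>) / k"
proof -
  have "x * ((a + b) / k) * c = (x * a * c + x * b * c) / k" for x a b c by (simp add: algebra_simps)
  then show ?thesis unfolding form_inner_def by (simp only: sum.distrib sum_divide_distrib[symmetric]) (simp add: add_divide_distrib mult.commute)
qed

lemma form_inner_add_divide_right:
  "form_inner g q \<gamma> (\<lambda>vs. (\<alpha> vs + \<beta> vs) / of_real k) = (form_inner g q \<gamma> \<alpha> + form_inner g q \<gamma> \<beta>) / of_real k"
proof -
  have "x * a * cnj ((b + c) / of_real k) = (x * a * cnj b + x * a * cnj c) / of_real k" for x a b c by (simp add: algebra_simps)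
  then show ?thesis unfolding form_inner_def by (simp only: sum.distrib sum_divide_distrib[symmetric]) (simp add: add_divide_distrib mult.commute)
qed

lemma ce_diff_3: "ce_diff \<omega> [u, v, w] = - \<omega> [bracket u v, w] + \<omega> [bracket u w, v] - \<omega> [bracket v w, u]"
  by (simp add: ce_diff_def eval_nat_numeral lessThan_Suc nths_Cons)

lemma bracket_component: "bracket u v $ 1 = 0" "bracket u v $ 2 = 0" "bracket u v $ 3 = u $ 1 * v $ 2 - u $ 2 * v $ 1"
  "bracket u v $ 4 = u $ 1 * v $ 3 - u $ 3 * v $ 1" "bracket u v $ 5 = u $ 2 * v $ 3 - u $ 3 * v $ 2"
  by (simp_all add: bracket_def X_component)

text \<open>Neither form is closed by itself; their differentials are opposite multiples of
  \<chi>^123.\<close>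

lemma chi_15_24_closed: "ce_diff (chi [1,5]) vs + ce_diff (chi [2,4]) vs = 0"
proof (cases "length vs = 3")
  case True
  then obtain u v w where vs: "vs = [u, v, w]" by (auto simp: numeral_3_eq_3 length_Suc_conv)
  show ?thesis unfolding vs ce_diff_3 chi_2 bracket_component
    by (simp flip: of_real_add of_real_diff of_real_minus del: of_real_mult) (simp add: algebra_simps)
next
  case False
  then show ?thesis using ce_diff_length[OF chi_forms[of "[1,5]"], of vs] ce_diff_length[OF chi_forms[of "[2,4]"], of vs] by simp
qed

text \<open>The matrix m is the inverse Gram matrix on the plane of degree -1 and k3 that in degree
  -2. Proportionality of the two metrics enters through \<kappa>: in degree -3 the inverse Gram
  matrix is \<kappa> times the same m.\<close>

locale rumin_frame = coframe +
  fixes m11 m12 m22 k3 \<kappa> :: real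
  assumes m11_pos: "m11 > 0" and m_det: "m11 * m22 - m12 * m12 > 0" and k3_pos: "k3 > 0" and kappa_pos: "\<kappa> > 0"
    and sh_1: "sh 1 = m11 *\<^sub>R X 1 + m12 *\<^sub>R X 2" and sh_2: "sh 2 = m12 *\<^sub>R X 1 + m22 *\<^sub>R X 2"
    and sh_3: "sh 3 = k3 *\<^sub>R X 3"
    and sh_4: "sh 4 = \<kappa> *\<^sub>R (m11 *\<^sub>R X 4 + m12 *\<^sub>R X 5)" and sh_5: "sh 5 = \<kappa> *\<^sub>R (m12 *\<^sub>R X 4 + m22 *\<^sub>R X 5)"
begin

lemmas sh_simps = sh_1 sh_2 sh_3 sh_4 sh_5

lemma bracket_sh_13: "bracket (sh 1) (sh 3) = (k3 / \<kappa>) *\<^sub>R sh 4" and bracket_sh_23: "bracket (sh 2) (sh 3) = (k3 / \<kappa>) *\<^sub>R sh 5"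
  using kappa_pos k3_pos unfolding sh_simps
  by (simp_all add: bracket_def X_component algebra_simps)

lemma bracket_sh_12: "bracket (sh 1) (sh 2) = ((m11 * m22 - m12 * m12) / k3) *\<^sub>R sh 3"
proof -
  have "bracket (sh 1) (sh 2) = (m11 * m22 - m12 * m12) *\<^sub>R X 3"
    unfolding sh_simps by (simp add: bracket_def X_component)
  then show ?thesis using k3_pos unfolding sh_3 by simp
qed

lemma bracket_swap: "bracket u v = - bracket v u"
  by (simp add: bracket_def algebra_simps)

text \<open>Passing to g-dual vectors preserves the shape of the bracket relations. For degree -3
  this needs the same matrix m in both planes.\<close>

lemma bracket_table_sh: "bracket_table sh"
proof -
  have 1: "bracket (sh a) (sh b) = 0" if "a \<in> {4, 5} \<or> b \<in> {4, 5}" for a b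
    using that exhaust_5[of a] exhaust_5[of b] unfolding bracket_def by (auto simp: sh_simps X_component)
  have 2: "\<exists>r. bracket (sh 3) (sh 1) = r *\<^sub>R sh 4" "\<exists>r. bracket (sh 3) (sh 2) = r *\<^sub>R sh 5" "\<exists>r. bracket (sh 2) (sh 1) = r *\<^sub>R sh 3"
    using bracket_sh_13 bracket_sh_23 bracket_sh_12 bracket_swap by (metis scaleR_minus_left)+
  show ?thesis unfolding bracket_table_def forall_5
    using 1 2 bracket_sh_13 bracket_sh_23 bracket_sh_12 bracket_self by auto
qed

lemma chi_harmonic:
  assumes "distinct S" and
    "1 \<in> set S \<or> 2 \<in> set S \<or> 3 \<notin> set S" "1 \<in> set S \<or> 3 \<in> set S \<or> 4 \<notin> set S" "2 \<in> set S \<or> 3 \<in> set S \<or> 5 \<notin> set S"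
    "1 \<in> set S \<Longrightarrow> 2 \<in> set S \<Longrightarrow> 3 \<in> set S" "1 \<in> set S \<Longrightarrow> 3 \<in> set S \<Longrightarrow> 4 \<in> set S" "2 \<in> set S \<Longrightarrow> 3 \<in> set S \<Longrightarrow> 5 \<in> set S"
    and q: "length S = q"
  shows "harmonic_rep g q (coh_class q (chi S)) = chi S"
proof (rule harmonic_rep_eq)
  show "chi S \<in> forms q" using chi_forms[of S] q by simp
  show "ce_diff (chi S) = 0" by (rule chi_closed) fact+
  show "form_inner g q (ce_diff \<alpha>) (chi S) = 0" if "q = Suc p" "\<alpha> \<in> forms p" for p \<alpha>
  proof -
    have "form_inner g q (ce_diff \<alpha>) (chi S) = ce_diff \<alpha> (map sh S)"
      by (rule form_inner_chi) (use that ce_diff_forms q in auto)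
    also have "\<dots> = 0" by (rule coclosed[OF that(2) _ _ bracket_table_sh]) (use that q assms in auto)
    finally show ?thesis .
  qed
qed

text \<open>Here orthogonality to coboundaries holds for each summand, while closedness needs their
  sum.\<close>

lemma chi_15_24_harmonic:
  "harmonic_rep g 2 (coh_class 2 (\<lambda>vs. (chi [1,5] vs + chi [2,4] vs) / of_real (sqrt 2))) = (\<lambda>vs. (chi [1,5] vs + chi [2,4] vs) / of_real (sqrt 2))"
proof (rule harmonic_rep_eq)
  have f: "chi [1,5] \<in> forms 2" "chi [2,4] \<in> forms 2" using chi_forms[of "[1,5]"] chi_forms[of "[2,4]"] by (simp_all add: numeral_2_eq_2)
  then show "(\<lambda>vs. (chi [1,5] vs + chi [2,4] vs) / of_real (sqrt 2)) \<in> forms 2" by (rule forms_add_divide)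
  show "ce_diff (\<lambda>vs. (chi [1,5] vs + chi [2,4] vs) / of_real (sqrt 2)) = 0"
    by (rule ext) (simp add: ce_diff_add_divide chi_15_24_closed)
  show "form_inner g 2 (ce_diff \<alpha>) (\<lambda>vs. (chi [1,5] vs + chi [2,4] vs) / of_real (sqrt 2)) = 0" if "2 = Suc p" "\<alpha> \<in> forms p" for p \<alpha>
  proof -
    have d: "ce_diff \<alpha> \<in> forms 2" using ce_diff_forms[OF that(2)] unfolding that(1)[symmetric] .
    have p: "p = 1" using that(1) by simp
    have "ce_diff \<alpha> (map sh [1,5]) = 0" by (rule coclosed[OF that(2) _ _ bracket_table_sh]) (simp_all add: p)
    moreover have "ce_diff \<alpha> (map sh [2,4]) = 0" by (rule coclosed[OF that(2) _ _ bracket_table_sh]) (simp_all add: p)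
    ultimately show ?thesis unfolding form_inner_add_divide_right using form_inner_chi[OF d, of "[1,5]"] form_inner_chi[OF d, of "[2,4]"] by simp
  qed
qed

text \<open>The reverse of degree 2: each summand is closed, but orthogonality needs the sum. The
  two remaining evaluations on sh 4 and sh 5 carry the same constant k3 / \<kappa> and cancel by
  antisymmetry.\<close>

lemma chi_135_234_harmonic:
  "harmonic_rep g 3 (coh_class 3 (\<lambda>vs. (chi [1,3,5] vs + chi [2,3,4] vs) / of_real (sqrt 2))) = (\<lambda>vs. (chi [1,3,5] vs + chi [2,3,4] vs) / of_real (sqrt 2))"
proof (rule harmonic_rep_eq)
  have f: "chi [1,3,5] \<in> forms 3" "chi [2,3,4] \<in> forms 3" using chi_forms[of "[1,3,5]"] chi_forms[of "[2,3,4]"] by (simp_all add: numeral_3_eq_3)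
  then show "(\<lambda>vs. (chi [1,3,5] vs + chi [2,3,4] vs) / of_real (sqrt 2)) \<in> forms 3" by (rule forms_add_divide)
  have "ce_diff (chi [1,3,5]) = 0" "ce_diff (chi [2,3,4]) = 0" by (rule chi_closed; simp)+
  then show "ce_diff (\<lambda>vs. (chi [1,3,5] vs + chi [2,3,4] vs) / of_real (sqrt 2)) = 0"
    by (intro ext) (simp add: ce_diff_add_divide)
  show "form_inner g 3 (ce_diff \<alpha>) (\<lambda>vs. (chi [1,3,5] vs + chi [2,3,4] vs) / of_real (sqrt 2)) = 0" if "3 = Suc p" "\<alpha> \<in> forms p" for p \<alpha>
  proof -
    have \<alpha>: "\<alpha> \<in> forms (Suc (length [w]))" for w :: lie using that by (simp add: numeral_2_eq_2)
    have d: "ce_diff \<alpha> \<in> forms 3" using ce_diff_forms[OF that(2)] unfolding that(1)[symmetric] .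
    have z: "bracket (sh 1) (sh 5) = 0" "bracket (sh 3) (sh 5) = 0" "bracket (sh 2) (sh 4) = 0" "bracket (sh 3) (sh 4) = 0"
      unfolding sh_simps by (simp_all add: bracket_def X_component)
    have "ce_diff \<alpha> (map sh [1,3,5]) + ce_diff \<alpha> (map sh [2,3,4]) = - of_real (k3 / \<kappa>) * (\<alpha> [sh 4, sh 5] + \<alpha> [sh 5, sh 4])"
      by (simp add: ce_diff_3 z bracket_sh_13 bracket_sh_23 forms_head_scale[OF \<alpha>] algebra_simps)
    also have "\<alpha> [sh 5, sh 4] = - \<alpha> [sh 4, sh 5]"
      using forms_swap[OF that(2), of "[sh 4, sh 5]" 0 1] that(1) by simp
    finally have "ce_diff \<alpha> (map sh [1,3,5]) + ce_diff \<alpha> (map sh [2,3,4]) = 0" by simp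
    then show ?thesis unfolding form_inner_add_divide_right using form_inner_chi[OF d, of "[1,3,5]"] form_inner_chi[OF d, of "[2,3,4]"] by simp
  qed
qed

lemma harmonic_basis:
  assumes "q \<le> 5" "i < coh_dim q"
  shows "harmonic_rep g q (coh_class q (coh_basis q ! i)) = coh_basis q ! i"
proof -
  have "q = 0 \<or> q = 1 \<or> q = 2 \<or> q = 3 \<or> q = 4 \<or> q = 5" using assms(1) by linarith
  then show ?thesis using assms(2) chi_15_24_harmonic chi_135_234_harmonic
    by (elim disjE) (auto simp: coh_basis_def coh_dim_def less_Suc_eq numeral_2_eq_2 numeral_3_eq_3 intro!: chi_harmonic)
qed

lemma h_gram_eq: "q \<le> 5 \<Longrightarrow> i < coh_dim q \<Longrightarrow> j < coh_dim q \<Longrightarrow> h_gram g q i j = form_inner g q (coh_basis q ! i) (coh_basis q ! j)"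
  unfolding h_gram_def h_inner_def by (simp add: harmonic_basis)

lemma form_inner_chi_chi: "length S = q \<Longrightarrow> length S' = q \<Longrightarrow> form_inner g q (chi S) (chi S') = chi S (map sh S')"
  using form_inner_chi[OF chi_forms[of S], of S'] by simp

end

section \<open>Gram matrices of the cohomology basis\<close>

context rumin_frame
begin

lemma gram0: "h_gram g 0 0 0 = 1"
  by (simp add: h_gram_eq coh_dim_def coh_basis_def form_inner_chi_chi chi_0)

lemmas gram_simps = h_gram_eq coh_dim_def coh_basis_def form_inner_chi_chi chi_1 chi_2 chi_3 chi_4 sh_simps X_component
  form_inner_add_divide_left form_inner_add_divide_right less_Suc_eq numeral_2_eq_2 numeral_3_eq_3

lemma gram1: "i < 2 \<Longrightarrow> j < 2 \<Longrightarrow> h_gram g 1 i j = of_real (gram_sym1 m11 m12 m22 i j)"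
  by (auto simp: gram_simps gram_sym1_def)

lemma gram4: "i < 2 \<Longrightarrow> j < 2 \<Longrightarrow> h_gram g 4 i j = of_real (k3 * \<kappa> ^ 2 * (m11 * m22 - m12 * m12) * gram_sym1 m11 m12 m22 i j)"
  by (auto simp: gram_simps gram_sym1_def power2_eq_square algebra_simps)

lemma gram2:
  assumes "i < 3" "j < 3" shows "h_gram g 2 i j = of_real (\<kappa> * gram_sym2 m11 m12 m22 i j)"
proof -
  have 1: "chi [1,4] \<in> forms 2" "chi [1,5] \<in> forms 2" "chi [2,4] \<in> forms 2" "chi [2,5] \<in> forms 2"
    using chi_forms[of "[1,4]"] chi_forms[of "[1,5]"] chi_forms[of "[2,4]"] chi_forms[of "[2,5]"] by (simp_all add: numeral_2_eq_2)
  have l: "length [a, b] = 2" for a b :: 5 by simp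
  have c: "form_inner g 2 (chi [a, b]) (chi [a', b']) = of_real (sh a' $ a * sh b' $ b - sh b' $ a * sh a' $ b)" for a b a' b'
    by (simp add: form_inner_chi_chi chi_2)
  have "i = 0 \<or> i = 1 \<or> i = 2" "j = 0 \<or> j = 1 \<or> j = 2" using assms by auto
  then show ?thesis
    by (elim disjE; simp add: h_gram_eq coh_dim_def coh_basis_def nth_Cons_numeral form_inner_add_divide_left form_inner_add_divide_right c sh_simps X_component gram_sym2_def;
        simp add: field_simps cnj_times_self_sqrt2)
qed

lemma gram3:
  assumes "i < 3" "j < 3" shows "h_gram g 3 i j = of_real (\<kappa> * k3 * gram_sym2 m11 m12 m22 i j)"
proof -
  have c: "form_inner g 3 (chi [a, 3, b]) (chi [a', 3, b']) = of_real (k3 * (sh a' $ a * sh b' $ b))"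
    if "a \<in> {1, 2}" "b \<in> {4, 5}" "a' \<in> {1, 2}" "b' \<in> {4, 5}" for a b a' b'
    using that by (auto simp: form_inner_chi_chi chi_3 sh_simps X_component)
  have "i = 0 \<or> i = 1 \<or> i = 2" "j = 0 \<or> j = 1 \<or> j = 2" using assms by auto
  then show ?thesis
    by (elim disjE; simp add: h_gram_eq coh_dim_def coh_basis_def nth_Cons_numeral form_inner_add_divide_left form_inner_add_divide_right c sh_simps X_component gram_sym2_def;
        simp add: field_simps cnj_times_self_sqrt2)
qed

text \<open>Positivity is enough: this constant only rescales D_4, and a scalar does not change the
  determinant.\<close>

lemma gram5: "\<exists>k>0. h_gram g 5 0 0 = of_real k"
proof -
  have f: "chi [1,2,3,4,5] \<in> forms 5" using chi_forms[of "[1,2,3,4,5]"] by (simp add: eval_nat_numeral)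
  have "form_inner g 5 (chi [1,2,3,4,5]) (chi [1,2,3,4,5]) \<noteq> 0"
  proof
    assume "form_inner g 5 (chi [1,2,3,4,5]) (chi [1,2,3,4,5]) = 0"
    then have "chi [1,2,3,4,5] = 0" by (rule form_inner_self_0[OF f])
    moreover have "chi [1,2,3,4,5] (map X [1,2,3,4,5]) = 1"
    proof -
      let ?S = "[1,2,3,4,5] :: 5 list"
      have z: "(\<Prod>k<length ?S. (map X ?S ! p k) $ (?S ! k)) = (if p = id then 1 else 0)" if p: "p permutes {..<length ?S}" for p
      proof (cases "p = id")
        case True
        have "(map X ?S ! id k) $ (?S ! k) = 1" if "k < length ?S" for k
          using that by (simp only: nth_map id_apply) (simp add: X_component)
        then show ?thesis using True by simp
      next
        case False
        then obtain k where k: "p k \<noteq> k" by (auto simp: fun_eq_iff)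
        then have kl: "k < length ?S" "p k < length ?S"
          using p permutes_not_in[OF p, of k] permutes_in_image[OF p, of k] by (auto simp only: lessThan_iff)
        have "distinct ?S" by simp
        then have "?S ! p k \<noteq> ?S ! k" using k kl by (simp only: nth_eq_iff_index_eq simp_thms)
        then have "(map X ?S ! p k) $ (?S ! k) = 0" using kl by (simp only: nth_map) (simp add: X_component)
        then show ?thesis using kl(1) False by (simp only: if_False) (intro prod_zero bexI[of _ k]; simp)
      qed
      have "(\<Sum>p | p permutes {..<length ?S}. of_int (sign p) * (\<Prod>k<length ?S. (map X ?S ! p k) $ (?S ! k)))
        = (\<Sum>p | p permutes {..<length ?S}. if p = id then 1 else 0 :: real)"
      proof (intro sum.cong refl)
        fix p assume "p \<in> {p. p permutes {..<length ?S}}"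
        then have p: "p permutes {..<length ?S}" by simp
        show "of_int (sign p) * (\<Prod>k<length ?S. (map X ?S ! p k) $ (?S ! k)) = (if p = id then 1 else 0 :: real)"
          unfolding z[OF p] by (simp add: sign_id)
      qed
      also have "\<dots> = 1" using permutes_id[of "{..<length ?S}"] by (simp add: finite_permutations)
      finally show ?thesis unfolding chi_def by (simp only: length_map if_True refl of_real_1)
    qed
    ultimately show False by simp
  qed
  then have "(\<Sum>L | length L = 5. (cmod (chi [1,2,3,4,5] (map Y L)))\<^sup>2) / fact 5 \<noteq> 0"
    unfolding form_inner_self[OF f] by (metis of_real_0)
  moreover have "(\<Sum>L | length L = 5. (cmod (chi [1,2,3,4,5] (map Y L)))\<^sup>2) / fact 5 \<ge> 0"
    by (intro divide_nonneg_nonneg sum_nonneg) auto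
  ultimately have "(\<Sum>L | length L = 5. (cmod (chi [1,2,3,4,5] (map Y L)))\<^sup>2) / fact 5 > 0" by linarith
  moreover have "h_gram g 5 0 0 = form_inner g 5 (chi [1,2,3,4,5]) (chi [1,2,3,4,5])"
    by (simp add: h_gram_eq coh_dim_def coh_basis_def nth_Cons_numeral)
  ultimately show ?thesis using form_inner_self[OF f] by auto
qed

end

section \<open>Existence of an adapted frame\<close>

lemma dual_gram_eq:
  assumes bil: "bilinear g" and exp: "\<And>v. v = (\<Sum>l\<in>UNIV. g v (Y l) *\<^sub>R Y l)"
  shows "dual_gram g $ i $ j = (\<Sum>l\<in>UNIV. Y l $ i * Y l $ j)"
proof -
  define G where "G = (\<chi> i j. g (X i) (X j))"
  define K where "K = (\<chi> i j. \<Sum>l\<in>UNIV. Y l $ i * Y l $ j)"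
  have lin: "linear (g u)" for u using bil by (simp add: bilinear_def)
  have X: "v = (\<Sum>i\<in>UNIV. (v $ i) *\<^sub>R X i)" for v :: lie
    using basis_expansion[of v] unfolding X_def scalar_mult_eq_scaleR by simp
  have "(G ** K) $ i $ k = mat 1 $ i $ k" for i k
  proof -
    have "(G ** K) $ i $ k = (\<Sum>j\<in>UNIV. \<Sum>l\<in>UNIV. g (X i) (X j) * (Y l $ j * Y l $ k))"
      by (simp add: matrix_matrix_mult_def G_def K_def sum_distrib_left)
    also have "\<dots> = (\<Sum>l\<in>UNIV. (\<Sum>j\<in>UNIV. Y l $ j * g (X i) (X j)) * Y l $ k)"
      unfolding sum_distrib_right by (subst sum.swap) (simp add: mult_ac)
    also have "\<dots> = (\<Sum>l\<in>UNIV. g (X i) (Y l) * Y l $ k)"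
    proof -
      have "g (X i) (Y l) = (\<Sum>j\<in>UNIV. Y l $ j * g (X i) (X j))" for l
        by (subst X[of "Y l"]) (simp add: linear_sum[OF lin] linear_scale[OF lin])
      then show ?thesis by simp
    qed
    also have "\<dots> = (\<Sum>l\<in>UNIV. g (X i) (Y l) *\<^sub>R Y l) $ k" by simp
    also have "\<dots> = X i $ k" using exp[of "X i"] by simp
    finally show ?thesis by (simp add: X_component mat_def)
  qed
  then have GK: "G ** K = mat 1" by (simp add: vec_eq_iff)
  then have KG: "K ** G = mat 1" by (simp add: matrix_left_right_inverse)
  have "matrix_inv G = K"
    unfolding matrix_inv_def
  proof (rule some_equality)
    fix A' assume A': "G ** A' = mat 1 \<and> A' ** G = mat 1"
    have "A' = (K ** G) ** A'" unfolding KG by simp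
    also have "\<dots> = K" unfolding matrix_mul_assoc[symmetric] using A' by simp
    finally show "A' = K" .
  qed (use GK KG in blast)
  then show ?thesis by (simp add: dual_gram_def G_def[symmetric]) (simp add: K_def)
qed

text \<open>Gram-Schmidt in degree -1. Since ad X 3 identifies the planes of degree -1 and -3 up to
  sign, and by proportionality also their metrics up to scale, the same coefficients orthonormalise
  X 4 and X 5.\<close>

lemma rumin_frame_exists:
  assumes ge: "graded_euclidean g" and bp: "b_proportional g"
  shows "\<exists>Y c m11 m12 m22 k3 \<kappa>. rumin_frame g Y c m11 m12 m22 k3 \<kappa>"
proof -
  have bil: "bilinear g" and sym: "g u v = g v u" and pos: "u \<noteq> 0 \<Longrightarrow> g u u > 0"
    and orth: "k \<noteq> l \<Longrightarrow> u \<in> grade k \<Longrightarrow> v \<in> grade l \<Longrightarrow> g u v = 0" for u v k l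
    using ge by (auto simp: graded_euclidean_def)
  note g_simps = bilinear_ladd[OF bil] bilinear_radd[OF bil] bilinear_lmul[OF bil] bilinear_rmul[OF bil]
    bilinear_lsub[OF bil] bilinear_rsub[OF bil]
  have X_nz: "X i \<noteq> 0" for i using X_component[of i i] by auto
  have gr: "X 1 \<in> grade 1" "X 2 \<in> grade 1" "X 3 \<in> grade 2" "X 4 \<in> grade 3" "X 5 \<in> grade 3"
    by (auto simp: grade_def intro: span_base)
  define a where "a = g (X 1) (X 1)"
  define b where "b = g (X 1) (X 2)"
  define d where "d = g (X 2) (X 2)"
  define g3 where "g3 = g (X 3) (X 3)"
  have a: "a > 0" and g3: "g3 > 0" unfolding a_def g3_def using pos X_nz by blast+
  define D where "D = a * d - b * b"
  have "D > 0"
  proof -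
    \<comment> \<open>Orthogonal to X 1, so its squared length is a times the Gram
      determinant.\<close>
    let ?u = "b *\<^sub>R X 1 - a *\<^sub>R X 2"
    have "?u $ 2 = - a" by (simp add: X_component)
    then have "?u \<noteq> 0" using a by (metis less_irrefl neg_equal_0_iff_equal zero_index)
    then have "0 < g ?u ?u" by (rule pos)
    also have "g ?u ?u = a * D"
      by (simp add: g_simps sym[of "X 2" "X 1"] a_def[symmetric] b_def[symmetric] d_def[symmetric] D_def) (simp add: algebra_simps)
    finally show ?thesis using a by (simp add: zero_less_mult_iff)
  qed
  obtain c where c: "c > 0" and bc: "\<And>u v. u \<in> grade 1 \<Longrightarrow> v \<in> grade 1 \<Longrightarrow> b_form g u v = c * g u v"
    using bp by (auto simp: b_proportional_def)
  have br: "bracket (X 1) (z *\<^sub>R X 3) = z *\<^sub>R X 4" "bracket (X 2) (z *\<^sub>R X 3) = z *\<^sub>R X 5" for z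
    by (simp_all add: bracket_def X_component)
  have bval: "b_form g u v = g u' v' / g3" if "\<And>z. bracket u (z *\<^sub>R X 3) = z *\<^sub>R u'" "\<And>z. bracket v (z *\<^sub>R X 3) = z *\<^sub>R v'" for u v u' v'
    unfolding b_form_def
  proof (rule the_equality)
    have gr2: "grade 2 = range (\<lambda>z. z *\<^sub>R X 3)" by (simp add: grade_def span_singleton)
    show "\<forall>Z\<in>grade 2. g (bracket u Z) (bracket v Z) = g Z Z * (g u' v' / g3)"
      unfolding gr2 using g3 by (auto simp: that g_simps g3_def[symmetric])
    fix r assume "\<forall>Z\<in>grade 2. g (bracket u Z) (bracket v Z) = g Z Z * r"
    then have "g (bracket u (1 *\<^sub>R X 3)) (bracket v (1 *\<^sub>R X 3)) = g (1 *\<^sub>R X 3) (1 *\<^sub>R X 3) * r" unfolding gr2 by blast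
    then show "r = g u' v' / g3" using g3 unfolding that by (simp add: g3_def[symmetric] field_simps)
  qed
  \<comment> \<open>The ratio of the metric in degree -3 to that in degree -1 under X 1 -> X 4, X 2
    -> X 5.\<close>
  define e where "e = g3 * c"
  have e: "e > 0" using g3 c by (simp add: e_def)
  have g44: "g (X 4) (X 4) = e * a" and g45: "g (X 4) (X 5) = e * b" and g55: "g (X 5) (X 5) = e * d"
    using bval[OF br(1) br(1)] bval[OF br(1) br(2)] bval[OF br(2) br(2)] bc[OF gr(1,1)] bc[OF gr(1,2)] bc[OF gr(2,2)] g3
    by (simp_all add: e_def a_def b_def d_def field_simps)
  have off: "g (X 1) (X 3) = 0" "g (X 1) (X 4) = 0" "g (X 1) (X 5) = 0" "g (X 2) (X 3) = 0" "g (X 2) (X 4) = 0" "g (X 2) (X 5) = 0"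
     "g (X 3) (X 4) = 0" "g (X 3) (X 5) = 0"
    using orth[OF _ gr(1) gr(3)] orth[OF _ gr(1) gr(4)] orth[OF _ gr(1) gr(5)] orth[OF _ gr(2) gr(3)] orth[OF _ gr(2) gr(4)]
      orth[OF _ gr(2) gr(5)] orth[OF _ gr(3) gr(4)] orth[OF _ gr(3) gr(5)] by simp_all
  have gX: "g (X 2) (X 1) = b" "g (X 5) (X 4) = e * b" "g (X 3) (X 1) = 0" "g (X 4) (X 1) = 0" "g (X 5) (X 1) = 0" "g (X 3) (X 2) = 0"
    "g (X 4) (X 2) = 0" "g (X 5) (X 2) = 0" "g (X 4) (X 3) = 0" "g (X 5) (X 3) = 0"
    using off g45 b_def sym by metis+
  note gXs = gX off g44 g45 g55 a_def[symmetric] b_def[symmetric] d_def[symmetric] g3_def[symmetric]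
  \<comment> \<open>Normalising constants: X 2 - q X 1 is the Gram-Schmidt vector, with squared
    length D / a.\<close>
  define s where "s = 1 / sqrt a"
  define t where "t = sqrt (a / D)"
  define s3 where "s3 = 1 / sqrt g3"
  define k where "k = 1 / sqrt e"
  define q where "q = b / a"
  have ss: "s * s = 1 / a" "t * t = a / D" "s3 * s3 = 1 / g3" "k * k = 1 / e"
    using a \<open>D > 0\<close> g3 e by (simp_all add: s_def t_def s3_def k_def)
  define Y where "Y l = (if l = 1 then s *\<^sub>R X 1 else if l = 2 then t *\<^sub>R (X 2 - q *\<^sub>R X 1) else if l = 3 then s3 *\<^sub>R X 3
     else if l = 4 then (k * s) *\<^sub>R X 4 else (k * t) *\<^sub>R (X 5 - q *\<^sub>R X 4))" for l :: 5
  have Y: "Y 1 = s *\<^sub>R X 1" "Y 2 = t *\<^sub>R (X 2 - q *\<^sub>R X 1)" "Y 3 = s3 *\<^sub>R X 3" "Y 4 = (k * s) *\<^sub>R X 4" "Y 5 = (k * t) *\<^sub>R (X 5 - q *\<^sub>R X 4)"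
    by (simp_all add: Y_def)
  have qa: "b - q * a = 0" "d - q * b = D / a" using a by (simp_all add: q_def D_def field_simps)
  define E where "E v = (\<Sum>l\<in>UNIV. g v (Y l) *\<^sub>R Y l)" for v
  have E_lin: "linear E" unfolding E_def
    by (intro linear_compose_sum ballI) (simp add: linear_iff g_simps scaleR_add_left)
  have EX: "E (X i) = X i" for i
  proof -
    have n: "s * s * a = 1" "t * t * (D / a) = 1" "s3 * s3 * g3 = 1" "k * k * e = 1"
      using a \<open>D > 0\<close> g3 e by (simp_all add: ss)
    have "E (X 1) = (s * s * a) *\<^sub>R X 1 + (t * t * (b - q * a)) *\<^sub>R (X 2 - q *\<^sub>R X 1)"
      unfolding E_def sum_5 Y by (simp add: g_simps gXs algebra_simps)
    then have 1: "E (X 1) = X 1" unfolding qa n by simp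
    have "E (X 2) = (q * (s * s * a)) *\<^sub>R X 1 + (s * s * (b - q * a)) *\<^sub>R X 1 + (t * t * (d - q * b)) *\<^sub>R (X 2 - q *\<^sub>R X 1)"
      unfolding E_def sum_5 Y by (simp add: g_simps gXs algebra_simps)
    then have 2: "E (X 2) = X 2" unfolding qa n by simp
    have "E (X 3) = (s3 * s3 * g3) *\<^sub>R X 3"
      unfolding E_def sum_5 Y by (simp add: g_simps gXs algebra_simps)
    then have 3: "E (X 3) = X 3" unfolding n by simp
    have "E (X 4) = ((k * k * e) * (s * s * a)) *\<^sub>R X 4 + ((k * k * e) * (t * t) * (b - q * a)) *\<^sub>R (X 5 - q *\<^sub>R X 4)"
      unfolding E_def sum_5 Y by (simp add: g_simps gXs algebra_simps)
    then have 4: "E (X 4) = X 4" unfolding qa n by simp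
    have "E (X 5) = ((k * k * e) * q * (s * s * a)) *\<^sub>R X 4 + ((k * k * e) * (s * s) * (b - q * a)) *\<^sub>R X 4 + ((k * k * e) * (t * t * (d - q * b))) *\<^sub>R (X 5 - q *\<^sub>R X 4)"
      unfolding E_def sum_5 Y by (simp add: g_simps gXs algebra_simps)
    then have 5: "E (X 5) = X 5" unfolding qa n by simp
    show ?thesis using exhaust_5[of i] 1 2 3 4 5 by auto
  qed
  have E: "v = (\<Sum>l\<in>UNIV. g v (Y l) *\<^sub>R Y l)" for v
  proof -
    have X: "v = (\<Sum>i\<in>UNIV. (v $ i) *\<^sub>R X i)"
      using basis_expansion[of v] unfolding X_def scalar_mult_eq_scaleR by simp
    have "E v = (\<Sum>i\<in>UNIV. (v $ i) *\<^sub>R E (X i))"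
      by (subst X) (simp add: linear_sum[OF E_lin] linear_scale[OF E_lin])
    then have "E v = v" unfolding EX X[symmetric] .
    then show ?thesis unfolding E_def by simp
  qed
  let ?c = "\<lambda>l v. g v (Y l)"
  interpret coframe g Y ?c
  proof (rule coframe.intro)
    show "linear (\<lambda>v. g v (Y l))" for l using bil by (simp add: bilinear_def)
    show "v = (\<Sum>l\<in>UNIV. g v (Y l) *\<^sub>R Y l)" for v by (rule E)
    show "g (Y m) (Y l) = g (Y l) (Y m)" for l m by (rule sym)
    show "dual_gram g $ i $ j = (\<Sum>l\<in>UNIV. Y l $ i * Y l $ j)" for i j by (rule dual_gram_eq[OF bil E])
  qed
  \<comment> \<open>Entries of the sum of Y l times its transpose over l = 1, 2, which is the
    inverse of the Gram matrix (a b; b d).\<close>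
  let ?m11 = "s * s + t * t * (q * q)" and ?m12 = "- (t * t * q)" and ?m22 = "t * t"
  have "rumin_frame g Y ?c ?m11 ?m12 ?m22 (s3 * s3) (k * k)"
  proof unfold_locales
    have p: "s * s > 0" "t * t > 0" using a \<open>D > 0\<close> by (simp_all add: ss)
    show "?m11 > 0" using p by (intro add_pos_nonneg mult_nonneg_nonneg[OF less_imp_le] zero_le_square)
    have "?m11 * ?m22 - ?m12 * ?m12 = (s * s) * (t * t)" by (simp add: algebra_simps)
    then show "?m11 * ?m22 - ?m12 * ?m12 > 0" using p by (simp only: mult_pos_pos)
    show "s3 * s3 > 0" "k * k > 0" using g3 e by (simp_all add: ss)
    show "sh 1 = ?m11 *\<^sub>R X 1 + ?m12 *\<^sub>R X 2" "sh 2 = ?m12 *\<^sub>R X 1 + ?m22 *\<^sub>R X 2" "sh 3 = (s3 * s3) *\<^sub>R X 3"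
      "sh 4 = (k * k) *\<^sub>R (?m11 *\<^sub>R X 4 + ?m12 *\<^sub>R X 5)" "sh 5 = (k * k) *\<^sub>R (?m12 *\<^sub>R X 4 + ?m22 *\<^sub>R X 5)"
      unfolding sharp_def sum_5 Y by (simp_all add: X_component algebra_simps)
  qed
  then show ?thesis by blast
qed

theorem theorem3:
  fixes g :: "lie \<Rightarrow> lie \<Rightarrow> real" and hb :: real
  assumes "graded_euclidean g" and "b_proportional g" and "hb \<noteq> 0"
  shows "(\<forall>q\<le>4. \<exists>Z. is_zeta g hb q Z) \<and>
    det_star g hb 4 = det_star g hb 0 \<and>
    det_star g hb 0 = of_real (2 powr (1/4)) \<and>
    det_star g hb 3 = det_star g hb 1 \<and>
    det_star g hb 1 = of_real (2 powr (3/4) * sin (pi * ((sqrt 2 - 1) / 2)) powr (1/2)) \<and>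
    det_star g hb 2 = of_real (2 * sin (pi * ((sqrt 2 - 1) / 2))) \<and>
    torsion g hb = 1"
proof -
  obtain Y c m11 m12 m22 k3 \<kappa> where "rumin_frame g Y c m11 m12 m22 k3 \<kappa>"
    using rumin_frame_exists[OF assms(1,2)] by blast
  then interpret rumin_frame g Y c m11 m12 m22 k3 \<kappa> .
  obtain k5 where k5: "k5 > 0" "h_gram g 5 0 0 = of_real k5" using gram5 by blast
  define \<delta> where "\<delta> = sqrt (m11 * m22 - m12 * m12)"
  \<comment> \<open>\<open>isotropic\<close> is a quadratic equation for p / r, with roots (-m12 +-
    i \<delta>) / m11. The root giving Re be > 0 fixes be up to the factor al, and 2 al Re be = 1
    then fixes al. The imaginary part of be reflects a nonzero inner product of X 1 and X 2.\<close>
  define al where "al = sqrt (m11 / (2 * \<delta>))"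
  define be where "be = of_real (al / m11) * (of_real \<delta> + \<i> * of_real (sgn hb * m12))"
  have \<delta>: "\<delta> > 0" "\<delta> * \<delta> = m11 * m22 - m12 * m12" using m_det by (simp_all add: \<delta>_def)
  have al: "al > 0" "al * al = m11 / (2 * \<delta>)" using m11_pos \<delta>(1) by (simp_all add: al_def)
  have "Re be = al / m11 * \<delta>" by (simp add: be_def)
  then have "2 * al * Re be = 2 * (al * al) * \<delta> / m11" by simp
  also have "\<dots> = 1" unfolding al(2) using \<delta>(1) m11_pos by simp
  finally have ab: "2 * al * Re be = 1" .
  interpret S: schroedinger al be hb by unfold_locales (use al ab assms(3) in auto)
  have iso: "of_real m11 * (S.p * S.p) + 2 * of_real m12 * (S.p * S.r) + of_real m22 * (S.r * S.r) = 0"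
  proof -
    define \<sigma> where "\<sigma> = complex_of_real (sgn hb)"
    define k where "k = complex_of_real (sqrt \<bar>hb\<bar> * al)"
    have \<sigma>: "\<sigma> * \<sigma> = 1" using assms(3) by (simp add: \<sigma>_def sgn_if flip: of_real_mult)
    have p: "S.p = k * (of_real \<delta> - \<i> * \<sigma> * of_real m12) / of_real m11" and r: "S.r = k * (\<i> * \<sigma>)"
      unfolding S.p_def S.r_def \<sigma>_def k_def by (simp_all add: be_def)
    have gen: "M * (k * (D - \<i> * s * B) / M * (k * (D - \<i> * s * B) / M)) + 2 * B * (k * (D - \<i> * s * B) / M * (k * (\<i> * s))) + C * (k * (\<i> * s) * (k * (\<i> * s)))
      = k * k / M * (D * D + (s * s) * (B * B) - (s * s) * (M * C))" if "M \<noteq> 0" for M D B C s k :: complex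
      using that by (simp add: field_simps)
    have d: "complex_of_real \<delta> * of_real \<delta> = of_real m11 * of_real m22 - of_real m12 * of_real m12"
      by (metis \<delta>(2) of_real_diff of_real_mult)
    have "complex_of_real m11 \<noteq> 0" using m11_pos by simp
    from gen[OF this] show ?thesis unfolding p r by (simp add: \<sigma> d)
  qed
  interpret R: rumin_metric al be hb g m11 m12 m22 \<kappa> "\<kappa> * k3" "k3 * \<kappa> ^ 2 * (m11 * m22 - m12 * m12)" k5
    by unfold_locales (use m11_pos m_det iso kappa_pos k3_pos k5 gram0 gram1 gram2 gram3 gram4 in auto)
  let ?s = "sin (pi * ((sqrt 2 - 1) / 2))"
  have s: "?s > 0" using sin_value_pos by (simp add: sin_value_def)
  have d0: "det_star g hb 0 = of_real (exp (ln 2 / 4))" "det_star g hb 4 = of_real (exp (ln 2 / 4))"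
    using R.det_0 R.det_4 by (simp_all add: exp_of_real[symmetric])
  have d1: "det_star g hb 1 = of_real (exp (3 / 4 * ln 2 + ln ?s / 2))" "det_star g hb 3 = of_real (exp (3 / 4 * ln 2 + ln ?s / 2))"
    using R.det_1 R.det_3 by (simp_all add: sin_value_def exp_of_real[symmetric] add.commute)
  have d2: "det_star g hb 2 = of_real (exp (ln 2 + ln ?s))"
    using R.det_2 by (simp add: sin_value_def exp_of_real[symmetric] add.commute)
  have "torsion g hb = of_real (exp (ln 2 / 4) * exp (ln 2 + ln ?s) * exp (ln 2 / 4) / (exp (3 / 4 * ln 2 + ln ?s / 2) * exp (3 / 4 * ln 2 + ln ?s / 2)))"
    unfolding torsion_def d0 d1 d2 by simp
  also have "\<dots> = 1" by (simp flip: exp_add exp_diff)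
  finally have "torsion g hb = 1" .
  moreover have "\<exists>Z. is_zeta g hb q Z" if "q \<le> 4" for q
  proof -
    have "q = 0 \<or> q = 1 \<or> q = 2 \<or> q = 3 \<or> q = 4" using that by linarith
    then show ?thesis using R.det_0 R.det_1 R.det_2 R.det_3 R.det_4 by blast
  qed
  moreover have "exp (ln 2 / 4) = (2::real) powr (1 / 4)" by (simp add: powr_def)
  moreover have "exp (3 / 4 * ln 2 + ln ?s / 2) = 2 powr (3 / 4) * ?s powr (1 / 2)"
    using s by (simp add: powr_def exp_add)
  moreover have "exp (ln 2 + ln ?s) = 2 * ?s" using s by (simp add: exp_add)
  ultimately show ?thesis using d0 d1 d2 by (simp only: simp_thms) blast
qed

end
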